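(* Let $n\ge 2$ be an integer. (i) Let $\Gamma\subseteq \mathrm{Isom}(H^n)$ be an arithmetic lattice of the simplest type defined over a totally real number field $K$. Let $\gamma$ be a hyperbolic element of $\Gamma$, and let $\lambda=e^{\ell(\gamma)}$. If $n$ is even or $\gamma\in\Gamma^{(2)}$, then $\lambda$ is a Salem number such that $K\subseteq\mathbb{Q}(\lambda+\lambda^{-1})$ and $\deg_K(\lambda)\le n+1$. (ii) Conversely, if $\lambda$ is a Salem number, and $K$ is a subfield of $\mathbb{Q}(\lambda+\lambda^{-1})$ such that $\deg_K(\lambda)\le n+1$, then there exist an arithmetic lattice $\Gamma\subseteq\mathrm{Isom}(H^n)$ of the simplest type defined over $K$ and a hyperbolic element $\gamma$ in $\Gamma$ such that $\lambda=e^{\ell(\gamma)}$.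
   Context: A Salem number is a real algebraic integer $\lambda>1$ that is conjugate (over $\mathbb{Q}$) to $\lambda^{-1}$ and whose remaining conjugates lie on the unit circle; degree $2$ is allowed. For a number field $K\subseteq\mathbb{C}$ and an algebraic number $\lambda$, $\deg_K(\lambda)=[K(\lambda):K]$. Let $f_n(x)=x_1^2+\cdots+x_n^2-x_{n+1}^2$ and $H^n=\{x\in\mathbb{R}^{n+1}: f_n(x)=-1,\ x_{n+1}>0\}$ (hyperboloid model of hyperbolic $n$-space). $\mathrm{O}^+(n,1)$ is the group of real matrices preserving $f_n$ and leaving $H^n$ invariant; it is identified with $\mathrm{Isom}(H^n)$. An element $\gamma\in\mathrm{Isom}(H^n)$ is hyperbolic if there is a unique geodesic in $H^n$ (its axis) along which $\gamma$ acts as a translation by a positive distance $\ell(\gamma)$, called the translation length of $\gamma$. Totally real number fields $K$ are taken as subfields of $\mathbb{R}$, with ring of integers $\mathfrak{o}_K$. A quadratic form $f(x)=x^tAx$ over $K$ in $n+1$ variables (with $A$ a symmetric matrix over $K$) is admissible if $f$ has signature $(n,1)$ and, for each nonidentity embedding $\sigma:K\to\mathbb{R}$, the form $f^\sigma$ obtained by applying $\sigma$ to the entries of $A$ is positive definite. For a subring $R\subseteq\mathbb{R}$, $\mathrm{O}'(f,R)$ is the group of $T\in\mathrm{GL}(n+1,R)$ with $T^tAT=A$ that leave invariant both components of the cone $\{x\in\mathbb{R}^{n+1}:f(x)<0\}$. A subgroup $\Gamma\subseteq\mathrm{O}^+(n,1)=\mathrm{Isom}(H^n)$ is an arithmetic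 lattice of the simplest type defined over $K$ if there exist an admissible quadratic form $f$ over $K$ in $n+1$ variables and $M\in\mathrm{GL}(n+1,\mathbb{R})$ such that $f(Mx)=f_n(x)$ for all $x\in\mathbb{R}^{n+1}$ and $M\Gamma M^{-1}$ is commensurable with $\mathrm{O}'(f,\mathfrak{o}_K)$ (their intersection has finite index in both). $\Gamma^{(2)}$ denotes the subgroup of $\Gamma$ generated by the squares of elements of $\Gamma$. *)

theory Defs
  imports
    "HOL-Analysis.Analysis"
    "HOL-Algebra.Algebra"
    "HOL-Algebra.Algebraic_Closure_Type"
begin

unbundle no fps_syntax

section \<open>Number fields inside the reals and Salem numbers\<close>

abbreviation real_field :: "real ring"
  where "real_field \<equiv> ring_of_type_algebra"

abbreviation complex_field :: "complex ring"
  where "complex_field \<equiv> ring_of_type_algebra"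

definition number_field :: "real set \<Rightarrow> bool"
  where "number_field K \<longleftrightarrow> subfield K real_field \<and> ring.finite_dimension real_field \<rat> K"

text \<open>Values of an embedding outside the carrier \<open>K\<close> are irrelevant.\<close>

definition totally_real_number_field :: "real set \<Rightarrow> bool"
  where "totally_real_number_field K \<longleftrightarrow> number_field K \<and>
    (\<forall>\<sigma> \<in> ring_hom (real_field\<lparr>carrier := K\<rparr>) complex_field. \<sigma> ` K \<subseteq> \<real>)"

definition ring_of_integers :: "real set \<Rightarrow> real set"
  where "ring_of_integers K = {x \<in> K. algebraic_int x}"

text \<open>\<open>generate_field\<close> always contains the prime field, so this is \<open>\<rat>(\<alpha>)\<close>.\<close>

definition rat_adjoin :: "real \<Rightarrow> real set"
  where "rat_adjoin \<alpha> = generate_field real_field {\<alpha>}"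

text \<open>The degree \<open>[K(\<alpha>):K]\<close>; only meaningful for \<open>\<alpha>\<close> algebraic over \<open>K\<close>.\<close>

definition degree_over :: "real set \<Rightarrow> real \<Rightarrow> nat"
  where "degree_over K \<alpha> = ring.dim real_field K (generate_field real_field (insert \<alpha> K))"

definition conjugate_over_rat :: "complex \<Rightarrow> complex \<Rightarrow> bool"
  where "conjugate_over_rat w z \<longleftrightarrow>
    (\<exists>p :: rat poly. Factorial_Ring.irreducible p \<and>
       poly (map_poly of_rat p) w = 0 \<and> poly (map_poly of_rat p) z = 0)"

definition Salem_number :: "real \<Rightarrow> bool"
  where "Salem_number l \<longleftrightarrow> l > 1 \<and> algebraic_int l \<and>
    conjugate_over_rat (of_real l) (of_real (inverse l)) \<and>
    (\<forall>z. conjugate_over_rat (of_real l) z \<longrightarrow> z \<noteq> of_real l \<longrightarrow> z \<noteq> of_real (inverse l)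
       \<longrightarrow> cmod z = 1)"


section \<open>The hyperboloid model\<close>

text \<open>
  For \<open>CARD('n) = n\<close>, the space \<open>\<real>\<^sup>n\<^sup>+\<^sup>1\<close> is \<open>real ^ ('n option)\<close>: the indices \<open>Some i\<close> are the
  \<open>n\<close> positive coordinates and \<open>None\<close> is the last, negative one.
\<close>

type_synonym 'n lvec = "real ^ ('n option)"
type_synonym 'n lmat = "real ^ ('n option) ^ ('n option)"

definition lorentz_form :: "('n::finite) lvec \<Rightarrow> real"
  where "lorentz_form x = (\<Sum>i\<in>UNIV. (x $ Some i)\<^sup>2) - (x $ None)\<^sup>2"

definition lorentz_inner :: "('n::finite) lvec \<Rightarrow> 'n lvec \<Rightarrow> real"
  where "lorentz_inner x y = (\<Sum>i\<in>UNIV. x $ Some i * y $ Some i) - x $ None * y $ None"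

definition hyp_space :: "('n::finite) lvec set"
  where "hyp_space = {x. lorentz_form x = -1 \<and> x $ None > 0}"

definition hyp_dist :: "('n::finite) lvec \<Rightarrow> 'n lvec \<Rightarrow> real"
  where "hyp_dist x y = arcosh (- lorentz_inner x y)"

text \<open>The group \<open>O\<^sup>+(n,1)\<close>, identified with the isometry group of hyperbolic \<open>n\<close>-space.\<close>

definition pos_lorentz :: "('n::finite) lmat set"
  where "pos_lorentz = {T. (\<forall>x. lorentz_form (T *v x) = lorentz_form x) \<and>
    (\<lambda>x. T *v x) ` hyp_space = hyp_space}"

text \<open>Unit-speed parametrisations of (complete) geodesics.\<close>

definition geodesic_line :: "(real \<Rightarrow> ('n::finite) lvec) \<Rightarrow> bool"
  where "geodesic_line c \<longleftrightarrow> range c \<subseteq> hyp_space \<and> (\<forall>s t. hyp_dist (c s) (c t) = \<bar>s - t\<bar>)"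

definition translates_along :: "('n::finite) lmat \<Rightarrow> 'n lvec set \<Rightarrow> real \<Rightarrow> bool"
  where "translates_along T L d \<longleftrightarrow>
    (\<exists>c. geodesic_line c \<and> L = range c \<and> (\<forall>t. T *v c t = c (t + d)))"

definition hyperbolic :: "('n::finite) lmat \<Rightarrow> bool"
  where "hyperbolic T \<longleftrightarrow> T \<in> pos_lorentz \<and> (\<exists>!L. \<exists>d>0. translates_along T L d)"

definition axis_of :: "('n::finite) lmat \<Rightarrow> 'n lvec set"
  where "axis_of T = (THE L. \<exists>d>0. translates_along T L d)"

definition translation_length :: "('n::finite) lmat \<Rightarrow> real"
  where "translation_length T = (THE d. d > 0 \<and> translates_along T (axis_of T) d)"


section \<open>Matrix groups and quadratic forms\<close>

definition matrix_over :: "real set \<Rightarrow> real ^ 'm ^ 'm \<Rightarrow> bool"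
  where "matrix_over R A \<longleftrightarrow> (\<forall>i j. A $ i $ j \<in> R)"

definition GL :: "real set \<Rightarrow> (real ^ ('m::finite) ^ 'm) set"
  where "GL R = {T. matrix_over R T \<and>
    (\<exists>S. matrix_over R S \<and> T ** S = mat 1 \<and> S ** T = mat 1)}"

definition GL_group :: "(real ^ ('m::finite) ^ 'm) monoid"
  where "GL_group = \<lparr>carrier = GL UNIV, monoid.mult = (**), one = mat 1\<rparr>"

definition qform :: "real ^ ('m::finite) ^ 'm \<Rightarrow> real ^ 'm \<Rightarrow> real"
  where "qform A x = x \<bullet> (A *v x)"

definition positive_definite :: "real ^ ('m::finite) ^ 'm \<Rightarrow> bool"
  where "positive_definite A \<longleftrightarrow> (\<forall>x. x \<noteq> 0 \<longrightarrow> qform A x > 0)"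

definition has_signature :: "real ^ ('m::finite) ^ 'm \<Rightarrow> nat \<Rightarrow> nat \<Rightarrow> bool"
  where "has_signature A p q \<longleftrightarrow>
    (\<exists>(P :: real ^ 'm ^ 'm) D. invertible P \<and> D = transpose P ** A ** P \<and> (\<forall>i j. i \<noteq> j \<longrightarrow> D $ i $ j = 0) \<and>
       card {i. D $ i $ i > 0} = p \<and> card {i. D $ i $ i < 0} = q)"

definition admissible :: "real set \<Rightarrow> ('n::finite) lmat \<Rightarrow> bool"
  where "admissible K A \<longleftrightarrow>
    matrix_over K A \<and> transpose A = A \<and> has_signature A CARD('n) 1 \<and>
    (\<forall>\<sigma> \<in> ring_hom (real_field\<lparr>carrier := K\<rparr>) real_field.
       (\<exists>x\<in>K. \<sigma> x \<noteq> x) \<longrightarrow> positive_definite (\<chi> i j. \<sigma> (A $ i $ j)))"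

text \<open>The group \<open>O'(f,R)\<close> for \<open>f(x) = x\<^sup>tAx\<close>.\<close>

definition O_prime :: "real ^ ('m::finite) ^ 'm \<Rightarrow> real set \<Rightarrow> (real ^ 'm ^ 'm) set"
  where "O_prime A R = {T \<in> GL R. transpose T ** A ** T = A \<and>
    (\<forall>C \<in> components {x. qform A x < 0}. (\<lambda>x. T *v x) ` C = C)}"


section \<open>Arithmetic lattices of the simplest type\<close>

definition finite_index :: "('a, 'b) monoid_scheme \<Rightarrow> 'a set \<Rightarrow> 'a set \<Rightarrow> bool"
  where "finite_index G H' H \<longleftrightarrow> finite (rcosets\<^bsub>G\<lparr>carrier := H\<rparr>\<^esub> H')"

definition commensurable :: "('a, 'b) monoid_scheme \<Rightarrow> 'a set \<Rightarrow> 'a set \<Rightarrow> bool"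
  where "commensurable G H1 H2 \<longleftrightarrow>
    finite_index G (H1 \<inter> H2) H1 \<and> finite_index G (H1 \<inter> H2) H2"

definition arithmetic_simplest_type :: "real set \<Rightarrow> ('n::finite) lmat set \<Rightarrow> bool"
  where "arithmetic_simplest_type K \<Gamma> \<longleftrightarrow>
    totally_real_number_field K \<and> subgroup \<Gamma> GL_group \<and> \<Gamma> \<subseteq> pos_lorentz \<and>
    (\<exists>A M. admissible K A \<and> M \<in> GL UNIV \<and> (\<forall>x. qform A (M *v x) = lorentz_form x) \<and>
       commensurable GL_group ((\<lambda>T. M ** T ** matrix_inv M) ` \<Gamma>)
         (O_prime A (ring_of_integers K)))"

definition squares_subgroup :: "('n::finite) lmat set \<Rightarrow> 'n lmat set"
  where "squares_subgroup \<Gamma> = generate GL_group {\<gamma> ** \<gamma> | \<gamma>. \<gamma> \<in> \<Gamma>}"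

end

theory Submission
  imports Defs
begin

text \<open>
  (i) A hyperbolic element has null eigenvectors with eigenvalues \<open>\<lambda>\<close> and \<open>1/\<lambda>\<close>. The Pell equation over
  \<open>K\<close> yields, in many planes defined over \<open>K\<close>, boosts in \<open>O'(f, \<oo>\<^sub>K)\<close>; conjugating them shows that the
  products of any two entries of an element of the commensurator lie in \<open>K\<close>, so squares and, by a
  determinant argument for odd \<open>n + 1\<close>, all elements are matrices over \<open>K\<close>. The conjugates of such a matrix
  preserve positive definite forms, so their eigenvalues have modulus \<open>1\<close>; hence \<open>\<lambda>\<close> is a Salem
  number, \<open>K\<close> is contained in \<open>\<rat>(\<lambda> + 1/\<lambda>)\<close>, and the characteristic polynomial bounds the degree of
  \<open>\<lambda>\<close> over \<open>K\<close>.

  (ii) Let \<open>p\<close> be the minimal polynomial of \<open>\<lambda>\<close> over \<open>K\<close>. Multiplication by the variable on \<open>K[x]/p\<close>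
  preserves the trace form \<open>(g, h) \<mapsto> Tr (g(x) h(1/x))\<close>. Over the complex numbers it is a sum over the
  roots of \<open>p\<close>: roots on the unit circle contribute positive squares and the pair \<open>\<lambda>, 1/\<lambda>\<close> a hyperbolic
  plane, which occurs only for the identity embedding. Adding a sum of squares gives an
  admissible form in \<open>n + 1\<close> variables.
\<close>

text \<open>Conjugation by \<open>g\<close> is blind to scalar factors, so the commensurator
  argument can only show that \<open>g\<close> is a matrix over K times some c with c^2 in K. Hence
  the products of two entries, and hence the two ways to remove c: squares, or the determinant,
  which is 1 or -1 and for odd n + 1 becomes a sum of products of an even number of entries once
  multiplied by one more entry.

  For the inclusion of K, let t be a primitive element, H(y) the matrix of the isometry with t
  replaced by its conjugate y, and \<tau> = \<lambda> + 1/\<lambda>. The polynomial det (\<tau> H(y)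
  - H(y)^2 - 1) has coefficients in \<rat>(\<tau>). It vanishes at t, but at no other conjugate:
  there H(y) is orthogonal for a definite form, which excludes \<tau> > 2. So t is the only root
  that this polynomial shares with the minimal polynomial of t, and therefore t lies in
  \<rat>(\<tau>).

  In (ii) the entries of the trace form are written with Newton's recursion for power sums. Being
  ring expressions in the coefficients of p, they lie in K, and any embedding of K turns them into
  power sums of the roots of the conjugate polynomial.\<close>

no_notation fps_nth (infixl "$" 75)

hide_const (open) Polynomials.degree Polynomials.lead_coeff up_ring.coeff up_ring.monom
  Module.smult Coset.order

abbreviation rat_irreducible :: "rat poly \<Rightarrow> bool"
  where "rat_irreducible \<equiv> Factorial_Ring.irreducible"

subsection \<open>Evaluation of rational polynomials\<close>

text \<open>One rational polynomial is evaluated in several fields, so that a relation satisfied by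
  a real number can be moved to its real and complex conjugates.\<close>

definition qeval :: "rat poly \<Rightarrow> 'a::field_char_0 \<Rightarrow> 'a"
  where "qeval p x = poly (map_poly of_rat p) x"

lemma qeval_0 [simp]: "qeval 0 x = 0"
  by (simp add: qeval_def)

lemma qeval_pCons [simp]: "qeval (pCons a p) x = of_rat a + x * qeval p x"
  by (simp add: qeval_def map_poly_pCons)

lemma qeval_1 [simp]: "qeval 1 x = 1"
  by (simp add: one_pCons)

lemma qeval_add [simp]: "qeval (p + q) x = qeval p x + qeval q x"
  by (induction p q rule: poly_induct2) (auto simp: of_rat_add algebra_simps)

lemma qeval_smult [simp]: "qeval (smult c p) x = of_rat c * qeval p x"
  by (induction p) (auto simp: of_rat_mult algebra_simps)

lemma qeval_minus [simp]: "qeval (- p) x = - qeval p x"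
  by (induction p) (auto simp: of_rat_minus algebra_simps)

lemma qeval_diff [simp]: "qeval (p - q) x = qeval p x - qeval q x"
  using qeval_add[of p "- q" x] by simp

lemma qeval_mult [simp]: "qeval (p * q) x = qeval p x * qeval q x"
  by (induction p) (auto simp: algebra_simps)

lemma qeval_power [simp]: "qeval (p ^ n) x = qeval p x ^ n"
  by (induction n) auto

lemma qeval_sum [simp]: "qeval (sum f A) x = (\<Sum>a\<in>A. qeval (f a) x)"
  by (induction A rule: infinite_finite_induct) auto

lemma qeval_prod [simp]: "qeval (prod f A) x = (\<Prod>a\<in>A. qeval (f a) x)"
  by (induction A rule: infinite_finite_induct) auto

lemma qeval_pcompose [simp]: "qeval (pcompose p q) x = qeval p (qeval q x)"
  by (induction p) (auto simp: pcompose_pCons)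

lemma qeval_of_nat [simp]: "qeval (of_nat n) x = of_nat n"
  by (induction n) auto

lemma qeval_of_int [simp]: "qeval (of_int n) x = of_int n"
  by (cases n) auto

lemma of_real_of_rat [simp]: "of_real (of_rat a) = (of_rat a :: complex)"
  by (cases a) (simp add: of_rat_rat)

lemma cnj_of_rat [simp]: "cnj (of_rat a) = of_rat a"
  by (cases a) (simp add: of_rat_rat)

lemma qeval_of_real: "qeval p (of_real x :: complex) = of_real (qeval p x)"
  by (induction p) auto

lemma qeval_cnj: "qeval p (cnj z) = cnj (qeval p z)"
  by (induction p) auto

lemma coeff_map_poly_of_rat [simp]:
  "coeff (map_poly of_rat p :: 'a::field_char_0 poly) i = of_rat (coeff p i)"
  by (simp add: coeff_map_poly)

lemma degree_map_poly_of_rat [simp]: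
  "degree (map_poly of_rat p :: 'a::field_char_0 poly) = degree p"
  by (simp add: degree_map_poly)

lemma map_poly_of_rat_eq_0_iff [simp]:
  "(map_poly of_rat p :: 'a::field_char_0 poly) = 0 \<longleftrightarrow> p = 0"
  by (metis coeff_map_poly_of_rat coeff_0 of_rat_0 of_rat_eq_0_iff poly_eq_iff)

lemma finite_qeval_roots: "p \<noteq> 0 \<Longrightarrow> finite {x :: 'a::field_char_0. qeval p x = 0}"
  unfolding qeval_def by (rule poly_roots_finite) auto

lemma qeval_pderiv: "qeval (pderiv p) x = poly (pderiv (map_poly of_rat p)) x"
proof -
  have "map_poly of_rat (pderiv p) = pderiv (map_poly of_rat p :: 'a poly)"
    by (rule poly_eqI) (simp add: coeff_pderiv of_rat_mult of_rat_add)
  thus ?thesis by (simp add: qeval_def)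
qed

text \<open>By Bezout, coprime polynomials have no common zero in any extension of \<rat>. This is
  the transfer principle used throughout: a rational relation at one root of \<open>h\<close> holds
  at all roots of \<open>h\<close>, whatever field they lie in.\<close>

lemma irreducible_rat_poly_dvd:
  fixes x :: "'a::field_char_0"
  assumes "rat_irreducible h" "qeval h x = 0" "qeval g x = 0"
  shows "h dvd g"
proof (rule ccontr)
  assume "\<not> h dvd g"
  hence "coprime h g"
    using assms(1) by (intro prime_elem_imp_coprime irreducible_imp_prime_elem_gcd)
  moreover obtain a b where "a * h + b * g = gcd h g"
    using bezout_coefficients_fst_snd by metis
  ultimately have "a * h + b * g = 1" by simp
  hence "qeval (a * h + b * g) x = 1" by simp
  with assms show False by simp
qed

lemma irreducible_rat_poly_degree: "rat_irreducible h \<Longrightarrow> degree h > 0"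
  by (metis gr0I Factorial_Ring.irreducible_def is_unit_iff_degree)

text \<open>In characteristic 0 the derivative is nonzero and has smaller degree, so
  \<open>h\<close> cannot divide it.\<close>

lemma irreducible_rat_poly_separable:
  fixes x :: "'a::field_char_0"
  assumes "rat_irreducible h" "qeval h x = 0"
  shows "qeval (pderiv h) x \<noteq> 0"
proof
  assume "qeval (pderiv h) x = 0"
  with assms have "h dvd pderiv h" by (intro irreducible_rat_poly_dvd)
  moreover have "degree h > 0" using assms(1) by (rule irreducible_rat_poly_degree)
  moreover from this have "pderiv h \<noteq> 0" by (auto simp: pderiv_eq_0_iff)
  ultimately have "degree h \<le> degree (pderiv h)" by (intro dvd_imp_degree_le)
  with \<open>degree h > 0\<close> show False by (simp add: degree_pderiv)
qed

lemma minimal_polynomial_exists: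
  fixes x :: "'a::field_char_0"
  assumes "g \<noteq> 0" "qeval g x = 0"
  obtains h where "rat_irreducible h" "lead_coeff h = 1" "qeval h x = 0"
proof -
  obtain h0 where h0: "h0 \<noteq> 0" "qeval h0 x = 0"
    and min: "\<And>p. p \<noteq> 0 \<Longrightarrow> qeval p x = 0 \<Longrightarrow> degree h0 \<le> degree p"
    using ex_has_least_nat[of "\<lambda>p. p \<noteq> 0 \<and> qeval p x = 0" g degree] assms by blast
  define h where "h = smult (inverse (lead_coeff h0)) h0"
  have h: "h \<noteq> 0" "qeval h x = 0" "lead_coeff h = 1" "degree h = degree h0"
    using h0 by (auto simp: h_def)
  have "rat_irreducible h"
  proof (rule Factorial_Ring.irreducibleI)
    show "\<not> is_unit h"
    proof
      assume "is_unit h"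
      then obtain c where "h = [:c:]" "c \<noteq> 0"
        using is_unit_poly_iff by (metis is_unit_iff_degree degree_eq_zeroE h(1) pCons_0_0)
      thus False using h(2) by simp
    qed
    fix a b assume ab: "h = a * b"
    with h have "a \<noteq> 0" "b \<noteq> 0" by auto
    hence deg: "degree h = degree a + degree b" using ab by (simp add: degree_mult_eq)
    from ab h(2) have "qeval a x = 0 \<or> qeval b x = 0" by simp
    with min[of a] min[of b] \<open>a \<noteq> 0\<close> \<open>b \<noteq> 0\<close> deg h(4) have "degree b = 0 \<or> degree a = 0"
      by linarith
    thus "is_unit a \<or> is_unit b"
      using \<open>a \<noteq> 0\<close> \<open>b \<noteq> 0\<close> is_unit_iff_degree by blast
  qed (use h in auto)
  thus ?thesis using that h by blast
qed

lemma algebraic_iff_qeval: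
  "Polynomial.algebraic (x :: 'a::field_char_0) \<longleftrightarrow> (\<exists>g. g \<noteq> 0 \<and> qeval g x = 0)"
proof
  assume "Polynomial.algebraic x"
  then obtain p where p: "\<And>i. coeff p i \<in> \<rat>" "p \<noteq> 0" "poly p x = 0"
    unfolding algebraic_altdef by blast
  have *: "\<exists>q. p = map_poly of_rat q" if "\<And>i. coeff p i \<in> \<rat>" for p :: "'a poly"
    using that
  proof (induction p)
    case (pCons a p)
    have "coeff p i \<in> \<rat>" for i using pCons.prems[of "Suc i"] by simp
    with pCons.IH obtain q where "p = map_poly of_rat q" by blast
    moreover obtain c where "a = of_rat c"
      using pCons.prems[of 0] by (auto elim: Rats_cases)
    ultimately have "pCons a p = map_poly of_rat (pCons c q)" by (simp add: map_poly_pCons)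
    thus ?case by blast
  qed (auto intro: exI[of _ 0])
  then obtain q where "p = map_poly of_rat q" using p by blast
  with p show "\<exists>g. g \<noteq> 0 \<and> qeval g x = 0" by (intro exI[of _ q]) (auto simp: qeval_def)
next
  assume "\<exists>g. g \<noteq> 0 \<and> qeval g x = 0"
  then obtain g where "g \<noteq> 0" "qeval g x = 0" by blast
  thus "Polynomial.algebraic x" unfolding algebraic_altdef
    by (intro exI[of _ "map_poly of_rat g"]) (auto simp: qeval_def)
qed

subsection \<open>Subfields of the reals\<close>

lemma type_algebra_simps [simp]:
  "carrier (ring_of_type_algebra :: 'a::comm_ring_1 ring) = UNIV"
  "monoid.mult (ring_of_type_algebra :: 'a ring) = (*)"
  "one (ring_of_type_algebra :: 'a ring) = 1"
  "ring.zero (ring_of_type_algebra :: 'a ring) = 0"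
  "add (ring_of_type_algebra :: 'a ring) = (+)"
  by (simp_all add: ring_of_type_algebra_def fun_eq_iff)

lemma real_field_field: "field real_field"
  by (rule field_from_type_algebra)

interpretation RF: domain real_field
  using real_field_field by (rule field.axioms)

lemma real_field_uminus [simp]: "\<ominus>\<^bsub>real_field\<^esub> x = - x"
  using RF.minus_equality[of "- x" x] by simp

lemma real_field_inv [simp]: "x \<noteq> 0 \<Longrightarrow> inv\<^bsub>real_field\<^esub> x = inverse x"
  using RF.inv_unique'[of x "inverse x"] by simp

lemma real_field_pow [simp]: "x [^]\<^bsub>real_field\<^esub> (n::nat) = x ^ n"
  by (induction n) auto

text \<open>Since \<open>inverse 0 = 0\<close>, closure under inverses can be asked of all elements,
  which spares a case distinction at 0 later on.\<close>

lemma subfield_real_iff: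
  "subfield F real_field \<longleftrightarrow> 1 \<in> F \<and> (\<forall>x\<in>F. - x \<in> F) \<and> (\<forall>x\<in>F. \<forall>y\<in>F. x + y \<in> F \<and> x * y \<in> F) \<and>
     (\<forall>x\<in>F. inverse x \<in> F)" (is "_ \<longleftrightarrow> ?R")
proof
  assume F: "subfield F real_field"
  note S = subringE[OF subfieldE(1)[OF F]]
  have "inverse x \<in> F" if "x \<in> F" for x
    using RF.subfield_m_inv(1)[OF F, of x] that S(2) by (cases "x = 0") auto
  with S show ?R by auto
next
  assume R: ?R
  show "subfield F real_field"
  proof (rule field.subfieldI'[OF real_field_field])
    show "subring F real_field"
      by (rule RF.subringI) (use R in auto)
  qed (use R in auto)
qed

locale real_subfield =
  fixes F :: "real set"
  assumes F: "subfield F real_field"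
begin

lemma one_mem [simp, intro]: "1 \<in> F"
  and uminus_mem [intro]: "x \<in> F \<Longrightarrow> - x \<in> F"
  and add_mem [intro]: "x \<in> F \<Longrightarrow> y \<in> F \<Longrightarrow> x + y \<in> F"
  and mult_mem [intro]: "x \<in> F \<Longrightarrow> y \<in> F \<Longrightarrow> x * y \<in> F"
  and inverse_mem [intro]: "x \<in> F \<Longrightarrow> inverse x \<in> F"
  using F unfolding subfield_real_iff by auto

lemma zero_mem [simp, intro]: "0 \<in> F"
  using add_mem[of 1 "-1"] by auto

lemma diff_mem [intro]: "x \<in> F \<Longrightarrow> y \<in> F \<Longrightarrow> x - y \<in> F"
  using add_mem[of x "- y"] by auto

lemma divide_mem [intro]: "x \<in> F \<Longrightarrow> y \<in> F \<Longrightarrow> x / y \<in> F"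
  by (auto simp: divide_inverse)

lemma power_mem [intro]: "x \<in> F \<Longrightarrow> x ^ n \<in> F"
  by (induction n) auto

lemma sum_mem [intro]: "(\<And>a. a \<in> A \<Longrightarrow> f a \<in> F) \<Longrightarrow> sum f A \<in> F"
  by (induction A rule: infinite_finite_induct) auto

lemma prod_mem [intro]: "(\<And>a. a \<in> A \<Longrightarrow> f a \<in> F) \<Longrightarrow> prod f A \<in> F"
  by (induction A rule: infinite_finite_induct) auto

lemma of_nat_mem [simp, intro]: "of_nat n \<in> F"
  by (induction n) auto

lemma of_int_mem [simp, intro]: "of_int n \<in> F"
  by (cases n) auto

lemma of_rat_mem [simp, intro]: "of_rat q \<in> F"
  by (cases q) (auto simp: of_rat_rat)

lemma numeral_mem [simp, intro]: "numeral n \<in> F"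
  using of_nat_mem[of "numeral n"] by simp

lemma qeval_mem [intro]: "x \<in> F \<Longrightarrow> qeval p x \<in> F"
  by (induction p) auto

end

section \<open>Polynomials with coefficients in a subfield of the reals\<close>

definition coeffs_in :: "'a::zero set \<Rightarrow> 'a poly \<Rightarrow> bool"
  where "coeffs_in F p \<longleftrightarrow> (\<forall>i. coeff p i \<in> F)"

lemma coeffs_in_pCons [simp]: "0 \<in> F \<Longrightarrow> coeffs_in F (pCons a p) \<longleftrightarrow> a \<in> F \<and> coeffs_in F p"
  unfolding coeffs_in_def by (force simp: coeff_pCons split: nat.splits)

context real_subfield
begin

lemma coeffs_in_0 [simp]: "coeffs_in F 0"
  by (simp add: coeffs_in_def)

lemma coeffs_in_add: "coeffs_in F p \<Longrightarrow> coeffs_in F q \<Longrightarrow> coeffs_in F (p + q)"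
  by (auto simp: coeffs_in_def)

lemma coeffs_in_diff: "coeffs_in F p \<Longrightarrow> coeffs_in F q \<Longrightarrow> coeffs_in F (p - q)"
  by (auto simp: coeffs_in_def)

lemma coeffs_in_mult: "coeffs_in F p \<Longrightarrow> coeffs_in F q \<Longrightarrow> coeffs_in F (p * q)"
  by (auto simp: coeffs_in_def coeff_mult)

lemma coeffs_in_smult: "c \<in> F \<Longrightarrow> coeffs_in F q \<Longrightarrow> coeffs_in F (smult c q)"
  by (auto simp: coeffs_in_def)

lemma coeffs_in_monom: "c \<in> F \<Longrightarrow> coeffs_in F (monom c n)"
  by (auto simp: coeffs_in_def)

lemma coeffs_in_sum: "(\<And>a. a \<in> A \<Longrightarrow> coeffs_in F (f a)) \<Longrightarrow> coeffs_in F (sum f A)"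
  by (induction A rule: infinite_finite_induct) (auto intro: coeffs_in_add)

lemma coeffs_in_prod: "(\<And>a. a \<in> A \<Longrightarrow> coeffs_in F (f a)) \<Longrightarrow> coeffs_in F (prod f A)"
  by (induction A rule: infinite_finite_induct) (auto intro: coeffs_in_mult simp: one_pCons)

lemma coeffs_in_pcompose: "coeffs_in F p \<Longrightarrow> coeffs_in F q \<Longrightarrow> coeffs_in F (pcompose p q)"
  by (induction p) (auto simp: pcompose_pCons intro!: coeffs_in_add coeffs_in_mult)

lemma coeffs_in_of_rat [simp]: "coeffs_in F (map_poly of_rat p)"
  by (auto simp: coeffs_in_def)

text \<open>The usual cancellation of leading terms. It divides only by the leading coefficient of
  \<open>m\<close>, so quotient and remainder stay over the field \<open>F\<close>.\<close>

lemma coeffs_in_division: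
  assumes "coeffs_in F m" "m \<noteq> 0" "coeffs_in F p"
  shows "\<exists>q r. coeffs_in F q \<and> coeffs_in F r \<and> p = q * m + r \<and> (r = 0 \<or> degree r < degree m)"
  using assms(3)
proof (induction "degree p" arbitrary: p rule: less_induct)
  case less
  show ?case
  proof (cases "degree p < degree m \<or> p = 0")
    case True
    thus ?thesis using less.prems by (intro exI[of _ 0] exI[of _ p]) auto
  next
    case False
    define c where "c = lead_coeff p / lead_coeff m"
    define s where "s = monom c (degree p - degree m)"
    define p' where "p' = p - s * m"
    have "c \<in> F" using less.prems assms by (auto simp: c_def coeffs_in_def)
    hence s: "coeffs_in F s" by (auto simp: s_def intro: coeffs_in_monom)
    hence p': "coeffs_in F p'" using less.prems assms
      by (auto simp: p'_def intro!: coeffs_in_diff coeffs_in_mult)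
    have "c \<noteq> 0" using False assms by (auto simp: c_def)
    hence deg: "degree (s * m) = degree p"
      using False assms by (subst degree_mult_eq) (auto simp: s_def degree_monom_eq)
    have "coeff (s * m) (degree p) = lead_coeff p"
    proof -
      have "lead_coeff (s * m) = c * lead_coeff m"
        by (simp add: lead_coeff_mult s_def degree_monom_eq \<open>c \<noteq> 0\<close>)
      thus ?thesis using assms(2) deg by (simp add: c_def)
    qed
    hence "coeff p' (degree p) = 0" by (simp add: p'_def)
    moreover have "degree p' \<le> degree p"
      unfolding p'_def by (rule degree_diff_le) (use deg in auto)
    ultimately have *: "p' = 0 \<or> degree p' < degree p"
      by (metis eq_zero_or_degree_less)
    have "\<exists>q r. coeffs_in F q \<and> coeffs_in F r \<and> p' = q * m + r \<and> (r = 0 \<or> degree r < degree m)"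
    proof (cases "p' = 0")
      case True
      thus ?thesis by (intro exI[of _ 0]) auto
    next
      case False
      with * less.hyps[OF _ p'] show ?thesis by blast
    qed
    then obtain q r where "coeffs_in F q" "coeffs_in F r" "p' = q * m + r" "r = 0 \<or> degree r < degree m"
      by blast
    thus ?thesis using s
      by (intro exI[of _ "s + q"] exI[of _ r]) (auto simp: p'_def algebra_simps intro: coeffs_in_add)
  qed
qed

text \<open>A polynomial of least degree, made monic. The quotient is required to lie over
  \<open>F\<close> as well, so that an embedding of \<open>F\<close> can later be applied to the
  whole factorization.\<close>

lemma minimal_polynomial_over_exists:
  assumes "coeffs_in F g" "g \<noteq> 0" "poly g x = 0"
  obtains m where "coeffs_in F m" "lead_coeff m = 1" "poly m x = 0" "degree m \<le> degree g"
    "\<And>p. coeffs_in F p \<Longrightarrow> poly p x = 0 \<Longrightarrow> \<exists>q. coeffs_in F q \<and> p = q * m"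
proof -
  obtain m0 where m0: "coeffs_in F m0" "m0 \<noteq> 0" "poly m0 x = 0"
    and min: "\<And>p. coeffs_in F p \<Longrightarrow> p \<noteq> 0 \<Longrightarrow> poly p x = 0 \<Longrightarrow> degree m0 \<le> degree p"
    using ex_has_least_nat[of "\<lambda>p. coeffs_in F p \<and> p \<noteq> 0 \<and> poly p x = 0" g degree] assms by blast
  define m where "m = smult (inverse (lead_coeff m0)) m0"
  have m: "m \<noteq> 0" "poly m x = 0" "lead_coeff m = 1" "degree m = degree m0"
    using m0 by (auto simp: m_def)
  have mF: "coeffs_in F m"
    unfolding m_def using m0 by (intro coeffs_in_smult) (auto simp: coeffs_in_def)
  show ?thesis
  proof (rule that)
    fix p assume p: "coeffs_in F p" "poly p x = 0"
    from coeffs_in_division[OF mF m(1) p(1)] obtain q r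
      where qr: "coeffs_in F q" "coeffs_in F r" "p = q * m + r" "r = 0 \<or> degree r < degree m"
      by blast
    have "poly r x = 0" using qr(3) p(2) m(2) by simp
    with min[of r] qr(2,4) m(4) have "r = 0" by linarith
    thus "\<exists>q. coeffs_in F q \<and> p = q * m" using qr by auto
  qed (use m mF min[OF assms] in auto)
qed

end

section \<open>Real polynomials at complex points\<close>

abbreviation cpoly :: "real poly \<Rightarrow> complex \<Rightarrow> complex"
  where "cpoly p z \<equiv> poly (map_poly of_real p) z"

lemma cpoly_add: "cpoly (p + q) z = cpoly p z + cpoly q z"
  by (induction p q rule: poly_induct2) (auto simp: algebra_simps map_poly_pCons)

lemma cpoly_smult: "cpoly (smult c p) z = of_real c * cpoly p z"
  by (induction p) (auto simp: algebra_simps map_poly_pCons)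

lemma cpoly_mult: "cpoly (p * q) z = cpoly p z * cpoly q z"
  by (induction p) (auto simp: algebra_simps map_poly_pCons cpoly_add cpoly_smult)

lemma cpoly_of_real: "cpoly p (of_real x) = of_real (poly p x)"
  by (induction p) (auto simp: algebra_simps map_poly_pCons)

lemma cpoly_of_rat: "cpoly (map_poly of_rat p) z = qeval p z"
  by (induction p) (auto simp: algebra_simps map_poly_pCons)

lemma complex_root_exists:
  assumes "degree (p :: real poly) > 0"
  obtains z where "cpoly p z = 0"
proof -
  have "degree (map_poly of_real p :: complex poly) > 0"
    using assms by (simp add: degree_map_poly)
  hence "\<not> constant (poly (map_poly of_real p :: complex poly))"
    by (simp add: constant_degree)
  thus ?thesis using fundamental_theorem_of_algebra that by blast
qed

text \<open>Otherwise the minimal polynomial of \<open>b\<close> over \<open>F\<close>, which divides both \<open>h\<close> and \<open>D\<close>, would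
  provide a second common root.\<close>

lemma (in real_subfield) unique_common_root_mem:
  assumes h: "coeffs_in F h" "poly h b = 0" "poly (pderiv h) b \<noteq> 0"
    and D: "coeffs_in F D" "poly D b = 0"
    and unique: "\<And>z. cpoly h z = 0 \<Longrightarrow> cpoly D z = 0 \<Longrightarrow> z = of_real b"
  shows "b \<in> F"
proof -
  have "h \<noteq> 0" using h by auto
  from minimal_polynomial_over_exists[OF h(1) this h(2)] obtain m
    where m: "coeffs_in F m" "lead_coeff m = 1" "poly m b = 0"
      and dvd: "\<And>p. coeffs_in F p \<Longrightarrow> poly p b = 0 \<Longrightarrow> \<exists>q. coeffs_in F q \<and> p = q * m"
    by metis
  obtain q where q: "h = q * m" using dvd[OF h(1,2)] by blast
  obtain q' where q': "D = q' * m" using dvd[OF D] by blast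
  from m(3) obtain m1 where m1: "m = [:-b, 1:] * m1"
    by (auto simp: poly_eq_0_iff_dvd elim: dvdE)
  have "m1 \<noteq> 0" using m m1 by auto
  hence degm: "degree m = Suc (degree m1)" by (simp add: m1 degree_mult_eq del: mult_pCons_left)
  have "degree m1 = 0"
  proof (rule ccontr)
    assume "degree m1 \<noteq> 0"
    then obtain z where z: "cpoly m1 z = 0" using complex_root_exists by blast
    hence "cpoly m z = 0" unfolding m1 cpoly_mult by simp
    hence "z = of_real b" by (intro unique) (simp_all add: q q' cpoly_mult)
    \<comment> \<open>Uniqueness alone does not exclude a repeated root \<open>b\<close> of
      \<open>m\<close>; but that would be a double root of \<open>h\<close>, against the condition
      on the derivative.\<close>
    with z have "poly m1 b = 0" by (simp add: cpoly_of_real)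
    then obtain m2 where m2: "m1 = [:-b, 1:] * m2" by (auto simp: poly_eq_0_iff_dvd elim: dvdE)
    hence "h = [:-b, 1:] * ([:-b, 1:] * (q * m2))" by (simp only: q m1 m2 mult_ac)
    hence "poly (pderiv h) b = 0" by (simp add: pderiv_mult del: mult_pCons_left)
    with h(3) show False by simp
  qed
  with degm m(2) m1 have "m = [:-b, 1:]"
    by (auto elim!: degree_eq_zeroE split: if_splits)
  hence "coeff m 0 = - b" by simp
  moreover have "coeff m 0 \<in> F" using m(1) by (simp add: coeffs_in_def)
  ultimately show ?thesis using uminus_mem[of "-b"] by auto
qed

subsection \<open>Number fields\<close>

lemma subfield_rat_adjoin: "subfield (rat_adjoin a) real_field"
  unfolding rat_adjoin_def by (rule field.generate_field_is_subfield[OF real_field_field]) auto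

lemma rat_adjoin_self: "a \<in> rat_adjoin a"
  unfolding rat_adjoin_def by (rule generate_field.incl) auto

lemma rat_adjoin_minimal: "subfield F real_field \<Longrightarrow> a \<in> F \<Longrightarrow> rat_adjoin a \<subseteq> F"
  unfolding rat_adjoin_def
  by (rule field.generate_field_min_subfield1[OF real_field_field]) auto

text \<open>Inverses come from Bezout with an irreducible polynomial of \<open>a\<close>, so the
  polynomial values at \<open>a\<close> already form a field.\<close>

lemma rat_adjoin_eq:
  assumes "Polynomial.algebraic a"
  shows "rat_adjoin a = range (\<lambda>g. qeval g a)"
proof
  obtain h where h: "rat_irreducible h" "qeval h a = 0"
    using assms minimal_polynomial_exists[of _ a] unfolding algebraic_iff_qeval by metis
  have "subfield (range (\<lambda>g. qeval g a)) real_field"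
    unfolding subfield_real_iff
  proof (intro conjI ballI)
    show "1 \<in> range (\<lambda>g. qeval g a)" by (metis qeval_1 rangeI)
  next
    fix x assume "x \<in> range (\<lambda>g. qeval g a)"
    then obtain g where g: "x = qeval g a" by blast
    show "- x \<in> range (\<lambda>g. qeval g a)" unfolding g by (metis qeval_minus rangeI)
    show "inverse x \<in> range (\<lambda>g. qeval g a)"
    proof (cases "x = 0")
      case True
      thus ?thesis by (metis qeval_0 rangeI inverse_zero)
    next
      case False
      have "\<not> h dvd g"
      proof
        assume "h dvd g"
        then obtain k where "g = h * k" ..
        with g False h(2) show False by simp
      qed
      hence "coprime h g"
        using h(1) by (intro prime_elem_imp_coprime irreducible_imp_prime_elem_gcd)
      moreover obtain u v where "u * h + v * g = gcd h g"
        using bezout_coefficients_fst_snd by metis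
      ultimately have "u * h + v * g = 1" by simp
      hence "qeval (u * h + v * g) a = 1" by simp
      hence "qeval v a * x = 1" using h(2) g by simp
      hence "inverse x = qeval v a" using False by (simp add: field_simps)
      thus ?thesis by blast
    qed
    fix y assume "y \<in> range (\<lambda>g. qeval g a)"
    then obtain k where k: "y = qeval k a" by blast
    show "x + y \<in> range (\<lambda>g. qeval g a)" "x * y \<in> range (\<lambda>g. qeval g a)"
      unfolding g k by (metis qeval_add qeval_mult rangeI)+
  qed
  moreover have "a \<in> range (\<lambda>g. qeval g a)"
    by (rule image_eqI[of _ _ "[:0, 1:]"]) auto
  ultimately show "rat_adjoin a \<subseteq> range (\<lambda>g. qeval g a)" by (rule rat_adjoin_minimal)
next
  interpret A: real_subfield "rat_adjoin a" by (intro real_subfield.intro subfield_rat_adjoin)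
  show "range (\<lambda>g. qeval g a) \<subseteq> rat_adjoin a"
    using rat_adjoin_self by auto
qed

text \<open>The usual choice of c: it avoids the finitely many quotients (a - x) / (y - b), where x
  and y run through the complex roots of \<open>ha\<close> and \<open>hb\<close>. Then b is the only
  common root of \<open>hb\<close> and ha(a + c b - c X). Both have coefficients in the field
  generated by a + c b, so \<open>unique_common_root_mem\<close> applies.\<close>

lemma primitive_element_pair:
  fixes a b :: real
  assumes "Polynomial.algebraic a" "Polynomial.algebraic b"
  obtains c :: rat where "a \<in> rat_adjoin (a + of_rat c * b)" "b \<in> rat_adjoin (a + of_rat c * b)"
proof -
  obtain ha where ha: "ha \<noteq> 0" "qeval ha a = 0" using assms unfolding algebraic_iff_qeval by blast
  obtain hb where hb: "rat_irreducible hb" "qeval hb b = 0"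
    using assms minimal_polynomial_exists[of _ b] unfolding algebraic_iff_qeval by metis
  have "hb \<noteq> 0" using hb by auto
  define A where "A = {z :: complex. qeval ha z = 0}"
  define B where "B = {z :: complex. qeval hb z = 0}"
  \<comment> \<open>For y = b the division by 0 yields 0, which only adds 0 to the excluded
    values.\<close>
  define bad where "bad = (\<lambda>(x, y). (of_real a - x) / (y - of_real b)) ` (A \<times> B)"
  have "finite bad" unfolding bad_def A_def B_def
    using ha \<open>hb \<noteq> 0\<close> by (intro finite_imageI finite_cartesian_product finite_qeval_roots)
  moreover have "infinite (range (of_nat :: nat \<Rightarrow> complex))"
    by (simp add: finite_image_iff)
  ultimately obtain n :: nat where n: "of_nat n \<notin> bad"
    by (metis (no_types, lifting) finite_subset image_subset_iff rangeE subsetI)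
  define c :: rat where "c = of_nat n"
  define t where "t = a + of_rat c * b"
  interpret F: real_subfield "rat_adjoin t" by (intro real_subfield.intro subfield_rat_adjoin)
  have tF: "t \<in> rat_adjoin t" by (rule rat_adjoin_self)
  have "b \<in> rat_adjoin t"
  proof (rule F.unique_common_root_mem)
    define D where "D = pcompose (map_poly of_rat ha) [:t, - of_rat c:]"
    show "coeffs_in (rat_adjoin t) (map_poly of_rat hb)" by simp
    show "poly (map_poly of_rat hb) b = 0" using hb(2) by (simp add: qeval_def)
    show "poly (pderiv (map_poly of_rat hb)) b \<noteq> 0"
      using irreducible_rat_poly_separable[OF hb] by (simp add: qeval_pderiv)
    show "coeffs_in (rat_adjoin t) D" unfolding D_def
      by (intro F.coeffs_in_pcompose) (use tF in auto)
    have D: "cpoly D z = qeval ha (of_real t - of_rat c * z)" for z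
    proof -
      have "cpoly (pcompose p q) z = cpoly p (cpoly q z)" for p q :: "real poly"
        by (induction p) (auto simp: pcompose_pCons cpoly_add cpoly_mult map_poly_pCons)
      thus ?thesis unfolding D_def
        by (simp add: cpoly_of_rat map_poly_pCons mult.commute)
    qed
    show "poly D b = 0" unfolding D_def poly_pcompose
      using ha(2) by (simp add: qeval_def t_def mult.commute)
    fix z assume z: "cpoly (map_poly of_rat hb) z = 0" "cpoly D z = 0"
    show "z = of_real b"
    proof (rule ccontr)
      assume nz: "z \<noteq> of_real b"
      have "z \<in> B" using z(1) by (simp add: B_def cpoly_of_rat)
      moreover have "of_real t - of_rat c * z \<in> A" using z(2) by (simp add: A_def D)
      ultimately have "(of_real a - (of_real t - of_rat c * z)) / (z - of_real b) \<in> bad"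
        unfolding bad_def by force
      also have "(of_real a - (of_real t - of_rat c * z)) / (z - of_real b) = of_rat c"
        using nz by (simp add: t_def field_simps)
      finally show False using n by (simp add: c_def)
    qed
  qed
  moreover from this have "t - of_rat c * b \<in> rat_adjoin t" using tF by auto
  hence "a \<in> rat_adjoin t" by (simp add: t_def)
  ultimately show ?thesis using that unfolding t_def by blast
qed

text \<open>In HOL-Algebra a polynomial is a coefficient list with the leading coefficient first,
  hence the \<open>rev\<close>. This and the following lemmas carry \<open>degree_over\<close> and
  algebraicity over to ordinary polynomials.\<close>

lemma RF_eval: "RF.eval p x = poly (Poly (rev p)) x"
  by (induction p) (auto simp: Poly_snoc poly_monom)

lemma RF_polynomial:
  assumes "p \<in> carrier (K [X]\<^bsub>real_field\<^esub>)" "p \<noteq> []" "0 \<in> K"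
  shows "Poly (rev p) \<noteq> 0" "coeffs_in K (Poly (rev p))" "degree (Poly (rev p)) = length p - 1"
proof -
  from assms have p: "set p \<subseteq> K" "hd p \<noteq> 0"
    by (auto simp: polynomial_def simp flip: univ_poly_carrier)
  show "coeffs_in K (Poly (rev p))"
    using p assms(3) by (auto simp: coeffs_in_def nth_default_def rev_nth)
  have "coeff (Poly (rev p)) (length p - 1) = hd p"
    using assms(2) by (auto simp: nth_default_def rev_nth hd_conv_nth)
  hence "coeff (Poly (rev p)) (length p - 1) \<noteq> 0" using p by simp
  thus "Poly (rev p) \<noteq> 0" by (metis coeff_0)
  show "degree (Poly (rev p)) = length p - 1"
  proof (rule antisym)
    show "length p - 1 \<le> degree (Poly (rev p))"
      using \<open>coeff _ _ \<noteq> 0\<close> by (rule le_degree)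
    show "degree (Poly (rev p)) \<le> length p - 1"
      by (rule degree_le) (auto simp: nth_default_def)
  qed
qed

lemma RF_polynomial_conv:
  assumes "q \<noteq> 0" "coeffs_in K q"
  shows "rev (coeffs q) \<in> carrier (K [X]\<^bsub>real_field\<^esub>)" "rev (coeffs q) \<noteq> []"
    "length (rev (coeffs q)) - 1 = degree q" "RF.eval (rev (coeffs q)) x = poly q x"
proof -
  show "rev (coeffs q) \<in> carrier (K [X]\<^bsub>real_field\<^esub>)"
    using assms by (auto simp: polynomial_def coeffs_in_def coeffs_def hd_rev last_map
      simp flip: univ_poly_carrier)
qed (use assms in \<open>auto simp: RF_eval length_coeffs_degree\<close>)

lemma algebraic_over_iff:
  assumes "subfield K real_field"
  shows "(RF.algebraic over K) x \<longleftrightarrow> (\<exists>q. q \<noteq> 0 \<and> coeffs_in K q \<and> poly q x = 0)"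
proof
  interpret real_subfield K using assms by (rule real_subfield.intro)
  assume "(RF.algebraic over K) x"
  then obtain p where "p \<in> carrier (K [X]\<^bsub>real_field\<^esub>)" "p \<noteq> []" "RF.eval p x = 0"
    using RF.algebraicE[OF subfieldE(1)[OF assms], of x] by auto
  with RF_polynomial[of p K] show "\<exists>q. q \<noteq> 0 \<and> coeffs_in K q \<and> poly q x = 0"
    by (auto simp: RF_eval)
next
  assume "\<exists>q. q \<noteq> 0 \<and> coeffs_in K q \<and> poly q x = 0"
  then obtain q where "q \<noteq> 0" "coeffs_in K q" "poly q x = 0" by blast
  hence "RF.eval (rev (coeffs q)) x = 0" using RF_polynomial_conv(4)[of q K x] by simp
  with \<open>q \<noteq> 0\<close> \<open>coeffs_in K q\<close> show "(RF.algebraic over K) x"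
    using RF.algebraicI[of "rev (coeffs q)" K x] RF_polynomial_conv(1,2)[of q K] by simp
qed

text \<open>For algebraic \<open>x\<close> the ring K[x] is already a field, hence equal to the
  generated field, and its dimension is the degree of the minimal polynomial.\<close>

lemma degree_over_eq:
  assumes K: "subfield K real_field" and alg: "(RF.algebraic over K) x"
  shows "degree_over K x = length (RF.Irr K x) - 1"
proof -
  have "subfield (RF.simple_extension K x) real_field"
    using RF.simple_extension_is_subfield[OF K, of x] alg by auto
  moreover have "insert x K \<subseteq> RF.simple_extension K x"
    using RF.simple_extension_incl[of K x] RF.simple_extension_mem[OF subfieldE(1)[OF K], of x] by auto
  ultimately have "generate_field real_field (insert x K) \<subseteq> RF.simple_extension K x"
    by (intro field.generate_field_min_subfield1[OF real_field_field]) auto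
  moreover have "RF.simple_extension K x \<subseteq> generate_field real_field (insert x K)"
    by (intro RF.simple_extension_subring_incl subfieldE(1)
          field.generate_field_is_subfield[OF real_field_field])
       (auto intro: generate_field.incl)
  ultimately have "generate_field real_field (insert x K) = RF.simple_extension K x" by blast
  with RF.simple_extension_dim[OF K _ alg] show ?thesis
    by (simp add: degree_over_def over_def)
qed

lemma degree_over_le:
  assumes K: "subfield K real_field" and q: "q \<noteq> 0" "coeffs_in K q" "poly q x = 0"
  shows "degree_over K x \<le> degree q"
proof -
  have alg: "(RF.algebraic over K) x" using q algebraic_over_iff[OF K] by blast
  note c = RF_polynomial_conv[OF q(1,2)]
  have "RF.Irr K x pdivides\<^bsub>real_field\<^esub> rev (coeffs q)"
    using c q(3) by (intro RF.Irr_minimal[OF K _ alg]) auto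
  hence "length (RF.Irr K x) - 1 \<le> length (rev (coeffs q)) - 1"
    using RF.pdivides_imp_degree_le[OF subfieldE(1)[OF K] RF.IrrE(1)[OF K _ alg] c(1,2)] by auto
  thus ?thesis using c(3) by (simp add: degree_over_eq[OF K alg])
qed

text \<open>Used in (ii), where the bound on \<open>degree_over\<close> has to become a bound on the
  number of coordinates of K[x]/p.\<close>

lemma degree_over_attained:
  assumes K: "subfield K real_field" and q: "q \<noteq> 0" "coeffs_in K q" "poly q x = 0"
  obtains p where "p \<noteq> 0" "coeffs_in K p" "poly p x = 0" "degree p = degree_over K x"
proof -
  interpret real_subfield K using K by (rule real_subfield.intro)
  have alg: "(RF.algebraic over K) x" using q algebraic_over_iff[OF K] by blast
  note I = RF.IrrE[OF K _ alg]
  have ne: "RF.Irr K x \<noteq> []"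
    using I(2) by (auto simp: ring_irreducible_def univ_poly_zero)
  show ?thesis
    using RF_polynomial[OF I(1) ne] I(4) that[of "Poly (rev (RF.Irr K x))"]
    by (auto simp: degree_over_eq[OF K alg] RF_eval)
qed

lemma (in real_subfield) Span_Rats_subset:
  assumes "set Vs \<subseteq> F"
  shows "RF.Span \<rat> Vs \<subseteq> F"
  using assms
proof (induction Vs)
  case (Cons v Vs)
  show ?case
  proof
    fix x assume "x \<in> RF.Span \<rat> (v # Vs)"
    then obtain k w where kw: "k \<in> \<rat>" "w \<in> RF.Span \<rat> Vs" "x = k * v + w"
      by (auto simp: RF.line_extension_mem_iff)
    have "k \<in> F" using kw(1) by (cases rule: Rats_cases) auto
    have "set Vs \<subseteq> F" using Cons.prems by simp
    hence "w \<in> F" using kw(2) Cons.IH by blast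
    with \<open>k \<in> F\<close> show "x \<in> F" unfolding kw(3) using Cons.prems by (intro add_mem mult_mem) simp_all
  qed
qed simp

lemma number_field_algebraic:
  assumes "number_field K" "x \<in> K"
  shows "Polynomial.algebraic x"
proof -
  have K: "subfield K real_field" and fin: "RF.finite_dimension \<rat> K"
    using assms by (auto simp: number_field_def)
  have Q: "subfield \<rat> real_field"
    unfolding subfield_real_iff by auto
  have "(RF.algebraic over \<rat>) x"
    using RF.finite_dimension_imp_algebraic[OF Q subfieldE(1)[OF K] fin assms(2)] .
  thus ?thesis unfolding algebraic_over_iff[OF Q] algebraic_altdef coeffs_in_def by blast
qed

text \<open>Induction over a finite spanning list; each further element is absorbed by
  \<open>primitive_element_pair\<close>.\<close>

lemma number_field_primitive_element:
  assumes "number_field K"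
  obtains t where "t \<in> K" "K = range (\<lambda>g. qeval g t)"
proof -
  have K: "subfield K real_field" and fin: "RF.finite_dimension \<rat> K"
    using assms by (auto simp: number_field_def)
  interpret K: real_subfield K using K by (rule real_subfield.intro)
  have Q: "subfield \<rat> real_field"
    unfolding subfield_real_iff by auto
  obtain Us where Us: "RF.Span \<rat> Us = K"
    using fin RF.exists_base[OF Q] unfolding RF.finite_dimension_def by blast
  have base: "set Us \<subseteq> K"
    using RF.Span_base_incl[OF Q, of Us] Us by simp
  have "\<exists>t\<in>K. set Vs \<subseteq> rat_adjoin t" if "set Vs \<subseteq> K" for Vs
    using that
  proof (induction Vs)
    case (Cons v Vs)
    then obtain t where t: "t \<in> K" "set Vs \<subseteq> rat_adjoin t" by auto
    obtain c where c: "t \<in> rat_adjoin (t + of_rat c * v)" "v \<in> rat_adjoin (t + of_rat c * v)"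
      using primitive_element_pair number_field_algebraic[OF assms] t(1) Cons.prems
      by (metis list.set_intros(1) subsetD)
    have "rat_adjoin t \<subseteq> rat_adjoin (t + of_rat c * v)"
      using c(1) subfield_rat_adjoin by (intro rat_adjoin_minimal)
    moreover have "t + of_rat c * v \<in> K" using t(1) Cons.prems by auto
    ultimately show ?case using t c by (intro bexI[of _ "t + of_rat c * v"]) auto
  qed (auto intro: bexI[of _ 0])
  with base obtain t where t: "t \<in> K" "set Us \<subseteq> rat_adjoin t" by blast
  interpret A: real_subfield "rat_adjoin t" by (intro real_subfield.intro subfield_rat_adjoin)
  have "K \<subseteq> rat_adjoin t"
  proof -
    from A.Span_Rats_subset[OF t(2)] Us show ?thesis by blast
  qed
  moreover have "rat_adjoin t \<subseteq> K" using t(1) K by (intro rat_adjoin_minimal)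
  ultimately have "K = rat_adjoin t" by (rule antisym)
  thus ?thesis
    using that[OF t(1)] rat_adjoin_eq[OF number_field_algebraic[OF assms t(1)]] by simp
qed

text \<open>Independent lists in \<open>K\<close> are no longer than the dimension of the field
  generated by \<open>a\<close>; one of greatest length spans \<open>K\<close> by maximality. In
  (ii) this shows that the given subfield has finite degree.\<close>

lemma number_field_subset_adjoin:
  assumes K: "subfield K real_field" and a: "Polynomial.algebraic a" and sub: "K \<subseteq> rat_adjoin a"
  shows "number_field K"
proof -
  interpret K: real_subfield K using K by (rule real_subfield.intro)
  have Q: "subfield \<rat> real_field"
    unfolding subfield_real_iff by auto
  have "(RF.algebraic over \<rat>) a"
    using a unfolding algebraic_over_iff[OF Q] algebraic_altdef coeffs_in_def by blast
  hence sf: "subfield (RF.simple_extension \<rat> a) real_field"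
    and fin: "RF.finite_dimension \<rat> (RF.simple_extension \<rat> a)"
    using RF.simple_extension_is_subfield[OF Q, of a] RF.finite_dimension_simple_extension[OF Q, of a] by auto
  have "a \<in> RF.simple_extension \<rat> a" by (rule RF.simple_extension_mem[OF subfieldE(1)[OF Q]]) auto
  hence sub': "K \<subseteq> RF.simple_extension \<rat> a" using rat_adjoin_minimal[OF sf] sub by blast
  obtain n where n: "RF.dimension n \<rat> (RF.simple_extension \<rat> a)"
    using fin unfolding RF.finite_dimension_def by blast
  define P where "P = (\<lambda>Us. RF.independent \<rat> Us \<and> set Us \<subseteq> K)"
  have "P []" by (simp add: P_def)
  moreover have "length Us \<le> n" if "P Us" for Us
    using RF.independent_length_le_dimension[OF Q n] that sub' by (auto simp: P_def)
  hence "\<forall>y. P y \<longrightarrow> length y < Suc n" by (simp add: less_Suc_eq_le)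
  ultimately obtain Us where Us: "P Us" and max: "\<And>Vs. P Vs \<Longrightarrow> length Vs \<le> length Us"
    using ex_has_greatest_nat[of P "[]" length "Suc n"] by blast
  have "RF.Span \<rat> Us = K"
  proof
    show "RF.Span \<rat> Us \<subseteq> K" by (rule K.Span_Rats_subset) (use Us in \<open>simp add: P_def\<close>)
    show "K \<subseteq> RF.Span \<rat> Us"
    proof
      fix x assume "x \<in> K"
      show "x \<in> RF.Span \<rat> Us"
      proof (rule ccontr)
        assume "x \<notin> RF.Span \<rat> Us"
        with Us \<open>x \<in> K\<close> have "P (x # Us)" using RF.li_Cons[of x \<rat> Us] by (simp add: P_def del: RF.Span.simps)
        from max[OF this] show False by simp
      qed
    qed
  qed
  moreover have "RF.dimension (length Us) \<rat> (RF.Span \<rat> Us)"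
    by (rule RF.dimension_independent) (use Us in \<open>simp add: P_def\<close>)
  ultimately have "RF.finite_dimension \<rat> K"
    unfolding RF.finite_dimension_def by metis
  thus ?thesis using K by (simp add: number_field_def)
qed

text \<open>If N clears the denominators of the minimal polynomial f of a, of degree r, then t = N a
  is a root of the monic integral polynomial N^r f(X/N) and generates the same field. Integral
  coefficients are needed for the pigeonhole arguments behind the Pell equation.\<close>

lemma integral_primitive_element:
  assumes "number_field K"
  obtains t and h :: "int poly" where "lead_coeff h = 1" "rat_irreducible (map_poly of_int h)"
    "qeval (map_poly of_int h) t = 0" "K = range (\<lambda>g. qeval g t)"
proof -
  obtain a where a: "a \<in> K" "K = range (\<lambda>g. qeval g a)"
    using number_field_primitive_element[OF assms] by blast
  have alg: "Polynomial.algebraic a" using number_field_algebraic[OF assms a(1)] .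
  then obtain f where f: "rat_irreducible f" "lead_coeff f = 1" "qeval f a = 0"
    using minimal_polynomial_exists[of _ a] unfolding algebraic_iff_qeval by metis
  have "\<exists>N>0. \<forall>i\<in>I. of_nat N * coeff f i \<in> \<int>" if "finite I" for I
    using that
  proof (induction I)
    case (insert i I)
    then obtain N where N: "N > 0" "\<forall>i\<in>I. of_nat N * coeff f i \<in> \<int>" by blast
    obtain u v where uv: "coeff f i = of_int u / of_int v" "v > 0"
      by (cases "coeff f i") (auto simp: Fract_of_int_quotient)
    have "of_nat (N * nat v) * coeff f i = of_int (int N * u)" using uv by simp
    moreover have "of_nat (N * nat v) * coeff f j \<in> \<int>" if "j \<in> I" for j
      using Ints_mult[OF bspec[OF N(2) that] Ints_of_int[of v]] uv by (simp add: algebra_simps)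
    ultimately show ?case using N uv by (intro exI[of _ "N * nat v"]) (auto intro: Ints_of_int)
  qed (auto intro: exI[of _ 1])
  from this[of "{..degree f}"] obtain N where N: "N > 0" "\<forall>i\<le>degree f. of_nat N * coeff f i \<in> \<int>"
    by auto
  define r where "r = degree f"
  define t where "t = of_nat N * a"
  define s where "s = [:0, of_nat N :: rat:]"
  define g where "g = smult (of_nat N ^ r) (pcompose f [:0, inverse (of_nat N):])"
  have qs: "qeval s a = t" by (simp add: s_def t_def)
  have g_coeff: "coeff g i = of_nat N ^ r * (coeff f i * inverse (of_nat N) ^ i)" for i
    by (simp add: g_def coeff_pcompose_linear)
  have g_int: "coeff g i \<in> \<int>" for i
  proof (cases "i < r")
    case True
    hence "coeff g i = of_nat N ^ (r - i - 1) * (of_nat N * coeff f i)"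
    proof -
      have "(of_nat N :: rat) ^ r = of_nat N ^ (r - i - 1) * of_nat N * of_nat N ^ i"
      proof -
        have "(of_nat N :: rat) ^ r = of_nat N ^ ((r - i - 1) + 1 + i)" using True by simp
        thus ?thesis by (simp only: power_add power_one_right)
      qed
      thus ?thesis using N(1) by (simp add: g_coeff power_inverse)
    qed
    moreover have "of_nat N * coeff f i \<in> \<int>" using N(2) True by (simp add: r_def)
    ultimately show ?thesis by (metis Ints_mult Ints_power Ints_of_nat)
  next
    case False
    show ?thesis
    proof (cases "i = r")
      case True
      thus ?thesis using f(2) N(1) by (simp add: g_coeff r_def power_inverse)
    next
      case i: False
      with False have "coeff f i = 0" by (intro coeff_eq_0) (simp add: r_def)
      thus ?thesis by (simp add: g_coeff)
    qed
  qed
  have degg: "degree g = r"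
    using N(1) by (simp add: g_def r_def degree_pcompose)
  have leadg: "lead_coeff g = 1"
    using f(2) N(1) by (simp add: degg g_coeff r_def power_inverse)
  have rootg: "qeval g t = 0"
  proof -
    have "qeval [:0, inverse (of_nat N):] t = a" using N(1) by (simp add: t_def of_rat_inverse)
    thus ?thesis using f(3) by (simp add: g_def)
  qed
  have "g \<noteq> 0" using leadg by auto
  then obtain h where h: "rat_irreducible h" "lead_coeff h = 1" "qeval h t = 0"
    using minimal_polynomial_exists[of g t] rootg by blast
  have "h dvd g" using irreducible_rat_poly_dvd[OF h(1,3) rootg] .
  \<comment> \<open>\<open>g\<close> is irreducible itself: a proper factor \<open>h\<close>
    vanishing at \<open>t\<close> would give, as h(N X), a polynomial of degree below r vanishing at
    \<open>a\<close>.\<close>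
  have "qeval (pcompose h s) a = 0" using h(3) qs by simp
  hence "f dvd pcompose h s" using irreducible_rat_poly_dvd[OF f(1,3)] by blast
  moreover have "pcompose h s \<noteq> 0"
    using h(2) N(1) by (auto simp: pcompose_eq_0_iff s_def)
  ultimately have "degree f \<le> degree (pcompose h s)" by (intro dvd_imp_degree_le)
  also have "\<dots> = degree h" using N(1) by (simp add: degree_pcompose s_def)
  finally have "r \<le> degree h" by (simp add: r_def)
  from \<open>h dvd g\<close> obtain k where k: "g = h * k" ..
  with leadg have "h \<noteq> 0" "k \<noteq> 0" by auto
  hence "degree g = degree h + degree k" using k by (simp add: degree_mult_eq)
  with \<open>r \<le> degree h\<close> degg have "degree k = 0" by simp
  then obtain c where "k = [:c:]" by (elim degree_eq_zeroE)
  with k leadg h(2) have "g = h" by (auto split: if_splits)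
  have "\<exists>q. p = map_poly of_int q" if "\<And>i. coeff p i \<in> \<int>" for p :: "rat poly"
    using that
  proof (induction p)
    case (pCons a p)
    have "coeff p i \<in> \<int>" for i using pCons.prems[of "Suc i"] by simp
    with pCons.IH obtain q where "p = map_poly of_int q" by blast
    moreover obtain c where "a = of_int c"
      using pCons.prems[of 0] by (auto elim: Ints_cases)
    ultimately have "pCons a p = map_poly of_int (pCons c q)" by (simp add: map_poly_pCons)
    thus ?case by blast
  qed (auto intro: exI[of _ 0])
  then obtain H where H: "g = map_poly of_int H" using g_int by blast
  have "lead_coeff H = 1"
    using leadg unfolding H by (simp add: degree_map_poly coeff_map_poly)
  moreover have "rat_adjoin a = rat_adjoin t"
  proof
    interpret A: real_subfield "rat_adjoin a" by (intro real_subfield.intro subfield_rat_adjoin)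
    interpret T: real_subfield "rat_adjoin t" by (intro real_subfield.intro subfield_rat_adjoin)
    show "rat_adjoin t \<subseteq> rat_adjoin a"
      using A.mult_mem[OF A.of_nat_mem[of N] rat_adjoin_self]
      by (intro rat_adjoin_minimal subfield_rat_adjoin) (simp add: t_def)
    have "a = t / of_nat N" using N(1) by (simp add: t_def)
    also have "\<dots> \<in> rat_adjoin t" using rat_adjoin_self by auto
    finally show "rat_adjoin a \<subseteq> rat_adjoin t"
      by (intro rat_adjoin_minimal subfield_rat_adjoin)
  qed
  moreover have "Polynomial.algebraic t"
    unfolding algebraic_iff_qeval using rootg leadg by (intro exI[of _ g]) auto
  ultimately show ?thesis
    using that[of H t] h \<open>g = h\<close> H a(2) rat_adjoin_eq[OF alg] rat_adjoin_eq by metis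
qed

text \<open>Another choice of the representing polynomial changes the value at \<open>z\<close> by a
  multiple of h(z) = 0, so the value is well defined. Thus every root of \<open>h\<close> provides
  one of the embeddings over which the definitions quantify.\<close>

lemma embedding_exists:
  fixes t :: real and z :: "'a::field_char_0"
  assumes h: "rat_irreducible h" "qeval h t = 0" "qeval h z = 0"
  obtains \<sigma> where
    "\<sigma> \<in> ring_hom (real_field\<lparr>carrier := range (\<lambda>g. qeval g t)\<rparr>) (ring_of_type_algebra :: 'a ring)"
    "\<And>g. \<sigma> (qeval g t) = qeval g z"
proof -
  define \<sigma> where "\<sigma> = (\<lambda>x. qeval (SOME g. qeval g t = x) z)"
  have \<sigma>: "\<sigma> (qeval g t) = qeval g z" for g
  proof -
    define k where "k = (SOME k. qeval k t = qeval g t)"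
    have "qeval k t = qeval g t" unfolding k_def by (rule someI) auto
    hence "h dvd k - g" by (intro irreducible_rat_poly_dvd[OF h(1,2)]) simp
    then obtain u where "k - g = h * u" ..
    hence "qeval (k - g) z = 0" using h(3) by simp
    thus ?thesis by (simp add: \<sigma>_def k_def)
  qed
  have "\<sigma> \<in> ring_hom (real_field\<lparr>carrier := range (\<lambda>g. qeval g t)\<rparr>) (ring_of_type_algebra :: 'a ring)"
  proof (rule ring_hom_memI)
    fix x y assume "x \<in> carrier (real_field\<lparr>carrier := range (\<lambda>g. qeval g t)\<rparr>)"
      "y \<in> carrier (real_field\<lparr>carrier := range (\<lambda>g. qeval g t)\<rparr>)"
    then obtain g k where gk: "x = qeval g t" "y = qeval k t" by auto
    have "\<sigma> (x * y) = \<sigma> (qeval (g * k) t)" "\<sigma> (x + y) = \<sigma> (qeval (g + k) t)"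
      by (simp_all add: gk)
    thus "\<sigma> (x \<otimes>\<^bsub>real_field\<lparr>carrier := range (\<lambda>g. qeval g t)\<rparr>\<^esub> y) = \<sigma> x \<otimes>\<^bsub>ring_of_type_algebra\<^esub> \<sigma> y"
      "\<sigma> (x \<oplus>\<^bsub>real_field\<lparr>carrier := range (\<lambda>g. qeval g t)\<rparr>\<^esub> y) = \<sigma> x \<oplus>\<^bsub>ring_of_type_algebra\<^esub> \<sigma> y"
      by (simp_all only: \<sigma>) (simp_all add: gk \<sigma>)
  next
    show "\<sigma> \<one>\<^bsub>real_field\<lparr>carrier := range (\<lambda>g. qeval g t)\<rparr>\<^esub> = \<one>\<^bsub>ring_of_type_algebra\<^esub>"
      using \<sigma>[of 1] by simp
  qed auto
  with \<sigma> that show ?thesis by blast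
qed

subsection \<open>Algebraic integers\<close>

definition ieval :: "int poly \<Rightarrow> 'a::field_char_0 \<Rightarrow> 'a"
  where "ieval p x = poly (map_poly of_int p) x"

lemma ieval_qeval: "ieval p x = qeval (map_poly of_int p) x"
proof -
  have "map_poly of_int p = (map_poly of_rat (map_poly of_int p) :: 'a poly)"
    by (rule poly_eqI) (simp add: coeff_map_poly)
  thus ?thesis by (simp add: ieval_def qeval_def)
qed

lemma ieval_0 [simp]: "ieval 0 x = 0"
  by (simp add: ieval_def)

lemma ieval_pCons [simp]: "ieval (pCons a p) x = of_int a + x * ieval p x"
  by (simp add: ieval_def map_poly_pCons)

lemma ieval_1 [simp]: "ieval 1 x = 1"
  by (simp add: one_pCons)

lemma ieval_add [simp]: "ieval (p + q) x = ieval p x + ieval q x"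
  by (induction p q rule: poly_induct2) (auto simp: algebra_simps)

lemma ieval_smult [simp]: "ieval (smult c p) x = of_int c * ieval p x"
  by (induction p) (auto simp: algebra_simps)

lemma ieval_minus [simp]: "ieval (- p) x = - ieval p x"
  by (induction p) (auto simp: algebra_simps)

lemma ieval_diff [simp]: "ieval (p - q) x = ieval p x - ieval q x"
  using ieval_add[of p "- q" x] by simp

lemma ieval_mult [simp]: "ieval (p * q) x = ieval p x * ieval q x"
  by (induction p) (auto simp: algebra_simps)

lemma ieval_power [simp]: "ieval (p ^ n) x = ieval p x ^ n"
  by (induction n) auto

lemma ieval_altdef: "ieval p x = (\<Sum>i\<le>degree p. of_int (coeff p i) * x ^ i)"
  by (simp add: ieval_def poly_altdef degree_map_poly coeff_map_poly)

lemma ieval_of_real: "ieval p (of_real x :: complex) = of_real (ieval p x)"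
  by (simp add: ieval_qeval qeval_of_real)

lemma algebraic_int_iff_ieval: "algebraic_int x \<longleftrightarrow> (\<exists>p. lead_coeff p = 1 \<and> ieval p x = 0)"
  by (auto simp: algebraic_int_altdef_ipoly ieval_def)

text \<open>Eliminating one unknown at a time by cross multiplication keeps the diagonal entries monic
  of degree \<open>d\<close> and the other entries of smaller degree.\<close>

lemma monic_elimination:
  fixes x :: "'a::field_char_0" and P :: "'a \<Rightarrow> 'a \<Rightarrow> int poly"
  assumes "finite S" "d > 0"
    and "\<And>i. i \<in> S \<Longrightarrow> degree (P i i) = d \<and> lead_coeff (P i i) = 1"
    and "\<And>i j. i \<in> S \<Longrightarrow> j \<in> S \<Longrightarrow> i \<noteq> j \<Longrightarrow> degree (P i j) < d"
    and "\<And>i. i \<in> S \<Longrightarrow> (\<Sum>j\<in>S. ieval (P i j) x * j) = 0"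
    and "s \<in> S" "s \<noteq> 0"
  shows "algebraic_int x"
  using assms
proof (induction S arbitrary: d P s rule: finite_induct)
  case (insert k S)
  note d = insert.prems(1) and diag = insert.prems(2) and off = insert.prems(3)
    and eq = insert.prems(4) and s = insert.prems(5,6)
  show ?case
  \<comment> \<open>The unknowns are the elements of \<open>S\<close> and \<open>k\<close>
    themselves. If all but \<open>k\<close> vanish, row \<open>k\<close> is already a monic equation
    for \<open>x\<close>; otherwise a nonzero unknown remains after \<open>k\<close> has been
    eliminated.\<close>
  proof (cases "\<exists>t\<in>S. t \<noteq> 0")
    case False
    hence "k \<noteq> 0" using s by auto
    moreover have "(\<Sum>j\<in>S. ieval (P k j) x * j) = 0" using False by (intro sum.neutral) auto
    hence "ieval (P k k) x * k = 0" using eq[of k] insert.hyps by simp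
    ultimately have "ieval (P k k) x = 0" by simp
    thus ?thesis using diag[of k] by (auto simp: algebraic_int_iff_ieval)
  next
    case True
    then obtain t where t: "t \<in> S" "t \<noteq> 0" by blast
    define Q where "Q = (\<lambda>i j. P k k * P i j - P i k * P k j)"
    have small: "degree (P i k * P k j) < d + d" if "i \<in> S" "j \<in> S" for i j
    proof -
      have "degree (P i k) < d" "degree (P k j) < d"
        using off[of i k] off[of k j] that insert.hyps by auto
      thus ?thesis using degree_mult_le[of "P i k" "P k j"] by linarith
    qed
    have kk: "degree (P k k) = d" "lead_coeff (P k k) = 1" using diag by auto
    show ?thesis
    proof (rule insert.IH[of "d + d" Q t])
      show "d + d > 0" using d by simp
      fix i assume i: "i \<in> S"
      have ii: "degree (P i i) = d" "lead_coeff (P i i) = 1" using diag i by auto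
      have "P k k \<noteq> 0" "P i i \<noteq> 0" using kk ii by auto
      hence "degree (P k k * P i i) = d + d" using kk ii by (simp add: degree_mult_eq)
      moreover have "lead_coeff (P k k * P i i) = 1" using kk ii by (simp add: lead_coeff_mult)
      moreover note small[OF i i]
      ultimately have "degree (Q i i) = d + d \<and> coeff (Q i i) (d + d) = 1"
        using degree_add_eq_left[of "- (P i k * P k i)" "P k k * P i i"]
        by (auto simp: Q_def coeff_eq_0)
      thus "degree (Q i i) = d + d \<and> lead_coeff (Q i i) = 1" by simp
      have "(\<Sum>j\<in>S. ieval (Q i j) x * j) =
          ieval (P k k) x * (\<Sum>j\<in>S. ieval (P i j) x * j) - ieval (P i k) x * (\<Sum>j\<in>S. ieval (P k j) x * j)"
        by (simp add: Q_def sum_distrib_left sum_subtractf algebra_simps)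
      also have "(\<Sum>j\<in>S. ieval (P i j) x * j) = - (ieval (P i k) x * k)"
        using eq[of i] i insert.hyps by (simp add: eq_neg_iff_add_eq_0 add.commute)
      also have "(\<Sum>j\<in>S. ieval (P k j) x * j) = - (ieval (P k k) x * k)"
        using eq[of k] insert.hyps by (simp add: eq_neg_iff_add_eq_0 add.commute)
      finally show "(\<Sum>j\<in>S. ieval (Q i j) x * j) = 0" by (simp add: algebra_simps)
      fix j assume j: "j \<in> S" "i \<noteq> j"
      have "degree (P k k * P i j) < d + d"
        using degree_mult_le[of "P k k" "P i j"] kk off[of i j] i j by auto
      with small[OF i j(1)] show "degree (Q i j) < d + d"
        unfolding Q_def by (intro degree_diff_less)
    qed (use t in auto)
  qed
qed auto

section \<open>Integrality by finitely generated \<int>-modules\<close>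

inductive_set zspan :: "'a::field_char_0 set \<Rightarrow> 'a set" for S where
  zero: "0 \<in> zspan S"
| base: "s \<in> S \<Longrightarrow> s \<in> zspan S"
| diff: "a \<in> zspan S \<Longrightarrow> b \<in> zspan S \<Longrightarrow> a - b \<in> zspan S"

lemma zspan_minus: "a \<in> zspan S \<Longrightarrow> - a \<in> zspan S"
  using zspan.diff[OF zspan.zero, of a S] by simp

lemma zspan_add: "a \<in> zspan S \<Longrightarrow> b \<in> zspan S \<Longrightarrow> a + b \<in> zspan S"
  using zspan.diff[of a S "- b"] zspan_minus by force

lemma zspan_sum: "(\<And>i. i \<in> I \<Longrightarrow> f i \<in> zspan S) \<Longrightarrow> sum f I \<in> zspan S"
  by (induction I rule: infinite_finite_induct) (auto intro: zspan.zero zspan_add)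

lemma zspan_of_int_mult: "a \<in> zspan S \<Longrightarrow> of_int n * a \<in> zspan S"
proof -
  assume a: "a \<in> zspan S"
  have "of_nat k * a \<in> zspan S" for k
    by (induction k) (auto simp: algebra_simps intro: zspan.zero zspan_add a)
  thus ?thesis by (cases n rule: int_cases2) (auto intro: zspan_minus)
qed

lemma zspan_mult_mono:
  assumes "a \<in> zspan S" "\<And>s. s \<in> S \<Longrightarrow> c * s \<in> zspan T"
  shows "c * a \<in> zspan T"
  using assms(1) by induction (auto simp: right_diff_distrib intro: zspan.intros assms(2))

lemma zspan_imp_sum:
  assumes "a \<in> zspan S" "finite S"
  obtains c :: "'a::field_char_0 \<Rightarrow> int" where "a = (\<Sum>s\<in>S. of_int (c s) * s)"
proof -
  have "\<exists>c :: 'a \<Rightarrow> int. a = (\<Sum>s\<in>S. of_int (c s) * s)"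
    using assms(1)
  proof induction
    case zero
    show ?case by (intro exI[of _ "\<lambda>_. 0"]) simp
  next
    case (base s)
    have "(\<Sum>t\<in>S. of_int (if t = s then 1 else 0) * t) = (\<Sum>t\<in>S. if t = s then t else 0)"
      by (intro sum.cong) auto
    thus ?case using assms(2) base by (intro exI[of _ "\<lambda>t. if t = s then 1 else 0"]) simp
  next
    case (diff a b)
    then obtain c d where "a = (\<Sum>s\<in>S. of_int (c s) * s)" "b = (\<Sum>s\<in>S. of_int (d s) * s)" by blast
    thus ?case by (intro exI[of _ "\<lambda>s. c s - d s"]) (simp add: sum_subtractf algebra_simps)
  qed
  with that show ?thesis by blast
qed

text \<open>Multiplication by \<open>x\<close> is given by an integer matrix on \<open>S\<close>, so
  the elements of \<open>S\<close> solve the linear system of x minus this matrix. Its diagonal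
  entries are monic of degree 1 and the others constant, the starting position of
  \<open>monic_elimination\<close>.\<close>

lemma algebraic_int_if_zspan_stable:
  fixes x :: "'a::field_char_0"
  assumes S: "finite S" "s \<in> S" "s \<noteq> 0" and stable: "\<And>t. t \<in> S \<Longrightarrow> x * t \<in> zspan S"
  shows "algebraic_int x"
proof -
  have "\<exists>c :: 'a \<Rightarrow> int. x * t = (\<Sum>s\<in>S. of_int (c s) * s)" if "t \<in> S" for t
    using zspan_imp_sum[OF stable[OF that] S(1)] by metis
  then obtain c :: "'a \<Rightarrow> 'a \<Rightarrow> int" where c: "\<And>t. t \<in> S \<Longrightarrow> x * t = (\<Sum>s\<in>S. of_int (c t s) * s)"
    by metis
  define P where "P = (\<lambda>i j. if i = j then [:- c i j, 1:] else [:- c i j:])"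
  show ?thesis
  proof (rule monic_elimination[OF S(1), of 1 P])
    fix i assume i: "i \<in> S"
    have "(\<Sum>j\<in>S. ieval (P i j) x * j) = (\<Sum>j\<in>S. (if j = i then x * i else 0) - of_int (c i j) * j)"
      by (intro sum.cong) (auto simp: P_def algebra_simps)
    also have "\<dots> = x * i - (\<Sum>j\<in>S. of_int (c i j) * j)"
      using S(1) i by (simp add: sum_subtractf)
    finally show "(\<Sum>j\<in>S. ieval (P i j) x * j) = 0" using c[OF i] by simp
  qed (use S in \<open>auto simp: P_def\<close>)
qed

text \<open>A further integer e is accommodated by multiplying the generators with 1, e, ..., e^(n -
  1); its monic equation of degree n brings e^n back into the span. Sums and products then need only
  one module.\<close>

lemma algebraic_int_common_module:
  fixes E :: "'a::field_char_0 set"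
  assumes "finite E" "\<And>e. e \<in> E \<Longrightarrow> algebraic_int e"
  obtains S where "finite S" "1 \<in> S" "\<And>e s. e \<in> E \<Longrightarrow> s \<in> S \<Longrightarrow> e * s \<in> zspan S"
proof -
  have "\<exists>S. finite S \<and> 1 \<in> S \<and> (\<forall>e\<in>E. \<forall>s\<in>S. e * s \<in> zspan S)"
    using assms
  proof (induction E rule: finite_induct)
    case empty
    show ?case by (intro exI[of _ "{1}"]) auto
  next
    case (insert e E)
    then obtain S where S: "finite S" "1 \<in> S" "\<And>e s. e \<in> E \<Longrightarrow> s \<in> S \<Longrightarrow> e * s \<in> zspan S"
      by blast
    obtain p where p: "lead_coeff p = 1" "ieval p e = 0"
      using insert.prems[of e] by (auto simp: algebraic_int_iff_ieval)
    have "degree p > 0"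
    proof (rule ccontr)
      assume "\<not> degree p > 0"
      then obtain c where "p = [:c:]" by (auto elim: degree_eq_zeroE)
      with p show False by simp
    qed
    define n where "n = degree p"
    have n: "n > 0" using \<open>degree p > 0\<close> by (simp add: n_def)
    define T where "T = (\<lambda>(i, s). e ^ i * s) ` ({..<n} \<times> S)"
    have TI: "e ^ i * s \<in> T" if "i < n" "s \<in> S" for i s
      unfolding T_def using that by (intro image_eqI[of _ _ "(i, s)"]) auto
    have "e ^ n = - (\<Sum>i<n. of_int (coeff p i) * e ^ i)"
    proof -
      have "(\<Sum>i<Suc n. of_int (coeff p i) * e ^ i) = 0"
        using p(2) unfolding ieval_altdef n_def lessThan_Suc_atMost .
      thus ?thesis using p(1) by (simp add: n_def eq_neg_iff_add_eq_0 add.commute)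
    qed
    hence top: "e ^ n * s = - (\<Sum>i<n. of_int (coeff p i) * (e ^ i * s))" for s
      by (simp add: sum_distrib_right mult.assoc)
    have "f * t \<in> zspan T" if f: "f \<in> insert e E" and t: "t \<in> T" for f t
    proof -
      from t obtain i s where IS: "i < n" "s \<in> S" "t = e ^ i * s" by (auto simp: T_def)
      show ?thesis
      proof (cases "f = e")
        case True
        show ?thesis
        proof (cases "Suc i < n")
          case True
          thus ?thesis using TI[of "Suc i" s] IS \<open>f = e\<close> by (auto intro: zspan.base simp: mult.assoc)
        next
          case False
          hence "n = Suc i" using IS by simp
          hence "f * t = e ^ n * s" using IS \<open>f = e\<close> by (simp add: mult.assoc)
          thus ?thesis unfolding top
            by (simp only:) (intro zspan_minus zspan_sum zspan_of_int_mult zspan.base, use IS TI in auto)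
        qed
      next
        case False
        hence "f * s \<in> zspan S" using f S(3) IS by auto
        hence "e ^ i * (f * s) \<in> zspan T"
          by (rule zspan_mult_mono) (use TI IS in \<open>auto intro: zspan.base\<close>)
        thus ?thesis by (simp add: IS algebra_simps)
      qed
    qed
    moreover have "1 \<in> T" using TI[of 0 1] n S by simp
    moreover have "finite T" using S by (simp add: T_def)
    ultimately show ?case by blast
  qed
  with that show ?thesis by blast
qed

lemma algebraic_int_add [intro]:
  fixes x y :: "'a::field_char_0"
  assumes "algebraic_int x" "algebraic_int y"
  shows "algebraic_int (x + y)"
proof -
  obtain S where S: "finite S" "1 \<in> S" "\<And>e s. e \<in> {x, y} \<Longrightarrow> s \<in> S \<Longrightarrow> e * s \<in> zspan S"
    using algebraic_int_common_module[of "{x, y}"] assms by blast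
  show ?thesis
    by (rule algebraic_int_if_zspan_stable[OF S(1,2)])
       (use S(3) in \<open>auto simp: distrib_right intro: zspan_add\<close>)
qed

lemma algebraic_int_mult [intro]:
  fixes x y :: "'a::field_char_0"
  assumes "algebraic_int x" "algebraic_int y"
  shows "algebraic_int (x * y)"
proof -
  obtain S where S: "finite S" "1 \<in> S" "\<And>e s. e \<in> {x, y} \<Longrightarrow> s \<in> S \<Longrightarrow> e * s \<in> zspan S"
    using algebraic_int_common_module[of "{x, y}"] assms by blast
  show ?thesis
  proof (rule algebraic_int_if_zspan_stable[OF S(1,2)])
    fix t assume "t \<in> S"
    hence "x * (y * t) \<in> zspan S" using S(3) by (intro zspan_mult_mono[of "y * t" S]) auto
    thus "x * y * t \<in> zspan S" by (simp add: mult.assoc)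
  qed auto
qed

lemma algebraic_int_diff [intro]:
  fixes x y :: "'a::field_char_0"
  shows "algebraic_int x \<Longrightarrow> algebraic_int y \<Longrightarrow> algebraic_int (x - y)"
  using algebraic_int_add[of x "- y"] by (simp add: algebraic_int_minus)

lemma algebraic_int_of_int [simp, intro]: "algebraic_int (of_int n :: 'a::field_char_0)"
  by (rule int_imp_algebraic_int) simp

lemma algebraic_int_1' [simp, intro]: "algebraic_int (1 :: 'a::field_char_0)"
  using algebraic_int_of_int[of 1] by simp

lemma algebraic_int_of_nat [simp, intro]: "algebraic_int (of_nat n :: 'a::field_char_0)"
  using algebraic_int_of_int[of "int n"] by simp

lemma algebraic_int_sum [intro]:
  fixes f :: "'b \<Rightarrow> 'a::field_char_0"
  shows "(\<And>a. a \<in> A \<Longrightarrow> algebraic_int (f a)) \<Longrightarrow> algebraic_int (sum f A)"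
  by (induction A rule: infinite_finite_induct) auto

lemma algebraic_int_prod [intro]:
  fixes f :: "'b \<Rightarrow> 'a::field_char_0"
  shows "(\<And>a. a \<in> A \<Longrightarrow> algebraic_int (f a)) \<Longrightarrow> algebraic_int (prod f A)"
  by (induction A rule: infinite_finite_induct) auto

lemma algebraic_int_ieval [intro]: "algebraic_int x \<Longrightarrow> algebraic_int (ieval p x)"
  by (induction p) auto

lemma algebraic_int_prod_poly:
  fixes f :: "'b \<Rightarrow> 'a::field_char_0 poly"
  assumes "\<And>a i. a \<in> A \<Longrightarrow> algebraic_int (coeff (f a) i)"
  shows "algebraic_int (coeff (prod f A) i)"
  using assms
proof (induction A arbitrary: i rule: infinite_finite_induct)
  case (insert a A)
  thus ?case by (simp add: coeff_mult) blast
qed (auto simp: coeff_1)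

text \<open>Multiplying the generators of a module stable under all entries by the coordinates of
  \<open>v\<close> gives generators of a module stable under \<open>x\<close>. This takes the place
  of the characteristic polynomial.\<close>

lemma algebraic_int_eigenvalue:
  fixes x :: "'a::field_char_0" and v :: "'n::finite \<Rightarrow> 'a"
  assumes "\<And>i j. algebraic_int (T i j)" "\<And>i. (\<Sum>j\<in>UNIV. T i j * v j) = x * v i" "v k \<noteq> 0"
  shows "algebraic_int x"
proof -
  define E where "E = range (\<lambda>(i, j). T i j)"
  have "finite E" "\<And>e. e \<in> E \<Longrightarrow> algebraic_int e" using assms(1) by (auto simp: E_def)
  then obtain S where S: "finite S" "1 \<in> S" "\<And>e s. e \<in> E \<Longrightarrow> s \<in> S \<Longrightarrow> e * s \<in> zspan S"
    using algebraic_int_common_module by metis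
  define U where "U = (\<lambda>(s, i). s * v i) ` (S \<times> UNIV)"
  have UI: "s * v i \<in> U" if "s \<in> S" for s i
    unfolding U_def using that by (intro image_eqI[of _ _ "(s, i)"]) auto
  show ?thesis
  proof (rule algebraic_int_if_zspan_stable)
    show "finite U" using S by (simp add: U_def)
    show "v k \<in> U" using UI[OF S(2), of k] by simp
    show "v k \<noteq> 0" by fact
    fix u assume "u \<in> U"
    then obtain s i where u: "s \<in> S" "u = s * v i" by (auto simp: U_def)
    have "x * u = (\<Sum>j\<in>UNIV. v j * (T i j * s))"
    proof -
      have "x * u = s * (x * v i)" by (simp add: u)
      also have "\<dots> = (\<Sum>j\<in>UNIV. s * (T i j * v j))"
        unfolding assms(2)[symmetric] by (rule sum_distrib_left)
      finally show ?thesis by (simp add: algebra_simps)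
    qed
    also have "\<dots> \<in> zspan U"
    proof (rule zspan_sum)
      fix j
      have "T i j * s \<in> zspan S" using S(3) u by (auto simp: E_def)
      thus "v j * (T i j * s) \<in> zspan U"
        by (rule zspan_mult_mono) (use UI in \<open>auto intro: zspan.base simp: mult.commute\<close>)
    qed
    finally show "x * u \<in> zspan U" .
  qed
qed

lemma algebraic_int_power_root:
  fixes x :: "'a::field_char_0"
  assumes "algebraic_int (x ^ k)" "k > 0"
  shows "algebraic_int x"
  by (rule algebraic_int_root[OF assms(1), of "monom 1 k"])
     (use assms(2) in \<open>auto simp: poly_monom degree_monom_eq coeff_monom\<close>)

subsection \<open>Hyperbolic isometries and their null eigenvectors\<close>

definition spatial :: "('n::finite) lvec \<Rightarrow> real ^ 'n"
  where "spatial x = (\<chi> i. x $ Some i)"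

lemma spatial_linear [simp]:
  "spatial (x + y) = spatial x + spatial y" "spatial (x - y) = spatial x - spatial y"
  "spatial (c *\<^sub>R x) = c *\<^sub>R spatial x" "spatial (- x) = - spatial x"
  by (simp_all add: spatial_def vec_eq_iff)

lemma lorentz_inner_spatial: "lorentz_inner x y = spatial x \<bullet> spatial y - x $ None * y $ None"
  by (simp add: lorentz_inner_def spatial_def inner_vec_def)

lemma lorentz_form_inner: "lorentz_form x = lorentz_inner x x"
  by (simp add: lorentz_form_def lorentz_inner_def power2_eq_square)

lemma lorentz_form_spatial: "lorentz_form x = spatial x \<bullet> spatial x - (x $ None)\<^sup>2"
  by (simp only: lorentz_form_inner lorentz_inner_spatial power2_eq_square)

lemma lvec_eq_0_iff: "x = 0 \<longleftrightarrow> spatial x = 0 \<and> x $ None = 0"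
proof
  assume *: "spatial x = 0 \<and> x $ None = 0"
  have s: "x $ Some i = 0" for i using * by (metis spatial_def vec_lambda_beta zero_index)
  have "x $ i = 0" for i
    using * s by (cases i) simp_all
  thus "x = 0" by (simp add: vec_eq_iff)
next
  assume "x = 0"
  thus "spatial x = 0 \<and> x $ None = 0" by (simp add: spatial_def zero_vec_def)
qed

lemma lorentz_inner_commute: "lorentz_inner x y = lorentz_inner y x"
  by (simp add: lorentz_inner_spatial inner_commute)

lemma lorentz_inner_linear:
  "lorentz_inner (x + y) z = lorentz_inner x z + lorentz_inner y z"
  "lorentz_inner (x - y) z = lorentz_inner x z - lorentz_inner y z"
  "lorentz_inner (c *\<^sub>R x) z = c * lorentz_inner x z"
  "lorentz_inner (- x) z = - lorentz_inner x z"
  "lorentz_inner z (x + y) = lorentz_inner z x + lorentz_inner z y"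
  "lorentz_inner z (x - y) = lorentz_inner z x - lorentz_inner z y"
  "lorentz_inner z (c *\<^sub>R x) = c * lorentz_inner z x"
  "lorentz_inner z (- x) = - lorentz_inner z x"
  by (simp_all add: lorentz_inner_spatial inner_add inner_diff algebra_simps)

text \<open>If the form at \<open>z\<close> were not positive, orthogonality and Cauchy-Schwarz for
  the spatial parts would give (u_0 z_0)^2 < (u_0 z_0)^2 for the last coordinates.\<close>

lemma lorentz_form_orthogonal_pos:
  assumes u: "lorentz_form u < 0" and uz: "lorentz_inner u z = 0" and z: "z \<noteq> 0"
  shows "lorentz_form z > 0"
proof (rule ccontr)
  assume neg: "\<not> lorentz_form z > 0"
  have u': "spatial u \<bullet> spatial u < (u $ None)\<^sup>2"
    using u unfolding lorentz_form_spatial by linarith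
  have z': "spatial z \<bullet> spatial z \<le> (z $ None)\<^sup>2"
    using neg unfolding lorentz_form_spatial by linarith
  have "z $ None \<noteq> 0"
  proof
    assume "z $ None = 0"
    with z' have "spatial z = 0" using inner_ge_zero[of "spatial z"] by simp
    with \<open>z $ None = 0\<close> z show False by (simp add: lvec_eq_0_iff)
  qed
  have "(u $ None)\<^sup>2 * (z $ None)\<^sup>2 = (spatial u \<bullet> spatial z)\<^sup>2"
    using uz by (simp add: lorentz_inner_spatial power_mult_distrib)
  also have "\<dots> \<le> (spatial u \<bullet> spatial u) * (spatial z \<bullet> spatial z)"
    by (rule Cauchy_Schwarz_ineq)
  also have "\<dots> \<le> (spatial u \<bullet> spatial u) * (z $ None)\<^sup>2"
    using z' by (intro mult_left_mono) auto
  also have "\<dots> < (u $ None)\<^sup>2 * (z $ None)\<^sup>2"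
    using u' \<open>z $ None \<noteq> 0\<close> by (intro mult_strict_right_mono) auto
  finally show False by simp
qed

text \<open>Subtract the multiple of \<open>a\<close> with the same last coordinate as
  \<open>b\<close>. The difference is null with last coordinate 0, hence 0.\<close>

lemma null_orthogonal_parallel:
  assumes a: "lorentz_form a = 0" "a \<noteq> 0" and b: "lorentz_form b = 0" and ab: "lorentz_inner a b = 0"
  obtains r where "b = r *\<^sub>R a"
proof -
  have a0: "a $ None \<noteq> 0"
  proof
    assume "a $ None = 0"
    with a(1) have "spatial a = 0" by (simp add: lorentz_form_inner lorentz_inner_spatial)
    with \<open>a $ None = 0\<close> a(2) show False by (simp add: lvec_eq_0_iff)
  qed
  define r where "r = b $ None / a $ None"
  define z where "z = b - r *\<^sub>R a"
  have z0: "z $ None = 0" using a0 by (simp add: z_def r_def)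
  have "lorentz_form z = 0"
    using a b ab by (simp add: z_def lorentz_form_inner lorentz_inner_linear lorentz_inner_commute[of b a])
  with z0 have "spatial z = 0" by (simp add: lorentz_form_inner lorentz_inner_spatial)
  with z0 have "z = 0" by (simp add: lvec_eq_0_iff)
  thus ?thesis using that[of r] by (simp add: z_def)
qed

text \<open>The value -1/2 is the normalization that puts exp(t) a + exp(-t) b on the hyperboloid,
  as the two mixed terms add up to -1. By Cauchy-Schwarz, null vectors on opposite halves of the
  light cone have a nonnegative product.\<close>

lemma null_pair_None:
  assumes "lorentz_form a = 0" "lorentz_form b = 0" "lorentz_inner a b = - 1 / 2"
  shows "a $ None * b $ None > 0"
proof (rule ccontr)
  assume neg: "\<not> a $ None * b $ None > 0"
  have "(norm (spatial a))\<^sup>2 = (a $ None)\<^sup>2" "(norm (spatial b))\<^sup>2 = (b $ None)\<^sup>2"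
    using assms(1,2) by (simp_all add: lorentz_form_inner lorentz_inner_spatial power2_eq_square
      flip: power2_norm_eq_inner)
  hence n: "norm (spatial a) = \<bar>a $ None\<bar>" "norm (spatial b) = \<bar>b $ None\<bar>"
    by (metis abs_norm_cancel power2_eq_iff_nonneg norm_ge_zero abs_ge_zero power2_abs)+
  have "- (spatial a \<bullet> spatial b) \<le> \<bar>a $ None\<bar> * \<bar>b $ None\<bar>"
    using Cauchy_Schwarz_ineq2[of "spatial a" "spatial b"] unfolding n by linarith
  also have "\<dots> = - (a $ None * b $ None)" using neg by (simp flip: abs_mult)
  finally show False using assms(3) by (simp add: lorentz_inner_spatial)
qed

lemma hyp_space_inner_ge_1:
  assumes "x \<in> hyp_space" "y \<in> hyp_space"
  shows "- lorentz_inner x y \<ge> 1"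
proof -
  define p q where "p = norm (spatial x)" and "q = norm (spatial y)"
  have "p\<^sup>2 - (x $ None)\<^sup>2 = -1" "q\<^sup>2 - (y $ None)\<^sup>2 = -1" and pos: "x $ None > 0" "y $ None > 0"
    using assms by (simp_all add: hyp_space_def lorentz_form_inner lorentz_inner_spatial p_def q_def
       power2_norm_eq_inner power2_eq_square[of "_ $ None"])
  hence xy: "(x $ None)\<^sup>2 = 1 + p\<^sup>2" "(y $ None)\<^sup>2 = 1 + q\<^sup>2" by simp_all
  have "(1 + p * q)\<^sup>2 \<le> (1 + p * q)\<^sup>2 + (p - q)\<^sup>2" by simp
  also have "\<dots> = (x $ None * y $ None)\<^sup>2"
    unfolding power_mult_distrib xy by (simp add: power2_eq_square algebra_simps)
  finally have "1 + p * q \<le> x $ None * y $ None" using pos by (auto intro: power2_le_imp_le)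
  moreover have "spatial x \<bullet> spatial y \<le> p * q"
    using norm_cauchy_schwarz[of "spatial x" "spatial y"] by (simp add: p_def q_def)
  ultimately show ?thesis by (simp add: lorentz_inner_spatial)
qed

text \<open>The distance condition alone prescribes all products of points, namely - cosh (s - t)
  for c s and c t. From these, \<open>v\<close> is the unit tangent vector at c 0, found by
  orthogonalizing c 1 against c 0. The defect \<open>w\<close> of the formula c t = cosh t c 0 +
  sinh t v is null and orthogonal to the timelike vector c 0, hence 0.\<close>

lemma geodesic_line_null_vectors:
  assumes "geodesic_line c"
  obtains a b where "lorentz_form a = 0" "lorentz_form b = 0" "lorentz_inner a b = - 1 / 2"
    "\<And>t. c t = exp t *\<^sub>R a + exp (- t) *\<^sub>R b" "a $ None + b $ None > 0"
proof -
  have c: "c t \<in> hyp_space" for t using assms by (auto simp: geodesic_line_def)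
  have ip: "lorentz_inner (c s) (c t) = - cosh (s - t)" for s t
  proof -
    have "arcosh (- lorentz_inner (c s) (c t)) = \<bar>s - t\<bar>"
      using assms by (auto simp: geodesic_line_def hyp_dist_def)
    hence "cosh \<bar>s - t\<bar> = - lorentz_inner (c s) (c t)"
      using cosh_arcosh_real[OF hyp_space_inner_ge_1[OF c c], of s t] by simp
    thus ?thesis by (simp add: cosh_real_abs)
  qed
  define v where "v = (1 / sinh 1) *\<^sub>R (c 1 - cosh 1 *\<^sub>R c 0)"
  have sinh1: "sinh (1 :: real) \<noteq> 0" by simp
  have vc: "lorentz_inner v (c t) = sinh t" for t
  proof -
    have "cosh (1 - t) = cosh 1 * cosh t - sinh 1 * sinh t" by (rule cosh_diff)
    thus ?thesis using sinh1 by (simp add: v_def lorentz_inner_linear ip field_simps)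
  qed
  have ct: "c t = cosh t *\<^sub>R c 0 + sinh t *\<^sub>R v" for t
  proof -
    define w where "w = c t - cosh t *\<^sub>R c 0 - sinh t *\<^sub>R v"
    have w0: "lorentz_inner (c 0) w = 0"
      using vc[of 0] by (simp add: w_def lorentz_inner_linear ip lorentz_inner_commute[of _ v])
    have w1: "lorentz_inner (c 1) w = 0"
    proof -
      have "cosh (1 - t) = cosh 1 * cosh t - sinh 1 * sinh t" by (rule cosh_diff)
      thus ?thesis using vc[of 1] by (simp add: w_def lorentz_inner_linear ip lorentz_inner_commute[of _ v])
    qed
    have wv: "lorentz_inner v w = 0"
      using w0 w1 by (simp add: v_def lorentz_inner_linear)
    have "lorentz_form w = lorentz_inner (c t) w"
    proof -
      have "lorentz_form w = lorentz_inner (c t) w - cosh t * lorentz_inner (c 0) w - sinh t * lorentz_inner v w"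
        unfolding lorentz_form_inner by (subst (1) w_def) (simp add: lorentz_inner_linear)
      thus ?thesis using w0 wv by simp
    qed
    also have "\<dots> = -1 + cosh t * cosh t - sinh t * sinh t"
      by (simp add: w_def lorentz_inner_linear ip lorentz_inner_commute[of _ v] vc)
    also have "\<dots> = 0" using hyperbolic_pythagoras[of t] by (simp add: power2_eq_square)
    finally have "lorentz_form w = 0" .
    moreover have "lorentz_form (c 0) < 0" using c[of 0] by (simp add: hyp_space_def)
    ultimately have "w = 0" using lorentz_form_orthogonal_pos[OF _ w0] by fastforce
    thus ?thesis by (simp add: w_def algebra_simps)
  qed
  have vv: "lorentz_form v = 1"
  proof -
    have "lorentz_form v = lorentz_inner v ((1 / sinh 1) *\<^sub>R (c 1 - cosh 1 *\<^sub>R c 0))"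
      unfolding lorentz_form_inner by (subst (2) v_def) simp
    thus ?thesis using sinh1 by (simp add: lorentz_inner_linear vc)
  qed
  define a b where "a = (1/2) *\<^sub>R (c 0 + v)" and "b = (1/2) *\<^sub>R (c 0 - v)"
  have cc: "lorentz_inner (c 0) (c 0) = -1" "lorentz_inner v (c 0) = 0" "lorentz_inner (c 0) v = 0"
    using ip[of 0 0] vc[of 0] by (simp_all add: lorentz_inner_commute[of _ v])
  show ?thesis
  proof (rule that)
    show "lorentz_form a = 0" "lorentz_form b = 0" "lorentz_inner a b = - 1 / 2"
      using vv cc by (simp_all add: a_def b_def lorentz_form_inner lorentz_inner_linear)
    show "c t = exp t *\<^sub>R a + exp (- t) *\<^sub>R b" for t
      unfolding ct[of t] a_def b_def cosh_def sinh_def by (simp add: algebra_simps flip: scaleR_add_left)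
    show "a $ None + b $ None > 0"
      using c[of 0] by (simp add: a_def b_def hyp_space_def field_simps)
  qed
qed

lemma geodesic_line_from_null_vectors:
  assumes a: "lorentz_form a = 0" and b: "lorentz_form b = 0" and ab: "lorentz_inner a b = - 1 / 2"
    and pos: "a $ None > 0"
  shows "geodesic_line (\<lambda>t. exp t *\<^sub>R a + exp (- t) *\<^sub>R b)"
proof -
  have b0: "b $ None > 0" using null_pair_None[OF a b ab] pos by (simp add: zero_less_mult_iff)
  have ip: "lorentz_inner (exp s *\<^sub>R a + exp (- s) *\<^sub>R b) (exp t *\<^sub>R a + exp (- t) *\<^sub>R b) = - cosh (s - t)" for s t
  proof -
    have e: "exp (s - t) = exp s * exp (- t)" "exp (- (s - t)) = exp (- s) * exp t"
      by (simp_all flip: exp_add)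
    have ip: "lorentz_inner a a = 0" "lorentz_inner b b = 0" "lorentz_inner b a = - 1 / 2"
      using a b ab by (simp_all add: lorentz_form_inner lorentz_inner_commute[of b a])
    show ?thesis
      by (simp only: lorentz_inner_linear ip ab cosh_def e) (simp add: field_simps)
  qed
  show ?thesis
    unfolding geodesic_line_def
  proof (intro conjI allI subsetI)
    fix x assume "x \<in> range (\<lambda>t. exp t *\<^sub>R a + exp (- t) *\<^sub>R b)"
    then obtain t where t: "x = exp t *\<^sub>R a + exp (- t) *\<^sub>R b" by blast
    show "x \<in> hyp_space"
      using ip[of t t] pos b0 by (auto simp: t hyp_space_def lorentz_form_inner intro!: add_pos_pos)
  next
    fix s t
    show "hyp_dist (exp s *\<^sub>R a + exp (- s) *\<^sub>R b) (exp t *\<^sub>R a + exp (- t) *\<^sub>R b) = \<bar>s - t\<bar>"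
      unfolding hyp_dist_def ip using arcosh_cosh_real[of "\<bar>s - t\<bar>"] by (simp add: cosh_real_abs)
  qed
qed

lemma pos_lorentz_inner:
  assumes "T \<in> pos_lorentz"
  shows "lorentz_inner (T *v x) (T *v y) = lorentz_inner x y"
proof -
  have f: "lorentz_form (T *v z) = lorentz_form z" for z using assms by (simp add: pos_lorentz_def)
  have pol: "4 * lorentz_inner u w = lorentz_form (u + w) - lorentz_form (u - w)" for u w :: "'a lvec"
    by (simp add: lorentz_form_inner lorentz_inner_linear lorentz_inner_commute[of w u])
  have "4 * lorentz_inner (T *v x) (T *v y) = 4 * lorentz_inner x y"
    unfolding pol by (simp add: f flip: matrix_vector_mult_add_rdistrib matrix_vector_right_distrib
      matrix_vector_mult_diff_distrib)
  thus ?thesis by simp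
qed

text \<open>The defects \<open>p\<close> and \<open>q\<close> of the two eigenvector equations
  satisfy exp(t) p + exp(-t) q = 0 for all t; the values t = 0 and t = 1 force both to
  vanish.\<close>

lemma translates_along_null_vectors:
  assumes "translates_along T L d"
  obtains a b where "lorentz_form a = 0" "lorentz_form b = 0" "lorentz_inner a b = - 1 / 2"
    "a $ None > 0" "L = range (\<lambda>t. exp t *\<^sub>R a + exp (- t) *\<^sub>R b)"
    "T *v a = exp d *\<^sub>R a" "T *v b = exp (- d) *\<^sub>R b"
proof -
  obtain c where c: "geodesic_line c" "L = range c" "\<And>t. T *v c t = c (t + d)"
    using assms by (auto simp: translates_along_def)
  obtain a b where ab: "lorentz_form a = 0" "lorentz_form b = 0" "lorentz_inner a b = - 1 / 2"
    "\<And>t. c t = exp t *\<^sub>R a + exp (- t) *\<^sub>R b" "a $ None + b $ None > 0"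
    by (rule geodesic_line_null_vectors[OF c(1)]) (blast intro: that)
  have "a $ None > 0"
    using null_pair_None[OF ab(1-3)] ab(5) by (auto simp: zero_less_mult_iff)
  have eq: "exp t *\<^sub>R (T *v a) + exp (- t) *\<^sub>R (T *v b) = exp (t + d) *\<^sub>R a + exp (- t - d) *\<^sub>R b" for t
    using c(3)[of t] unfolding ab(4)
    by (simp add: matrix_vector_right_distrib scaleR_matrix_vector_assoc matrix_vector_mult_scaleR)
  define p q where "p = T *v a - exp d *\<^sub>R a" and "q = T *v b - exp (- d) *\<^sub>R b"
  have pq: "exp t *\<^sub>R p + exp (- t) *\<^sub>R q = 0" for t
    using eq[of t] by (simp add: p_def q_def algebra_simps exp_add exp_diff exp_minus divide_inverse)
  have "p + q = 0" using pq[of 0] by simp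
  hence q: "q = - p" by (simp add: eq_neg_iff_add_eq_0 add.commute)
  hence "(exp 1 - exp (- 1)) *\<^sub>R p = 0" using pq[of 1] by (simp add: algebra_simps)
  hence "p = 0" by simp
  with q have "p = 0" "q = 0" by simp_all
  hence "T *v a = exp d *\<^sub>R a" "T *v b = exp (- d) *\<^sub>R b" by (simp_all add: p_def q_def)
  moreover have "c = (\<lambda>t. exp t *\<^sub>R a + exp (- t) *\<^sub>R b)" by (rule ext) (rule ab(4))
  hence "L = range (\<lambda>t. exp t *\<^sub>R a + exp (- t) *\<^sub>R b)" using c(2) by simp
  ultimately show ?thesis using that[of a b] ab(1-3) \<open>a $ None > 0\<close> by blast
qed

text \<open>The product of the two expanded null vectors is multiplied by exp (d + d') and also
  preserved, so it is 0 and the vectors are parallel; likewise for the contracted ones. The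
  remaining factor \<open>r\<close> only shifts the parameter of the geodesic by ln r.\<close>

lemma translates_along_unique:
  assumes T: "T \<in> pos_lorentz" and "translates_along T L d" "d > 0" "translates_along T L' d'" "d' > 0"
  shows "L = L'" "d = d'"
proof -
  obtain a b where a: "lorentz_form a = 0" "lorentz_form b = 0" "lorentz_inner a b = - 1 / 2"
    "a $ None > 0" "L = range (\<lambda>t. exp t *\<^sub>R a + exp (- t) *\<^sub>R b)"
    "T *v a = exp d *\<^sub>R a" "T *v b = exp (- d) *\<^sub>R b"
    by (rule translates_along_null_vectors[OF assms(2)])
  obtain a' b' where a': "lorentz_form a' = 0" "lorentz_form b' = 0" "lorentz_inner a' b' = - 1 / 2"
    "a' $ None > 0" "L' = range (\<lambda>t. exp t *\<^sub>R a' + exp (- t) *\<^sub>R b')"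
    "T *v a' = exp d' *\<^sub>R a'" "T *v b' = exp (- d') *\<^sub>R b'"
    by (rule translates_along_null_vectors[OF assms(4)])
  have nz: "a \<noteq> 0" "b \<noteq> 0" using a(3) by (auto simp: lorentz_inner_def)
  have "lorentz_inner a a' = exp (d + d') * lorentz_inner a a'"
    using pos_lorentz_inner[OF T, of a a'] unfolding a(6) a'(6)
    by (simp only: lorentz_inner_linear exp_add mult_ac)
  moreover have "exp (d + d') \<noteq> 1" using assms(3,5) by simp
  ultimately have "lorentz_inner a a' = 0" by simp
  then obtain r where r: "a' = r *\<^sub>R a" using null_orthogonal_parallel a(1) a'(1) nz by metis
  have "lorentz_inner b b' = exp (- (d + d')) * lorentz_inner b b'"
    using pos_lorentz_inner[OF T, of b b'] unfolding a(7) a'(7)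
    by (simp only: lorentz_inner_linear exp_add mult_ac minus_add_distrib)
  moreover have "exp (- (d + d')) \<noteq> 1" using assms(3,5) by simp
  ultimately have "lorentz_inner b b' = 0" by simp
  then obtain q where q: "b' = q *\<^sub>R b" using null_orthogonal_parallel a(2) a'(2) nz by metis
  have "r > 0" using a(4) a'(4) r by (simp add: zero_less_mult_iff)
  have "q * r = 1" using a'(3) a(3) by (simp add: r q lorentz_inner_linear)
  hence q': "q = exp (- ln r)" using \<open>r > 0\<close> by (simp add: exp_minus field_simps)
  have r': "r = exp (ln r)" using \<open>r > 0\<close> by simp
  have "exp t *\<^sub>R a' + exp (- t) *\<^sub>R b' = exp (t + ln r) *\<^sub>R a + exp (- (t + ln r)) *\<^sub>R b" for t
    unfolding r q using \<open>r > 0\<close> by (simp add: q' exp_add exp_diff exp_minus divide_inverse)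
  hence "L' = range ((\<lambda>t. exp t *\<^sub>R a + exp (- t) *\<^sub>R b) \<circ> (\<lambda>t. t + ln r))"
    unfolding a'(5) by (simp add: o_def)
  also have "\<dots> = L" unfolding a(5) image_comp[symmetric] by (subst surj_plus_right) simp
  finally show "L = L'" by simp
  have "exp d' *\<^sub>R a' = exp d *\<^sub>R a'"
    using a'(6) unfolding r matrix_vector_mult_scaleR a(6) by (metis scaleR_left_commute)
  moreover have "a' \<noteq> 0" using a'(3) by (auto simp: lorentz_inner_def)
  ultimately show "d = d'" by auto
qed

lemma hyperbolic_if_translates:
  assumes "T \<in> pos_lorentz" "translates_along T L d" "d > 0"
  shows "hyperbolic T" "translation_length T = d"
proof -
  show "hyperbolic T" unfolding hyperbolic_def
    using assms translates_along_unique(1)[OF assms] by blast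
  have "axis_of T = L" unfolding axis_of_def
    by (rule the_equality) (use assms translates_along_unique(1)[OF assms(1)] in blast)+
  thus "translation_length T = d" unfolding translation_length_def
    by (intro the_equality) (use assms translates_along_unique(2)[OF assms(1)] in auto)
qed

lemma hyperbolic_if_null_eigenvectors:
  assumes T: "T \<in> pos_lorentz" and null: "lorentz_form a = 0" "lorentz_form b = 0" "lorentz_inner a b \<noteq> 0"
    and l: "l > 1" and eig: "T *v a = l *\<^sub>R a" "T *v b = inverse l *\<^sub>R b"
  shows "hyperbolic T" "exp (translation_length T) = l"
proof -
  define b1 where "b1 = (- 1 / (2 * lorentz_inner a b)) *\<^sub>R b"
  have b1: "lorentz_form b1 = 0" "lorentz_inner a b1 = - 1 / 2"
    using null by (simp_all add: b1_def lorentz_form_inner lorentz_inner_linear)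
  have b1_eig: "T *v b1 = inverse l *\<^sub>R b1"
    unfolding b1_def matrix_vector_mult_scaleR eig(2) by (rule scaleR_left_commute)
  \<comment> \<open>One sign moves both null vectors to the half of the cone with positive last
    coordinate, because by \<open>null_pair_None\<close> they lie on the same half.\<close>
  define s where "s = sgn (a $ None)"
  have "a $ None \<noteq> 0" using null_pair_None[OF null(1) b1(1,2)] by auto
  hence s: "s * s = 1" "s * a $ None > 0" by (auto simp: s_def sgn_if)
  define a' b' where "a' = s *\<^sub>R a" and "b' = s *\<^sub>R b1"
  have a': "lorentz_form a' = 0" "lorentz_form b' = 0" "a' $ None > 0"
    using null b1 s by (simp_all add: a'_def b'_def lorentz_form_inner lorentz_inner_linear)
  have ab': "lorentz_inner a' b' = - 1 / 2"
    using b1(2) s(1) by (simp add: a'_def b'_def lorentz_inner_linear mult.assoc[symmetric])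
  have eig': "T *v a' = l *\<^sub>R a'" "T *v b' = inverse l *\<^sub>R b'"
    unfolding a'_def b'_def matrix_vector_mult_scaleR eig(1) b1_eig by (rule scaleR_left_commute)+
  define c where "c = (\<lambda>t. exp t *\<^sub>R a' + exp (- t) *\<^sub>R b')"
  have "geodesic_line c" unfolding c_def by (rule geodesic_line_from_null_vectors[OF a'(1,2) ab' a'(3)])
  moreover have "T *v c t = c (t + ln l)" for t
    using l by (simp add: c_def matrix_vector_right_distrib matrix_vector_mult_scaleR eig' exp_add exp_diff
      exp_minus field_simps)
  ultimately have "translates_along T (range c) (ln l)" unfolding translates_along_def by blast
  from hyperbolic_if_translates[OF T this] l show "hyperbolic T" "exp (translation_length T) = l"
    by simp_all
qed

lemma hyperbolic_null_eigenvectors: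
  assumes "hyperbolic T"
  defines "l \<equiv> exp (translation_length T)"
  obtains a b where "l > 1" "lorentz_form a = 0" "lorentz_form b = 0" "lorentz_inner a b = - 1 / 2"
    "T *v a = l *\<^sub>R a" "T *v b = inverse l *\<^sub>R b"
proof -
  have T: "T \<in> pos_lorentz" and "\<exists>L. \<exists>d>0. translates_along T L d"
    using assms(1) unfolding hyperbolic_def by (fast, fast)
  then obtain L d where d: "d > 0" "translates_along T L d" by blast
  have "l = exp d" using hyperbolic_if_translates(2)[OF T d(2,1)] by (simp add: l_def)
  moreover obtain a b where "lorentz_form a = 0" "lorentz_form b = 0" "lorentz_inner a b = - 1 / 2"
    "a $ None > 0" "L = range (\<lambda>t. exp t *\<^sub>R a + exp (- t) *\<^sub>R b)"
    "T *v a = exp d *\<^sub>R a" "T *v b = exp (- d) *\<^sub>R b"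
    by (rule translates_along_null_vectors[OF d(2)])
  ultimately show ?thesis using that[of a b] d(1) by (simp add: exp_minus)
qed

subsection \<open>Matrix groups over subrings\<close>

definition real_subring :: "real set \<Rightarrow> bool"
  where "real_subring R \<longleftrightarrow> 1 \<in> R \<and> (\<forall>x\<in>R. \<forall>y\<in>R. x - y \<in> R \<and> x * y \<in> R)"

lemma real_subringD:
  assumes "real_subring R"
  shows "0 \<in> R" "1 \<in> R" "x \<in> R \<Longrightarrow> - x \<in> R" "x \<in> R \<Longrightarrow> y \<in> R \<Longrightarrow> x - y \<in> R"
    "x \<in> R \<Longrightarrow> y \<in> R \<Longrightarrow> x + y \<in> R" "x \<in> R \<Longrightarrow> y \<in> R \<Longrightarrow> x * y \<in> R"
    "(\<And>a. a \<in> I \<Longrightarrow> f a \<in> R) \<Longrightarrow> sum f I \<in> R"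
proof -
  show 1: "1 \<in> R" and d: "x \<in> R \<Longrightarrow> y \<in> R \<Longrightarrow> x - y \<in> R"
    and "x \<in> R \<Longrightarrow> y \<in> R \<Longrightarrow> x * y \<in> R" for x y using assms by (auto simp: real_subring_def)
  show z: "0 \<in> R" using d[OF 1 1] by simp
  show m: "x \<in> R \<Longrightarrow> - x \<in> R" for x using d[OF z, of x] by simp
  show a: "x \<in> R \<Longrightarrow> y \<in> R \<Longrightarrow> x + y \<in> R" for x y using d[of x "- y"] m by simp
  show "(\<And>a. a \<in> I \<Longrightarrow> f a \<in> R) \<Longrightarrow> sum f I \<in> R"
    by (induction I rule: infinite_finite_induct) (auto intro: z a)
qed

lemma real_subring_field: "subfield K real_field \<Longrightarrow> real_subring K"
proof -
  assume "subfield K real_field"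
  then interpret real_subfield K by (rule real_subfield.intro)
  show ?thesis unfolding real_subring_def by auto
qed

lemma real_subring_integers: "subfield K real_field \<Longrightarrow> real_subring (ring_of_integers K)"
proof -
  assume "subfield K real_field"
  then interpret real_subfield K by (rule real_subfield.intro)
  show ?thesis unfolding real_subring_def ring_of_integers_def by auto
qed

lemma matrix_over_mult:
  "real_subring R \<Longrightarrow> matrix_over R A \<Longrightarrow> matrix_over R B \<Longrightarrow> matrix_over R (A ** B)"
  unfolding matrix_over_def matrix_matrix_mult_def by (auto intro!: real_subringD(6,7))

lemma matrix_over_add:
  "real_subring R \<Longrightarrow> matrix_over R A \<Longrightarrow> matrix_over R B \<Longrightarrow> matrix_over R (A + B)"
  unfolding matrix_over_def by (auto intro!: real_subringD(5))

lemma matrix_over_diff: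
  "real_subring R \<Longrightarrow> matrix_over R A \<Longrightarrow> matrix_over R B \<Longrightarrow> matrix_over R (A - B)"
  unfolding matrix_over_def by (auto intro!: real_subringD(4))

lemma matrix_over_scale:
  "real_subring R \<Longrightarrow> c \<in> R \<Longrightarrow> matrix_over R A \<Longrightarrow> matrix_over R (c *\<^sub>R A)"
  unfolding matrix_over_def by (auto intro!: real_subringD(6))

lemma matrix_over_mat_1: "real_subring R \<Longrightarrow> matrix_over R (mat 1)"
  unfolding matrix_over_def mat_def by (auto intro: real_subringD(1,2))

lemma matrix_over_mono: "R \<subseteq> R' \<Longrightarrow> matrix_over R A \<Longrightarrow> matrix_over R' A"
  unfolding matrix_over_def by auto

lemma GL_UNIV_iff: "T \<in> GL UNIV \<longleftrightarrow> invertible T"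
  by (simp add: GL_def matrix_over_def invertible_def)

lemma GL_imp_invertible: "T \<in> GL R \<Longrightarrow> invertible T"
  by (auto simp: GL_def invertible_def)

lemma matrix_inv_props:
  assumes "invertible (A :: 'a::semiring_1 ^ 'n ^ 'n)"
  shows "A ** matrix_inv A = mat 1" "matrix_inv A ** A = mat 1"
  using someI_ex[OF assms[unfolded invertible_def]] by (auto simp: matrix_inv_def)

lemma matrix_inv_unique:
  fixes A :: "'a::field ^ 'n ^ 'n"
  assumes "A ** B = mat 1"
  shows "matrix_inv A = B"
proof -
  have "B ** A = mat 1" using assms matrix_left_right_inverse by blast
  with assms have "invertible A" by (auto simp: invertible_def)
  have "matrix_inv A = matrix_inv A ** (A ** B)" by (simp add: assms)
  also have "\<dots> = B" using matrix_inv_props(2)[OF \<open>invertible A\<close>] by (simp add: matrix_mul_assoc)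
  finally show ?thesis .
qed

lemma GL_mult:
  assumes "real_subring R" "S \<in> GL R" "T \<in> GL R"
  shows "S ** T \<in> GL R"
proof -
  obtain S' T' where "matrix_over R S'" "S ** S' = mat 1" "S' ** S = mat 1"
    "matrix_over R T'" "T ** T' = mat 1" "T' ** T = mat 1"
    using assms by (auto simp: GL_def)
  moreover from this have "(S ** T) ** (T' ** S') = mat 1" "(T' ** S') ** (S ** T) = mat 1"
    by (metis matrix_mul_assoc matrix_mul_lid)+
  ultimately show ?thesis using assms unfolding GL_def by (auto intro!: matrix_over_mult exI[of _ "T' ** S'"])
qed

lemma GL_group_group: "group (GL_group :: (real ^ ('m::finite) ^ 'm) monoid)"
proof (rule groupI)
  fix x :: "real ^ 'm ^ 'm" assume "x \<in> carrier GL_group"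
  thus "\<exists>y\<in>carrier GL_group. y \<otimes>\<^bsub>GL_group\<^esub> x = \<one>\<^bsub>GL_group\<^esub>"
    by (auto simp: GL_group_def GL_def matrix_over_def)
qed (auto simp: GL_group_def matrix_mul_assoc GL_UNIV_iff invertible_mult,
     auto simp: invertible_def)

lemma GL_group_simps [simp]:
  "carrier GL_group = GL UNIV" "x \<otimes>\<^bsub>GL_group\<^esub> y = x ** y" "\<one>\<^bsub>GL_group\<^esub> = mat 1"
  by (simp_all add: GL_group_def)

lemma invertible_matrix_inv: "invertible A \<Longrightarrow> invertible (matrix_inv (A :: 'a::semiring_1 ^ 'n ^ 'n))"
  using matrix_inv_props unfolding invertible_def[of "matrix_inv A"] by blast

lemma GL_group_inv: "invertible T \<Longrightarrow> inv\<^bsub>GL_group\<^esub> T = matrix_inv T"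
  by (rule group.inv_equality[OF GL_group_group])
     (auto simp: GL_UNIV_iff matrix_inv_props invertible_matrix_inv)

fun mpow :: "'a::semiring_1 ^ ('n::finite) ^ 'n \<Rightarrow> nat \<Rightarrow> 'a ^ 'n ^ 'n" where
  "mpow T 0 = mat 1"
| "mpow T (Suc k) = T ** mpow T k"

lemma mpow_add: "mpow T (i + j) = mpow T i ** mpow T j"
  by (induction i) (auto simp: matrix_mul_assoc)

lemma mpow_mult: "mpow T (i * j) = mpow (mpow T i) j"
  by (induction j) (auto simp: mpow_add)

lemma mpow_conj:
  fixes g T g' :: "'a::field ^ ('n::finite) ^ 'n"
  assumes "g' ** g = mat 1" "g ** g' = mat 1"
  shows "mpow (g ** T ** g') k = g ** mpow T k ** g'"
proof (induction k)
  case (Suc k)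
  have "mpow (g ** T ** g') (Suc k) = g ** T ** (g' ** g) ** mpow T k ** g'"
    by (simp add: Suc matrix_mul_assoc)
  thus ?case using assms by (simp add: matrix_mul_assoc)
qed (use assms in simp)

lemma mpow_eigenvector: "T *v x = c *s x \<Longrightarrow> mpow T k *v x = c ^ k *s (x :: 'a::field ^ 'n::finite)"
  by (induction k) (auto simp: vec.scale vector_smult_assoc mult.commute simp flip: matrix_vector_mul_assoc)

text \<open>Two powers of \<open>T\<close> fall into the same right coset of \<open>H'\<close>, and
  their quotient is the required power.\<close>

lemma finite_index_power_mem:
  assumes fin: "finite_index GL_group H' H" and H: "H \<subseteq> GL UNIV" "mat 1 \<in> H"
    "\<And>x y. x \<in> H \<Longrightarrow> y \<in> H \<Longrightarrow> x ** y \<in> H" and H': "mat 1 \<in> H'" and T: "T \<in> H"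
  obtains k where "k > 0" "mpow T k \<in> H'"
proof -
  have pow: "mpow T k \<in> H" for k by (induction k) (use H T in auto)
  define C where "C = (\<lambda>k. (\<Union>h\<in>H'. {h ** mpow T k}))"
  have "range C \<subseteq> rcosets\<^bsub>GL_group\<lparr>carrier := H\<rparr>\<^esub> H'"
    using pow by (auto simp: RCOSETS_def r_coset_def C_def)
  hence "finite (range C)" using fin by (auto simp: finite_index_def intro: finite_subset)
  hence "\<not> inj C" using finite_imageD by blast
  then obtain i j where ij: "i < j" "C i = C j" by (metis injI linorder_neqE_nat)
  have "mat 1 ** mpow T j \<in> C j" unfolding C_def using H' by (intro UN_I[of "mat 1"]) auto
  then obtain h where h: "h \<in> H'" "mpow T j = h ** mpow T i"
    unfolding ij(2)[symmetric] by (auto simp: C_def)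
  have "invertible (mpow T i)" using pow[of i] H(1) GL_UNIV_iff by blast
  then obtain S where S: "mpow T i ** S = mat 1" by (auto simp: invertible_def)
  have "mpow T (j - i) = mpow T (j - i) ** (mpow T i ** S)" by (simp add: S)
  also have "\<dots> = mpow T (j - i + i) ** S" by (simp add: mpow_add matrix_mul_assoc)
  also have "\<dots> = h ** (mpow T i ** S)" using ij(1) h(2) by (simp add: matrix_mul_assoc)
  finally have "mpow T (j - i) \<in> H'" using h(1) by (simp add: S)
  thus ?thesis using that[of "j - i"] ij(1) by simp
qed

subsection \<open>Quadratic forms\<close>

definition bform :: "real ^ ('m::finite) ^ 'm \<Rightarrow> real ^ 'm \<Rightarrow> real ^ 'm \<Rightarrow> real"
  where "bform A x y = x \<bullet> (A *v y)"

lemma qform_bform: "qform A x = bform A x x"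
  by (simp add: qform_def bform_def)

lemma bform_linear:
  "bform A (x + y) z = bform A x z + bform A y z"
  "bform A (x - y) z = bform A x z - bform A y z"
  "bform A (c *\<^sub>R x) z = c * bform A x z"
  "bform A (- x) z = - bform A x z"
  "bform A z (x + y) = bform A z x + bform A z y"
  "bform A z (x - y) = bform A z x - bform A z y"
  "bform A z (c *\<^sub>R x) = c * bform A z x"
  "bform A z (- x) = - bform A z x"
  "bform A 0 z = 0" "bform A z 0 = 0"
  by (simp_all add: bform_def inner_add inner_diff matrix_vector_right_distrib
      matrix_vector_mult_diff_distrib matrix_vector_mult_scaleR vec.neg)

lemma bform_sum_left: "bform A (\<Sum>i\<in>I. f i) z = (\<Sum>i\<in>I. bform A (f i) z)"
  by (induction I rule: infinite_finite_induct) (auto simp: bform_linear)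

lemma bform_sum_right: "bform A z (\<Sum>i\<in>I. f i) = (\<Sum>i\<in>I. bform A z (f i))"
  by (induction I rule: infinite_finite_induct) (auto simp: bform_linear)

lemma bform_transpose: "bform (transpose A) x y = bform A y x"
  by (simp add: bform_def dot_lmul_matrix inner_commute[of x])

lemma bform_commute: "transpose A = A \<Longrightarrow> bform A x y = bform A y x"
  using bform_transpose[of A x y] by simp

lemma bform_altdef: "bform A x y = (\<Sum>i\<in>UNIV. \<Sum>j\<in>UNIV. x $ i * A $ i $ j * y $ j)"
  by (simp add: bform_def inner_vec_def matrix_vector_mult_def sum_distrib_left mult.assoc)

lemma bform_preserved_iff:
  "transpose T ** A ** T = A \<longleftrightarrow> (\<forall>x y. bform A (T *v x) (T *v y) = bform A x y)"
proof -
  have e: "bform A (T *v x) (T *v y) = bform (transpose T ** A ** T) x y" for x y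
  proof -
    have "bform A (T *v x) (T *v y) = (A *v (T *v y)) \<bullet> (T *v x)"
      by (simp add: bform_def inner_commute)
    also have "\<dots> = ((A *v (T *v y)) v* T) \<bullet> x" by (simp add: dot_lmul_matrix)
    finally show ?thesis
      by (simp add: bform_def inner_commute matrix_vector_mul_assoc[symmetric])
  qed
  show ?thesis
  proof
    assume *: "\<forall>x y. bform A (T *v x) (T *v y) = bform A x y"
    have "bform (transpose T ** A ** T) x y = bform A x y" for x y
      using * e by simp
    hence "x \<bullet> ((transpose T ** A ** T) *v y) = x \<bullet> (A *v y)" for x y
      unfolding bform_def .
    hence "(transpose T ** A ** T) *v y = A *v y" for y by (metis vector_eq_ldot)
    thus "transpose T ** A ** T = A" by (simp add: matrix_eq)
  qed (simp add: e)
qed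

lemma bform_eq_lorentz:
  fixes A M :: "('n::finite) lmat"
  assumes "transpose A = A" "\<And>x. qform A (M *v x) = lorentz_form x"
  shows "bform A (M *v x) (M *v y) = lorentz_inner x y"
proof -
  have 1: "4 * bform A u w = qform A (u + w) - qform A (u - w)" for u w
    using bform_commute[OF assms(1), of w u] by (simp add: qform_bform bform_linear)
  have 2: "4 * lorentz_inner u w = lorentz_form (u + w) - lorentz_form (u - w)" for u w :: "'n lvec"
    by (simp add: lorentz_form_inner lorentz_inner_linear lorentz_inner_commute[of w u])
  have "4 * bform A (M *v x) (M *v y) = 4 * lorentz_inner x y"
    unfolding 1 2 by (simp add: assms(2) flip: matrix_vector_right_distrib
      matrix_vector_mult_diff_distrib)
  thus ?thesis by simp
qed

text \<open>The components are treated without being determined: if the product of two vectors of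
  the negative cone is negative, the segment between them stays in the cone. Applied to x and T x,
  this keeps T x in the component of x.\<close>

lemma O_primeI:
  assumes sym: "transpose A = A" and T: "T \<in> GL R" "transpose T ** A ** T = A"
    and neg: "\<And>x. qform A x < 0 \<Longrightarrow> bform A x (T *v x) < 0"
  shows "T \<in> O_prime A R"
proof -
  have pres: "bform A (T *v x) (T *v y) = bform A x y" for x y using T(2) bform_preserved_iff by metis
  have path: "y \<in> C" if C: "C \<in> components {x. qform A x < 0}" "x \<in> C" "qform A y < 0" "bform A x y < 0" for C x y
  proof -
    have x: "qform A x < 0" using in_components_subset[OF C(1)] C(2) by auto
    have "closed_segment x y \<subseteq> {x. qform A x < 0}"
    proof
      fix z assume "z \<in> closed_segment x y"
      then obtain u where u: "0 \<le> u" "u \<le> 1" "z = (1 - u) *\<^sub>R x + u *\<^sub>R y"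
        by (auto simp: in_segment)
      have "qform A z = (1 - u)\<^sup>2 * qform A x + u\<^sup>2 * qform A y + 2 * (u * (1 - u)) * bform A x y"
        using bform_commute[OF sym, of y x]
        by (simp add: u(3) qform_bform bform_linear power2_eq_square algebra_simps)
      moreover have "(1 - u)\<^sup>2 * qform A x \<le> 0" "u\<^sup>2 * qform A y \<le> 0" "2 * (u * (1 - u)) * bform A x y \<le> 0"
        using x C u by (auto simp: mult_le_0_iff)
      moreover have "(1 - u)\<^sup>2 * qform A x < 0 \<or> u\<^sup>2 * qform A y < 0"
        using x C(3) by (cases "u = 0") (auto simp: mult_less_0_iff)
      ultimately show "z \<in> {x. qform A x < 0}" by auto
    qed
    from components_maximal[OF C(1) connected_segment this] C(2) show ?thesis by auto
  qed
  have "(\<lambda>x. T *v x) ` C = C" if C: "C \<in> components {x. qform A x < 0}" for C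
  proof
    show "(\<lambda>x. T *v x) ` C \<subseteq> C"
    proof clarify
      fix x assume "x \<in> C"
      moreover from this have x: "qform A x < 0" using in_components_subset[OF C] by auto
      ultimately show "T *v x \<in> C"
        using path[OF C \<open>x \<in> C\<close>, of "T *v x"] neg[OF x] by (simp add: qform_bform pres)
    qed
    show "C \<subseteq> (\<lambda>x. T *v x) ` C"
    proof
      fix y assume y: "y \<in> C"
      obtain S where S: "T ** S = mat 1" using T(1) by (auto simp: GL_def)
      define x where "x = S *v y"
      have Tx: "T *v x = y" by (simp add: x_def matrix_vector_mul_assoc S)
      have "qform A y < 0" using in_components_subset[OF C] y by auto
      moreover from this have "qform A x < 0" using pres[of x x] by (simp add: Tx qform_bform)
      moreover have "bform A y x < 0"
        using neg[OF \<open>qform A x < 0\<close>] bform_commute[OF sym] by (simp add: Tx)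
      ultimately have "x \<in> C" using path[OF C y] by blast
      thus "y \<in> (\<lambda>x. T *v x) ` C" using Tx by blast
    qed
  qed
  thus ?thesis using T by (auto simp: O_prime_def)
qed

lemma O_prime_preserves: "T \<in> O_prime A R \<Longrightarrow> bform A (T *v x) (T *v y) = bform A x y"
  unfolding O_prime_def by (metis (mono_tags, lifting) bform_preserved_iff mem_Collect_eq)

lemma O_prime_mult:
  assumes "real_subring R" "S \<in> O_prime A R" "T \<in> O_prime A R"
  shows "S ** T \<in> O_prime A R"
proof -
  have "(\<lambda>x. (S ** T) *v x) ` C = C" if "C \<in> components {x. qform A x < 0}" for C
  proof -
    have "(\<lambda>x. (S ** T) *v x) ` C = (\<lambda>x. S *v x) ` (\<lambda>x. T *v x) ` C"
      by (simp add: image_image matrix_vector_mul_assoc)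
    thus ?thesis using assms(2,3) that by (simp add: O_prime_def)
  qed
  moreover have "transpose (S ** T) ** A ** (S ** T) = A"
    unfolding bform_preserved_iff
    by (simp add: O_prime_preserves[OF assms(2)] O_prime_preserves[OF assms(3)] flip: matrix_vector_mul_assoc)
  ultimately show ?thesis using assms by (auto simp: O_prime_def intro: GL_mult)
qed

lemma O_prime_one: "real_subring R \<Longrightarrow> mat 1 \<in> O_prime A R"
  by (auto simp: O_prime_def GL_def bform_preserved_iff intro: matrix_over_mat_1 exI[of _ "mat 1"])

lemma O_prime_inv:
  assumes "T \<in> O_prime A R"
  shows "matrix_inv T \<in> O_prime A R"
proof -
  obtain S where S: "matrix_over R S" "T ** S = mat 1" "S ** T = mat 1"
    using assms by (auto simp: O_prime_def GL_def)
  have inv: "matrix_inv T = S" by (rule matrix_inv_unique[OF S(2)])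
  have TS: "T *v (S *v x) = x" for x by (simp add: matrix_vector_mul_assoc S)
  have ST: "S *v (T *v x) = x" for x by (simp add: matrix_vector_mul_assoc S)
  have "(\<lambda>x. S *v x) ` C = C" if "C \<in> components {x. qform A x < 0}" for C
  proof -
    have "(\<lambda>x. S *v x) ` C = (\<lambda>x. S *v x) ` (\<lambda>x. T *v x) ` C"
      using assms that by (simp add: O_prime_def)
    thus ?thesis by (simp add: image_image ST)
  qed
  moreover have "transpose S ** A ** S = A"
    unfolding bform_preserved_iff
  proof (intro allI)
    fix x y show "bform A (S *v x) (S *v y) = bform A x y"
      using O_prime_preserves[OF assms, of "S *v x" "S *v y"] by (simp add: TS)
  qed
  ultimately show ?thesis unfolding inv using S assms by (auto simp: O_prime_def GL_def)
qed

text \<open>Carried back to Lorentz coordinates, a component is connected and misses the hyperplane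
  where the last coordinate is 0, since the form is nonnegative there. So the last coordinate has
  constant sign on it, and the upper sheet is preserved.\<close>

lemma conj_O_prime_pos_lorentz:
  fixes M :: "('n::finite) lmat"
  assumes M: "invertible M" "\<And>x. qform A (M *v x) = lorentz_form x" and T: "T \<in> O_prime A R"
  shows "matrix_inv M ** T ** M \<in> pos_lorentz"
proof -
  note inv = matrix_inv_props[OF M(1)]
  have MM: "M *v (matrix_inv M *v x) = x" "matrix_inv M *v (M *v x) = x" for x
    by (simp_all add: matrix_vector_mul_assoc inv)
  define f where "f = (\<lambda>S x. (matrix_inv M ** S ** M) *v x)"
  have f: "f S x = matrix_inv M *v (S *v (M *v x))" for S x
    by (simp add: f_def matrix_vector_mul_assoc[symmetric])
  have form: "lorentz_form (f S x) = lorentz_form x" if S: "S \<in> O_prime A R" for S x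
  proof -
    have "lorentz_form (f S x) = qform A (S *v (M *v x))" by (simp add: f MM flip: M(2))
    also have "\<dots> = lorentz_form x" using O_prime_preserves[OF S] by (simp add: qform_bform flip: M(2))
    finally show ?thesis .
  qed
  have sub: "f S ` (hyp_space :: 'n lvec set) \<subseteq> hyp_space" if S: "S \<in> O_prime A R" for S
  proof clarify
    fix x :: "'n lvec" assume x: "x \<in> hyp_space"
    define N where "N = {x. qform A x < 0}"
    have "M *v x \<in> N" using x by (simp add: N_def M(2) hyp_space_def)
    then obtain C where C: "C \<in> components N" "M *v x \<in> C" by (metis UnionE Union_components)
    have "S *v (M *v x) \<in> C" using S C by (auto simp: O_prime_def N_def)
    define D where "D = (\<lambda>y. matrix_inv M *v y) ` C"
    have "connected D" unfolding D_def
      using in_components_connected[OF C(1)] by (intro connected_continuous_image)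
        (auto intro!: continuous_intros linear_continuous_on matrix_vector_mul_bounded_linear)
    have "f S x \<in> D" using \<open>S *v (M *v x) \<in> C\<close> by (auto simp: f D_def)
    have "x \<in> D" unfolding D_def using C(2) by (intro image_eqI[of _ _ "M *v x"]) (auto simp: MM)
    have ne: "y $ None \<noteq> 0" if "y \<in> D" for y
    proof
      assume "y $ None = 0"
      hence "lorentz_form y \<ge> 0" by (simp add: lorentz_form_spatial)
      moreover have "M *v y \<in> N" using that in_components_subset[OF C(1)] by (auto simp: D_def MM)
      hence "lorentz_form y < 0" by (simp add: N_def M(2))
      ultimately show False by simp
    qed
    have "connected ((\<lambda>y. y $ None) ` D)"
      using \<open>connected D\<close> by (intro connected_continuous_image continuous_intros)
    hence "is_interval ((\<lambda>y. y $ None) ` D)" by (simp add: is_interval_connected_1)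
    have "f S x $ None > 0"
    proof (rule ccontr)
      assume "\<not> f S x $ None > 0"
      hence "0 \<in> (\<lambda>y. y $ None) ` D"
        using mem_is_interval_1_I[OF \<open>is_interval _\<close> imageI[OF \<open>f S x \<in> D\<close>] imageI[OF \<open>x \<in> D\<close>], of 0] x
        by (simp add: hyp_space_def)
      thus False using ne by auto
    qed
    thus "f S x \<in> hyp_space" using form[OF S, of x] x by (simp add: hyp_space_def)
  qed
  have "hyp_space \<subseteq> f T ` hyp_space"
  proof
    fix x :: "'n lvec" assume "x \<in> hyp_space"
    hence "f (matrix_inv T) x \<in> hyp_space" using sub[OF O_prime_inv[OF T]] by blast
    moreover have "invertible T" using T GL_imp_invertible by (auto simp: O_prime_def)
    hence "T *v (matrix_inv T *v y) = y" for y by (simp add: matrix_vector_mul_assoc matrix_inv_props)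
    hence "f T (f (matrix_inv T) x) = x" by (simp add: f MM)
    ultimately show "x \<in> f T ` hyp_space" by (metis image_eqI)
  qed
  with sub[OF T] form[OF T] show ?thesis by (auto simp: pos_lorentz_def f_def)
qed

text \<open>Orthonormal sets in the complement of the normalized \<open>u\<close> have at most n
  elements. A largest one has exactly n: otherwise a vector outside the span could be projected to
  the complement, where the form is positive, normalized and added.\<close>

lemma lorentz_diagonalization:
  fixes A :: "('n::finite) lmat"
  assumes sym: "transpose A = A" and u: "qform A u < 0"
    and pos: "\<And>z. bform A z u = 0 \<Longrightarrow> z \<noteq> 0 \<Longrightarrow> qform A z > 0"
  obtains P :: "'n lmat" where "invertible P" "\<And>x. qform A (P *v x) = lorentz_form x" "has_signature A CARD('n) 1"
proof -
  note comm = bform_commute[OF sym]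
  define u' where "u' = (1 / sqrt (- qform A u)) *\<^sub>R u"
  have uu: "bform A u' u' = -1"
  proof -
    have "sqrt (- qform A u) * sqrt (- qform A u) = - qform A u" using u by simp
    moreover have "bform A u u = qform A u" by (simp add: qform_bform)
    ultimately show ?thesis using u by (simp add: u'_def bform_linear divide_simps)
  qed
  have pos': "qform A z > 0" if "bform A z u' = 0" "z \<noteq> 0" for z
    using pos[of z] that u by (simp add: u'_def bform_linear)
  define good where "good = (\<lambda>S. finite S \<and> (\<forall>s\<in>S. bform A s u' = 0) \<and>
     (\<forall>s\<in>S. \<forall>t\<in>S. bform A s t = (if s = t then 1 else 0)))"
  have proj: "bform A (\<Sum>s\<in>S. c s *\<^sub>R s) t = c t" if "good S" "t \<in> S" for S c t
  proof -
    have "bform A (\<Sum>s\<in>S. c s *\<^sub>R s) t = (\<Sum>s\<in>S. if s = t then c s else 0)"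
      unfolding bform_sum_left using that by (intro sum.cong) (auto simp: good_def bform_linear)
    thus ?thesis using that by (simp add: good_def)
  qed
  have indep: "independent (insert u' S) \<and> u' \<notin> S" if S: "good S" for S
  proof -
    have u'S: "bform A (\<Sum>s\<in>S. c s *\<^sub>R s) u' = 0" for c
      unfolding bform_sum_left using S by (intro sum.neutral) (auto simp: good_def bform_linear)
    have fin: "finite S" using S by (simp add: good_def)
    have "independent S" unfolding independent_explicit_finite_subsets
    proof (intro allI impI ballI)
      fix T c t assume T: "T \<subseteq> S" "finite T" "(\<Sum>s\<in>T. c s *\<^sub>R s) = 0" "t \<in> T"
      hence "good T" using S unfolding good_def by (meson subsetD)
      from proj[OF this T(4), of c] T(3) show "c t = 0" by (simp add: bform_linear)
    qed
    moreover have "u' \<notin> span S"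
    proof
      assume "u' \<in> span S"
      then obtain c where "u' = (\<Sum>s\<in>S. c s *\<^sub>R s)" using fin by (auto simp: span_finite)
      with u'S[of c] uu show False by simp
    qed
    ultimately show ?thesis by (auto simp: independent_insert intro: span_base)
  qed
  have card: "card S < CARD('n option)" if "good S" for S
  proof -
    have "card (insert u' S) \<le> DIM('n lvec)" using indep[OF that] independent_card_le by blast
    moreover have "card (insert u' S) = Suc (card S)"
      using indep[OF that] that by (simp add: good_def)
    ultimately show ?thesis by simp
  qed
  have "good {}" by (simp add: good_def)
  then obtain S where S: "good S" and max: "\<And>S'. good S' \<Longrightarrow> card S' \<le> card S"
    using ex_has_greatest_nat[of good "{}" card "CARD('n option)"] card by blast
  have finS: "finite S" using S by (simp add: good_def)
  have "card S = CARD('n)"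
  proof (rule ccontr)
    assume ne: "card S \<noteq> CARD('n)"
    hence "card (insert u' S) < DIM('n lvec)" using card[OF S] indep[OF S] finS by simp
    hence "span (insert u' S) \<noteq> UNIV"
      using dim_UNIV[where 'a = "'n lvec"] dim_eq_card_independent[of "insert u' S"] indep[OF S]
      by (metis dim_span less_irrefl)
    then obtain v where v: "v \<notin> span (insert u' S)" by blast
    \<comment> \<open>The plus sign in front of the \<open>u'\<close> part is due to
      \<open>bform A u' u' = -1\<close>.\<close>
    define z where "z = v + bform A v u' *\<^sub>R u' - (\<Sum>s\<in>S. bform A v s *\<^sub>R s)"
    have zin: "bform A v u' *\<^sub>R u' - (\<Sum>s\<in>S. bform A v s *\<^sub>R s) \<in> span (insert u' S)"
      by (intro span_diff span_sum span_scale span_base) auto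
    have "z \<noteq> 0"
    proof
      assume "z = 0"
      hence "v = - (bform A v u' *\<^sub>R u' - (\<Sum>s\<in>S. bform A v s *\<^sub>R s))"
        by (simp add: z_def algebra_simps eq_neg_iff_add_eq_0)
      with v span_neg[OF zin] show False by simp
    qed
    have zu: "bform A z u' = 0"
    proof -
      have "bform A (\<Sum>s\<in>S. bform A v s *\<^sub>R s) u' = 0"
        unfolding bform_sum_left using S by (intro sum.neutral) (auto simp: good_def bform_linear)
      thus ?thesis by (simp add: z_def bform_linear uu)
    qed
    have zs: "bform A z s = 0" if "s \<in> S" for s
      using proj[OF S that, of "bform A v"] S that comm[of u' s] by (simp add: z_def bform_linear good_def)
    have zpos: "qform A z > 0" using pos'[OF zu \<open>z \<noteq> 0\<close>] .
    define z' where "z' = (1 / sqrt (qform A z)) *\<^sub>R z"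
    have "sqrt (qform A z) * sqrt (qform A z) = qform A z" using zpos by simp
    moreover have "bform A z z = qform A z" by (simp add: qform_bform)
    ultimately have "bform A z' z' = 1" using zpos by (simp add: z'_def bform_linear divide_simps)
    moreover have "bform A z' u' = 0" "\<And>s. s \<in> S \<Longrightarrow> bform A z' s = 0"
      using zu zs by (simp_all add: z'_def bform_linear)
    ultimately have z': "bform A z' z' = 1" "bform A z' u' = 0" "\<And>s. s \<in> S \<Longrightarrow> bform A z' s = 0"
      by blast+
    hence "z' \<notin> S" using S by (auto simp: good_def)
    have z'2: "bform A s z' = 0" if "s \<in> S" for s using z'(3)[OF that] comm[of s z'] by simp
    have "good (insert z' S)"
      using S z' z'2 \<open>z' \<notin> S\<close> by (auto simp: good_def)
    from max[OF this] \<open>z' \<notin> S\<close> finS show False by simp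
  qed
  then obtain b :: "'n \<Rightarrow> 'n lvec" where b: "bij_betw b UNIV S"
    using finite_same_card_bij[of "UNIV :: 'n set" S] finS by auto
  define w where "w = (\<lambda>i. case i of None \<Rightarrow> u' | Some j \<Rightarrow> b j)"
  define e where "e = (\<lambda>i :: 'n option. if i = None then -1 else 1 :: real)"
  have bS: "b j \<in> S" for j using b by (auto simp: bij_betw_def)
  have binj: "b i = b j \<longleftrightarrow> i = j" for i j using b by (auto simp: bij_betw_def inj_eq)
  have w: "bform A (w i) (w j) = (if i = j then e i else 0)" for i j
    using S bS uu by (auto simp: w_def e_def good_def binj comm[of u' "b _"] split: option.splits)
  define P :: "'n lmat" where "P = (\<chi> i j. w j $ i)"
  have Pv: "P *v x = (\<Sum>j\<in>UNIV. x $ j *\<^sub>R w j)" for x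
    by (simp add: P_def matrix_vector_mult_def vec_eq_iff mult.commute)
  have bP: "bform A (P *v x) (P *v y) = (\<Sum>i\<in>UNIV. e i * x $ i * y $ i)" for x y
  proof -
    have "bform A (P *v x) (P *v y) = (\<Sum>i\<in>UNIV. \<Sum>j\<in>UNIV. if i = j then e i * x $ i * y $ i else 0)"
      unfolding Pv bform_sum_left bform_sum_right
      by (intro sum.cong) (auto simp: bform_linear w mult.commute)
    thus ?thesis by simp
  qed
  have UNIV_option: "(\<Sum>i\<in>(UNIV :: 'n option set). f i) = f None + (\<Sum>i\<in>UNIV. f (Some i))" for f :: "'n option \<Rightarrow> real"
    by (simp add: UNIV_option_conv sum.reindex)
  have form: "qform A (P *v x) = lorentz_form x" for x
    unfolding qform_bform bP UNIV_option by (simp add: e_def lorentz_form_def power2_eq_square)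
  have inv: "invertible P"
  proof -
    have "x = 0" if "P *v x = 0" for x
    proof -
      have "x $ k = 0" for k
      proof -
        have "bform A (P *v x) (P *v axis k 1) = (\<Sum>i\<in>UNIV. if i = k then e i * x $ i else 0)"
          unfolding bP by (intro sum.cong) (auto simp: axis_def)
        thus ?thesis using that by (simp add: bform_linear e_def split: if_splits)
      qed
      thus ?thesis by (simp add: vec_eq_iff)
    qed
    thus ?thesis using invertible_left_inverse matrix_left_invertible_ker by blast
  qed
  define D where "D = transpose P ** A ** P"
  have D: "D $ i $ j = (if i = j then e i else 0)" for i j
  proof -
    have "D $ i $ j = axis i 1 \<bullet> (D *v axis j 1)"
      by (simp add: inner_axis' matrix_vector_mul_component inner_axis)
    also have "\<dots> = bform A (P *v axis i 1) (P *v axis j 1)"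
      unfolding D_def bform_def
      by (metis dot_lmul_matrix inner_commute matrix_vector_mul_assoc transpose_matrix_vector)
    also have "\<dots> = (\<Sum>k\<in>UNIV. if k = i then (if i = j then e i else 0) else 0)"
      unfolding bP by (intro sum.cong) (auto simp: axis_def)
    finally show ?thesis by simp
  qed
  have "{i. D $ i $ i > 0} = range Some" "{i. D $ i $ i < 0} = {None}"
    by (auto simp: D e_def notin_range_Some split: if_splits)
  hence "card {i. D $ i $ i > 0} = CARD('n)" "card {i. D $ i $ i < 0} = 1"
    by (simp_all add: card_image)
  hence "has_signature A CARD('n) 1"
    unfolding has_signature_def using inv D by (intro exI[of _ P] exI[of _ D]) (simp add: D_def)
  from that[OF inv _ this] form show ?thesis by blast
qed

subsection \<open>The Pell equation over totally real fields\<close>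

text \<open>Pigeonhole on the (N + 1)^card I integer vectors with entries from 0 to N. Boxes of side
  1 for the forms in \<open>J\<close> and of side C / N for \<open>c0\<close> number about N^card J
  times N^2, which explains the two additional elements of \<open>I\<close>; the constants are
  absorbed by \<open>C\<close>.\<close>

lemma dirichlet_linear_forms:
  fixes c :: "'j \<Rightarrow> 'i \<Rightarrow> real" and c0 :: "'i \<Rightarrow> real"
  assumes fin: "finite I" "finite J" and card: "card I = card J + 2"
  obtains C N0 where "C > 0" "\<And>N. N \<ge> N0 \<Longrightarrow> \<exists>a :: 'i \<Rightarrow> int. (\<exists>i\<in>I. a i \<noteq> 0) \<and> (\<forall>i\<in>I. \<bar>a i\<bar> \<le> int N) \<and>
      (\<forall>j\<in>J. \<bar>\<Sum>i\<in>I. c j i * of_int (a i)\<bar> \<le> 1) \<and> \<bar>\<Sum>i\<in>I. c0 i * of_int (a i)\<bar> \<le> C / real N"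
proof -
  define B where "B = nat \<lceil>(\<Sum>j\<in>J. \<Sum>i\<in>I. \<bar>c j i\<bar>) + (\<Sum>i\<in>I. \<bar>c0 i\<bar>)\<rceil> + 1"
  have B1: "B \<ge> 1" by (simp add: B_def)
  have Bsum: "(\<Sum>j\<in>J. \<Sum>i\<in>I. \<bar>c j i\<bar>) + (\<Sum>i\<in>I. \<bar>c0 i\<bar>) \<le> real B"
    unfolding B_def by linarith
  have Bj: "(\<Sum>i\<in>I. \<bar>c j i\<bar>) \<le> real B" if "j \<in> J" for j
  proof -
    have "(\<Sum>i\<in>I. \<bar>c j i\<bar>) \<le> (\<Sum>j\<in>J. \<Sum>i\<in>I. \<bar>c j i\<bar>)"
      using that fin by (intro member_le_sum) (auto intro: sum_nonneg)
    moreover have "(\<Sum>i\<in>I. \<bar>c0 i\<bar>) \<ge> 0" by (intro sum_nonneg) auto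
    ultimately show ?thesis using Bsum by linarith
  qed
  have B0: "(\<Sum>i\<in>I. \<bar>c0 i\<bar>) \<le> real B"
  proof -
    have "(\<Sum>j\<in>J. \<Sum>i\<in>I. \<bar>c j i\<bar>) \<ge> 0" by (intro sum_nonneg) auto
    thus ?thesis using Bsum by linarith
  qed
  \<comment> \<open>There are at most E N^card J unit boxes for the forms in \<open>J\<close>. The
    factor 4 B E in \<open>C\<close> leaves at most N^2 / E boxes for \<open>c0\<close> as soon as N
    is at least 6 E, so at most N^card I boxes in all.\<close>
  define E where "E = (3 * real B) ^ card J"
  have E1: "E \<ge> 1" unfolding E_def using B1 by (intro one_le_power) auto
  define C where "C = 4 * real B * E"
  have C: "C > 0" using B1 E1 by (auto simp: C_def)
  define N0 where "N0 = nat \<lceil>6 * E\<rceil> + 1"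
  show ?thesis
  proof (rule that[OF C])
    fix N assume N: "N \<ge> N0"
    have N1: "real N \<ge> 1" "real N \<ge> 6 * E" using N E1 unfolding N0_def by linarith+
    define L where "L = (\<lambda>f a. \<Sum>i\<in>I. f i * real_of_int (a i))"
    define F where "F = (I \<rightarrow>\<^sub>E {0..int N})"
    have Lbound: "\<bar>L f a\<bar> \<le> real B * real N" if "(\<Sum>i\<in>I. \<bar>f i\<bar>) \<le> real B" "a \<in> F" for f a
    proof -
      have "\<bar>L f a\<bar> \<le> (\<Sum>i\<in>I. \<bar>f i * real_of_int (a i)\<bar>)" unfolding L_def by (rule sum_abs)
      also have "\<dots> \<le> (\<Sum>i\<in>I. \<bar>f i\<bar> * real N)"
      proof (rule sum_mono)
        fix i assume "i \<in> I"
        hence "\<bar>real_of_int (a i)\<bar> \<le> real N" using that(2) by (auto simp: F_def PiE_iff)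
        thus "\<bar>f i * real_of_int (a i)\<bar> \<le> \<bar>f i\<bar> * real N" by (simp add: abs_mult mult_left_mono)
      qed
      also have "\<dots> = (\<Sum>i\<in>I. \<bar>f i\<bar>) * real N" by (simp add: sum_distrib_right)
      also have "\<dots> \<le> real B * real N" using that(1) by (intro mult_right_mono) auto
      finally show ?thesis .
    qed
    define q where "q = \<lceil>(real N)\<^sup>2 / (4 * E)\<rceil>"
    define G where "G = (J \<rightarrow>\<^sub>E {- int (B * N)..int (B * N)}) \<times> {- q..q}"
    define \<phi> where "\<phi> = (\<lambda>a. (restrict (\<lambda>j. \<lfloor>L (c j) a\<rfloor>) J, \<lfloor>L c0 a * real N / C\<rfloor>))"
    have "\<phi> ` F \<subseteq> G"
    proof (rule image_subsetI)
      fix a assume a: "a \<in> F"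
      have 1: "\<lfloor>L (c j) a\<rfloor> \<in> {- int (B * N)..int (B * N)}" if "j \<in> J" for j
      proof -
        have "\<bar>L (c j) a\<bar> \<le> real_of_int (int (B * N))" using Lbound[OF Bj[OF that] a] by simp
        thus ?thesis by (auto simp: abs_le_iff le_floor_iff floor_le_iff)
      qed
      have "\<bar>L c0 a * real N / C\<bar> = \<bar>L c0 a\<bar> * (real N / C)" using C by (simp add: abs_mult)
      also have "\<dots> \<le> real B * real N * (real N / C)"
        using Lbound[OF B0 a] C by (intro mult_right_mono) auto
      also have "\<dots> = (real N)\<^sup>2 / (4 * E)" using B1 by (simp add: C_def power2_eq_square)
      also have "\<dots> \<le> of_int q" unfolding q_def by (rule le_of_int_ceiling)
      finally have "\<bar>L c0 a * real N / C\<bar> \<le> of_int q" .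
      hence "- of_int q \<le> L c0 a * real N / C" "L c0 a * real N / C \<le> of_int q"
        unfolding abs_le_iff by linarith+
      hence "- q \<le> \<lfloor>L c0 a * real N / C\<rfloor>" "\<lfloor>L c0 a * real N / C\<rfloor> \<le> q"
        by linarith+
      hence 2: "\<lfloor>L c0 a * real N / C\<rfloor> \<in> {- q..q}" by simp
      from 1 2 show "\<phi> a \<in> G" by (auto simp: \<phi>_def G_def)
    qed
    have finG: "finite G" unfolding G_def using fin by (intro finite_cartesian_product finite_PiE) auto
    have "card G < card F"
    proof -
      have "(real N)\<^sup>2 / (4 * E) \<ge> 0" using E1 by simp
      hence q0: "q \<ge> 0" unfolding q_def by linarith
      have "real (card G) = real (2 * (B * N) + 1) ^ card J * real_of_int (2 * q + 1)"
      proof -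
        have cB: "card {- int m..int m} = 2 * m + 1" for m
          unfolding card_atLeastAtMost_int by linarith
        have cq: "real (card {- q..q}) = real_of_int (2 * q + 1)"
          using q0 by simp
        have "card G = (2 * (B * N) + 1) ^ card J * card {- q..q}"
          unfolding G_def card_cartesian_product card_PiE[OF fin(2)] cB by simp
        thus ?thesis using cq by simp
      qed
      also have "\<dots> \<le> (3 * real B * real N) ^ card J * ((real N)\<^sup>2 / E)"
      proof (rule mult_mono)
        have "real B * real N \<ge> 1 * 1" using B1 N1 by (intro mult_mono) auto
        thus "real (2 * (B * N) + 1) ^ card J \<le> (3 * real B * real N) ^ card J"
          by (intro power_mono) auto
        have "real_of_int q \<le> (real N)\<^sup>2 / (4 * E) + 1" unfolding q_def by linarith
        hence "real_of_int (2 * q + 1) \<le> (real N)\<^sup>2 / (2 * E) + 3" by simp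
        also have "6 * E * 1 \<le> real N * real N" using N1 E1 by (intro mult_mono) auto
        hence "(real N)\<^sup>2 / (2 * E) + 3 \<le> (real N)\<^sup>2 / E"
          using E1 by (simp add: field_simps power2_eq_square)
        finally show "real_of_int (2 * q + 1) \<le> (real N)\<^sup>2 / E" .
      qed (use q0 in auto)
      also have "\<dots> = real N ^ (card J + 2)"
      proof -
        have "(3 * real B * real N) ^ card J = E * real N ^ card J" by (simp add: E_def power_mult_distrib)
        thus ?thesis using E1 by (simp add: power_add power2_eq_square)
      qed
      also have "\<dots> < real (N + 1) ^ card I"
        unfolding card by (intro power_strict_mono) auto
      also have "\<dots> = real (card F)"
        using fin by (simp add: F_def card_PiE nat_add_distrib)
      finally show ?thesis by simp
    qed
    moreover have "card (\<phi> ` F) \<le> card G" using \<open>\<phi> ` F \<subseteq> G\<close> finG by (rule card_mono[rotated])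
    ultimately have "\<not> inj_on \<phi> F" by (intro pigeonhole) simp
    then obtain a b where ab: "a \<in> F" "b \<in> F" "a \<noteq> b" "\<phi> a = \<phi> b" by (auto simp: inj_on_def)
    have Ldiff: "L f (\<lambda>i. a i - b i) = L f a - L f b" for f
      by (simp add: L_def sum_subtractf algebra_simps)
    have floors: "\<lfloor>x\<rfloor> = \<lfloor>y\<rfloor> \<Longrightarrow> \<bar>x - y\<bar> \<le> 1" for x y :: real by linarith
    show "\<exists>a :: 'i \<Rightarrow> int. (\<exists>i\<in>I. a i \<noteq> 0) \<and> (\<forall>i\<in>I. \<bar>a i\<bar> \<le> int N) \<and>
      (\<forall>j\<in>J. \<bar>\<Sum>i\<in>I. c j i * of_int (a i)\<bar> \<le> 1) \<and> \<bar>\<Sum>i\<in>I. c0 i * of_int (a i)\<bar> \<le> C / real N"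
    proof (intro exI conjI ballI)
      show "\<exists>i\<in>I. a i - b i \<noteq> 0"
        using ab(1-3) unfolding F_def by (metis PiE_ext right_minus_eq)
      show "\<bar>a i - b i\<bar> \<le> int N" if "i \<in> I" for i
      proof -
        have "a i \<in> {0..int N}" "b i \<in> {0..int N}" using ab(1,2) that by (auto simp: F_def PiE_iff)
        thus ?thesis by auto
      qed
      show "\<bar>\<Sum>i\<in>I. c j i * of_int (a i - b i)\<bar> \<le> 1" if "j \<in> J" for j
      proof -
        have "restrict (\<lambda>j. \<lfloor>L (c j) a\<rfloor>) J j = restrict (\<lambda>j. \<lfloor>L (c j) b\<rfloor>) J j"
          using ab(4) by (simp add: \<phi>_def)
        hence "\<bar>L (c j) a - L (c j) b\<bar> \<le> 1" using that by (intro floors) simp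
        thus ?thesis using Ldiff[of "c j"] by (simp add: L_def)
      qed
      have "\<bar>L c0 a * real N / C - L c0 b * real N / C\<bar> \<le> 1"
        using ab(4) by (intro floors) (simp add: \<phi>_def)
      hence "\<bar>(L c0 a - L c0 b) * (real N / C)\<bar> \<le> 1" by (simp add: algebra_simps diff_divide_distrib)
      hence "\<bar>L c0 a - L c0 b\<bar> * (real N / C) \<le> 1" using C by (simp add: abs_mult)
      hence "\<bar>L c0 a - L c0 b\<bar> \<le> C / real N" using C N1 by (simp add: field_simps)
      thus "\<bar>\<Sum>i\<in>I. c0 i * of_int (a i - b i)\<bar> \<le> C / real N" using Ldiff[of c0] by (simp add: L_def)
    qed
  qed
qed

lemma ieval_pcompose [simp]: "ieval (pcompose p q) x = ieval p (ieval q x)"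
  by (induction p) (auto simp: pcompose_pCons)

lemma ieval_Poly: "ieval (Poly xs) x = (\<Sum>i<length xs. of_int (xs ! i) * x ^ i)"
proof (induction xs)
  case (Cons a xs)
  have "(\<Sum>i<length (a # xs). of_int ((a # xs) ! i) * x ^ i) =
      of_int a + (\<Sum>i<length xs. of_int (xs ! i) * (x * x ^ i))"
    by (simp add: sum.lessThan_Suc_shift del: sum.lessThan_Suc)
  also have "(\<Sum>i<length xs. of_int (xs ! i) * (x * x ^ i)) = x * (\<Sum>i<length xs. of_int (xs ! i) * x ^ i)"
    by (simp add: sum_distrib_left algebra_simps)
  finally show ?case using Cons by simp
qed simp

lemma Poly_coeff_list: "degree p < r \<Longrightarrow> Poly (map (coeff p) [0..<r]) = p"
  by (rule poly_eqI) (auto simp: nth_default_def coeff_eq_0)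

lemma finite_bounded_int_polys:
  "finite {p :: int poly. degree p < r \<and> (\<forall>i<r. \<bar>coeff p i\<bar> \<le> b)}"
proof (rule finite_subset)
  show "{p :: int poly. degree p < r \<and> (\<forall>i<r. \<bar>coeff p i\<bar> \<le> b)} \<subseteq>
      Poly ` {xs. set xs \<subseteq> {-b..b} \<and> length xs = r}"
  proof clarify
    fix p :: "int poly" assume p: "degree p < r" "\<forall>i<r. \<bar>coeff p i\<bar> \<le> b"
    show "p \<in> Poly ` {xs. set xs \<subseteq> {-b..b} \<and> length xs = r}"
      using p by (intro image_eqI[of _ _ "map (coeff p) [0..<r]"]) (auto simp: Poly_coeff_list abs_le_iff minus_le_iff)
  qed
qed (intro finite_imageI finite_lists_length_eq, simp)

text \<open>The constant term of an integral relation of least degree for p(t) is nonzero, and it is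
  a multiple of p(t) in Z[t]. \<open>pell_equation\<close> uses it as a modulus that is an ordinary
  integer.\<close>

lemma int_combination_of_algebraic:
  fixes t :: real
  assumes "algebraic_int t" "ieval p t \<noteq> 0"
  obtains M :: int and w where "M > 0" "of_int M = ieval p t * ieval w t"
proof -
  define z where "z = ieval p t"
  have "algebraic_int z" using assms by (auto simp: z_def)
  then obtain q0 where "lead_coeff q0 = 1" "ieval q0 z = 0"
    unfolding algebraic_int_iff_ieval by blast
  hence q0: "q0 \<noteq> 0" "ieval q0 z = 0" by auto
  then obtain q where q: "q \<noteq> 0" "ieval q z = 0"
    and min: "\<And>q'. q' \<noteq> 0 \<Longrightarrow> ieval q' z = 0 \<Longrightarrow> degree q \<le> degree q'"
    using ex_has_least_nat[of "\<lambda>q. q \<noteq> 0 \<and> ieval q z = 0" q0 degree] by blast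
  obtain a s where as: "q = pCons a s" by (cases q)
  have "a \<noteq> 0"
  proof
    assume "a = 0"
    with as q have "s \<noteq> 0" by auto
    moreover have "ieval s z = 0" using q(2) as \<open>a = 0\<close> assms(2) by (simp add: z_def)
    ultimately show False using min[of s] as by simp
  qed
  have "of_int a + z * ieval s z = 0" using q as by simp
  hence e: "of_int (- a) = z * ieval (pcompose s p) t" by (simp add: z_def algebra_simps)
  show ?thesis
  proof (cases "a < 0")
    case True
    thus ?thesis using that[of "- a" "pcompose s p"] e by (simp add: z_def)
  next
    case False
    thus ?thesis using that[of a "- pcompose s p"] e \<open>a \<noteq> 0\<close> by (simp add: z_def)
  qed
qed

text \<open>The embeddings of \<rat>(t) appear as the roots of \<open>h\<close>, and total reality
  becomes \<open>real_roots\<close>. As \<open>h\<close> is monic and integral, Z[t] has integer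
  coordinates, to which pigeonhole arguments apply.\<close>

locale totally_real_primitive =
  fixes h :: "int poly" and t :: real
  assumes monic: "lead_coeff h = 1"
    and irred: "rat_irreducible (map_poly of_int h)"
    and root: "qeval (map_poly of_int h) t = 0"
    and real_roots: "\<And>z :: complex. qeval (map_poly of_int h) z = 0 \<Longrightarrow> z \<in> \<real>"
begin

definition conjs :: "real set"
  where "conjs = {x. ieval h x = 0}"

lemma t_conj: "t \<in> conjs"
  using root by (simp add: conjs_def ieval_qeval)

lemma algebraic_int_t: "algebraic_int t"
  using monic root by (auto simp: algebraic_int_iff_ieval ieval_qeval)

lemma degree_pos: "degree h > 0"
  using irreducible_rat_poly_degree[OF irred] by (simp add: degree_map_poly)

text \<open>Irreducibility makes the complex roots of \<open>h\<close> simple, and all of them are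
  real.\<close>

lemma card_conjs: "card conjs = degree h" "finite conjs"
proof -
  define H :: "complex poly" where "H = map_poly of_int h"
  have degH: "degree H = degree h" by (simp add: H_def degree_map_poly)
  have "H \<noteq> 0" using degree_pos degH by auto
  have roots: "{z. poly H z = 0} = of_real ` conjs"
  proof (intro equalityI subsetI)
    fix z assume "z \<in> {z. poly H z = 0}"
    hence z: "ieval h z = 0" by (simp add: H_def ieval_def)
    hence "z \<in> \<real>" using real_roots by (simp add: ieval_qeval)
    then obtain x where "z = of_real x" by (auto elim: Reals_cases)
    with z show "z \<in> of_real ` conjs" by (auto simp: conjs_def ieval_of_real)
  next
    fix z :: complex assume "z \<in> of_real ` conjs"
    thus "z \<in> {z. poly H z = 0}" by (auto simp: conjs_def H_def ieval_of_real simp flip: ieval_def)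
  qed
  have "rsquarefree H"
    unfolding rsquarefree_roots
  proof (intro allI notI)
    fix z assume z: "poly H z = 0 \<and> poly (pderiv H) z = 0"
    have H: "H = map_poly of_rat (map_poly of_int h)"
      unfolding H_def by (rule poly_eqI) (simp add: coeff_map_poly)
    have "qeval (map_poly of_int h) z = 0" "qeval (pderiv (map_poly of_int h)) z = 0"
      using z unfolding H qeval_pderiv by (simp_all add: qeval_def)
    with irreducible_rat_poly_separable[OF irred, of z] show False by simp
  qed
  hence "H = smult (lead_coeff H) (\<Prod>z|poly H z = 0. [:- z, 1:])"
    by (simp add: complex_poly_decompose_rsquarefree)
  hence "degree H = degree (\<Prod>z|poly H z = 0. [:- z, 1:])"
    using \<open>H \<noteq> 0\<close> by (metis degree_smult_eq leading_coeff_0_iff)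
  hence "card {z. poly H z = 0} = degree H"
    by (simp add: degree_prod_eq_sum_degree)
  thus "card conjs = degree h" by (simp add: roots degH card_image inj_on_def)
  show "finite conjs"
    using poly_roots_finite[OF \<open>H \<noteq> 0\<close>] unfolding roots by (rule finite_imageD) (simp add: inj_on_def)
qed

lemma qeval_eq_0_imp: "qeval g t = 0 \<Longrightarrow> x \<in> conjs \<Longrightarrow> qeval g x = 0"
proof -
  assume g: "qeval g t = 0" and x: "x \<in> conjs"
  have "map_poly of_int h dvd g" using irreducible_rat_poly_dvd[OF irred root g] .
  then obtain k where "g = map_poly of_int h * k" ..
  thus ?thesis using x by (simp add: conjs_def ieval_qeval)
qed

lemma small_degree_eq_0: "degree p < degree h \<Longrightarrow> ieval p t = 0 \<Longrightarrow> p = 0"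
proof (rule ccontr)
  assume p: "degree p < degree h" "ieval p t = 0" "p \<noteq> 0"
  have "map_poly of_int h dvd (map_poly of_int p :: rat poly)"
    using irreducible_rat_poly_dvd[OF irred root] p(2) by (simp add: ieval_qeval)
  moreover have "(map_poly of_int p :: rat poly) \<noteq> 0" using p(3) by (simp add: map_poly_eq_0_iff)
  ultimately have "degree (map_poly of_int h :: rat poly) \<le> degree (map_poly of_int p :: rat poly)"
    by (rule dvd_imp_degree_le)
  thus False using p(1) by (simp add: degree_map_poly)
qed

lemma reduce_degree:
  obtains q where "degree q < degree h" "\<And>x. x \<in> conjs \<Longrightarrow> ieval q x = ieval p x"
proof -
  have "h \<noteq> 0" using degree_pos by auto
  \<comment> \<open>Pseudo-division by a monic polynomial is genuine division with remainder over
    the integers.\<close>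
  obtain q r where qr: "pseudo_divmod p h = (q, r)" by (cases "pseudo_divmod p h")
  from pseudo_divmod[OF \<open>h \<noteq> 0\<close> qr] monic have "p = h * q + r" "r = 0 \<or> degree r < degree h"
    by auto
  thus ?thesis using that[of r] degree_pos by (auto simp: conjs_def)
qed

text \<open>Lagrange interpolation recovers the integer coefficients from the values at the
  conjugates, so bounded conjugates leave finitely many polynomials of degree below that of
  \<open>h\<close>.\<close>

lemma finite_bounded_conjugates:
  "finite {ieval p t | p. \<forall>x\<in>conjs. \<bar>ieval p x\<bar> \<le> C}"
proof -
  define r where "r = degree h"
  define l :: "real \<Rightarrow> real poly" where "l = (\<lambda>x. \<Prod>y\<in>conjs - {x}. smult (inverse (x - y)) [:- y, 1:])"
  have lx: "poly (l x) y = (if x = y then 1 else 0)" if "x \<in> conjs" "y \<in> conjs" for x y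
  proof (cases "x = y")
    case True
    have "poly (l x) x = (\<Prod>y\<in>conjs - {x}. inverse (x - y) * (x - y))"
      unfolding l_def poly_prod by (intro prod.cong) (auto simp: algebra_simps)
    also have "\<dots> = 1" by (intro prod.neutral) auto
    finally show ?thesis using True by simp
  next
    case False
    thus ?thesis using that card_conjs(2) unfolding l_def poly_prod by (auto intro!: prod_zero bexI[of _ y])
  qed
  have ldeg: "degree (l x) < r" if "x \<in> conjs" for x
  proof -
    have "degree (l x) \<le> (\<Sum>y\<in>conjs - {x}. degree (smult (inverse (x - y)) [:- y, 1:]))"
      unfolding l_def using card_conjs(2) by (intro order.trans[OF degree_prod_sum_le]) (auto simp: o_def)
    also have "\<dots> \<le> (\<Sum>y\<in>conjs - {x}. 1)" by (intro sum_mono) (auto simp: degree_smult_eq)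
    also have "\<dots> < r" using that card_conjs degree_pos by (simp add: r_def)
    finally show ?thesis .
  qed
  define b where "b = \<lceil>\<Sum>i<r. \<Sum>x\<in>conjs. C * \<bar>coeff (l x) i\<bar>\<rceil>"
  have "{ieval p t | p. \<forall>x\<in>conjs. \<bar>ieval p x\<bar> \<le> C} \<subseteq>
      (\<lambda>p. ieval p t) ` {p :: int poly. degree p < r \<and> (\<forall>i<r. \<bar>coeff p i\<bar> \<le> b)}"
  proof clarify
    fix p0 assume p0: "\<forall>x\<in>conjs. \<bar>ieval p0 x\<bar> \<le> C"
    obtain p where p: "degree p < r" "\<And>x. x \<in> conjs \<Longrightarrow> ieval p x = ieval p0 x"
      unfolding r_def by (rule reduce_degree[of p0]) blast
    have bnd: "\<bar>ieval p x\<bar> \<le> C" if "x \<in> conjs" for x using p0 p(2) that by simp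
    have C0: "C \<ge> 0" using bnd[OF t_conj] by linarith
    define q where "q = (\<Sum>x\<in>conjs. smult (ieval p x) (l x))"
    have "map_poly of_int p = q"
    proof (rule poly_eqI_degree)
      show "poly (map_poly of_int p) y = poly q y" if "y \<in> conjs" for y
      proof -
        have "poly q y = (\<Sum>x\<in>conjs. if x = y then ieval p x else 0)"
          unfolding q_def poly_sum using that by (intro sum.cong) (auto simp: lx)
        thus ?thesis using that card_conjs(2) by (simp add: ieval_def)
      qed
      show "degree (map_poly of_int p :: real poly) < card conjs"
        using p(1) by (simp add: degree_map_poly card_conjs r_def)
      have "degree q < r" unfolding q_def
      proof (rule degree_sum_less)
        show "degree (smult (ieval p x) (l x)) < r" if "x \<in> conjs" for x
          using ldeg[OF that] degree_smult_le le_less_trans by blast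
        show "0 < r" using degree_pos by (simp add: r_def)
      qed
      thus "degree q < card conjs" by (simp add: card_conjs r_def)
    qed
    hence cf: "real_of_int (coeff p i) = (\<Sum>x\<in>conjs. ieval p x * coeff (l x) i)" for i
      by (metis (no_types, lifting) coeff_map_poly coeff_smult coeff_sum of_int_0 q_def sum.cong)
    have "\<bar>coeff p i\<bar> \<le> b" if "i < r" for i
    proof -
      have "real_of_int \<bar>coeff p i\<bar> \<le> (\<Sum>x\<in>conjs. \<bar>ieval p x * coeff (l x) i\<bar>)"
        using cf[of i] sum_abs by (metis of_int_abs)
      also have "\<dots> \<le> (\<Sum>x\<in>conjs. C * \<bar>coeff (l x) i\<bar>)"
        unfolding abs_mult by (intro sum_mono mult_right_mono bnd) auto
      also have "\<dots> \<le> (\<Sum>i<r. \<Sum>x\<in>conjs. C * \<bar>coeff (l x) i\<bar>)"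
        using that C0 by (intro member_le_sum) (auto intro!: sum_nonneg)
      also have "\<dots> \<le> of_int b" unfolding b_def by (rule le_of_int_ceiling)
      finally show ?thesis by simp
    qed
    thus "ieval p0 t \<in> (\<lambda>p. ieval p t) ` {p :: int poly. degree p < r \<and> (\<forall>i<r. \<bar>coeff p i\<bar> \<le> b)}"
      using p t_conj by (intro image_eqI[of _ _ p]) auto
  qed
  thus ?thesis using finite_bounded_int_polys by (meson finite_imageI finite_subset)
qed

text \<open>Elements x + y sqrt d whose relative norm is bounded at \<open>t\<close>, while at the
  other conjugates x and y are bounded themselves; then all conjugates of the norm are bounded. The
  degree bounds make a polynomial determined by its value at \<open>t\<close>.\<close>

definition pell_candidate :: "real \<Rightarrow> real \<Rightarrow> int poly \<times> int poly \<Rightarrow> bool"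
  where "pell_candidate d C = (\<lambda>(x, y). degree x < degree h \<and> degree y < degree h \<and> (x, y) \<noteq> (0, 0) \<and>
     (\<forall>z\<in>conjs - {t}. \<bar>ieval x z\<bar> \<le> 1 \<and> \<bar>ieval y z\<bar> \<le> 1) \<and>
     \<bar>(ieval x t)\<^sup>2 - d * (ieval y t)\<^sup>2\<bar> \<le> C)"

text \<open>A nontrivial relation would exhibit a square root of d as a quotient in
  \<rat>(t).\<close>

lemma nonsquare_linear_independent:
  assumes d: "d > 0" "\<And>g. (qeval g t)\<^sup>2 \<noteq> d"
    and xy: "degree x < degree h" "degree y < degree h" "ieval x t = sqrt d * ieval y t"
  shows "x = 0" "y = 0"
proof -
  interpret K: real_subfield "rat_adjoin t" by (intro real_subfield.intro subfield_rat_adjoin)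
  have alg: "Polynomial.algebraic t" using algebraic_int_t by blast
  have "ieval y t = 0"
  proof (rule ccontr)
    assume ny: "ieval y t \<noteq> 0"
    have "ieval x t / ieval y t \<in> rat_adjoin t"
      unfolding ieval_qeval using rat_adjoin_self by auto
    then obtain g where "ieval x t / ieval y t = qeval g t"
      unfolding rat_adjoin_eq[OF alg] by blast
    hence "(qeval g t)\<^sup>2 = (ieval x t / ieval y t)\<^sup>2" by simp
    also have "\<dots> = d" using xy(3) ny d(1) by (simp add: power_divide power_mult_distrib)
    finally show False using d(2) by blast
  qed
  with xy show "x = 0" "y = 0" by (auto intro: small_degree_eq_0)
qed

text \<open>Together x and y have 2r integer coefficients, r being the degree of \<open>h\<close>.
  Their values at the r - 1 other conjugates are the 2r - 2 forms to be bounded, and x(t) - sqrt d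
  y(t) is the form to be made small: the count required by \<open>dirichlet_linear_forms\<close>.
  The cofactor x(t) + sqrt d y(t) is at most N W, so the norm stays bounded. Finitely many
  candidates would keep the small form away from 0.\<close>

lemma infinitely_many_pell_candidates:
  assumes d: "d > 0" "\<And>g. (qeval g t)\<^sup>2 \<noteq> d"
  obtains C where "infinite {xy. pell_candidate d C xy}"
proof -
  define r where "r = degree h"
  define I where "I = (UNIV :: bool set) \<times> {..<r}"
  define J where "J = (conjs - {t}) \<times> (UNIV :: bool set)"
  define c :: "real \<times> bool \<Rightarrow> bool \<times> nat \<Rightarrow> real"
    where "c = (\<lambda>(z, b) (b', i). if b = b' then z ^ i else 0)"
  define c0 :: "bool \<times> nat \<Rightarrow> real" where "c0 = (\<lambda>(b, i). if b then t ^ i else - sqrt d * t ^ i)"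
  define P :: "(bool \<times> nat \<Rightarrow> int) \<Rightarrow> bool \<Rightarrow> int poly"
    where "P = (\<lambda>a b. Poly (map (\<lambda>i. a (b, i)) [0..<r]))"
  have fin: "finite I" "finite J" using card_conjs(2) by (auto simp: I_def J_def)
  have "card I = 2 * r" by (simp add: I_def card_cartesian_product)
  moreover have "card J = (r - 1) * 2"
    using card_conjs t_conj by (simp add: J_def card_cartesian_product r_def)
  ultimately have card: "card I = card J + 2" using degree_pos by (simp add: r_def)
  have evP: "ieval (P a b) z = (\<Sum>i<r. of_int (a (b, i)) * z ^ i)" for a b and z :: real
    by (simp add: P_def ieval_Poly)
  have sumI: "(\<Sum>i\<in>I. f i) = (\<Sum>i<r. f (True, i)) + (\<Sum>i<r. f (False, i))" for f :: "bool \<times> nat \<Rightarrow> real"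
  proof -
    have "sum f I = (\<Sum>b\<in>UNIV. \<Sum>i<r. f (b, i))" unfolding I_def by (simp add: sum.cartesian_product)
    thus ?thesis by (simp add: UNIV_bool)
  qed
  have ev: "(\<Sum>i\<in>I. c (z, b) i * of_int (a i)) = ieval (P a b) z" for z b a
    unfolding sumI evP by (cases b) (simp_all add: c_def mult.commute)
  have ev0: "(\<Sum>i\<in>I. c0 i * of_int (a i)) = ieval (P a True) t - sqrt d * ieval (P a False) t" for a
    unfolding sumI evP by (simp add: c0_def mult.commute sum_distrib_left sum_negf algebra_simps)
  have degP: "degree (P a b) < r" for a b
  proof -
    have "length (map (\<lambda>i. a (b, i)) [0..<r]) = r" by simp
    thus ?thesis unfolding P_def using degree_pos
      by (intro degree_lessI) (auto simp: r_def nth_default_def)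
  qed
  obtain C N0 where C: "C > 0" and forms: "\<And>N. N \<ge> N0 \<Longrightarrow> \<exists>a :: bool \<times> nat \<Rightarrow> int. (\<exists>i\<in>I. a i \<noteq> 0) \<and> (\<forall>i\<in>I. \<bar>a i\<bar> \<le> int N) \<and>
      (\<forall>j\<in>J. \<bar>\<Sum>i\<in>I. c j i * of_int (a i)\<bar> \<le> 1) \<and> \<bar>\<Sum>i\<in>I. c0 i * of_int (a i)\<bar> \<le> C / real N"
    using dirichlet_linear_forms[OF fin card] by blast
  define W where "W = (1 + sqrt d) * (\<Sum>i<r. \<bar>t\<bar> ^ i)"
  have W: "W \<ge> 0" unfolding W_def using d by (intro mult_nonneg_nonneg sum_nonneg) auto
  have approx: "\<exists>x y. pell_candidate d (C * W) (x, y) \<and> \<bar>ieval x t - sqrt d * ieval y t\<bar> \<le> C / real N"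
    if N: "N \<ge> N0" "N > 0" for N
  proof -
    obtain a where a: "\<exists>i\<in>I. a i \<noteq> 0" "\<forall>i\<in>I. \<bar>a i\<bar> \<le> int N"
      "\<forall>j\<in>J. \<bar>\<Sum>i\<in>I. c j i * of_int (a i)\<bar> \<le> 1" "\<bar>\<Sum>i\<in>I. c0 i * of_int (a i)\<bar> \<le> C / real N"
      using forms[OF N(1)] by blast
    define x y where "x = P a True" and "y = P a False"
    have small: "\<bar>ieval x t - sqrt d * ieval y t\<bar> \<le> C / real N"
      using a(4) by (simp add: ev0 x_def y_def)
    have bnd: "\<bar>ieval (P a b) t\<bar> \<le> real N * (\<Sum>i<r. \<bar>t\<bar> ^ i)" for b
    proof -
      have "\<bar>ieval (P a b) t\<bar> \<le> (\<Sum>i<r. \<bar>of_int (a (b, i)) * t ^ i\<bar>)" unfolding evP by (rule sum_abs)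
      also have "\<dots> \<le> (\<Sum>i<r. real N * \<bar>t\<bar> ^ i)"
      proof (rule sum_mono)
        fix i assume "i \<in> {..<r}"
        hence "\<bar>a (b, i)\<bar> \<le> int N" using a(2) by (auto simp: I_def)
        hence "\<bar>real_of_int (a (b, i))\<bar> \<le> real N" by linarith
        thus "\<bar>of_int (a (b, i)) * t ^ i\<bar> \<le> real N * \<bar>t\<bar> ^ i"
          by (simp add: abs_mult power_abs mult_right_mono)
      qed
      finally show ?thesis by (simp add: sum_distrib_left)
    qed
    have "\<bar>ieval x t + sqrt d * ieval y t\<bar> \<le> \<bar>ieval x t\<bar> + sqrt d * \<bar>ieval y t\<bar>"
      using d abs_triangle_ineq[of "ieval x t" "sqrt d * ieval y t"] by (simp add: abs_mult)
    also have "\<dots> \<le> real N * (\<Sum>i<r. \<bar>t\<bar> ^ i) + sqrt d * (real N * (\<Sum>i<r. \<bar>t\<bar> ^ i))"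
      unfolding x_def y_def using d bnd by (intro add_mono mult_left_mono) auto
    also have "\<dots> = real N * W" by (simp add: W_def algebra_simps)
    finally have big: "\<bar>ieval x t + sqrt d * ieval y t\<bar> \<le> real N * W" .
    have "sqrt d * sqrt d = d" using d by simp
    hence "(ieval x t)\<^sup>2 - d * (ieval y t)\<^sup>2 = (ieval x t - sqrt d * ieval y t) * (ieval x t + sqrt d * ieval y t)"
      by (simp add: power2_eq_square algebra_simps)
    hence "\<bar>(ieval x t)\<^sup>2 - d * (ieval y t)\<^sup>2\<bar> =
        \<bar>ieval x t - sqrt d * ieval y t\<bar> * \<bar>ieval x t + sqrt d * ieval y t\<bar>"
      by (simp only: abs_mult)
    also have "\<dots> \<le> (C / real N) * (real N * W)"
      by (intro mult_mono small big) (use C W in auto)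
    also have "\<dots> = C * W" using N by simp
    finally have norm: "\<bar>(ieval x t)\<^sup>2 - d * (ieval y t)\<^sup>2\<bar> \<le> C * W" .
    have "\<bar>ieval (P a b) z\<bar> \<le> 1" if "z \<in> conjs - {t}" for z b
    proof -
      have "(z, b) \<in> J" using that by (simp add: J_def)
      hence "\<bar>\<Sum>i\<in>I. c (z, b) i * of_int (a i)\<bar> \<le> 1" using a(3) by blast
      thus ?thesis by (simp only: ev)
    qed
    moreover have "(x, y) \<noteq> (0, 0)"
    proof
      assume "(x, y) = (0, 0)"
      hence "P a b = 0" for b by (cases b) (auto simp: x_def y_def)
      moreover have "coeff (P a b) i = a (b, i)" if "i < r" for b i
        using that by (simp add: P_def nth_default_def)
      ultimately have "a (b, i) = 0" if "i < r" for b i using that by (metis coeff_0)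
      with a(1) show False by (auto simp: I_def)
    qed
    ultimately have "pell_candidate d (C * W) (x, y)"
      using norm degP by (auto simp: pell_candidate_def x_def y_def r_def)
    with small show ?thesis by blast
  qed
  define S where "S = {xy. pell_candidate d (C * W) xy}"
  define dist where "dist = (\<lambda>(x, y). \<bar>ieval x t - sqrt d * ieval y t\<bar>)"
  have distpos: "dist xy > 0" if "xy \<in> S" for xy
  proof -
    obtain x y where xy: "xy = (x, y)" by (cases xy)
    have "ieval x t \<noteq> sqrt d * ieval y t"
      using nonsquare_linear_independent[OF d, of x y] that by (auto simp: S_def pell_candidate_def xy)
    thus ?thesis by (simp add: dist_def xy)
  qed
  have "infinite S"
  proof
    assume finS: "finite S"
    have "S \<noteq> {}" using approx[of "Suc N0"] by (auto simp: S_def)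
    define m where "m = Min (dist ` S)"
    have "m > 0" unfolding m_def using finS \<open>S \<noteq> {}\<close> distpos by (subst Min_gr_iff) auto
    obtain N where N: "real N > C / m" using reals_Archimedean2 by blast
    define N' where "N' = max (Suc N0) N"
    have "N' \<ge> N0" "N' > 0" "real N' \<ge> real N" by (auto simp: N'_def)
    with approx obtain x y where "pell_candidate d (C * W) (x, y)"
      "\<bar>ieval x t - sqrt d * ieval y t\<bar> \<le> C / real N'" by blast
    hence xy: "(x, y) \<in> S" "dist (x, y) \<le> C / real N'"
      by (simp_all add: S_def dist_def)
    have "C < real N' * m" using N \<open>m > 0\<close> \<open>real N' \<ge> real N\<close>
      by (metis less_le_trans pos_divide_less_eq)
    hence "C / real N' < m" using \<open>N' > 0\<close> by (simp add: field_simps)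
    moreover have "m \<le> dist (x, y)" unfolding m_def using finS xy(1) by simp
    ultimately show False using xy(2) by simp
  qed
  thus ?thesis using that by (simp add: S_def)
qed

text \<open>Descent as for Pell's equation over the integers: infinitely many candidates share their
  norm \<nu> and their coefficients modulo a positive integer \<open>M\<close> divisible by \<nu> in
  Z[t]. Dividing one of them by another gives an element of norm 1 with coordinates in Z[t].\<close>

theorem pell_equation:
  assumes d: "ieval D t > 0" "\<And>g. (qeval g t)\<^sup>2 \<noteq> ieval D t"
  obtains U V where "(ieval U t)\<^sup>2 - ieval D t * (ieval V t)\<^sup>2 = 1" "ieval V t \<noteq> 0"
proof -
  define \<delta> where "\<delta> = ieval D t"
  have \<delta>: "\<delta> > 0" "\<And>g. (qeval g t)\<^sup>2 \<noteq> \<delta>" using d by (auto simp: \<delta>_def)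
  define r where "r = degree h"
  obtain C where inf: "infinite {xy. pell_candidate \<delta> C xy}"
    by (rule infinitely_many_pell_candidates[OF \<delta>])
  define S where "S = {xy. pell_candidate \<delta> C xy}"
  define N where "N = (\<lambda>(x, y). ieval (x\<^sup>2 - D * y\<^sup>2) t)"
  have N: "N (x, y) = (ieval x t)\<^sup>2 - \<delta> * (ieval y t)\<^sup>2" for x y by (simp add: N_def \<delta>_def)
  \<comment> \<open>Bounds all conjugates of the norm: \<open>C\<close> at \<open>t\<close>, and 1 +
    |D(z)| at any other conjugate z. The sum over all conjugates avoids a maximum.\<close>
  define C' where "C' = C + (\<Sum>z\<in>conjs. 1 + \<bar>ieval D z\<bar>)"
  have "C \<ge> 0"
  proof -
    obtain xy where "xy \<in> S" using inf by (metis S_def infinite_imp_nonempty ex_in_conv)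
    thus ?thesis by (auto simp: S_def pell_candidate_def)
  qed
  have "N ` S \<subseteq> {ieval p t | p. \<forall>z\<in>conjs. \<bar>ieval p z\<bar> \<le> C'}"
  proof clarify
    fix x y assume xy: "(x, y) \<in> S"
    have bd: "\<bar>ieval (x\<^sup>2 - D * y\<^sup>2) z\<bar> \<le> C'" if z: "z \<in> conjs" for z
    proof (cases "z = t")
      case True
      have "(\<Sum>z\<in>conjs. 1 + \<bar>ieval D z\<bar>) \<ge> 0" by (intro sum_nonneg) auto
      thus ?thesis using True xy by (auto simp: S_def pell_candidate_def C'_def \<delta>_def)
    next
      case False
      hence "\<bar>ieval x z\<bar> \<le> 1" "\<bar>ieval y z\<bar> \<le> 1" using xy z by (auto simp: S_def pell_candidate_def)
      hence sq: "\<bar>(ieval x z)\<^sup>2\<bar> \<le> 1" "\<bar>(ieval y z)\<^sup>2\<bar> \<le> 1" by (simp_all add: abs_square_le_1)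
      have "\<bar>ieval D z * (ieval y z)\<^sup>2\<bar> \<le> \<bar>ieval D z\<bar>"
        unfolding abs_mult by (rule mult_left_le) (use sq in auto)
      moreover have "\<bar>ieval (x\<^sup>2 - D * y\<^sup>2) z\<bar> \<le> \<bar>(ieval x z)\<^sup>2\<bar> + \<bar>ieval D z * (ieval y z)\<^sup>2\<bar>"
        by (simp only: ieval_diff ieval_mult ieval_power abs_triangle_ineq4)
      ultimately have "\<bar>ieval (x\<^sup>2 - D * y\<^sup>2) z\<bar> \<le> 1 + \<bar>ieval D z\<bar>" using sq by linarith
      also have "\<dots> \<le> (\<Sum>z\<in>conjs. 1 + \<bar>ieval D z\<bar>)"
        using z card_conjs(2) by (intro member_le_sum) auto
      also have "\<dots> \<le> C'" using \<open>C \<ge> 0\<close> by (simp add: C'_def)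
      finally show ?thesis .
    qed
    show "\<exists>p. N (x, y) = ieval p t \<and> (\<forall>z\<in>conjs. \<bar>ieval p z\<bar> \<le> C')"
    proof (intro exI conjI ballI)
      show "N (x, y) = ieval (x\<^sup>2 - D * y\<^sup>2) t" by (simp only: N_def prod.case)
    qed (rule bd)
  qed
  hence "finite (N ` S)" using finite_bounded_conjugates finite_subset by blast
  with inf obtain xy0 where xy0: "xy0 \<in> S" and inf1: "infinite {xy\<in>S. N xy = N xy0}"
    using pigeonhole_infinite[of S N] by (auto simp: S_def)
  define \<nu> where "\<nu> = N xy0"
  define S1 where "S1 = {xy\<in>S. N xy = \<nu>}"
  have \<nu>: "\<nu> \<noteq> 0"
  proof
    assume "\<nu> = 0"
    obtain x y where xy: "xy0 = (x, y)" by (cases xy0)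
    have "(ieval x t)\<^sup>2 = \<delta> * (ieval y t)\<^sup>2" using \<open>\<nu> = 0\<close> by (simp add: \<nu>_def xy N)
    hence "\<bar>ieval x t\<bar> = \<bar>sqrt \<delta> * ieval y t\<bar>"
      using \<delta> by (metis real_sqrt_abs real_sqrt_mult abs_mult real_sqrt_ge_zero abs_of_nonneg less_imp_le)
    hence "ieval x t = sqrt \<delta> * ieval y t \<or> ieval x t = sqrt \<delta> * ieval (- y) t" by (auto simp: abs_eq_iff)
    hence "x = 0 \<and> y = 0"
      using nonsquare_linear_independent[OF \<delta>, of x y] nonsquare_linear_independent[OF \<delta>, of x "- y"] xy0
      by (auto simp: S_def pell_candidate_def xy)
    thus False using xy0 by (simp add: S_def pell_candidate_def xy)
  qed
  obtain x0 y0 where "xy0 = (x0, y0)" by (cases xy0)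
  hence "\<nu> = ieval (x0\<^sup>2 - D * y0\<^sup>2) t" by (simp only: \<nu>_def N_def prod.case)
  then obtain p where p: "\<nu> = ieval p t" ..
  obtain M :: int and w where M: "M > 0" "of_int M = \<nu> * ieval w t"
    using int_combination_of_algebraic[OF algebraic_int_t, of p] \<nu> p by auto
  define res where "res = (\<lambda>(x, y). (map (\<lambda>i. coeff x i mod M) [0..<r], map (\<lambda>i. coeff y i mod M) [0..<r]))"
  define L where "L = {xs :: int list. set xs \<subseteq> {0..<M} \<and> length xs = r}"
  have "res ` S1 \<subseteq> L \<times> L" using M(1) by (auto simp: res_def L_def)
  moreover have "finite (L \<times> L)" unfolding L_def by (intro finite_cartesian_product finite_lists_length_eq) auto
  ultimately have "finite (res ` S1)" by (rule finite_subset)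
  moreover have "infinite S1" using inf1 by (simp add: S1_def \<nu>_def)
  ultimately obtain xy2 where xy2: "xy2 \<in> S1" and inf2: "infinite {xy\<in>S1. res xy = res xy2}"
    using pigeonhole_infinite[of S1 res] by auto
  obtain x2 y2 where e2: "xy2 = (x2, y2)" by (cases xy2)
  \<comment> \<open>Removing the pair and its negative excludes the quotients 1 and -1, the
    solutions with V = 0.\<close>
  have "infinite ({xy\<in>S1. res xy = res xy2} - {(x2, y2), (- x2, - y2)})"
    using inf2 by (intro Diff_infinite_finite) auto
  then obtain xy1 where "xy1 \<in> {xy\<in>S1. res xy = res xy2} - {(x2, y2), (- x2, - y2)}"
    using infinite_imp_nonempty by blast
  moreover obtain x1 y1 where "xy1 = (x1, y1)" by (cases xy1)
  ultimately have xy1: "(x1, y1) \<in> S1" "res (x1, y1) = res (x2, y2)"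
    "(x1, y1) \<noteq> (x2, y2)" "(x1, y1) \<noteq> (- x2, - y2)"
    unfolding e2 by blast+
  have small: "degree x1 < r" "degree y1 < r" "degree x2 < r" "degree y2 < r"
    using xy1(1) xy2 by (auto simp: S1_def S_def pell_candidate_def e2 r_def)
  have cong: "\<exists>u. a - b = smult M u" if "degree a < r" "degree b < r"
    "map (\<lambda>i. coeff a i mod M) [0..<r] = map (\<lambda>i. coeff b i mod M) [0..<r]" for a b :: "int poly"
  proof -
    have "coeff a i mod M = coeff b i mod M" for i
      using that by (cases "i < r") (auto simp: coeff_eq_0 map_eq_conv)
    hence "M dvd coeff (a - b) i" for i by (simp add: mod_eq_dvd_iff)
    hence "[:M:] dvd a - b" by (simp add: const_poly_dvd_iff)
    then obtain u where "a - b = [:M:] * u" ..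
    thus ?thesis by (intro exI[of _ u]) simp
  qed
  obtain u where u: "x1 - x2 = smult M u" using cong[of x1 x2] small xy1(2) by (auto simp: res_def)
  obtain v where v: "y1 - y2 = smult M v" using cong[of y1 y2] small xy1(2) by (auto simp: res_def)
  define a1 b1 a2 b2 where "a1 = ieval x1 t" and "b1 = ieval y1 t" and "a2 = ieval x2 t" and "b2 = ieval y2 t"
  have "ieval (x1 - x2) t = of_int M * ieval u t" unfolding u by simp
  hence a: "a1 = a2 + \<nu> * ieval w t * ieval u t" by (simp add: a1_def a2_def M(2))
  have "ieval (y1 - y2) t = of_int M * ieval v t" unfolding v by simp
  hence b: "b1 = b2 + \<nu> * ieval w t * ieval v t" by (simp add: b1_def b2_def M(2))
  have norms: "a1\<^sup>2 - \<delta> * b1\<^sup>2 = \<nu>" "a2\<^sup>2 - \<delta> * b2\<^sup>2 = \<nu>"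
    using xy1(1) xy2 by (auto simp: S1_def e2 N a1_def a2_def b1_def b2_def)
  \<comment> \<open>The coordinates of the quotient (a1 + b1 sqrt \<delta>) / (a2 + b2 sqrt
    \<delta>). Its denominator \<nu> cancels since both differences a1 - a2 and b1 - b2 are
    multiples of \<open>M\<close>.\<close>
  define U V where "U = 1 + w * (u * x2 - D * v * y2)" and "V = w * (v * x2 - u * y2)"
  have U: "\<nu> * ieval U t = a1 * a2 - \<delta> * b1 * b2"
  proof -
    have "a1 * a2 - \<delta> * b1 * b2 = (a2\<^sup>2 - \<delta> * b2\<^sup>2) + \<nu> * ieval w t * (ieval u t * a2 - \<delta> * ieval v t * b2)"
      unfolding a b by (simp add: power2_eq_square algebra_simps)
    thus ?thesis unfolding norms by (simp add: U_def \<delta>_def a2_def b2_def algebra_simps)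
  qed
  have V: "\<nu> * ieval V t = b1 * a2 - a1 * b2"
    unfolding a b by (simp add: V_def a2_def b2_def algebra_simps)
  have "\<nu>\<^sup>2 * ((ieval U t)\<^sup>2 - \<delta> * (ieval V t)\<^sup>2) = (\<nu> * ieval U t)\<^sup>2 - \<delta> * (\<nu> * ieval V t)\<^sup>2"
    by (simp add: power_mult_distrib algebra_simps)
  also have "\<dots> = (a1\<^sup>2 - \<delta> * b1\<^sup>2) * (a2\<^sup>2 - \<delta> * b2\<^sup>2)"
    unfolding U V by (simp add: power2_eq_square algebra_simps)
  also have "\<dots> = \<nu>\<^sup>2" unfolding norms by (simp add: power2_eq_square)
  finally have unit: "(ieval U t)\<^sup>2 - \<delta> * (ieval V t)\<^sup>2 = 1" using \<nu> by simp
  moreover have "ieval V t \<noteq> 0"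
  proof
    assume Y0: "ieval V t = 0"
    with unit have "ieval U t = 1 \<or> ieval U t = -1" by (simp add: power2_eq_1_iff)
    define s where "s = sqrt \<delta>"
    have s: "s * s = \<delta>" using \<delta> by (simp add: s_def)
    have "(a1 - s * b1) * (a2 + s * b2) = a1 * a2 - (s * s) * b1 * b2 - s * (b1 * a2 - a1 * b2)"
      by (simp add: algebra_simps)
    also have "\<dots> = \<nu> * ieval U t" unfolding s U[symmetric] V[symmetric] Y0 by simp
    finally have prod: "(a1 - s * b1) * (a2 + s * b2) = \<nu> * ieval U t" .
    have n1: "(a1 - s * b1) * (a1 + s * b1) = \<nu>"
      using norms(1) by (simp add: power2_eq_square algebra_simps flip: s)
    have nz: "a1 - s * b1 \<noteq> 0" using n1 \<nu> by auto
    from \<open>ieval U t = 1 \<or> _\<close> show False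
    proof
      assume "ieval U t = 1"
      with prod n1 nz have "a2 + s * b2 = a1 + s * b1" by (metis mult.right_neutral mult_left_cancel)
      hence "ieval (x1 - x2) t = sqrt \<delta> * ieval (y2 - y1) t"
        by (simp add: a1_def a2_def b1_def b2_def s_def algebra_simps)
      hence "x1 - x2 = 0" "y2 - y1 = 0"
        using nonsquare_linear_independent[OF \<delta>, of "x1 - x2" "y2 - y1"] small
        by (auto intro: degree_diff_less simp: r_def)
      with xy1(3) show False by simp
    next
      assume "ieval U t = -1"
      with prod n1 nz have "a2 + s * b2 = - (a1 + s * b1)"
        by (metis mult.right_neutral mult_left_cancel mult_minus_right)
      hence "ieval (x1 + x2) t = sqrt \<delta> * ieval (- y2 - y1) t"
        by (simp add: a1_def a2_def b1_def b2_def s_def algebra_simps)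
      moreover have "degree (x1 + x2) < r" "degree (- y2 - y1) < r"
        using small by (auto intro!: degree_add_less degree_diff_less)
      ultimately have "x1 + x2 = 0" "- y2 - y1 = 0"
        using nonsquare_linear_independent[OF \<delta>, of "x1 + x2" "- y2 - y1"] unfolding r_def by blast+
      hence "x1 = - x2" "y1 = - y2" by (simp_all add: eq_neg_iff_add_eq_0 add.commute)
      with xy1(4) show False by simp
    qed
  qed
  ultimately show ?thesis using that by (simp add: \<delta>_def)
qed

end

subsection \<open>Admissible forms\<close>

lemma det_mem:
  assumes "subfield K real_field" "matrix_over K A"
  shows "det A \<in> K"
proof -
  interpret real_subfield K using assms(1) by (rule real_subfield.intro)
  have "A $ i $ j \<in> K" for i j using assms(2) by (simp add: matrix_over_def)
  thus ?thesis unfolding det_def by (intro sum_mem mult_mem prod_mem of_int_mem)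
qed

text \<open>Cramer's rule writes the entries of the inverse as quotients of determinants over
  K.\<close>

lemma matrix_over_inv:
  fixes A :: "real ^ ('n::finite) ^ 'n"
  assumes K: "subfield K real_field" and A: "matrix_over K A" and inv: "invertible A"
  shows "matrix_over K (matrix_inv A)"
  unfolding matrix_over_def
proof (intro allI)
  fix i j
  interpret real_subfield K using K by (rule real_subfield.intro)
  have d: "det A \<noteq> 0" using inv invertible_det_nz by blast
  define y where "y = matrix_inv A *v axis j 1"
  have "A *v y = axis j 1"
    by (simp add: y_def matrix_vector_mul_assoc matrix_inv_props[OF inv])
  hence "y = (\<chi> k. det (\<chi> i l. if l = k then axis j 1 $ i else A $ i $ l) / det A)"
    using cramer[OF d] by blast
  hence "y $ i = det (\<chi> i' l. if l = i then axis j 1 $ i' else A $ i' $ l) / det A" by simp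
  also have "\<dots> \<in> K"
    using A by (intro divide_mem det_mem[OF K]) (auto simp: matrix_over_def axis_def)
  finally show "matrix_inv A $ i $ j \<in> K" by (simp add: y_def matrix_vector_mult_def axis_def if_distrib cong: if_cong)
qed

section \<open>Rank one matrices, projections and boosts\<close>

definition vec_over :: "real set \<Rightarrow> real ^ 'm \<Rightarrow> bool"
  where "vec_over K v \<longleftrightarrow> (\<forall>i. v $ i \<in> K)"

definition outer :: "real ^ 'm \<Rightarrow> real ^ 'm \<Rightarrow> real ^ 'm ^ 'm"
  where "outer x y = (\<chi> i j. x $ i * y $ j)"

lemma outer_mult_vec: "outer x y *v z = (y \<bullet> z) *\<^sub>R x"
  by (simp add: outer_def matrix_vector_mult_def vec_eq_iff inner_vec_def sum_distrib_left
      sum_distrib_right mult_ac)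

lemma outer_mult: "outer x y ** outer z w = (y \<bullet> z) *\<^sub>R outer x w"
  by (simp add: outer_def matrix_matrix_mult_def vec_eq_iff inner_vec_def sum_distrib_left
      sum_distrib_right mult_ac)

lemma mult_outer: "g ** outer x y = outer (g *v x) y"
  by (simp add: outer_def matrix_matrix_mult_def matrix_vector_mult_def vec_eq_iff sum_distrib_left
      sum_distrib_right mult_ac)

lemma outer_mult_right: "outer x y ** g = outer x (transpose g *v y)"
  by (simp add: outer_def matrix_matrix_mult_def matrix_vector_mult_def vec_eq_iff sum_distrib_left
      transpose_def mult_ac del: transpose_matrix_vector)

lemma matrix_scaleR_mult:
  "(c *\<^sub>R P) ** Q = c *\<^sub>R (P ** Q)" "P ** (c *\<^sub>R Q) = c *\<^sub>R (P ** Q)" for P Q :: "real ^ 'm ^ 'm"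
  by (simp_all add: matrix_matrix_mult_def vec_eq_iff sum_distrib_left mult_ac)

text \<open>The orthogonal projection onto the line of \<open>u\<close>, with respect to the form of
  \<open>A\<close>.\<close>

definition line_proj :: "real ^ ('m::finite) ^ 'm \<Rightarrow> real ^ 'm \<Rightarrow> real ^ 'm ^ 'm"
  where "line_proj A u = (1 / qform A u) *\<^sub>R outer u (A *v u)"

text \<open>The isometry that is \<open>(x y; dy x)\<close> in the plane spanned by the orthogonal vectors \<open>u\<close>
  and \<open>w\<close> and trivial on its orthogonal complement, where \<open>d = - f(u) f(w)\<close>.\<close>

definition boost :: "real ^ ('m::finite) ^ 'm \<Rightarrow> real ^ 'm \<Rightarrow> real ^ 'm \<Rightarrow> real \<Rightarrow> real \<Rightarrow> real ^ 'm ^ 'm"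
  where "boost A u w x y = mat 1 + (x - 1) *\<^sub>R (line_proj A u + line_proj A w) +
     y *\<^sub>R (outer u (A *v w) - outer w (A *v u))"

lemma line_proj_vec: "line_proj A u *v z = (bform A z u / qform A u) *\<^sub>R u"
  by (simp add: line_proj_def outer_mult_vec bform_def inner_commute scaleR_matrix_vector_assoc[symmetric])

lemma boost_vec:
  "boost A u w x y *v z = z + ((x - 1) * (bform A z u / qform A u) + y * bform A z w) *\<^sub>R u
     + ((x - 1) * (bform A z w / qform A w) - y * bform A z u) *\<^sub>R w"
proof -
  have "(y *\<^sub>R (outer u (A *v w) - outer w (A *v u))) *v z = (y * bform A z w) *\<^sub>R u - (y * bform A z u) *\<^sub>R w"
    by (simp add: scaleR_matrix_vector_assoc[symmetric] matrix_vector_mult_diff_rdistrib outer_mult_vec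
        bform_def inner_commute scaleR_diff_right)
  moreover have "((x - 1) *\<^sub>R (line_proj A u + line_proj A w)) *v z =
     ((x - 1) * (bform A z u / qform A u)) *\<^sub>R u + ((x - 1) * (bform A z w / qform A w)) *\<^sub>R w"
    by (simp add: scaleR_matrix_vector_assoc[symmetric] matrix_vector_mult_add_rdistrib line_proj_vec
        scaleR_add_right)
  ultimately show ?thesis
    by (simp add: boost_def matrix_vector_mult_add_rdistrib algebra_simps)
qed

locale orthogonal_pair =
  fixes A :: "real ^ ('m::finite) ^ 'm" and u w
  assumes sym: "transpose A = A" and uw: "bform A u w = 0" and nu: "qform A u \<noteq> 0" and nw: "qform A w \<noteq> 0"
begin

lemma wu: "bform A w u = 0"
  using uw bform_commute[OF sym] by metis

lemma boost_preserves:
  assumes "x\<^sup>2 + qform A u * qform A w * y\<^sup>2 = 1"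
  shows "bform A (boost A u w x y *v z) (boost A u w x y *v z') = bform A z z'"
proof -
  define \<alpha> \<beta> where "\<alpha> = qform A u" and "\<beta> = qform A w"
  define a b a' b' where "a = bform A z u / \<alpha>" and "b = bform A z w / \<beta>"
    and "a' = bform A z' u / \<alpha>" and "b' = bform A z' w / \<beta>"
  have zu: "bform A z u = \<alpha> * a" "bform A z w = \<beta> * b" "bform A z' u = \<alpha> * a'" "bform A z' w = \<beta> * b'"
    using nu nw by (simp_all add: a_def b_def a'_def b'_def \<alpha>_def \<beta>_def)
  define p q p' q' where "p = (x - 1) * a + y * (\<beta> * b)" and "q = (x - 1) * b - y * (\<alpha> * a)"
    and "p' = (x - 1) * a' + y * (\<beta> * b')" and "q' = (x - 1) * b' - y * (\<alpha> * a')"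
  have T: "boost A u w x y *v z = z + p *\<^sub>R u + q *\<^sub>R w" "boost A u w x y *v z' = z' + p' *\<^sub>R u + q' *\<^sub>R w"
    unfolding boost_vec zu using nu nw by (simp_all add: p_def q_def p'_def q'_def \<alpha>_def \<beta>_def)
  have zu': "bform A u z' = \<alpha> * a'" "bform A w z' = \<beta> * b'"
    using zu bform_commute[OF sym] by metis+
  have uu: "bform A u u = \<alpha>" "bform A w w = \<beta>" by (simp_all add: \<alpha>_def \<beta>_def qform_bform)
  have "bform A (boost A u w x y *v z) (boost A u w x y *v z') =
      bform A z z' + (\<alpha> * ((a + p) * (a' + p') - a * a') + \<beta> * ((b + q) * (b' + q') - b * b'))"
    unfolding T by (simp add: bform_linear zu zu' uu uw wu algebra_simps)
  also have "\<alpha> * ((a + p) * (a' + p') - a * a') + \<beta> * ((b + q) * (b' + q') - b * b') =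
      (\<alpha> * a * a' + \<beta> * b * b') * (x\<^sup>2 + \<alpha> * \<beta> * y\<^sup>2 - 1)"
    by (simp add: p_def q_def p'_def q'_def power2_eq_square algebra_simps)
  finally show ?thesis using assms by (simp add: \<alpha>_def \<beta>_def)
qed

text \<open>Boosts multiply like the elements x + y sqrt d with d = - f(u) f(w). So the Pell
  equation for d is the condition that a boost be an isometry, and y changes sign under
  inversion.\<close>

lemma boost_mult:
  "boost A u w x y ** boost A u w x' y' =
    boost A u w (x * x' - qform A u * qform A w * y * y') (x * y' + y * x')"
proof -
  have "(boost A u w x y ** boost A u w x' y') *v z =
    boost A u w (x * x' - qform A u * qform A w * y * y') (x * y' + y * x') *v z" for z
  proof -
    define \<alpha> \<beta> where "\<alpha> = qform A u" and "\<beta> = qform A w"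
    define a b where "a = bform A z u / \<alpha>" and "b = bform A z w / \<beta>"
    have zu: "bform A z u = \<alpha> * a" "bform A z w = \<beta> * b"
      using nu nw by (simp_all add: a_def b_def \<alpha>_def \<beta>_def)
    have uu: "bform A u u = \<alpha>" "bform A w w = \<beta>" by (simp_all add: \<alpha>_def \<beta>_def qform_bform)
    define p q where "p = (x' - 1) * a + y' * (\<beta> * b)" and "q = (x' - 1) * b - y' * (\<alpha> * a)"
    have nz: "\<alpha> \<noteq> 0" "\<beta> \<noteq> 0" using nu nw by (simp_all add: \<alpha>_def \<beta>_def)
    have T: "boost A u w s r *v v = v + ((s - 1) * c + r * (\<beta> * e)) *\<^sub>R u + ((s - 1) * e - r * (\<alpha> * c)) *\<^sub>R w"
      if "bform A v u = \<alpha> * c" "bform A v w = \<beta> * e" for s r v c e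
      unfolding boost_vec that using nz by (simp flip: \<alpha>_def \<beta>_def)
    have "boost A u w x' y' *v z = z + p *\<^sub>R u + q *\<^sub>R w"
      unfolding T[OF zu] p_def q_def ..
    moreover have "bform A (z + p *\<^sub>R u + q *\<^sub>R w) u = \<alpha> * (a + p)"
      "bform A (z + p *\<^sub>R u + q *\<^sub>R w) w = \<beta> * (b + q)"
      by (simp_all add: bform_linear zu uu uw wu algebra_simps)
    note T[OF this, of x y]
    ultimately have "(boost A u w x y ** boost A u w x' y') *v z = z +
        (p + ((x - 1) * (a + p) + y * (\<beta> * (b + q)))) *\<^sub>R u + (q + ((x - 1) * (b + q) - y * (\<alpha> * (a + p)))) *\<^sub>R w"
      by (simp add: matrix_vector_mul_assoc[symmetric] algebra_simps)
    also have "p + ((x - 1) * (a + p) + y * (\<beta> * (b + q))) =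
       (x * x' - \<alpha> * \<beta> * y * y' - 1) * a + (x * y' + y * x') * (\<beta> * b)"
      by (simp add: p_def q_def algebra_simps)
    also have "q + ((x - 1) * (b + q) - y * (\<alpha> * (a + p))) =
       (x * x' - \<alpha> * \<beta> * y * y' - 1) * b - (x * y' + y * x') * (\<alpha> * a)"
      by (simp add: p_def q_def algebra_simps)
    finally show ?thesis unfolding T[OF zu] by (simp flip: \<alpha>_def \<beta>_def)
  qed
  thus ?thesis by (simp add: matrix_eq)
qed

lemma boost_1_0: "boost A u w 1 0 = mat 1"
  by (simp add: boost_def)

lemma boost_inverse:
  assumes "x\<^sup>2 + qform A u * qform A w * y\<^sup>2 = 1"
  shows "boost A u w x y ** boost A u w x (- y) = mat 1" "boost A u w x (- y) ** boost A u w x y = mat 1"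
  using assms by (simp_all add: boost_mult power2_eq_square mult.assoc mult.commute boost_1_0)

end

text \<open>Write c = a / b. For s = b k the value 1 + c s^2 is the integer 1 + a b k^2. If it is a
  square m^2 for k = 1, then for k = 2 it is 4 m^2 - 3, which lies strictly between (2 m - 1)^2 and
  (2 m)^2.\<close>

lemma rational_nonsquare:
  fixes c :: rat
  assumes "c > 0"
  obtains s :: rat where "s \<noteq> 0" "\<And>q. q\<^sup>2 \<noteq> 1 + c * s\<^sup>2"
proof -
  have "\<exists>s. s \<noteq> 0 \<and> (\<forall>q. q\<^sup>2 \<noteq> 1 + c * s\<^sup>2)"
  proof (rule ccontr)
  assume neg: "\<not> ?thesis"
  obtain a b where ab: "c = of_int a / of_int b" "b > 0"
    by (cases c) (auto simp: Fract_of_int_quotient)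
  have a: "a > 0" using assms ab by (simp add: zero_less_divide_iff)
  have sq: "\<exists>m. m\<^sup>2 = 1 + a * b * k\<^sup>2" if "k \<noteq> 0" for k :: int
  proof -
    have "of_int (b * k) \<noteq> (0 :: rat)" using that ab(2) by simp
    then obtain q where "q\<^sup>2 = 1 + c * (of_int (b * k))\<^sup>2" using neg by blast
    hence q: "q\<^sup>2 = of_int (1 + a * b * k\<^sup>2)"
      using ab by (simp add: power2_eq_square)
    obtain m n where mn: "q = of_int m / of_int n" "n > 0" "coprime m n"
      by (cases q) (auto simp: Fract_of_int_quotient)
    have "of_int (m\<^sup>2) = (of_int (n\<^sup>2 * (1 + a * b * k\<^sup>2)) :: rat)"
      using q mn by (simp add: power_divide field_simps)
    hence "m\<^sup>2 = n\<^sup>2 * (1 + a * b * k\<^sup>2)" by (simp only: of_int_eq_iff)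
    hence "n\<^sup>2 dvd m\<^sup>2" by simp
    hence "n dvd m" by simp
    with mn(2,3) have "n = 1" using coprime_common_divisor_int[of m n n] by (simp add: coprime_commute)
    with \<open>m\<^sup>2 = _\<close> show ?thesis by auto
  qed
  obtain m where m: "m\<^sup>2 = 1 + a * b" using sq[of 1] by auto
  obtain n where n: "n\<^sup>2 = 1 + a * b * 4" using sq[of 2] by auto
  define m' n' where "m' = \<bar>m\<bar>" and "n' = \<bar>n\<bar>"
  have mn: "m'\<^sup>2 = 1 + a * b" "n'\<^sup>2 = 4 * m'\<^sup>2 - 3" "m' \<ge> 0" "n' \<ge> 0"
    using m n by (simp_all add: m'_def n'_def)
  have "a * b > 0" using a ab by simp
  hence "m'\<^sup>2 > 1" using mn by simp
  hence "m' \<ge> 2"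
  proof -
    have "m' \<noteq> 0" "m' \<noteq> 1" using \<open>m'\<^sup>2 > 1\<close> by auto
    thus ?thesis using mn(3) by linarith
  qed
  have "n' < 2 * m'" by (rule power2_less_imp_less) (use mn in \<open>auto simp: power_mult_distrib\<close>)
  hence "n' \<le> 2 * m' - 1" by simp
  hence "n'\<^sup>2 \<le> (2 * m' - 1)\<^sup>2" using mn by (intro power_mono) auto
  hence "4 * m'\<^sup>2 - 3 \<le> 4 * m'\<^sup>2 - 4 * m' + 1" using mn by (simp add: power2_eq_square algebra_simps)
  with \<open>m' \<ge> 2\<close> show False by simp
  qed
  with that show ?thesis by blast
qed

text \<open>Conjugates of \<open>A\<close> are formed by evaluating polynomials that represent its
  entries at the conjugates of \<open>t\<close>. All choices \<open>a\<close> of representatives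
  give the same matrix, so \<open>definite\<close> speaks of the embeddings of \<open>K\<close>
  other than the identity.\<close>

locale admissible_form = totally_real_primitive h t for h t +
  fixes K :: "real set" and A M :: "('n::finite) lmat"
  assumes K_eq: "K = range (\<lambda>g. qeval g t)"
    and A_over: "matrix_over K A" and A_sym: "transpose A = A"
    and M_inv: "invertible M" and M_form: "\<And>x. qform A (M *v x) = lorentz_form x"
    and definite: "\<And>x a. x \<in> conjs \<Longrightarrow> x \<noteq> t \<Longrightarrow> (\<And>i j. qeval (a i j) t = A $ i $ j) \<Longrightarrow>
       positive_definite (\<chi> i j. qeval (a i j) x)"
begin

lemma K_adjoin: "K = rat_adjoin t"
  using rat_adjoin_eq[of t] algebraic_int_t K_eq by blast

lemma subfield_K: "subfield K real_field"
  unfolding K_adjoin by (rule subfield_rat_adjoin)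

sublocale K: real_subfield K
  by (rule real_subfield.intro[OF subfield_K])

lemmas comm = bform_commute[OF A_sym]

lemma bform_lorentz: "bform A (M *v x) (M *v y) = lorentz_inner x y"
  by (rule bform_eq_lorentz[OF A_sym M_form])

lemma M_surj: obtains y where "x = M *v y"
  using that[of "matrix_inv M *v x"] by (simp add: matrix_vector_mul_assoc matrix_inv_props[OF M_inv])

lemma orthogonal_pos:
  assumes "qform A u < 0" "bform A z u = 0" "z \<noteq> 0"
  shows "qform A z > 0"
proof -
  obtain u' where u: "u = M *v u'" by (rule M_surj)
  obtain z' where z: "z = M *v z'" by (rule M_surj)
  have "z' \<noteq> 0" using assms(3) z by auto
  moreover have "lorentz_inner u' z' = 0"
    using assms(2) bform_lorentz[of z' u'] by (simp add: u z lorentz_inner_commute)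
  moreover have "lorentz_form u' < 0" using assms(1) by (simp add: u M_form)
  ultimately show ?thesis unfolding z M_form by (intro lorentz_form_orthogonal_pos)
qed

lemma nondegenerate:
  assumes "\<And>y. bform A y x = 0"
  shows "x = 0"
proof -
  obtain x' where x: "x = M *v x'" by (rule M_surj)
  have *: "lorentz_inner y x' = 0" for y
    using assms[of "M *v y"] by (simp add: x bform_lorentz)
  have "x' $ i = 0" for i
  proof -
    have "axis i 1 $ Some j * x' $ Some j = (if i = Some j then x' $ Some j else 0)" for j
      by (simp add: axis_def)
    hence "lorentz_inner (axis i 1) x' = (if i = None then - (x' $ i) else x' $ i)"
      by (cases i) (simp_all add: lorentz_inner_def axis_def)
    thus ?thesis using *[of "axis i 1"] by (simp split: if_splits)
  qed
  hence "x' = 0" by (simp add: vec_eq_iff)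
  thus ?thesis by (simp add: x)
qed

lemma A_invertible: "invertible A"
proof -
  have "x = 0" if "A *v x = 0" for x
    by (rule nondegenerate) (simp add: bform_def that)
  thus ?thesis using invertible_left_inverse matrix_left_invertible_ker by blast
qed

lemma bform_mem: "vec_over K x \<Longrightarrow> vec_over K y \<Longrightarrow> bform A x y \<in> K"
  unfolding bform_altdef by (intro K.sum_mem K.mult_mem) (use A_over in \<open>auto simp: matrix_over_def vec_over_def\<close>)

lemma vec_over_linear:
  "vec_over K x \<Longrightarrow> vec_over K y \<Longrightarrow> vec_over K (x + y)"
  "vec_over K x \<Longrightarrow> vec_over K y \<Longrightarrow> vec_over K (x - y)"
  "c \<in> K \<Longrightarrow> vec_over K x \<Longrightarrow> vec_over K (c *\<^sub>R x)"
  "vec_over K (axis i 1)"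
  "vec_over K x \<Longrightarrow> vec_over K (A *v x)"
proof -
  show "vec_over K x \<Longrightarrow> vec_over K (A *v x)"
    unfolding vec_over_def matrix_vector_mult_def using A_over
    by (auto simp: matrix_over_def intro!: K.sum_mem K.mult_mem)
qed (auto simp: vec_over_def axis_def)

lemma matrix_over_outer: "vec_over K x \<Longrightarrow> vec_over K y \<Longrightarrow> matrix_over K (outer x y)"
  by (auto simp: vec_over_def matrix_over_def outer_def)

lemma matrix_over_line_proj: "vec_over K x \<Longrightarrow> matrix_over K (line_proj A x)"
  unfolding line_proj_def
  by (intro matrix_over_scale[OF real_subring_field[OF subfield_K]] matrix_over_outer vec_over_linear(5)
        K.divide_mem K.one_mem) (simp_all add: qform_bform bform_mem)

lemma qeval_conj_eq_0_imp: "x \<in> conjs \<Longrightarrow> qeval g x = 0 \<Longrightarrow> qeval g t = 0"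
proof -
  assume x: "x \<in> conjs" and g: "qeval g x = 0"
  have "qeval (map_poly of_int h) x = 0" using x by (simp add: conjs_def ieval_qeval)
  hence "map_poly of_int h dvd g" using irreducible_rat_poly_dvd[OF irred _ g] by blast
  then obtain k where "g = map_poly of_int h * k" ..
  thus ?thesis using root by simp
qed

lemma vec_over_qeval:
  assumes "vec_over K v"
  obtains p where "\<And>i. v $ i = qeval (p i) t"
proof -
  have "\<forall>i. \<exists>g. v $ i = qeval g t" using assms by (auto simp: vec_over_def K_eq)
  from choice[OF this] that show ?thesis by blast
qed

lemma matrix_over_qeval:
  assumes "matrix_over K B"
  obtains b where "\<And>i j. B $ i $ j = qeval (b i j) t"
proof -
  have "\<forall>i. \<forall>j. \<exists>g. B $ i $ j = qeval g t" using assms by (auto simp: matrix_over_def K_eq)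
  hence "\<forall>i. \<exists>b. \<forall>j. B $ i $ j = qeval (b j) t" by (intro allI choice) blast
  from choice[OF this] that show ?thesis by blast
qed

text \<open>A nontrivial conjugation would turn a nonzero isotropic vector over K into one for a
  definite form.\<close>

lemma anisotropic:
  assumes x: "x \<in> conjs" "x \<noteq> t" and v: "vec_over K v" "v \<noteq> 0"
  shows "qform A v \<noteq> 0"
proof
  assume iso: "qform A v = 0"
  obtain p where p: "\<And>i. v $ i = qeval (p i) t" using v(1) vec_over_qeval by blast
  obtain a where a: "\<And>i j. A $ i $ j = qeval (a i j) t" using A_over matrix_over_qeval by blast
  define A' where "A' = (\<chi> i j. qeval (a i j) x)"
  define v' where "v' = (\<chi> i. qeval (p i) x)"
  define G where "G = (\<Sum>i\<in>UNIV. \<Sum>j\<in>UNIV. p i * a i j * p j)"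
  have "qeval G t = qform A v"
    by (simp add: G_def qform_bform bform_altdef p a)
  hence "qeval G x = 0" using iso qeval_eq_0_imp x(1) by simp
  hence "qform A' v' = 0"
    by (simp add: G_def qform_bform bform_altdef A'_def v'_def)
  moreover have "positive_definite A'" unfolding A'_def using definite[OF x, of a] a by simp
  ultimately have "v' = 0" unfolding positive_definite_def by (metis less_irrefl)
  hence "qeval (p i) x = 0" for i by (simp add: v'_def vec_eq_iff)
  hence "v $ i = 0" for i using qeval_conj_eq_0_imp[OF x(1)] p by simp
  with v(2) show False by (simp add: vec_eq_iff)
qed

lemma rational_case:
  assumes "\<And>x. x \<in> conjs \<Longrightarrow> x = t"
  shows "K = \<rat>"
proof -
  have "conjs = {t}" using assms t_conj by blast
  hence "degree h = 1" using card_conjs by simp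
  then obtain a b where ab: "h = [:a, b:]" "b \<noteq> 0" by (rule degree1_coeffs)
  have "b = 1" using monic ab(2) unfolding ab(1) by simp
  hence "of_int a + t = 0" using root unfolding ab(1) by (simp add: map_poly_pCons)
  hence t: "t = of_int (- a)" by simp
  have "K \<subseteq> \<rat>"
  proof -
    have "subfield \<rat> real_field" unfolding subfield_real_iff by auto
    thus ?thesis unfolding K_adjoin by (intro rat_adjoin_minimal) (simp_all add: t)
  qed
  moreover have "\<rat> \<subseteq> K" by (auto elim!: Rats_cases)
  ultimately show ?thesis by blast
qed

text \<open>The nonsquare condition says that the plane of \<open>u\<close> and \<open>w\<close>
  contains no isotropic vector over K. It is what the Pell equation needs in order to have a
  nontrivial solution, hence a boost of infinite order in this plane.\<close>

definition good_direction :: "'n lvec \<Rightarrow> 'n lvec \<Rightarrow> bool"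
  where "good_direction u w \<longleftrightarrow> vec_over K w \<and> bform A u w = 0 \<and> qform A w > 0 \<and>
     (\<forall>s\<in>K. s\<^sup>2 \<noteq> - qform A u * qform A w)"

text \<open>Gram-Schmidt, starting from \<open>u\<close> and continued with standard basis vectors
  outside the span reached so far; dimension n + 1 > 2 leaves room for two steps.\<close>

lemma orthogonal_directions:
  assumes n: "CARD('n) \<ge> 2" and u: "vec_over K u" "qform A u < 0"
  obtains w1 w2 where "vec_over K w1" "vec_over K w2" "bform A u w1 = 0" "bform A u w2 = 0"
    "bform A w1 w2 = 0" "w1 \<noteq> 0" "w2 \<noteq> 0"
proof -
  have u0: "qform A u \<noteq> 0" "bform A u u = qform A u" using u by (auto simp: qform_bform)
  have ex: "\<exists>i. axis i 1 \<notin> span S" if S: "finite S" "card S \<le> 2" for S :: "'n lvec set"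
  proof (rule ccontr)
    assume "\<not> (\<exists>i. axis i 1 \<notin> span S)"
    hence "Basis \<subseteq> span S" by (auto simp: Basis_vec_def)
    hence "span (Basis :: 'n lvec set) \<subseteq> span S" by (metis span_mono span_span)
    hence "span S = UNIV" by auto
    hence "dim S = DIM('n lvec)" by (metis dim_span dim_UNIV)
    moreover have "dim S \<le> card S" using S(1) by (rule dim_le_card')
    ultimately have "DIM('n lvec) \<le> card S" by simp
    thus False using n S(2) by simp
  qed
  have "card {u} \<le> 2" by simp
  then obtain i where i: "axis i 1 \<notin> span {u}" using ex[of "{u}"] by auto
  define w1 where "w1 = axis i 1 - (bform A u (axis i 1) / qform A u) *\<^sub>R u"
  have w1K: "vec_over K w1" unfolding w1_def
    by (intro vec_over_linear(2,3) vec_over_linear(4) u K.divide_mem) (simp_all add: qform_bform bform_mem u vec_over_linear(4))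
  have uw1: "bform A u w1 = 0" using u0 by (simp add: w1_def bform_linear)
  have w1: "w1 \<noteq> 0"
  proof
    assume "w1 = 0"
    hence "axis i 1 = (bform A u (axis i 1) / qform A u) *\<^sub>R u" by (simp add: w1_def)
    with i show False by (metis span_base span_scale insertI1)
  qed
  have w1pos: "qform A w1 > 0" using orthogonal_pos[OF u(2) _ w1] uw1 comm by metis
  have w10: "bform A w1 w1 = qform A w1" by (simp add: qform_bform)
  have "card {u, w1} \<le> 2" by (simp add: card_insert_if)
  then obtain j where j: "axis j 1 \<notin> span {u, w1}" using ex[of "{u, w1}"] by auto
  define w2 where "w2 = axis j 1 - (bform A u (axis j 1) / qform A u) *\<^sub>R u
     - (bform A w1 (axis j 1) / qform A w1) *\<^sub>R w1"
  have w2K: "vec_over K w2" unfolding w2_def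
    by (intro vec_over_linear(2,3) vec_over_linear(4) u w1K K.divide_mem)
       (simp_all add: qform_bform bform_mem u w1K vec_over_linear(4))
  have w1u: "bform A w1 u = 0" using uw1 comm by metis
  have uw2: "bform A u w2 = 0" using u0 uw1 by (simp add: w2_def bform_linear)
  have w12: "bform A w1 w2 = 0" using w1pos w10 w1u by (simp add: w2_def bform_linear)
  have w2: "w2 \<noteq> 0"
  proof
    assume "w2 = 0"
    hence "axis j 1 = (bform A u (axis j 1) / qform A u) *\<^sub>R u + (bform A w1 (axis j 1) / qform A w1) *\<^sub>R w1"
      by (simp add: w2_def algebra_simps)
    also have "\<dots> \<in> span {u, w1}" by (intro span_add span_scale span_base) auto
    finally show False using j by simp
  qed
  show ?thesis by (rule that[OF w1K w2K uw1 uw2 w12 w1 w2])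
qed

text \<open>Two directions that are not parallel are wanted, so that the planes they span with
  \<open>u\<close> meet in the line of \<open>u\<close>. If K is not \<rat>, all directions qualify:
  s^2 = - f(u) f(w) would make s u + f(u) w isotropic. Over \<rat> isotropic planes may occur. If -
  f(u) f(v1) is a square, v1 is replaced by v1 + s v2 and v1 - s v2, where s is chosen such that 1 +
  s^2 f(v2) / f(v1) is not a square.\<close>

lemma good_directions:
  assumes n: "CARD('n) \<ge> 2" and u: "vec_over K u" "qform A u < 0"
  obtains w1 w2 where "good_direction u w1" "good_direction u w2"
    "(bform A w1 w2)\<^sup>2 \<noteq> qform A w1 * qform A w2"
proof -
  note main = that
  obtain w1 w2 where w: "vec_over K w1" "vec_over K w2" "bform A u w1 = 0" "bform A u w2 = 0"
    "bform A w1 w2 = 0" "w1 \<noteq> 0" "w2 \<noteq> 0"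
    using orthogonal_directions[OF n u] by blast
  have pos: "qform A w1 > 0" "qform A w2 > 0"
    using orthogonal_pos[OF u(2)] w comm by metis+
  have mem: "qform A u \<in> K" "qform A w1 \<in> K" "qform A w2 \<in> K"
    using u w by (auto simp: qform_bform intro: bform_mem)
  show ?thesis
  proof (cases "\<exists>x\<in>conjs. x \<noteq> t")
    case True
    then obtain x where x: "x \<in> conjs" "x \<noteq> t" by blast
    have good: "good_direction u w" if w: "vec_over K w" "bform A u w = 0" "qform A w > 0" for w
      unfolding good_direction_def
    proof (intro conjI ballI w)
      fix s assume s: "s \<in> K"
      show "s\<^sup>2 \<noteq> - qform A u * qform A w"
      proof
        assume sq: "s\<^sup>2 = - qform A u * qform A w"
        define v where "v = s *\<^sub>R u + qform A u *\<^sub>R w"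
        have wu: "bform A w u = 0" using w comm by metis
        have "qform A v = s\<^sup>2 * qform A u + (qform A u)\<^sup>2 * qform A w"
          by (simp add: v_def qform_bform bform_linear w wu power2_eq_square algebra_simps)
        also have "\<dots> = 0" unfolding sq by (simp add: power2_eq_square)
        finally have "qform A v = 0" .
        moreover have "vec_over K v" unfolding v_def by (intro vec_over_linear s u w mem)
        moreover have "bform A v w = qform A u * qform A w"
          by (simp add: v_def bform_linear w qform_bform)
        hence "v \<noteq> 0" using u w by (auto simp: bform_linear)
        ultimately show False using anisotropic[OF x] by blast
      qed
    qed
    show ?thesis
      by (rule main[of w1 w2]) (use good w pos in auto)
  next
    case False
    hence KQ: "K = \<rat>" by (intro rational_case) auto
    define a b where "a = - qform A u * qform A w1" and "b = - qform A u * qform A w2"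
    have ab: "a > 0" "b > 0" "a \<in> K" "b \<in> K" using u pos mem by (auto simp: a_def b_def mult_neg_pos)
    have key: ?thesis
      if v: "vec_over K v1" "vec_over K v2" "bform A u v1 = 0" "bform A u v2 = 0" "bform A v1 v2 = 0"
        "qform A v1 > 0" "qform A v2 > 0" and sq: "s0 \<in> K" "s0\<^sup>2 = - qform A u * qform A v1" for v1 v2 s0
    proof -
      define c where "c = qform A v2 / qform A v1"
      have "c \<in> K" unfolding c_def using v by (auto simp: qform_bform intro!: K.divide_mem bform_mem)
      then obtain c' :: rat where c': "c = of_rat c'" unfolding KQ by (auto elim: Rats_cases)
      have "c > 0" using v by (simp add: c_def)
      hence "c' > 0" by (simp add: c')
      then obtain s' where s': "s' \<noteq> 0" "\<And>q. q\<^sup>2 \<noteq> 1 + c' * s'\<^sup>2" using rational_nonsquare by blast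
      define s :: real where "s = of_rat s'"
      have s: "s \<in> K" "s \<noteq> 0" using s' by (auto simp: s_def)
      have ns: "q\<^sup>2 \<noteq> 1 + c * s\<^sup>2" if qK: "q \<in> K" for q
      proof
        assume q: "q\<^sup>2 = 1 + c * s\<^sup>2"
        obtain q' where "q = of_rat q'" using qK unfolding KQ by (auto elim: Rats_cases)
        with q have "(of_rat (q'\<^sup>2) :: real) = of_rat (1 + c' * s'\<^sup>2)"
          by (simp add: of_rat_power of_rat_add of_rat_mult c' s_def)
        with s'(2) show False by (simp only: of_rat_eq_iff)
      qed
      have v21: "bform A v2 v1 = 0" using v comm by metis
      have good: "good_direction u (v1 + r *\<^sub>R v2)" "qform A (v1 + r *\<^sub>R v2) = qform A v1 + s\<^sup>2 * qform A v2"
        if r: "r \<in> K" "r\<^sup>2 = s\<^sup>2" for r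
      proof -
        have q: "qform A (v1 + r *\<^sub>R v2) = qform A v1 + r\<^sup>2 * qform A v2"
          by (simp add: qform_bform bform_linear v v21 power2_eq_square)
        thus "qform A (v1 + r *\<^sub>R v2) = qform A v1 + s\<^sup>2 * qform A v2" using r by simp
        have s0: "s0 \<noteq> 0" using sq(2) u v by auto
        have "y\<^sup>2 \<noteq> - qform A u * qform A (v1 + r *\<^sub>R v2)" if "y \<in> K" for y
        proof
          assume "y\<^sup>2 = - qform A u * qform A (v1 + r *\<^sub>R v2)"
          also have "\<dots> = - qform A u * qform A v1 * (1 + c * s\<^sup>2)"
            using v unfolding q r(2) by (simp add: c_def field_simps)
          also have "\<dots> = s0\<^sup>2 * (1 + c * s\<^sup>2)" unfolding sq(2) ..
          finally have "(y / s0)\<^sup>2 = 1 + c * s\<^sup>2" using s0 by (simp add: power_divide)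
          moreover have "y / s0 \<in> K" using that sq(1) by auto
          ultimately show False using ns by blast
        qed
        moreover have "qform A (v1 + r *\<^sub>R v2) > 0"
          unfolding q using v by (intro add_pos_nonneg) auto
        ultimately show "good_direction u (v1 + r *\<^sub>R v2)"
          unfolding good_direction_def using v r
          by (auto simp: bform_linear intro!: vec_over_linear)
      qed
      have "bform A (v1 + s *\<^sub>R v2) (v1 + (- s) *\<^sub>R v2) = qform A v1 - s\<^sup>2 * qform A v2"
        by (simp add: qform_bform bform_linear v v21 power2_eq_square)
      moreover have "(p - q)\<^sup>2 \<noteq> (p + q) * (p + q)" if "p * q \<noteq> 0" for p q :: real
        using that by (simp add: power2_eq_square algebra_simps)
      moreover have "qform A v1 * (s\<^sup>2 * qform A v2) \<noteq> 0" using v s by simp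
      ultimately show ?thesis
        using main[of "v1 + s *\<^sub>R v2" "v1 + (- s) *\<^sub>R v2"] good[of s] good[of "- s"] s
        by (simp add: K.uminus_mem)
    qed
    show ?thesis
    proof (cases "(\<forall>s\<in>K. s\<^sup>2 \<noteq> a) \<and> (\<forall>s\<in>K. s\<^sup>2 \<noteq> b)")
      case True
      thus ?thesis using main[of w1 w2] w pos by (auto simp: good_direction_def a_def b_def)
    next
      case False
      then consider s0 where "s0 \<in> K" "s0\<^sup>2 = a" | s0 where "s0 \<in> K" "s0\<^sup>2 = b" by blast
      thus ?thesis
      proof cases
        case 1
        thus ?thesis using key[of w1 w2 s0] w pos by (simp add: a_def)
      next
        case 2
        thus ?thesis using key[of w2 w1 s0] w pos comm[of w2 w1] by (simp add: b_def)
      qed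
    qed
  qed
qed

end

subsection \<open>The commensurator of the integral orthogonal group\<close>

lemma matrix_add_rdistrib: "(B + C) ** D = B ** D + C ** (D :: 'a::semiring_1 ^ 'l ^ 'm)"
  by (simp add: matrix_matrix_mult_def vec_eq_iff sum.distrib distrib_right)

context admissible_form
begin

text \<open>The order Z[t] stands in for the full ring of integers of K, because its elements have
  explicit integer coordinates.\<close>

definition Zt :: "real set"
  where "Zt = range (\<lambda>p :: int poly. ieval p t)"

lemma real_subring_Zt: "real_subring Zt"
  unfolding real_subring_def
proof (intro conjI ballI)
  show "1 \<in> Zt" unfolding Zt_def by (rule range_eqI[of _ _ 1]) simp
  fix x y assume "x \<in> Zt" "y \<in> Zt"
  then obtain p q where pq: "x = ieval p t" "y = ieval q t" by (auto simp: Zt_def)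
  show "x - y \<in> Zt" unfolding Zt_def pq by (rule range_eqI[of _ _ "p - q"]) simp
  show "x * y \<in> Zt" unfolding Zt_def pq by (rule range_eqI[of _ _ "p * q"]) simp
qed

lemma Zt_subset: "Zt \<subseteq> ring_of_integers K"
proof
  fix x assume "x \<in> Zt"
  then obtain p where p: "x = ieval p t" by (auto simp: Zt_def)
  have "x \<in> K" unfolding p ieval_qeval K_eq by blast
  thus "x \<in> ring_of_integers K" using algebraic_int_t by (auto simp: ring_of_integers_def p)
qed

lemma Zt_of_nat: "of_nat n \<in> Zt"
proof -
  have "ieval [:int n:] t = of_nat n" by simp
  thus ?thesis unfolding Zt_def by (metis rangeI)
qed

lemma common_denominator:
  assumes "finite S" "S \<subseteq> K"
  obtains N :: nat where "N > 0" "\<And>x. x \<in> S \<Longrightarrow> of_nat N * x \<in> Zt"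
proof -
  have one: "\<exists>N>0. of_nat N * qeval g t \<in> Zt" for g
  proof (induction g)
    case 0
    have "ieval 0 t \<in> Zt" unfolding Zt_def by blast
    thus ?case by (intro exI[of _ 1]) simp
  next
    case (pCons a g)
    then obtain N p where N: "N > 0" "of_nat N * qeval g t = ieval p t" by (auto simp: Zt_def)
    obtain m n where mn: "a = of_int m / of_int n" "n > 0"
      by (cases a) (auto simp: Fract_of_int_quotient)
    define N' where "N' = N * nat n"
    have "of_int n * of_rat a = (of_int m :: real)" using mn by (simp add: of_rat_divide)
    moreover have "(of_nat N' :: real) = of_nat N * of_int n" using mn(2) by (simp add: N'_def)
    hence "of_nat N' * qeval (pCons a g) t =
        of_nat N * (of_int n * of_rat a) + of_int n * (t * (of_nat N * qeval g t))"
      by (simp add: algebra_simps)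
    ultimately have "of_nat N' * qeval (pCons a g) t = ieval (pCons (int N * m) (smult n p)) t"
      by (simp add: N(2))
    moreover have "N' > 0" using N mn by (simp add: N'_def)
    ultimately show ?case unfolding Zt_def by blast
  qed
  have "\<exists>N>0. \<forall>x\<in>S. of_nat N * x \<in> Zt"
    using assms
  proof (induction S rule: finite_induct)
    case (insert x S)
    then obtain N1 where N1: "N1 > 0" "\<forall>y\<in>S. of_nat N1 * y \<in> Zt" by auto
    obtain g where "x = qeval g t" using insert.prems by (auto simp: K_eq)
    with one obtain N2 where N2: "N2 > 0" "of_nat N2 * x \<in> Zt" by blast
    have "of_nat (N1 * N2) * y \<in> Zt" if "y \<in> insert x S" for y
    proof (cases "y = x")
      case True
      have "of_nat N1 * (of_nat N2 * x) \<in> Zt" using N2 Zt_of_nat real_subringD(6)[OF real_subring_Zt] by blast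
      thus ?thesis using True by (simp add: mult.assoc)
    next
      case False
      hence "of_nat N2 * (of_nat N1 * y) \<in> Zt" using that N1 Zt_of_nat real_subringD(6)[OF real_subring_Zt] by blast
      thus ?thesis by (simp add: algebra_simps)
    qed
    moreover have "N1 * N2 > 0" using N1 N2 by simp
    ultimately show ?case by blast
  qed (auto intro: exI[of _ 1])
  then obtain N where "N > 0" "\<forall>x\<in>S. of_nat N * x \<in> Zt" by blast
  thus ?thesis by (intro that[of N]) simp_all
qed

text \<open>The element D = d (m N)^2 lies in Z[t], so its Pell solution gives u^2 - d v^2 = 1 with
  v divisible by N. Squaring u + v sqrt d yields x - 1 = 2 d v^2 and y = 2 u v, both divisible by N:
  a solution congruent to the trivial one.\<close>

lemma pell_multiple:
  assumes d: "d \<in> K" "d > 0" "\<And>s. s \<in> K \<Longrightarrow> s\<^sup>2 \<noteq> d" and N: "N > 0"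
  obtains x y where "x\<^sup>2 - d * y\<^sup>2 = 1" "x > 1" "y > 0" "x \<in> K" "y \<in> K"
    "\<exists>p\<in>Zt. x - 1 = of_nat N * p" "\<exists>q\<in>Zt. y = of_nat N * q"
proof -
  have "finite {d}" "{d} \<subseteq> K" using d(1) by simp_all
  then obtain m :: nat where m0: "m > 0" "\<And>x. x \<in> {d} \<Longrightarrow> of_nat m * x \<in> Zt"
    by (rule common_denominator) blast
  have m: "m > 0" "of_nat m * d \<in> Zt" using m0(1) m0(2)[of d] by simp_all
  then obtain D0 where D0: "of_nat m * d = ieval D0 t" by (auto simp: Zt_def)
  define D where "D = smult (int (m * N\<^sup>2)) D0"
  have D: "ieval D t = d * (of_nat (m * N))\<^sup>2"
    using D0 by (simp add: D_def power2_eq_square algebra_simps flip: D0)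
  have "ieval D t > 0" using D d(2) m N by simp
  moreover have "(qeval g t)\<^sup>2 \<noteq> ieval D t" for g
  proof
    assume "(qeval g t)\<^sup>2 = ieval D t"
    hence "(qeval g t / of_nat (m * N))\<^sup>2 = d" using m N by (simp add: D power_divide)
    moreover have "qeval g t / of_nat (m * N) \<in> K" by (intro K.divide_mem K.of_nat_mem) (simp add: K_eq)
    ultimately show False using d(3) by blast
  qed
  ultimately obtain U V where UV: "(ieval U t)\<^sup>2 - ieval D t * (ieval V t)\<^sup>2 = 1" "ieval V t \<noteq> 0"
    by (rule pell_equation)
  define u v where "u = \<bar>ieval U t\<bar>" and "v = \<bar>of_nat (m * N) * ieval V t\<bar>"
  have uv: "u\<^sup>2 - d * v\<^sup>2 = 1" using UV(1) by (simp add: u_def v_def D power_mult_distrib algebra_simps)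
  have v: "v > 0" using UV(2) m N by (simp add: v_def)
  have u: "u > 0"
  proof -
    have "u\<^sup>2 > 0" using uv d(2) v by (smt (verit) zero_less_power mult_pos_pos)
    thus ?thesis by (simp add: u_def)
  qed
  have absZ: "\<bar>z\<bar> \<in> Zt" if "z \<in> Zt" for z
    using that real_subringD(3)[OF real_subring_Zt] by (auto simp: abs_if)
  have uZ: "u \<in> Zt" unfolding u_def by (intro absZ) (auto simp: Zt_def)
  have VZ: "\<bar>ieval V t\<bar> \<in> Zt" by (intro absZ) (auto simp: Zt_def)
  have ZK: "Zt \<subseteq> K" using Zt_subset by (auto simp: ring_of_integers_def)
  have v': "v = of_nat N * (of_nat m * \<bar>ieval V t\<bar>)" by (simp add: v_def abs_mult)
  note R = real_subringD[OF real_subring_Zt]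
  have vZ: "of_nat m * \<bar>ieval V t\<bar> \<in> Zt" using VZ Zt_of_nat R(6) by blast
  define x y where "x = 2 * u\<^sup>2 - 1" and "y = 2 * u * v"
  have x1: "x - 1 = 2 * d * v\<^sup>2" using uv by (simp add: x_def)
  show ?thesis
  proof (rule that)
    have "x\<^sup>2 - d * y\<^sup>2 = (2 * u\<^sup>2 - 1)\<^sup>2 - 4 * u\<^sup>2 * (d * v\<^sup>2)"
      by (simp add: x_def y_def power_mult_distrib)
    also have "d * v\<^sup>2 = u\<^sup>2 - 1" using uv by simp
    finally show "x\<^sup>2 - d * y\<^sup>2 = 1" by (simp add: power2_eq_square algebra_simps)
    have "2 * d * v\<^sup>2 > 0" using d v by simp
    thus "x > 1" using x1 by linarith
    show "y > 0" using u v by (simp add: y_def)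
    have "x - 1 = of_nat N * (of_nat (2 * N) * (of_nat m * d) * (of_nat m * (\<bar>ieval V t\<bar> * \<bar>ieval V t\<bar>)))"
      unfolding x1 v' by (simp add: power2_eq_square algebra_simps)
    moreover have "of_nat (2 * N) * (of_nat m * d) * (of_nat m * (\<bar>ieval V t\<bar> * \<bar>ieval V t\<bar>)) \<in> Zt"
      by (rule R(6)[OF R(6)[OF Zt_of_nat m(2)] R(6)[OF Zt_of_nat R(6)[OF VZ VZ]]])
    ultimately show ex: "\<exists>p\<in>Zt. x - 1 = of_nat N * p" by blast
    have "of_nat 2 * u * (of_nat m * \<bar>ieval V t\<bar>) \<in> Zt" by (intro R(6) uZ vZ Zt_of_nat)
    moreover have "y = of_nat N * (of_nat 2 * u * (of_nat m * \<bar>ieval V t\<bar>))" by (simp add: y_def v')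
    ultimately show "\<exists>q\<in>Zt. y = of_nat N * q" by blast
    have uK: "u \<in> K" and vK: "v \<in> K" using uZ vZ ZK by (auto simp: v')
    show "x \<in> K" unfolding x_def using uK by (intro K.diff_mem K.mult_mem K.power_mem) auto
    show "y \<in> K" unfolding y_def using uK vK by (intro K.mult_mem) auto
  qed
qed

text \<open>Take \<open>N\<close> to be a common denominator of the matrices in the definition of
  \<open>boost\<close>; the congruences of \<open>pell_multiple\<close> then make the boost and its
  inverse integral. Components are kept because the product of z with its image is f(z) + (x - 1)
  f(z'), where z' is the projection of z to the plane: f(z') \<le> f(z) < 0, as the complement of
  the plane is positive.\<close>

lemma boost_in_O_prime:
  assumes u: "vec_over K u" "qform A u < 0" and w: "good_direction u w"
  obtains x y where "x\<^sup>2 + qform A u * qform A w * y\<^sup>2 = 1" "x > 1" "y > 0" "x \<in> K" "y \<in> K"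
    "boost A u w x y \<in> O_prime A (ring_of_integers K)"
proof -
  have w': "vec_over K w" "bform A u w = 0" "qform A w > 0" "\<And>s. s \<in> K \<Longrightarrow> s\<^sup>2 \<noteq> - qform A u * qform A w"
    using w by (auto simp: good_direction_def)
  interpret P: orthogonal_pair A u w using u w' A_sym by unfold_locales auto
  note RK = real_subring_field[OF subfield_K]
  define d where "d = - qform A u * qform A w"
  have "qform A u \<in> K" "qform A w \<in> K" unfolding qform_bform using u w' by (simp_all add: bform_mem)
  hence d: "d \<in> K" unfolding d_def by (intro K.mult_mem K.uminus_mem)
  have "d > 0" unfolding d_def using u w' by (simp add: mult_neg_pos)
  define Q where "Q = line_proj A u + line_proj A w"
  define Jm where "Jm = outer u (A *v w) - outer w (A *v u)"
  have QK: "matrix_over K Q" unfolding Q_def using u w' by (intro matrix_over_add[OF RK] matrix_over_line_proj)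
  have JK: "matrix_over K Jm" unfolding Jm_def using u w'
    by (intro matrix_over_diff[OF RK] matrix_over_outer vec_over_linear(5))
  define S where "S = range (\<lambda>(i, j). Q $ i $ j) \<union> range (\<lambda>(i, j). Jm $ i $ j)"
  have "finite S" by (simp add: S_def)
  moreover have "S \<subseteq> K" using QK JK by (auto simp: S_def matrix_over_def)
  ultimately obtain N :: nat where N: "N > 0" "\<And>x. x \<in> S \<Longrightarrow> of_nat N * x \<in> Zt"
    using common_denominator by blast
  obtain x y where xy: "x\<^sup>2 - d * y\<^sup>2 = 1" "x > 1" "y > 0" "x \<in> K" "y \<in> K"
    and int: "\<exists>p\<in>Zt. x - 1 = of_nat N * p" "\<exists>q\<in>Zt. y = of_nat N * q"
    by (rule pell_multiple[OF d \<open>d > 0\<close> _ N(1)]) (use w'(4) in \<open>auto simp: d_def\<close>)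
  obtain p q where pq: "p \<in> Zt" "x - 1 = of_nat N * p" "q \<in> Zt" "y = of_nat N * q" using int by blast
  note R = real_subringD[OF real_subring_Zt]
  have over: "matrix_over (ring_of_integers K) (boost A u w x (e * y))" if "e = 1 \<or> e = -1" for e
  proof (rule matrix_over_mono[OF Zt_subset])
    have "boost A u w x (e * y) $ i $ j \<in> Zt" for i j
    proof -
      have Qij: "of_nat N * Q $ i $ j \<in> Zt" and Jij: "of_nat N * Jm $ i $ j \<in> Zt"
        using N(2) by (force simp: S_def)+
      have "boost A u w x (e * y) $ i $ j = (if i = j then 1 else 0) + p * (of_nat N * Q $ i $ j) + e * (q * (of_nat N * Jm $ i $ j))"
        using pq by (simp add: boost_def mat_def Q_def[symmetric] Jm_def[symmetric])
      moreover have "p * (of_nat N * Q $ i $ j) \<in> Zt" "q * (of_nat N * Jm $ i $ j) \<in> Zt"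
        using pq Qij Jij R(6) by blast+
      moreover from this have "e * (q * (of_nat N * Jm $ i $ j)) \<in> Zt" using that R(3) by auto
      ultimately show ?thesis using R(1,2,5) by auto
    qed
    thus "matrix_over Zt (boost A u w x (e * y))" by (simp add: matrix_over_def)
  qed
  have unit: "x\<^sup>2 + qform A u * qform A w * y\<^sup>2 = 1" using xy(1) by (simp add: d_def)
  have "boost A u w x y \<in> GL (ring_of_integers K)"
    unfolding GL_def using over[of 1] over[of "-1"] P.boost_inverse[OF unit] by auto
  moreover have "transpose (boost A u w x y) ** A ** boost A u w x y = A"
    unfolding bform_preserved_iff using P.boost_preserves[OF unit] by blast
  moreover have "bform A z (boost A u w x y *v z) < 0" if z: "qform A z < 0" for z
  proof -
    define \<alpha> \<beta> where "\<alpha> = qform A u" and "\<beta> = qform A w"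
    define a b where "a = bform A z u / \<alpha>" and "b = bform A z w / \<beta>"
    have nz: "\<alpha> \<noteq> 0" "\<beta> \<noteq> 0" "\<alpha> < 0" using u w' by (auto simp: \<alpha>_def \<beta>_def)
    have zu: "bform A z u = \<alpha> * a" "bform A z w = \<beta> * b" using nz by (simp_all add: a_def b_def)
    have uz: "bform A u z = \<alpha> * a" "bform A w z = \<beta> * b" using zu comm by metis+
    have uu: "bform A u u = \<alpha>" "bform A w w = \<beta>" by (simp_all add: \<alpha>_def \<beta>_def qform_bform)
    define z0 where "z0 = z - a *\<^sub>R u - b *\<^sub>R w"
    have "bform A z0 u = 0" by (simp add: z0_def bform_linear zu uu P.wu)
    hence "qform A z0 \<ge> 0"
      using orthogonal_pos[OF u(2), of z0] by (cases "z0 = 0") (auto simp: qform_bform bform_linear)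
    moreover have "qform A z0 = qform A z - (\<alpha> * a\<^sup>2 + \<beta> * b\<^sup>2)"
      by (simp add: z0_def qform_bform bform_linear zu uz uu P.wu w' power2_eq_square algebra_simps)
    ultimately have le: "\<alpha> * a\<^sup>2 + \<beta> * b\<^sup>2 \<le> qform A z" by simp
    have T: "boost A u w x y *v z = z + ((x - 1) * a + y * (\<beta> * b)) *\<^sub>R u + ((x - 1) * b - y * (\<alpha> * a)) *\<^sub>R w"
      unfolding boost_vec zu using nz by (simp flip: \<alpha>_def \<beta>_def)
    have "bform A z (boost A u w x y *v z) = qform A z + (x - 1) * (\<alpha> * a\<^sup>2 + \<beta> * b\<^sup>2)"
      unfolding T by (simp add: bform_linear zu qform_bform power2_eq_square algebra_simps)
    moreover have "(x - 1) * (\<alpha> * a\<^sup>2 + \<beta> * b\<^sup>2) \<le> 0"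
      using xy(2) le z by (intro mult_nonneg_nonpos) auto
    ultimately show ?thesis using z by linarith
  qed
  ultimately have "boost A u w x y \<in> O_prime A (ring_of_integers K)"
    by (intro O_primeI[OF A_sym])
  with that[OF unit xy(2-5)] show ?thesis by blast
qed

text \<open>Powers must not become trivial: with e = f(u) f(w) < 0 and positive y, y', the new value
  x x' - e y y' exceeds x x', which exceeds 1.\<close>

lemma mpow_boost:
  assumes P: "orthogonal_pair A u w" and neg: "qform A u * qform A w < 0" and mem: "qform A u * qform A w \<in> K"
    and xy: "x\<^sup>2 + qform A u * qform A w * y\<^sup>2 = 1" "x > 1" "y > 0" "x \<in> K" "y \<in> K" and k: "k > 0"
  obtains x' y' where "mpow (boost A u w x y) k = boost A u w x' y'"
    "x'\<^sup>2 + qform A u * qform A w * y'\<^sup>2 = 1" "x' > 1" "x' \<in> K"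
proof -
  interpret orthogonal_pair A u w by (rule P)
  define e where "e = qform A u * qform A w"
  have "\<exists>x' y'. mpow (boost A u w x y) (Suc k) = boost A u w x' y' \<and>
     x'\<^sup>2 + e * y'\<^sup>2 = 1 \<and> x' > 1 \<and> y' > 0 \<and> x' \<in> K \<and> y' \<in> K" for k
  proof (induction k)
    case 0
    show ?case using xy by (intro exI[of _ x] exI[of _ y]) (simp add: e_def)
  next
    case (Suc k)
    then obtain x' y' where xy': "mpow (boost A u w x y) (Suc k) = boost A u w x' y'"
      "x'\<^sup>2 + e * y'\<^sup>2 = 1" "x' > 1" "y' > 0" "x' \<in> K" "y' \<in> K" by blast
    define x2 y2 where "x2 = x * x' - e * y * y'" and "y2 = x * y' + y * x'"
    have "mpow (boost A u w x y) (Suc (Suc k)) = boost A u w x y ** mpow (boost A u w x y) (Suc k)" by simp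
    also have "\<dots> = boost A u w x2 y2" unfolding xy'(1) boost_mult by (simp add: x2_def y2_def e_def)
    finally have 1: "mpow (boost A u w x y) (Suc (Suc k)) = boost A u w x2 y2" .
    have "x2\<^sup>2 + e * y2\<^sup>2 = (x\<^sup>2 + e * y\<^sup>2) * (x'\<^sup>2 + e * y'\<^sup>2)"
      by (simp add: x2_def y2_def power2_eq_square algebra_simps)
    hence 2: "x2\<^sup>2 + e * y2\<^sup>2 = 1" using xy xy' by (simp add: e_def)
    have "x * x' > 1" using xy xy' by (metis less_1_mult)
    moreover have "e * (y * y') < 0" using neg xy xy' by (intro mult_neg_pos) (simp_all add: e_def)
    ultimately have 3: "x2 > 1" by (simp add: x2_def mult.assoc)
    have 4: "y2 > 0" unfolding y2_def using xy xy' by (intro add_pos_pos mult_pos_pos) auto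
    have 5: "x2 \<in> K" "y2 \<in> K" unfolding x2_def y2_def e_def using xy xy' mem by auto
    from 1 2 3 4 5 show ?case by blast
  qed
  from this[of "k - 1"] k that show ?thesis by (auto simp: e_def)
qed

text \<open>The negative cone is open, hence contains rational points together with small
  displacements along all axes. The columns of a matrix are then difference quotients of its values
  at timelike vectors over K.\<close>

lemma timelike_neighbourhood:
  obtains u0 :: "'n lvec" and \<epsilon> where "\<epsilon> > 0" "\<epsilon> \<in> K" "vec_over K u0" "qform A u0 < 0"
    "\<And>j. qform A (u0 + \<epsilon> *\<^sub>R axis j 1) < 0"
proof -
  define U where "U = {x. qform A x < 0}"
  have "continuous_on UNIV (qform A)"
    unfolding qform_def by (intro continuous_intros linear_continuous_on matrix_vector_mul_bounded_linear)
  hence "open U" unfolding U_def by (intro open_Collect_less) (auto intro: continuous_intros)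
  define v where "v = M *v axis None 1"
  have "lorentz_form (axis None 1 :: 'n lvec) = -1" by (simp add: lorentz_form_def axis_def)
  hence "v \<in> U" by (simp add: U_def v_def M_form)
  then obtain e where e: "e > 0" "ball v e \<subseteq> U" using \<open>open U\<close> by (auto simp: open_contains_ball)
  define c where "c = real CARD('n option)"
  have c: "c > 0" by (simp add: c_def)
  have "\<exists>q :: rat. \<bar>of_rat q - v $ i\<bar> < e / c" for i
  proof -
    have "v $ i < v $ i + e / c" using e c by simp
    then obtain q where "v $ i < of_rat q" "of_rat q < v $ i + e / c" using of_rat_dense by blast
    thus ?thesis by (intro exI[of _ q]) auto
  qed
  then obtain q :: "'n option \<Rightarrow> rat" where q: "\<And>i. \<bar>of_rat (q i) - v $ i\<bar> < e / c" by metis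
  define u0 :: "'n lvec" where "u0 = (\<chi> i. of_rat (q i))"
  have "norm (u0 - v) \<le> (\<Sum>i\<in>UNIV. \<bar>(u0 - v) $ i\<bar>)" by (rule norm_le_l1_cart)
  also have "\<dots> < (\<Sum>i\<in>(UNIV :: 'n option set). e / c)"
    using q by (intro sum_strict_mono) (auto simp: u0_def)
  also have "\<dots> = e" using c by (simp add: c_def)
  finally have "u0 \<in> U" using e by (auto simp: dist_norm norm_minus_commute)
  then obtain r where r: "r > 0" "ball u0 r \<subseteq> U" using \<open>open U\<close> by (auto simp: open_contains_ball)
  obtain n where n: "inverse (of_nat (Suc n)) < r" using reals_Archimedean[OF r(1)] by blast
  define \<epsilon> :: real where "\<epsilon> = inverse (of_nat (Suc n))"
  show ?thesis
  proof (rule that)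
    show "\<epsilon> > 0" by (simp add: \<epsilon>_def)
    show "\<epsilon> \<in> K" unfolding \<epsilon>_def by (intro K.inverse_mem K.of_nat_mem)
    show "vec_over K u0" by (simp add: vec_over_def u0_def)
    show "qform A u0 < 0" using \<open>u0 \<in> U\<close> by (simp add: U_def)
    fix j
    have "dist u0 (u0 + \<epsilon> *\<^sub>R axis j 1) = \<epsilon>" by (simp add: dist_norm \<epsilon>_def)
    hence "u0 + \<epsilon> *\<^sub>R axis j 1 \<in> U" using n r(2) by (auto simp: \<epsilon>_def)
    thus "qform A (u0 + \<epsilon> *\<^sub>R axis j 1) < 0" by (simp add: U_def)
  qed
qed

text \<open>Conjugation by \<open>g\<close> keeps the boosts along rational planes rational up to a power. This makes the
  projections to these planes, then those to timelike lines, and finally all the matrices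
  \<open>(g x) (g y)\<^sup>t\<close> rational.\<close>

lemma entry_products_mem:
  fixes G :: "'n lmat set"
  assumes n: "CARD('n) \<ge> 2"
    and G: "\<And>x y. x \<in> G \<Longrightarrow> y \<in> G \<Longrightarrow> x ** y \<in> G" "\<And>x. x \<in> G \<Longrightarrow> invertible x" "\<And>x. x \<in> G \<Longrightarrow> matrix_inv x \<in> G"
    and pres: "\<And>g x y. g \<in> G \<Longrightarrow> bform A (g *v x) (g *v y) = bform A x y"
    and pow1: "\<And>S. S \<in> O_prime A (ring_of_integers K) \<Longrightarrow> \<exists>k>0. mpow S k \<in> G"
    and pow2: "\<And>S. S \<in> G \<Longrightarrow> \<exists>k>0. mpow S k \<in> O_prime A (ring_of_integers K)"
    and g: "g \<in> G"
  shows "g $ i $ j * g $ k $ l \<in> K"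
proof -
  note RK = real_subring_field[OF subfield_K]
  define g' where "g' = matrix_inv g"
  have gg: "g ** g' = mat 1" "g' ** g = mat 1" using matrix_inv_props[OF G(2)[OF g]] by (simp_all add: g'_def)
  have g'G: "g' \<in> G" using G(3)[OF g] by (simp add: g'_def)
  \<comment> \<open>Conjugation by \<open>g\<close> respects sums and products, so \<A> is closed
    under them and under multiplication by elements of K. The projections are obtained by computing
    inside \<A>.\<close>
  define \<A> where "\<A> = {Z. matrix_over K (g ** Z ** g')}"
  have alg: "Z + W \<in> \<A>" "Z - W \<in> \<A>" "Z ** W \<in> \<A>" if "Z \<in> \<A>" "W \<in> \<A>" for Z W
  proof -
    have "g ** (Z + W) ** g' = g ** Z ** g' + g ** W ** g'"
      by (simp add: matrix_add_ldistrib matrix_add_rdistrib)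
    thus "Z + W \<in> \<A>" using that matrix_over_add[OF RK] by (simp add: \<A>_def)
    have "g ** (Z - W) ** g' = g ** Z ** g' - g ** W ** g'"
      by (simp add: matrix_matrix_mult_def vec_eq_iff sum_subtractf algebra_simps)
    thus "Z - W \<in> \<A>" using that matrix_over_diff[OF RK] by (simp add: \<A>_def)
    have "g ** (Z ** W) ** g' = (g ** Z ** (g' ** g) ** W ** g')" by (simp add: gg matrix_mul_assoc)
    also have "\<dots> = (g ** Z ** g') ** (g ** W ** g')" by (simp add: matrix_mul_assoc)
    finally show "Z ** W \<in> \<A>" using that matrix_over_mult[OF RK] by (simp add: \<A>_def)
  qed
  have algs: "c *\<^sub>R Z \<in> \<A>" if "c \<in> K" "Z \<in> \<A>" for c Z
    using that matrix_over_scale[OF RK] by (simp add: \<A>_def matrix_scaleR_mult)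
  have plane: "line_proj A u + line_proj A w \<in> \<A>"
    if u: "vec_over K u" "qform A u < 0" and w: "good_direction u w" for u w
  proof -
    have w': "vec_over K w" "bform A u w = 0" "qform A w > 0" using w by (auto simp: good_direction_def)
    have P: "orthogonal_pair A u w" using u w' A_sym by unfold_locales auto
    interpret orthogonal_pair A u w by (rule P)
    have neg: "qform A u * qform A w < 0" "qform A u * qform A w \<in> K"
      using u w' by (auto simp: mult_neg_pos qform_bform intro!: K.mult_mem bform_mem)
    obtain x y where xy: "x\<^sup>2 + qform A u * qform A w * y\<^sup>2 = 1" "x > 1" "y > 0" "x \<in> K" "y \<in> K"
      and B: "boost A u w x y \<in> O_prime A (ring_of_integers K)"
      using boost_in_O_prime[OF u w] by metis
    obtain k1 where k1: "k1 > 0" "mpow (boost A u w x y) k1 \<in> G" using pow1[OF B] by blast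
    have "g ** mpow (boost A u w x y) k1 ** g' \<in> G" using G(1) g g'G k1 by blast
    then obtain k2 where k2: "k2 > 0"
      "mpow (g ** mpow (boost A u w x y) k1 ** g') k2 \<in> O_prime A (ring_of_integers K)"
      using pow2 by blast
    obtain x' y' where b: "mpow (boost A u w x y) (k1 * k2) = boost A u w x' y'"
      "x'\<^sup>2 + qform A u * qform A w * y'\<^sup>2 = 1" "x' > 1" "x' \<in> K"
      using mpow_boost[OF P neg xy, of "k1 * k2"] k1 k2 by (metis nat_0_less_mult_iff)
    define B1 B2 where "B1 = g ** boost A u w x' y' ** g'" and "B2 = g ** boost A u w x' (- y') ** g'"
    have "mpow (g ** mpow (boost A u w x y) k1 ** g') k2 = B1"
      unfolding mpow_conj[OF gg(2,1)] mpow_mult[symmetric] b(1) B1_def ..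
    hence B1: "B1 \<in> O_prime A (ring_of_integers K)" using k2 by simp
    have "B1 ** B2 = g ** boost A u w x' y' ** (g' ** g) ** boost A u w x' (- y') ** g'"
      by (simp add: B1_def B2_def matrix_mul_assoc)
    also have "\<dots> = g ** (boost A u w x' y' ** boost A u w x' (- y')) ** g'"
      by (simp add: gg matrix_mul_assoc)
    also have "\<dots> = mat 1" using boost_inverse[OF b(2)] gg by simp
    finally have "matrix_inv B1 = B2" by (rule matrix_inv_unique)
    hence B2: "B2 \<in> O_prime A (ring_of_integers K)" using O_prime_inv[OF B1] by simp
    have over: "matrix_over K S" if "S \<in> O_prime A (ring_of_integers K)" for S
    proof (rule matrix_over_mono)
      show "ring_of_integers K \<subseteq> K" by (auto simp: ring_of_integers_def)
      show "matrix_over (ring_of_integers K) S" using that by (simp add: O_prime_def GL_def)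
    qed
    have 1: "boost A u w x' y' \<in> \<A>" "boost A u w x' (- y') \<in> \<A>"
      using over[OF B1] over[OF B2] by (simp_all add: \<A>_def B1_def B2_def)
    have 2: "mat 1 \<in> \<A>" using matrix_over_mat_1[OF RK] gg by (simp add: \<A>_def)
    \<comment> \<open>Adding the inverse boost cancels the skew part and isolates the projection to
      the plane.\<close>
    have "boost A u w x' y' + boost A u w x' (- y') - mat 1 - mat 1 = (2 * (x' - 1)) *\<^sub>R (line_proj A u + line_proj A w)"
      by (simp add: vec_eq_iff boost_def algebra_simps)
    moreover have "boost A u w x' y' + boost A u w x' (- y') - mat 1 - mat 1 \<in> \<A>"
      by (intro alg 1 2)
    ultimately have "(2 * (x' - 1)) *\<^sub>R (line_proj A u + line_proj A w) \<in> \<A>" by (simp only:)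
    moreover have "inverse (2 * (x' - 1)) \<in> K"
      using b(4) by (intro K.inverse_mem K.mult_mem K.diff_mem) auto
    ultimately have "inverse (2 * (x' - 1)) *\<^sub>R ((2 * (x' - 1)) *\<^sub>R (line_proj A u + line_proj A w)) \<in> \<A>"
      by (rule algs[rotated])
    thus ?thesis using b(3) by simp
  qed
  have lp: "line_proj A x ** line_proj A y = (bform A x y / (qform A x * qform A y)) *\<^sub>R outer x (A *v y)" for x y
    using comm[of x y] by (simp add: line_proj_def matrix_scaleR_mult outer_mult bform_def inner_commute)
  have line: "line_proj A u \<in> \<A>" if u: "vec_over K u" "qform A u < 0" for u
  proof -
    obtain w1 w2 where w: "good_direction u w1" "good_direction u w2"
      "(bform A w1 w2)\<^sup>2 \<noteq> qform A w1 * qform A w2"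
      using good_directions[OF n u] by blast
    have w': "bform A u w1 = 0" "bform A u w2 = 0" "qform A w1 > 0" "qform A w2 > 0"
      "bform A w1 u = 0" "bform A w2 u = 0" "vec_over K w1" "vec_over K w2"
      using w comm by (auto simp: good_direction_def)
    define c where "c = (bform A w1 w2)\<^sup>2 / (qform A w1 * qform A w2)"
    have c: "c \<noteq> 1" using w(3) w' by (simp add: c_def)
    have cK: "c \<in> K" unfolding c_def using w'
      by (intro K.divide_mem K.power_mem K.mult_mem) (auto simp: qform_bform bform_mem)
    define P1 P2 where "P1 = line_proj A u + line_proj A w1" and "P2 = line_proj A u + line_proj A w2"
    have uu: "line_proj A u ** line_proj A u = line_proj A u"
      unfolding lp using u by (simp add: line_proj_def qform_bform)
    have z: "line_proj A u ** line_proj A w1 = 0" "line_proj A u ** line_proj A w2 = 0"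
      "line_proj A w1 ** line_proj A u = 0" "line_proj A w2 ** line_proj A u = 0"
      unfolding lp using w' by simp_all
    have "outer w1 (A *v w2) ** line_proj A w1 = bform A w1 w2 *\<^sub>R line_proj A w1"
      by (simp add: line_proj_def matrix_scaleR_mult outer_mult bform_def inner_commute)
    hence www: "line_proj A w1 ** line_proj A w2 ** line_proj A w1 = c *\<^sub>R line_proj A w1"
      unfolding lp by (simp add: matrix_scaleR_mult c_def power2_eq_square)
    \<comment> \<open>This product of plane projections is the identity on \<open>u\<close> and
      multiplication by c on \<open>w1\<close>. Subtracting c P1 therefore isolates the line of
      \<open>u\<close>; here c differs from 1 because \<open>w1\<close> and \<open>w2\<close> are
      not parallel.\<close>
    have "P1 ** P2 ** P1 = line_proj A u + c *\<^sub>R line_proj A w1"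
      unfolding P1_def P2_def matrix_add_ldistrib matrix_add_rdistrib
      by (simp add: uu z www matrix_mul_assoc[symmetric]) (simp add: uu z www matrix_mul_assoc)
    hence "P1 ** P2 ** P1 - c *\<^sub>R P1 = (1 - c) *\<^sub>R line_proj A u"
      by (simp add: P1_def algebra_simps)
    moreover have "P1 \<in> \<A>" "P2 \<in> \<A>" unfolding P1_def P2_def using plane u w by blast+
    ultimately have "inverse (1 - c) *\<^sub>R ((1 - c) *\<^sub>R line_proj A u) \<in> \<A>"
      using cK alg algs by (metis K.diff_mem K.inverse_mem K.one_mem)
    thus ?thesis using c by simp
  qed
  \<comment> \<open>As \<open>g\<close> preserves the form, conjugation turns the rank one matrix x
    (A y)^t into (g x) (A g y)^t.\<close>
  have tg: "transpose g' *v (A *v x) = A *v (g *v x)" for x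
  proof -
    have "y \<bullet> (transpose g' *v (A *v x)) = y \<bullet> (A *v (g *v x))" for y
    proof -
      have "y \<bullet> (transpose g' *v (A *v x)) = bform A (g' *v y) x"
        by (simp add: bform_def inner_commute[of y] dot_lmul_matrix) (simp add: inner_commute)
      also have "\<dots> = bform A (g *v (g' *v y)) (g *v x)" using pres[OF g] by simp
      also have "g *v (g' *v y) = y" by (simp add: matrix_vector_mul_assoc gg)
      finally show ?thesis by (simp add: bform_def)
    qed
    thus ?thesis by (metis vector_eq_ldot)
  qed
  have S: "matrix_over K (outer (g *v u) (A *v (g *v u)))" if u: "vec_over K u" "qform A u < 0" for u
  proof -
    have "qform A u *\<^sub>R line_proj A u = outer u (A *v u)" using u by (simp add: line_proj_def)
    hence "outer u (A *v u) \<in> \<A>" using algs[OF _ line[OF u]] u by (metis bform_mem qform_bform)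
    thus ?thesis unfolding \<A>_def by (simp add: mult_outer outer_mult_right tg del: transpose_matrix_vector)
  qed
  \<comment> \<open>The product of the rank one matrices of u and v is the mixed matrix times
    \<open>bform A v u\<close>. This factor is nonzero because two timelike vectors are never
    orthogonal.\<close>
  have S2: "matrix_over K (outer (g *v u) (A *v (g *v v)))"
    if u: "vec_over K u" "qform A u < 0" and v: "vec_over K v" "qform A v < 0" for u v
  proof -
    have b: "bform A v u = (A *v (g *v u)) \<bullet> (g *v v)"
      using pres[OF g, of v u] by (simp add: bform_def inner_commute)
    have "bform A v u \<noteq> 0"
    proof
      assume "bform A v u = 0"
      moreover have "v \<noteq> 0" using v by (auto simp: qform_bform bform_linear)
      ultimately show False using orthogonal_pos[OF u(2), of v] v by simp
    qed
    moreover have "outer (g *v u) (A *v (g *v u)) ** outer (g *v v) (A *v (g *v v)) =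
        bform A v u *\<^sub>R outer (g *v u) (A *v (g *v v))"
      unfolding outer_mult b ..
    moreover have "matrix_over K (outer (g *v u) (A *v (g *v u)) ** outer (g *v v) (A *v (g *v v)))"
      by (intro matrix_over_mult[OF RK] S u v)
    ultimately have "matrix_over K (bform A v u *\<^sub>R outer (g *v u) (A *v (g *v v)))" by simp
    from matrix_over_scale[OF RK K.inverse_mem[OF bform_mem[OF v(1) u(1)]] this]
    have "matrix_over K (inverse (bform A v u) *\<^sub>R (bform A v u *\<^sub>R outer (g *v u) (A *v (g *v v))))" .
    thus ?thesis using \<open>bform A v u \<noteq> 0\<close> by simp
  qed
  have S3: "(g *v u) $ i * (g *v v) $ k \<in> K"
    if u: "vec_over K u" "qform A u < 0" and v: "vec_over K v" "qform A v < 0" for u v i k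
  proof -
    have tA: "transpose (matrix_inv A) ** A = mat 1"
    proof -
      have "transpose (matrix_inv A) ** transpose A = transpose (A ** matrix_inv A)"
        by (simp add: matrix_transpose_mul)
      thus ?thesis using matrix_inv_props[OF A_invertible] A_sym by (simp add: transpose_mat)
    qed
    have "transpose (matrix_inv A) *v (A *v y) = y" for y
      by (simp only: matrix_vector_mul_assoc tA matrix_vector_mul_lid)
    hence "outer (g *v u) (A *v (g *v v)) ** matrix_inv A = outer (g *v u) (g *v v)"
      unfolding outer_mult_right by simp
    moreover have "matrix_over K (outer (g *v u) (A *v (g *v v)) ** matrix_inv A)"
      by (intro matrix_over_mult[OF RK] S2 u v matrix_over_inv[OF subfield_K A_over A_invertible])
    ultimately show ?thesis by (simp add: matrix_over_def outer_def)
  qed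
  obtain u0 :: "'n lvec" and \<epsilon> where u0: "\<epsilon> > 0" "\<epsilon> \<in> K" "vec_over K u0" "qform A u0 < 0"
    "\<And>j. qform A (u0 + \<epsilon> *\<^sub>R axis j 1) < 0" by (rule timelike_neighbourhood) blast
  define v where "v = (\<lambda>j. u0 + \<epsilon> *\<^sub>R axis j 1)"
  have v: "vec_over K (v j)" "qform A (v j) < 0" for j
    using u0 by (auto simp: v_def intro!: vec_over_linear)
  have gv: "g $ i $ j = ((g *v v j) $ i - (g *v u0) $ i) / \<epsilon>" for i j
  proof -
    have "g *v axis j 1 = (\<chi> i. g $ i $ j)"
      by (simp add: matrix_vector_mult_def vec_eq_iff axis_def if_distrib cong: if_cong)
    thus ?thesis using u0(1) by (simp add: v_def matrix_vector_right_distrib matrix_vector_mult_scaleR)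
  qed
  have "g $ i $ j * g $ k $ l = ((g *v v j) $ i * (g *v v l) $ k - (g *v v j) $ i * (g *v u0) $ k
      - (g *v u0) $ i * (g *v v l) $ k + (g *v u0) $ i * (g *v u0) $ k) / (\<epsilon> * \<epsilon>)"
    unfolding gv using u0(1) by (simp add: field_simps)
  also have "\<dots> \<in> K"
    using u0 v by (intro K.divide_mem K.add_mem K.diff_mem K.mult_mem[of \<epsilon> \<epsilon>] S3)
  finally show ?thesis .
qed

text \<open>The determinant is a sum of products of n + 1 entries, an odd number. With one more
  entry they split into pairs, so det g times any entry lies in K; and det g is 1 or -1 because
  \<open>g\<close> preserves a nondegenerate form.\<close>

lemma det_entry_products_mem:
  fixes g :: "'n lmat"
  assumes prod: "\<And>i j k l. g $ i $ j * g $ k $ l \<in> K" and even: "even CARD('n)"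
    and pres: "\<And>x y. bform A (g *v x) (g *v y) = bform A x y"
  shows "matrix_over K g"
proof -
  have pairs: "(even (card S) \<longrightarrow> (\<Prod>i\<in>S. g $ i $ p i) \<in> K) \<and>
      (odd (card S) \<longrightarrow> (\<forall>k l. (\<Prod>i\<in>S. g $ i $ p i) * g $ k $ l \<in> K))" if "finite S" for S p
    using that
  proof (induction S rule: finite_induct)
    case (insert a S)
    show ?case
    proof (cases "even (card S)")
      case True
      have "(\<Prod>i\<in>S. g $ i $ p i) * (g $ a $ p a * g $ k $ l) \<in> K" for k l
        using insert.IH True by (intro K.mult_mem prod) auto
      thus ?thesis using insert True by (simp add: algebra_simps)
    next
      case False
      thus ?thesis using insert by (simp add: mult.commute)
    qed
  qed auto
  have "odd (card (UNIV :: 'n option set))" using even by simp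
  hence "(\<Prod>i\<in>UNIV. g $ i $ p i) * g $ k $ l \<in> K" for p k l using pairs[of UNIV p] by auto
  hence "(\<Sum>p | p permutes UNIV. of_int (sign p) * ((\<Prod>i\<in>UNIV. g $ i $ p i) * g $ k $ l)) \<in> K" for k l
    by (intro K.sum_mem K.mult_mem[OF K.of_int_mem])
  hence detg: "det g * g $ k $ l \<in> K" for k l
    by (simp add: det_def sum_distrib_right mult.assoc)
  have "transpose g ** A ** g = A" unfolding bform_preserved_iff using pres by blast
  hence "det (transpose g ** A ** g) = det A" by simp
  hence "det g * det A * det g = det A" by (simp add: det_mul)
  moreover have "det A \<noteq> 0" using A_invertible invertible_det_nz by blast
  ultimately have "det g * det g = 1" by (simp add: mult.commute mult.left_commute)
  hence "det g = 1 \<or> det g = -1" by (metis power2_eq_1_iff power2_eq_square)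
  thus ?thesis unfolding matrix_over_def using detg K.uminus_mem by (metis minus_mult_left minus_minus mult_1)
qed

end

subsection \<open>Translation lengths in arithmetic lattices\<close>

lemma poly_det: "poly (det P) y = det (\<chi> i j. poly (P $ i $ j) (y :: 'a::comm_ring_1))"
  unfolding det_def by (simp add: poly_sum poly_prod)

lemma qeval_det: "qeval (det P) (y :: 'a::field_char_0) = det (\<chi> i j. qeval (P $ i $ j) y)"
  unfolding det_def by simp

lemma det_eq_0_iff_kernel:
  fixes P :: "'a::field ^ ('m::finite) ^ 'm"
  shows "det P = 0 \<longleftrightarrow> (\<exists>v. v \<noteq> 0 \<and> P *v v = 0)"
proof -
  have "det P \<noteq> 0 \<longleftrightarrow> (\<exists>B. B ** P = mat 1)"
    using invertible_det_nz invertible_left_inverse by blast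
  also have "\<dots> \<longleftrightarrow> (\<forall>v. P *v v = 0 \<longrightarrow> v = 0)" by (rule matrix_left_invertible_ker)
  finally show ?thesis by blast
qed

lemma (in real_subfield) coeffs_in_det:
  fixes P :: "real poly ^ ('m::finite) ^ 'm"
  assumes "\<And>i j. coeffs_in F (P $ i $ j)"
  shows "coeffs_in F (det P)"
  unfolding det_def
proof (intro coeffs_in_sum coeffs_in_mult coeffs_in_prod assms)
  fix p :: "'m \<Rightarrow> 'm"
  have "(of_int (sign p) :: real poly) = [:of_int (sign p):]" by (simp add: of_int_poly)
  thus "coeffs_in F (of_int (sign p))" by simp
qed

lemma degree_det_le:
  fixes P :: "real poly ^ ('m::finite) ^ 'm"
  assumes "\<And>i j. degree (P $ i $ j) \<le> 1"
  shows "degree (det P) \<le> CARD('m)"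
  unfolding det_def
proof (rule degree_sum_le)
  fix p :: "'m \<Rightarrow> 'm"
  have "degree (\<Prod>i\<in>UNIV. P $ i $ p i) \<le> (\<Sum>i\<in>UNIV. degree (P $ i $ p i))"
    by (rule order.trans[OF degree_prod_sum_le]) (auto simp: o_def)
  also have "\<dots> \<le> (\<Sum>i\<in>(UNIV :: 'm set). 1)" using assms by (intro sum_mono) auto
  finally have "degree (\<Prod>i\<in>UNIV. P $ i $ p i) \<le> CARD('m)" by simp
  thus "degree (of_int (sign p) * (\<Prod>i\<in>UNIV. P $ i $ p i)) \<le> CARD('m)"
    using degree_mult_le[of "of_int (sign p)" "\<Prod>i\<in>UNIV. P $ i $ p i"] by simp
qed (auto simp: finite_permutations)

text \<open>Splitting an eigenvector into real and imaginary parts allows complex eigenvalues to be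
  studied with the real form \<open>bform\<close>, without a Hermitian extension.\<close>

lemma complex_eigenvector_parts:
  fixes G :: "real ^ ('m::finite) ^ 'm"
  assumes "det ((\<chi> i j. (if i = j then z else 0) - of_real (G $ i $ j)) :: complex ^ 'm ^ 'm) = 0"
  obtains x y where "x \<noteq> 0 \<or> y \<noteq> 0" "G *v x = Re z *\<^sub>R x - Im z *\<^sub>R y" "G *v y = Im z *\<^sub>R x + Re z *\<^sub>R y"
proof -
  obtain v :: "complex ^ 'm" where v: "v \<noteq> 0" "(\<chi> i j. (if i = j then z else 0) - of_real (G $ i $ j)) *v v = 0"
    using assms unfolding det_eq_0_iff_kernel by blast
  have ev: "(\<Sum>j\<in>UNIV. of_real (G $ i $ j) * v $ j) = z * v $ i" for i
  proof -
    have "(\<Sum>j\<in>UNIV. ((if i = j then z else 0) - of_real (G $ i $ j)) * v $ j) = 0"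
      using arg_cong[OF v(2), of "\<lambda>w. w $ i"] by (simp add: matrix_vector_mult_def)
    hence "(\<Sum>j\<in>UNIV. (if i = j then z * v $ j else 0)) = (\<Sum>j\<in>UNIV. of_real (G $ i $ j) * v $ j)"
      by (simp add: left_diff_distrib sum_subtractf if_distrib[of "\<lambda>c. c * _"] cong: if_cong)
    thus ?thesis by simp
  qed
  define x y where "x = (\<chi> i. Re (v $ i))" and "y = (\<chi> i. Im (v $ i))"
  show ?thesis
  proof (rule that)
    show "x \<noteq> 0 \<or> y \<noteq> 0" using v(1) by (auto simp: x_def y_def vec_eq_iff complex_eq_iff)
    show "G *v x = Re z *\<^sub>R x - Im z *\<^sub>R y"
    proof (rule vec_eq_iff[THEN iffD2], rule allI)
      fix i show "(G *v x) $ i = (Re z *\<^sub>R x - Im z *\<^sub>R y) $ i"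
        using arg_cong[OF ev[of i], of Re] by (simp add: x_def y_def matrix_vector_mult_def)
    qed
    show "G *v y = Im z *\<^sub>R x + Re z *\<^sub>R y"
    proof (rule vec_eq_iff[THEN iffD2], rule allI)
      fix i show "(G *v y) $ i = (Im z *\<^sub>R x + Re z *\<^sub>R y) $ i"
        using arg_cong[OF ev[of i], of Im] by (simp add: x_def y_def matrix_vector_mult_def add.commute)
    qed
  qed
qed

text \<open>The number f(x) + f(y) is the value of the Hermitian extension of the form at x + i y,
  which an eigenvalue z = c + i d of an isometry multiplies by |z|^2.\<close>

lemma invariant_plane_modulus:
  assumes sym: "transpose A = A" and pres: "\<And>x y. bform A (G *v x) (G *v y) = bform A x y"
    and G: "G *v x = c *\<^sub>R x - d *\<^sub>R y" "G *v y = d *\<^sub>R x + c *\<^sub>R y" and pos: "qform A x + qform A y > 0"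
  shows "c\<^sup>2 + d\<^sup>2 = 1"
proof -
  have "qform A x + qform A y = qform A (G *v x) + qform A (G *v y)" by (simp add: qform_bform pres)
  also have "\<dots> = (c\<^sup>2 + d\<^sup>2) * (qform A x + qform A y)"
    unfolding G qform_bform using bform_commute[OF sym, of y x]
    by (simp add: bform_linear power2_eq_square algebra_simps)
  finally show ?thesis using pos by simp
qed

lemma qeval_reflect_poly:
  assumes "x \<noteq> 0"
  shows "qeval (reflect_poly p) x = x ^ degree p * qeval p (inverse (x :: 'a::field_char_0))"
proof -
  have "map_poly of_rat (reflect_poly p) = (reflect_poly (map_poly of_rat p) :: 'a poly)"
    by (rule poly_eqI) (simp add: coeff_reflect_poly)
  thus ?thesis using poly_reflect_poly_nz[OF assms, of "map_poly of_rat p"] by (simp add: qeval_def)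
qed

text \<open>A hyperbolic element of the lattice that is already known to be a matrix over K. As the
  lattice is only commensurable with the integral group, integrality is available for a power of
  it.\<close>

locale loxodromic = admissible_form h t K A M
  for h t K and A M :: "('n::finite) lmat" +
  fixes G :: "'n lmat" and l :: real and a b :: "'n lvec" and k :: nat
  assumes G_over: "matrix_over K G" and pres: "\<And>x y. bform A (G *v x) (G *v y) = bform A x y"
    and eigen: "G *v a = l *\<^sub>R a" "G *v b = inverse l *\<^sub>R b"
    and null: "qform A a = 0" "qform A b = 0" "bform A a b \<noteq> 0" and l: "l > 1"
    and k: "k > 0" and power: "mpow G k \<in> O_prime A (ring_of_integers K)"
begin

lemma ab_nz: "a \<noteq> 0" "b \<noteq> 0"
  using null by (auto simp: bform_linear)

lemma algebraic_int_l: "algebraic_int l" "algebraic_int (inverse l)"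
proof -
  define T where "T = mpow G k"
  have "matrix_over (ring_of_integers K) T" using power by (simp add: T_def O_prime_def GL_def)
  hence T: "algebraic_int (T $ i $ j)" for i j by (auto simp: matrix_over_def ring_of_integers_def)
  have ev: "algebraic_int c" if v: "v \<noteq> 0" and Gv: "G *v v = c *\<^sub>R v" for v c
  proof -
    have "G *v v = c *s v" using Gv by (simp add: scalar_mult_eq_scaleR)
    hence "T *v v = c ^ k *s v" unfolding T_def by (rule mpow_eigenvector)
    hence eq: "(\<Sum>j\<in>UNIV. T $ i $ j * v $ j) = c ^ k * v $ i" for i
      by (simp add: matrix_vector_mult_def vec_eq_iff)
    obtain i where "v $ i \<noteq> 0" using v by (auto simp: vec_eq_iff)
    hence "algebraic_int (c ^ k)"
      using algebraic_int_eigenvalue[of "\<lambda>i j. T $ i $ j" "\<lambda>i. v $ i" "c ^ k" i] T eq by blast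
    thus ?thesis using k by (rule algebraic_int_power_root)
  qed
  show "algebraic_int l" "algebraic_int (inverse l)" using ev eigen ab_nz by blast+
qed

lemma orthogonal_ab_pos:
  assumes "bform A x a = 0" "bform A x b = 0" "x \<noteq> 0"
  shows "qform A x > 0"
proof -
  \<comment> \<open>With this sign f(u) = - 2 |B(a, b)|, so \<open>u\<close> is timelike.\<close>
  define u where "u = a - sgn (bform A a b) *\<^sub>R b"
  have "qform A u = - 2 * (sgn (bform A a b) * bform A a b)"
    using null comm[of b a] by (simp add: u_def qform_bform bform_linear)
  hence "qform A u < 0" using null(3) by (simp add: sgn_mult_self_eq flip: abs_sgn mult.commute)
  moreover have "bform A x u = 0" using assms by (simp add: u_def bform_linear)
  ultimately show ?thesis using orthogonal_pos assms(3) by blast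
qed

text \<open>An eigenvector for z can fail to be orthogonal to an eigenvector with eigenvalue c only
  if z c = 1. For all other z its real and imaginary parts lie in the positive complement of
  \<open>a\<close> and \<open>b\<close>, where \<open>invariant_plane_modulus\<close>
  applies.\<close>

lemma eigenvalues:
  assumes "det ((\<chi> i j. (if i = j then z else 0) - of_real (G $ i $ j)) :: complex ^ 'n option ^ 'n option) = 0"
  shows "z = of_real l \<or> z = of_real (inverse l) \<or> cmod z = 1"
proof (rule ccontr)
  assume neg: "\<not> ?thesis"
  obtain x y where xy: "x \<noteq> 0 \<or> y \<noteq> 0" "G *v x = Re z *\<^sub>R x - Im z *\<^sub>R y" "G *v y = Im z *\<^sub>R x + Re z *\<^sub>R y"
    by (rule complex_eigenvector_parts[OF assms])
  have orth: "bform A x v = 0 \<and> bform A y v = 0" if v: "G *v v = c *\<^sub>R v" and c: "z * of_real c \<noteq> 1" for v c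
  proof -
    define p where "p = Complex (bform A x v) (bform A y v)"
    have "bform A x v = c * (Re z * bform A x v - Im z * bform A y v)"
      using pres[of x v] by (simp add: v xy bform_linear)
    moreover have "bform A y v = c * (Im z * bform A x v + Re z * bform A y v)"
      using pres[of y v] by (simp add: v xy bform_linear)
    ultimately have "p = z * of_real c * p" by (simp add: p_def complex_eq_iff algebra_simps)
    hence "p = 0" using c by auto
    thus ?thesis by (simp add: p_def complex_eq_iff)
  qed
  have "z * of_real l \<noteq> 1" "z * of_real (inverse l) \<noteq> 1"
    using neg l by (auto simp: field_simps)
  hence "bform A x a = 0" "bform A y a = 0" "bform A x b = 0" "bform A y b = 0"
    using orth[OF eigen(1)] orth[OF eigen(2)] by blast+
  hence "x \<noteq> 0 \<Longrightarrow> qform A x > 0" "y \<noteq> 0 \<Longrightarrow> qform A y > 0"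
    using orthogonal_ab_pos by blast+
  moreover have "qform A 0 = 0" by (simp add: qform_bform bform_linear)
  ultimately have "qform A x + qform A y > 0" using xy(1) by (cases "x = 0"; cases "y = 0") auto
  from invariant_plane_modulus[OF A_sym pres xy(2,3) this] have "cmod z = 1"
    by (simp add: cmod_def)
  with neg show False by simp
qed

text \<open>Symmetry of \<open>A\<close> and invariance under \<open>G\<close> are polynomial
  identities in \<open>t\<close>, hence hold at every conjugate of \<open>t\<close>.\<close>

lemma conjugate_data:
  obtains gp where "\<And>i j. G $ i $ j = qeval (gp i j) t"
    "\<And>x. x \<in> conjs \<Longrightarrow> x \<noteq> t \<Longrightarrow> \<exists>B. transpose B = B \<and> positive_definite B \<and>
       (\<forall>v w. bform B ((\<chi> i j. qeval (gp i j) x) *v v) ((\<chi> i j. qeval (gp i j) x) *v w) = bform B v w)"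
proof -
  obtain gp where gp: "\<And>i j. G $ i $ j = qeval (gp i j) t" using matrix_over_qeval[OF G_over] by blast
  obtain ap where ap: "\<And>i j. A $ i $ j = qeval (ap i j) t" using matrix_over_qeval[OF A_over] by blast
  show ?thesis
  proof (rule that[OF gp])
    fix x assume x: "x \<in> conjs" "x \<noteq> t"
    define B where "B = (\<chi> i j. qeval (ap i j) x)"
    define H where "H = (\<chi> i j. qeval (gp i j) x)"
    have transfer: "qeval p x = qeval q x" if "qeval p t = qeval q t" for p q
      using qeval_eq_0_imp[of "p - q" x] x that by simp
    have "transpose B = B"
    proof -
      have "qeval (ap j i) x = qeval (ap i j) x" for i j
        using arg_cong[OF A_sym, of "\<lambda>A. A $ i $ j"] by (intro transfer) (simp add: transpose_def flip: ap)
      thus ?thesis by (simp add: B_def transpose_def vec_eq_iff)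
    qed
    moreover have "positive_definite B" unfolding B_def using definite[OF x, of ap] ap by simp
    moreover have "transpose H ** B ** H = B"
    proof -
      have *: "transpose G ** A ** G = A" unfolding bform_preserved_iff using pres by blast
      have "qeval (\<Sum>k\<in>UNIV. (\<Sum>m\<in>UNIV. gp m i * ap m k) * gp k j) x = qeval (ap i j) x" for i j
        using arg_cong[OF *, of "\<lambda>A. A $ i $ j"]
        by (intro transfer) (simp add: matrix_matrix_mult_def transpose_def flip: ap gp)
      thus ?thesis by (simp add: B_def H_def matrix_matrix_mult_def transpose_def vec_eq_iff)
    qed
    ultimately show "\<exists>B. transpose B = B \<and> positive_definite B \<and>
       (\<forall>v w. bform B ((\<chi> i j. qeval (gp i j) x) *v v) ((\<chi> i j. qeval (gp i j) x) *v w) = bform B v w)"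
      unfolding H_def[symmetric] bform_preserved_iff by blast
  qed
qed

lemma conj_real:
  fixes z :: complex
  assumes "qeval (map_poly of_int h) z = 0"
  obtains x where "z = of_real x" "x \<in> conjs"
proof -
  obtain x where x: "z = of_real x" using real_roots[OF assms] by (auto elim: Reals_cases)
  with assms have "x \<in> conjs" by (simp add: conjs_def ieval_qeval qeval_of_real)
  with x that show ?thesis by blast
qed

lemma K_subset: "K \<subseteq> rat_adjoin (l + inverse l)"
proof -
  define \<tau> where "\<tau> = l + inverse l"
  interpret F: real_subfield "rat_adjoin \<tau>" by (intro real_subfield.intro subfield_rat_adjoin)
  obtain gp where gp: "\<And>i j. G $ i $ j = qeval (gp i j) t"
    and conj: "\<And>x. x \<in> conjs \<Longrightarrow> x \<noteq> t \<Longrightarrow> \<exists>B. transpose B = B \<and> positive_definite B \<and>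
       (\<forall>v w. bform B ((\<chi> i j. qeval (gp i j) x) *v v) ((\<chi> i j. qeval (gp i j) x) *v w) = bform B v w)"
    by (rule conjugate_data) blast
  define H where "H = (\<lambda>y. (\<chi> i j. qeval (gp i j) y) :: 'n lmat)"
  define P :: "real poly ^ 'n option ^ 'n option" where
    "P = (\<chi> i j. smult \<tau> (map_poly of_rat (gp i j)) - (\<Sum>k\<in>UNIV. map_poly of_rat (gp i k) * map_poly of_rat (gp k j))
        - (if i = j then 1 else 0))"
  define D where "D = det P"
  have H: "(\<chi> i j. poly (P $ i $ j) y) *v v = \<tau> *\<^sub>R (H y *v v) - H y *v (H y *v v) - v" for y v
  proof -
    have "(\<chi> i j. poly (P $ i $ j) y) = \<tau> *\<^sub>R H y - H y ** H y - mat 1"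
      by (simp add: P_def H_def vec_eq_iff poly_sum matrix_matrix_mult_def mat_def qeval_def)
    thus ?thesis
      by (simp add: matrix_vector_mult_diff_rdistrib scaleR_matrix_vector_assoc matrix_vector_mul_assoc)
  qed
  have kernel: "poly D y = 0 \<longleftrightarrow> (\<exists>v. v \<noteq> 0 \<and> \<tau> *\<^sub>R (H y *v v) - H y *v (H y *v v) - v = 0)" for y
    unfolding D_def poly_det det_eq_0_iff_kernel H ..
  have Ht: "H t = G" by (simp add: H_def vec_eq_iff gp)
  have "t \<in> rat_adjoin \<tau>"
  proof (rule F.unique_common_root_mem)
    show "coeffs_in (rat_adjoin \<tau>) (map_poly of_rat (map_poly of_int h))" by simp
    show "poly (map_poly of_rat (map_poly of_int h)) t = 0" using root by (simp add: qeval_def)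
    show "poly (pderiv (map_poly of_rat (map_poly of_int h))) t \<noteq> 0"
      using irreducible_rat_poly_separable[OF irred root] by (simp add: qeval_pderiv)
    show "coeffs_in (rat_adjoin \<tau>) D"
      unfolding D_def
    proof (rule F.coeffs_in_det)
      fix i j show "coeffs_in (rat_adjoin \<tau>) (P $ i $ j)"
        unfolding P_def using rat_adjoin_self
        by (auto intro!: F.coeffs_in_diff F.coeffs_in_smult F.coeffs_in_sum F.coeffs_in_mult simp: one_pCons)
    qed
    have "G *v (G *v a) = (l * l) *\<^sub>R a" by (simp add: eigen matrix_vector_mult_scaleR)
    hence "\<tau> *\<^sub>R (G *v a) - G *v (G *v a) - a = (\<tau> * l) *\<^sub>R a - (l * l) *\<^sub>R a - 1 *\<^sub>R a"
      by (simp only: eigen(1) scaleR_scaleR scaleR_one)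
    also have "\<dots> = (\<tau> * l - l * l - 1) *\<^sub>R a" by (simp only: scaleR_diff_left)
    also have "\<tau> * l - l * l - 1 = 0"
    proof -
      have "inverse l * l = 1" using l by simp
      thus ?thesis by (simp add: \<tau>_def distrib_right)
    qed
    finally have "\<tau> *\<^sub>R (G *v a) - G *v (G *v a) - a = 0" by (simp only: scaleR_zero_left)
    thus "poly D t = 0" unfolding kernel Ht using ab_nz(1) by blast
    fix z assume z: "cpoly (map_poly of_rat (map_poly of_int h)) z = 0" "cpoly D z = 0"
    then obtain x where x: "z = of_real x" "x \<in> conjs" using conj_real by (auto simp: cpoly_of_rat)
    show "z = of_real t"
    proof (rule ccontr)
      assume "z \<noteq> of_real t"
      with x have "x \<noteq> t" by auto
      from conj[OF x(2) this] obtain B where B: "transpose B = B" "positive_definite B"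
        "\<And>v w. bform B (H x *v v) (H x *v w) = bform B v w" unfolding H_def by blast
      have "poly D x = 0" using z(2) x(1) by (simp add: cpoly_of_real)
      then obtain v where v: "v \<noteq> 0" "\<tau> *\<^sub>R (H x *v v) - H x *v (H x *v v) - v = 0"
        unfolding kernel by blast
      have pos: "qform B v > 0" using B(2) v(1) by (simp add: positive_definite_def)
      \<comment> \<open>Pairing the relation with H v gives \<tau> B(v, v) = 2 B(v, H v). Since H
        preserves the positive definite B, the right side is at most 2 B(v, v), against \<tau> >
        2.\<close>
      have "bform B (H x *v v) (\<tau> *\<^sub>R (H x *v v) - H x *v (H x *v v) - v) = 0"
        unfolding v(2) by (simp add: bform_linear)
      hence "\<tau> * qform B v = 2 * bform B v (H x *v v)"
        using bform_commute[OF B(1), of "H x *v v" v] by (simp add: bform_linear B(3) qform_bform)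
      moreover have "qform B (v - H x *v v) \<ge> 0"
      proof (cases "v - H x *v v = 0")
        case True
        show ?thesis unfolding True by (simp add: qform_bform bform_linear)
      next
        case False
        thus ?thesis using B(2) unfolding positive_definite_def by (intro less_imp_le) blast
      qed
      hence "bform B v (H x *v v) \<le> qform B v"
        using bform_commute[OF B(1), of "H x *v v" v] by (simp add: qform_bform bform_linear B(3))
      ultimately have "\<tau> * qform B v \<le> 2 * qform B v" by simp
      hence "\<tau> \<le> 2" using pos by simp
      moreover have "\<tau> > 2"
      proof -
        have "0 < (l - 1) * (l - 1)" using l by simp
        also have "\<dots> = l * (l + inverse l - 2)"
          using l by (simp add: distrib_left distrib_right left_diff_distrib right_diff_distrib)
        finally show ?thesis using l by (simp add: \<tau>_def zero_less_mult_iff)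
      qed
      ultimately show False by simp
    qed
  qed
  thus ?thesis unfolding K_adjoin \<tau>_def by (intro rat_adjoin_minimal subfield_rat_adjoin)
qed

text \<open>By \<open>K_subset\<close> t is a polynomial s(l). Conjugating l to z carries t to a
  conjugate x = s(z), which is real, and \<open>G\<close> to the matrix H at x, of which z is an
  eigenvalue. If x = t, then \<open>eigenvalues\<close> applies; otherwise H preserves a definite
  form and |z| = 1.\<close>

lemma conjugate_classification:
  assumes p: "rat_irreducible p" "qeval p l = 0" and z: "qeval p (z :: complex) = 0"
  shows "z = of_real l \<or> z = of_real (inverse l) \<or> cmod z = 1"
proof -
  obtain gp where gp: "\<And>i j. G $ i $ j = qeval (gp i j) t"
    and conj: "\<And>x. x \<in> conjs \<Longrightarrow> x \<noteq> t \<Longrightarrow> \<exists>B. transpose B = B \<and> positive_definite B \<and>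
       (\<forall>v w. bform B ((\<chi> i j. qeval (gp i j) x) *v v) ((\<chi> i j. qeval (gp i j) x) *v w) = bform B v w)"
    by (rule conjugate_data) blast
  have alg: "Polynomial.algebraic l" using algebraic_int_l by blast
  interpret L: real_subfield "rat_adjoin l" by (intro real_subfield.intro subfield_rat_adjoin)
  have "l + inverse l \<in> rat_adjoin l" using rat_adjoin_self by auto
  hence "rat_adjoin (l + inverse l) \<subseteq> rat_adjoin l" by (intro rat_adjoin_minimal subfield_rat_adjoin)
  moreover have "t \<in> K" unfolding K_adjoin by (rule rat_adjoin_self)
  ultimately have "t \<in> rat_adjoin l" using K_subset by blast
  then obtain s where s: "t = qeval s l" unfolding rat_adjoin_eq[OF alg] by blast
  have "qeval (pcompose (map_poly of_int h) s) l = 0" using root s by simp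
  hence "p dvd pcompose (map_poly of_int h) s" using irreducible_rat_poly_dvd[OF p] by blast
  then obtain q where "pcompose (map_poly of_int h) s = p * q" ..
  hence "qeval (pcompose (map_poly of_int h) s) z = 0" using z by simp
  hence "qeval (map_poly of_int h) (qeval s z) = 0" by simp
  then obtain x where x: "qeval s z = of_real x" "x \<in> conjs" by (rule conj_real)
  define H where "H = ((\<chi> i j. qeval (gp i j) x) :: 'n lmat)"
  define R :: "rat poly ^ 'n option ^ 'n option"
    where "R = (\<chi> i j. (if i = j then [:0, 1:] else 0) - pcompose (gp i j) s)"
  have "qeval (det R) l = det (\<chi> i j. (if i = j then l else 0) - G $ i $ j)"
    unfolding qeval_det R_def by (rule arg_cong[of _ _ det]) (simp add: vec_eq_iff gp s)
  also have "\<dots> = 0"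
    unfolding det_eq_0_iff_kernel
  proof (intro exI conjI)
    have "(\<chi> i j. (if i = j then l else 0) - G $ i $ j) = l *\<^sub>R mat 1 - G"
      by (simp add: vec_eq_iff mat_def)
    thus "(\<chi> i j. (if i = j then l else 0) - G $ i $ j) *v a = 0"
      by (simp add: matrix_vector_mult_diff_rdistrib scaleR_matrix_vector_assoc[symmetric] eigen)
  qed (rule ab_nz)
  finally have "p dvd det R" using irreducible_rat_poly_dvd[OF p] by blast
  then obtain q where "det R = p * q" ..
  hence "qeval (det R) z = 0" using z by simp
  moreover have "qeval (det R) z = det (\<chi> i j. (if i = j then z else 0) - of_real (H $ i $ j))"
    unfolding qeval_det R_def H_def by (rule arg_cong[of _ _ det]) (simp add: vec_eq_iff x(1) qeval_of_real)
  ultimately have det: "det ((\<chi> i j. (if i = j then z else 0) - of_real (H $ i $ j)) :: complex ^ 'n option ^ 'n option) = 0"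
    by simp
  show ?thesis
  proof (cases "x = t")
    case True
    hence "H = G" by (simp add: H_def vec_eq_iff gp)
    with det show ?thesis using eigenvalues by simp
  next
    case False
    from conj[OF x(2) this] obtain B where B: "transpose B = B" "positive_definite B"
      "\<And>v w. bform B (H *v v) (H *v w) = bform B v w" unfolding H_def by blast
    obtain v w where vw: "v \<noteq> 0 \<or> w \<noteq> 0" "H *v v = Re z *\<^sub>R v - Im z *\<^sub>R w" "H *v w = Im z *\<^sub>R v + Re z *\<^sub>R w"
      by (rule complex_eigenvector_parts[OF det])
    have "v \<noteq> 0 \<Longrightarrow> qform B v > 0" "w \<noteq> 0 \<Longrightarrow> qform B w > 0" "qform B 0 = 0"
      using B(2) by (auto simp: positive_definite_def qform_bform bform_linear)
    hence "qform B v + qform B w > 0" using vw(1) by (cases "v = 0"; cases "w = 0") auto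
    from invariant_plane_modulus[OF B(1) B(3) vw(2,3) this] show ?thesis by (simp add: cmod_def)
  qed
qed

text \<open>If there is a conjugate z on the unit circle, its inverse is its complex conjugate and
  again a root, so \<open>p\<close> shares the root z with its reciprocal polynomial and divides it.
  Otherwise, were 1/l not a root, l would be the only one, hence rational; then l and 1/l would both
  be integers, which is impossible for l > 1.\<close>

lemma conjugate_inverse:
  assumes p: "rat_irreducible p" "qeval p l = 0"
  shows "qeval p (inverse l) = 0"
proof (cases "\<exists>z :: complex. qeval p z = 0 \<and> z \<noteq> of_real l \<and> z \<noteq> of_real (inverse l)")
  case True
  then obtain z :: complex where z: "qeval p z = 0" "z \<noteq> of_real l" "z \<noteq> of_real (inverse l)" by blast
  hence "cmod z = 1" using conjugate_classification[OF p] by blast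
  hence nz: "z \<noteq> 0" and "z * cnj z = 1"
    using complex_norm_square[of z] by auto
  hence "cnj z = inverse z" by (metis inverse_unique)
  hence "qeval p (inverse z) = 0" using z(1) by (metis qeval_cnj complex_cnj_zero)
  hence "qeval (reflect_poly p) z = 0" using nz by (simp add: qeval_reflect_poly)
  hence "p dvd reflect_poly p" using irreducible_rat_poly_dvd[OF p(1) z(1)] by blast
  then obtain q where "reflect_poly p = p * q" ..
  hence "qeval (reflect_poly p) l = 0" using p(2) by simp
  thus ?thesis using l by (simp add: qeval_reflect_poly)
next
  case False
  show ?thesis
  proof (rule ccontr)
    assume ninv: "qeval p (inverse l) \<noteq> 0"
    have Q: "subfield \<rat> real_field" unfolding subfield_real_iff by auto
    interpret Q: real_subfield \<rat> by (rule real_subfield.intro[OF Q])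
    have "l \<in> \<rat>"
    proof -
      have c: "coeffs_in \<rat> (map_poly of_rat p :: real poly)" by simp
      have r: "poly (map_poly of_rat p) l = 0" using p(2) by (simp add: qeval_def)
      have d: "poly (pderiv (map_poly of_rat p)) l \<noteq> 0"
        using irreducible_rat_poly_separable[OF p] by (simp add: qeval_pderiv)
      show ?thesis
      proof (rule Q.unique_common_root_mem[OF c r d c r])
        fix z assume "cpoly (map_poly of_rat p) z = 0"
        hence z: "qeval p z = 0" by (simp add: cpoly_of_rat)
        have "z \<noteq> of_real (inverse l)"
        proof
          assume "z = of_real (inverse l)"
          hence "(of_real (qeval p (inverse l)) :: complex) = 0" using z qeval_of_real by metis
          with ninv show False by simp
        qed
        thus "z = of_real l" using False z by blast
      qed
    qed
    hence "l \<in> \<int>" "inverse l \<in> \<int>"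
      using rational_algebraic_int_is_int algebraic_int_l by auto
    from this(2) obtain m where m: "inverse l = of_int m" by (rule Ints_cases)
    have "0 < inverse l" "inverse l < 1" using l by (auto simp: inverse_less_1_iff)
    hence "0 < m" "m < 1" unfolding m by simp_all
    thus False by linarith
  qed
qed

theorem Salem: "Salem_number l"
  unfolding Salem_number_def
proof (intro conjI allI impI)
  show "l > 1" by (rule l)
  show "algebraic_int l" by (rule algebraic_int_l)
  have "Polynomial.algebraic l" using algebraic_int_l by blast
  then obtain p where p: "rat_irreducible p" "qeval p l = 0"
    using minimal_polynomial_exists[of _ l] unfolding algebraic_iff_qeval by metis
  show "conjugate_over_rat (of_real l) (of_real (inverse l))"
    unfolding conjugate_over_rat_def using p conjugate_inverse[OF p]
    by (intro exI[of _ p]) (simp add: qeval_def[symmetric] qeval_of_real del: of_real_inverse)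
  fix z assume z: "conjugate_over_rat (of_real l) z" "z \<noteq> of_real l" "z \<noteq> of_real (inverse l)"
  then obtain q where "rat_irreducible q" "qeval q (of_real l :: complex) = 0" "qeval q z = 0"
    by (auto simp: conjugate_over_rat_def qeval_def)
  thus "cmod z = 1" using conjugate_classification[of q z] z by (simp add: qeval_of_real)
qed

theorem degree_le: "degree_over K l \<le> CARD('n) + 1"
proof -
  define P :: "real poly ^ 'n option ^ 'n option"
    where "P = (\<chi> i j. (if i = j then [:0, 1:] else 0) - [:G $ i $ j:])"
  have ev: "poly (det P) y = det (y *\<^sub>R mat 1 - G)" for y
  proof -
    have "(\<chi> i j. poly (P $ i $ j) y) = y *\<^sub>R mat 1 - G"
      by (simp add: P_def vec_eq_iff mat_def)
    thus ?thesis by (simp only: poly_det)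
  qed
  have ker: "poly (det P) y = 0 \<longleftrightarrow> (\<exists>v. v \<noteq> 0 \<and> G *v v = y *\<^sub>R v)" for y
    unfolding ev det_eq_0_iff_kernel
    by (auto simp: matrix_vector_mult_diff_rdistrib scaleR_matrix_vector_assoc[symmetric])
  have "poly (det P) l = 0" unfolding ker using eigen ab_nz by blast
  moreover have "coeffs_in K (det P)"
  proof (rule K.coeffs_in_det)
    fix i j show "coeffs_in K (P $ i $ j)"
      unfolding P_def using G_over by (auto intro!: K.coeffs_in_diff simp: matrix_over_def)
  qed
  \<comment> \<open>The value l + 1 is not an eigenvalue: an eigenvector would be orthogonal to
    \<open>a\<close> and \<open>b\<close>, hence have positive form, while \<open>G\<close> would
    scale this form by (l + 1)^2.\<close>
  moreover have "det P \<noteq> 0"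
  proof
    assume "det P = 0"
    hence "poly (det P) (l + 1) = 0" by simp
    then obtain v where v: "v \<noteq> 0" "G *v v = (l + 1) *\<^sub>R v" unfolding ker by blast
    have "bform A v a = ((l + 1) * l) * bform A v a"
      using pres[of v a] by (simp add: v eigen bform_linear mult_ac)
    moreover have "(l + 1) * l > 1" using l by (smt (verit) mult_less_cancel_left1)
    ultimately have "bform A v a = 0" by simp
    moreover have "bform A v b = ((l + 1) * inverse l) * bform A v b"
      using pres[of v b] by (simp add: v eigen bform_linear mult_ac)
    moreover have "(l + 1) * inverse l \<noteq> 1" using l by (simp add: field_simps)
    ultimately have "qform A v > 0" using orthogonal_ab_pos[OF _ _ v(1)] by simp
    moreover have "qform A v = (l + 1)\<^sup>2 * qform A v"
      using pres[of v v] by (simp add: v qform_bform bform_linear power2_eq_square mult_ac)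
    moreover have "(l + 1)\<^sup>2 \<noteq> 1" using l by (simp add: power2_eq_1_iff)
    ultimately show False by simp
  qed
  moreover have "degree (det P) \<le> CARD('n option)"
    by (rule degree_det_le) (simp add: P_def degree_diff_le)
  ultimately show ?thesis using degree_over_le[OF subfield_K, of "det P" l] by simp
qed

end

text \<open>Passes from conditions on embeddings to conditions on the conjugates of an integral
  primitive element, by means of \<open>embedding_exists\<close>.\<close>

lemma arithmetic_admissible_form:
  fixes A M :: "('n::finite) lmat"
  assumes K: "totally_real_number_field K" and A: "admissible K A"
    and M: "M \<in> GL UNIV" "\<And>x. qform A (M *v x) = lorentz_form x"
  obtains h t where "admissible_form h t K A M"
proof -
  have nf: "number_field K" using K by (simp add: totally_real_number_field_def)
  obtain t and h :: "int poly" where h: "lead_coeff h = 1" "rat_irreducible (map_poly of_int h)"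
    "qeval (map_poly of_int h) t = 0" and Kt: "K = range (\<lambda>g. qeval g t)"
    using integral_primitive_element[OF nf] by metis
  have real: "z \<in> \<real>" if z: "qeval (map_poly of_int h) z = 0" for z :: complex
  proof -
    obtain \<sigma> where \<sigma>: "\<sigma> \<in> ring_hom (real_field\<lparr>carrier := range (\<lambda>g. qeval g t)\<rparr>) complex_field"
      "\<And>g. \<sigma> (qeval g t) = qeval g z"
      using embedding_exists[OF h(2,3) z] by metis
    have "\<sigma> ` K \<subseteq> \<real>"
      using K \<sigma>(1) unfolding totally_real_number_field_def Kt by blast
    moreover have "qeval [:0, 1:] z \<in> \<sigma> ` K" unfolding Kt using \<sigma>(2)[of "[:0, 1:]"] by (metis imageI rangeI)
    ultimately show ?thesis by (auto simp: qeval_def map_poly_pCons)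
  qed
  interpret totally_real_primitive h t using h real by unfold_locales
  have "admissible_form h t K A M"
  proof
    show "K = range (\<lambda>g. qeval g t)" by fact
    show "matrix_over K A" "transpose A = A" using A by (simp_all add: admissible_def)
    show "invertible M" using M(1) by (simp add: GL_UNIV_iff)
    show "qform A (M *v x) = lorentz_form x" for x by fact
    fix x a assume x: "x \<in> conjs" "x \<noteq> t" and a: "\<And>i j. qeval (a i j) t = A $ i $ j"
    have z: "qeval (map_poly of_int h) x = 0" using x(1) by (simp add: conjs_def ieval_qeval)
    obtain \<sigma> where \<sigma>: "\<sigma> \<in> ring_hom (real_field\<lparr>carrier := range (\<lambda>g. qeval g t)\<rparr>) real_field"
      "\<And>g. \<sigma> (qeval g t) = qeval g x"
      using embedding_exists[OF h(2,3) z] by metis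
    have qX: "qeval [:0, 1:] y = y" for y :: real by (simp add: qeval_def map_poly_pCons)
    have "\<sigma> t = x" using \<sigma>(2)[of "[:0, 1:]"] by (simp add: qX)
    moreover have "t \<in> K" unfolding Kt using qX[of t] by (metis rangeI)
    ultimately have "\<exists>y\<in>K. \<sigma> y \<noteq> y" using x(2) by auto
    moreover have "\<sigma> \<in> ring_hom (real_field\<lparr>carrier := K\<rparr>) real_field" using \<sigma>(1) by (simp add: Kt)
    ultimately have "positive_definite (\<chi> i j. \<sigma> (A $ i $ j))" using A unfolding admissible_def by blast
    moreover have "\<sigma> (A $ i $ j) = qeval (a i j) x" for i j using \<sigma>(2)[of "a i j"] by (simp add: a)
    ultimately show "positive_definite (\<chi> i j. qeval (a i j) x)" by simp
  qed
  thus ?thesis by (rule that)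
qed

lemma subgroup_GL_group_closed:
  fixes \<Gamma> :: "(real ^ ('m::finite) ^ 'm) set"
  assumes "subgroup \<Gamma> GL_group"
  shows "\<And>x. x \<in> \<Gamma> \<Longrightarrow> invertible x" "mat 1 \<in> \<Gamma>"
    "\<And>x y. x \<in> \<Gamma> \<Longrightarrow> y \<in> \<Gamma> \<Longrightarrow> x ** y \<in> \<Gamma>" "\<And>x. x \<in> \<Gamma> \<Longrightarrow> matrix_inv x \<in> \<Gamma>"
proof -
  show inv: "invertible x" if "x \<in> \<Gamma>" for x
    using subgroup.mem_carrier[OF assms that] by (simp add: GL_UNIV_iff)
  show "mat 1 \<in> \<Gamma>" using subgroup.one_closed[OF assms] by simp
  show "x ** y \<in> \<Gamma>" if "x \<in> \<Gamma>" "y \<in> \<Gamma>" for x y using subgroup.m_closed[OF assms that] by simp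
  show "matrix_inv x \<in> \<Gamma>" if "x \<in> \<Gamma>" for x
    using subgroup.m_inv_closed[OF assms that] by (simp add: GL_group_inv[OF inv[OF that]])
qed

theorem arithmetic_hyperbolic_Salem:
  fixes \<Gamma> :: "('n::finite) lmat set"
  assumes n: "CARD('n) \<ge> 2" and arith: "arithmetic_simplest_type K \<Gamma>" and \<gamma>: "\<gamma> \<in> \<Gamma>"
    and hyp: "hyperbolic \<gamma>" and l: "l = exp (translation_length \<gamma>)"
    and cases: "even CARD('n) \<or> \<gamma> \<in> squares_subgroup \<Gamma>"
  shows "Salem_number l \<and> K \<subseteq> rat_adjoin (l + inverse l) \<and> degree_over K l \<le> CARD('n) + 1"
proof -
  have sub: "subgroup \<Gamma> GL_group" and pos: "\<Gamma> \<subseteq> pos_lorentz" and K: "totally_real_number_field K"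
    using arith by (simp_all add: arithmetic_simplest_type_def)
  note grp = subgroup_GL_group_closed[OF sub]
  obtain A M where A: "admissible K A" and M: "M \<in> GL UNIV" "\<And>x. qform A (M *v x) = lorentz_form x"
    and cms: "commensurable GL_group ((\<lambda>T. M ** T ** matrix_inv M) ` \<Gamma>) (O_prime A (ring_of_integers K))"
    using arith unfolding arithmetic_simplest_type_def by blast
  obtain h t where "admissible_form h t K A M" by (rule arithmetic_admissible_form[OF K A M])
  then interpret admissible_form h t K A M .
  note KS = real_subring_field[OF subfield_K]
  note RI = real_subring_integers[OF subfield_K]
  define c where "c T = M ** T ** matrix_inv M" for T
  note MM = matrix_inv_props[OF M_inv]
  have c_mult: "c (x ** y) = c x ** c y" for x y
  proof -
    have "c x ** c y = M ** x ** (matrix_inv M ** M) ** y ** matrix_inv M"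
      by (simp only: c_def matrix_mul_assoc)
    also have "\<dots> = c (x ** y)" by (simp only: MM matrix_mul_rid c_def matrix_mul_assoc)
    finally show ?thesis by simp
  qed
  have c_one: "c (mat 1) = mat 1" by (simp add: c_def MM)
  have c_vec: "c x *v (M *v v) = M *v (x *v v)" for x v
  proof -
    have "c x *v (M *v v) = (M ** x ** (matrix_inv M ** M)) *v v"
      by (simp only: c_def matrix_vector_mul_assoc matrix_mul_assoc)
    thus ?thesis by (simp only: MM matrix_mul_rid matrix_vector_mul_assoc)
  qed
  define H where "H = c ` \<Gamma>"
  define Ob where "Ob = O_prime A (ring_of_integers K)"
  have H_mult: "x ** y \<in> H" if "x \<in> H" "y \<in> H" for x y
    using that grp(3) by (auto simp: H_def simp flip: c_mult)
  have c_inv: "invertible (c x)" "matrix_inv (c x) = c (matrix_inv x)" if "x \<in> \<Gamma>" for x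
  proof -
    note xx = matrix_inv_props[OF grp(1)[OF that]]
    have e: "c x ** c (matrix_inv x) = mat 1" "c (matrix_inv x) ** c x = mat 1"
      by (simp_all only: c_mult[symmetric] xx c_one)
    show "invertible (c x)" unfolding invertible_def using e by blast
    show "matrix_inv (c x) = c (matrix_inv x)" by (rule matrix_inv_unique) (use e in simp_all)
  qed
  have H_inv: "invertible x" "matrix_inv x \<in> H" if "x \<in> H" for x
    using that c_inv grp(4) by (auto simp: H_def)
  have H_pres: "bform A (g *v x) (g *v y) = bform A x y" if g: "g \<in> H" for g x y
  proof -
    obtain T where T: "T \<in> \<Gamma>" "g = c T" using g by (auto simp: H_def)
    obtain x' where x': "x = M *v x'" by (rule M_surj)
    obtain y' where y': "y = M *v y'" by (rule M_surj)
    have "T \<in> pos_lorentz" using T(1) pos by blast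
    thus ?thesis by (simp only: T(2) x' y' c_vec bform_lorentz pos_lorentz_inner)
  qed
  have H_one: "mat 1 \<in> H" using grp(2) c_one unfolding H_def by (metis imageI)
  have Ob_one: "mat 1 \<in> Ob" unfolding Ob_def by (rule O_prime_one[OF RI])
  have fin: "finite_index GL_group (H \<inter> Ob) H" "finite_index GL_group (H \<inter> Ob) Ob"
    using cms unfolding commensurable_def H_def Ob_def c_def by blast+
  have H_GL: "H \<subseteq> GL UNIV" using H_inv(1) by (auto simp: GL_UNIV_iff)
  have Ob_GL: "Ob \<subseteq> GL UNIV" unfolding GL_UNIV_iff[abs_def] Ob_def O_prime_def
    by (auto simp: GL_UNIV_iff intro: GL_imp_invertible)
  \<comment> \<open>Commensurability enters only through powers: elements of either group have a
    power in the other one.\<close>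
  have pow1: "\<exists>k>0. mpow S k \<in> H" if S: "S \<in> O_prime A (ring_of_integers K)" for S
  proof -
    obtain k where "k > 0" "mpow S k \<in> H \<inter> Ob"
      by (rule finite_index_power_mem[OF fin(2) Ob_GL Ob_one _ _ S[folded Ob_def]])
         (use O_prime_mult[OF RI] H_one Ob_one in \<open>auto simp: Ob_def\<close>)
    thus ?thesis by blast
  qed
  have pow2: "\<exists>k>0. mpow S k \<in> O_prime A (ring_of_integers K)" if S: "S \<in> H" for S
  proof -
    obtain k where "k > 0" "mpow S k \<in> H \<inter> Ob"
      by (rule finite_index_power_mem[OF fin(1) H_GL H_one H_mult _ S])
         (use H_one Ob_one in auto)
    thus ?thesis unfolding Ob_def by blast
  qed
  have prod: "g $ i $ j * g $ k $ l \<in> K" if "g \<in> H" for g i j k l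
    by (rule entry_products_mem[OF n, of H]) (fact H_mult H_inv H_pres pow1 pow2 that)+
  have sq: "matrix_over K (g ** g)" if "g \<in> H" for g
    unfolding matrix_over_def matrix_matrix_mult_def
    using prod[OF that] by (auto intro!: K.sum_mem)
  have over: "matrix_over K (c \<gamma>)"
  proof (cases "even CARD('n)")
    case True
    have "c \<gamma> \<in> H" using \<gamma> by (simp add: H_def)
    show ?thesis
      by (rule det_entry_products_mem[OF prod[OF \<open>c \<gamma> \<in> H\<close>] True H_pres[OF \<open>c \<gamma> \<in> H\<close>]])
  next
    case False
    hence "\<gamma> \<in> generate GL_group {\<gamma> ** \<gamma> |\<gamma>. \<gamma> \<in> \<Gamma>}"
      using cases by (simp add: squares_subgroup_def)
    thus ?thesis
    proof (induction rule: generate.induct)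
      case one
      show ?case using matrix_over_mat_1[OF KS] by (simp add: c_one)
    next
      case (incl x)
      then obtain y where y: "y \<in> \<Gamma>" "x = y ** y" by blast
      hence "c y \<in> H" by (simp add: H_def)
      thus ?case using sq[of "c y"] by (simp add: y(2) c_mult)
    next
      \<comment> \<open>The inverse of a square is the square of the inverse, so \<open>sq\<close>
        applies again.\<close>
      case (inv x)
      then obtain y where y: "y \<in> \<Gamma>" "x = y ** y" by blast
      note yy = matrix_inv_props[OF grp(1)[OF y(1)]]
      have "x ** (matrix_inv y ** matrix_inv y) = y ** (y ** matrix_inv y) ** matrix_inv y"
        by (simp only: y(2) matrix_mul_assoc)
      hence e1: "x ** (matrix_inv y ** matrix_inv y) = mat 1" by (simp only: yy matrix_mul_rid)
      have "(matrix_inv y ** matrix_inv y) ** x = matrix_inv y ** (matrix_inv y ** y) ** y"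
        by (simp only: y(2) matrix_mul_assoc)
      hence e2: "(matrix_inv y ** matrix_inv y) ** x = mat 1" by (simp only: yy matrix_mul_rid)
      have "invertible x" using grp(1)[OF grp(3)[OF y(1) y(1)]] by (simp add: y(2))
      moreover have "matrix_inv x = matrix_inv y ** matrix_inv y"
        by (rule matrix_inv_unique) (use e1 e2 in simp_all)
      moreover have "c (matrix_inv y) \<in> H" using grp(4)[OF y(1)] by (simp add: H_def)
      ultimately show ?case using sq[of "c (matrix_inv y)"] by (simp add: GL_group_inv c_mult)
    next
      case (eng x y)
      thus ?case using matrix_over_mult[OF KS] by (simp add: c_mult)
    qed
  qed
  obtain a b where ab: "l > 1" "lorentz_form a = 0" "lorentz_form b = 0" "lorentz_inner a b = - 1 / 2"
    "\<gamma> *v a = l *\<^sub>R a" "\<gamma> *v b = inverse l *\<^sub>R b"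
    using hyperbolic_null_eigenvectors[OF hyp] unfolding l by metis
  have cH: "c \<gamma> \<in> H" using \<gamma> by (simp add: H_def)
  then obtain k where k: "k > 0" "mpow (c \<gamma>) k \<in> O_prime A (ring_of_integers K)" using pow2 by blast
  have "loxodromic h t K A M (c \<gamma>) l (M *v a) (M *v b) k"
  proof
    show "matrix_over K (c \<gamma>)" by (rule over)
    show "bform A (c \<gamma> *v x) (c \<gamma> *v y) = bform A x y" for x y by (rule H_pres[OF cH])
    show "c \<gamma> *v (M *v a) = l *\<^sub>R (M *v a)" "c \<gamma> *v (M *v b) = inverse l *\<^sub>R (M *v b)"
      by (simp_all only: c_vec ab matrix_vector_mult_scaleR)
    show "qform A (M *v a) = 0" "qform A (M *v b) = 0" using ab M by simp_all
    show "bform A (M *v a) (M *v b) \<noteq> 0" using ab by (simp add: bform_lorentz)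
  qed (use ab k in simp_all)
  then interpret loxodromic h t K A M "c \<gamma>" l "M *v a" "M *v b" k .
  show ?thesis using Salem K_subset degree_le by simp
qed

subsection \<open>Polynomials of Salem numbers and their power sums\<close>

text \<open>Newton's identities solved for the k-th power sum, k < m, of the roots of a monic
  polynomial of degree \<open>m\<close> with coefficients \<open>c\<close>. Only ring operations
  occur, so the values lie in the field of coefficients and are respected by embeddings.\<close>

fun newton :: "(nat \<Rightarrow> 'a::comm_ring_1) \<Rightarrow> nat \<Rightarrow> nat \<Rightarrow> 'a" where
  "newton c m k = of_nat (m - k) * c (m - k) - (\<Sum>r<k. c (m - k + r) * newton c m r)"

declare newton.simps [simp del]

text \<open>Synthetic division by the linear factor, from the top coefficient downwards.\<close>

lemma coeff_linear_quotient:
  fixes p s :: "'a::comm_ring_1 poly"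
  assumes p: "p = [:- x, 1:] * s" and s: "degree s < m" and k: "k < m"
  shows "coeff s (m - Suc k) = (\<Sum>r\<le>k. coeff p (m - k + r) * x ^ r)"
  using k
proof (induction k)
  case 0
  have "coeff s m = 0" using s by (intro coeff_eq_0)
  thus ?case using 0 by (cases m) (simp_all add: p)
next
  case (Suc k)
  define j where "j = m - Suc (Suc k)"
  have j: "m - Suc k = Suc j" "m - k = Suc (Suc j)" using Suc.prems by (simp_all add: j_def)
  have "coeff p (Suc j) = coeff s j - x * coeff s (Suc j)" by (simp add: p)
  hence "coeff s j = coeff p (Suc j) + x * coeff s (Suc j)" by simp
  also have "coeff s (Suc j) = (\<Sum>r\<le>k. coeff p (Suc (Suc j) + r) * x ^ r)"
    using Suc.IH Suc.prems by (simp only: j Suc_lessD)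
  also have "coeff p (Suc j) + x * \<dots> = (\<Sum>r\<le>Suc k. coeff p (Suc j + r) * x ^ r)"
    by (simp add: sum.atMost_Suc_shift sum_distrib_left mult_ac del: sum.atMost_Suc)
  finally show ?case by (simp only: j_def[symmetric] j)
qed

text \<open>The derivative of p is the sum of the quotients p / (X - x) over the roots. Comparing
  coefficients of X^(m - k - 1), with \<open>coeff_linear_quotient\<close> on one side, gives the
  recursion.\<close>

lemma newton_power_sum:
  fixes R :: "complex set"
  assumes R: "finite R" "card R = m" and p: "p = (\<Prod>x\<in>R. [:- x, 1:])" and k: "k < m"
  shows "newton (coeff p) m k = (\<Sum>x\<in>R. x ^ k)"
  using k
proof (induction k rule: less_induct)
  case (less k)
  define s where "s x = (\<Prod>y\<in>R - {x}. [:- y, 1:])" for x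
  have s: "p = [:- x, 1:] * s x" "degree (s x) < m" if "x \<in> R" for x
  proof -
    show "p = [:- x, 1:] * s x" unfolding p s_def using R(1) that by (rule prod.remove)
    have "degree (s x) = card (R - {x})"
      unfolding s_def by (subst degree_prod_eq_sum_degree) auto
    also have "\<dots> < m" using R that by (metis card_Diff1_less)
    finally show "degree (s x) < m" .
  qed
  have "m = degree p" unfolding p by (subst degree_prod_eq_sum_degree) (auto simp: R(2))
  moreover have "lead_coeff p = 1" unfolding p by (simp add: lead_coeff_prod)
  ultimately have lead: "coeff p m = 1" by simp
  have "pderiv p = (\<Sum>x\<in>R. s x)"
    unfolding p s_def by (simp add: pderiv_prod pderiv_pCons)
  moreover have "coeff (pderiv p) (m - Suc k) = of_nat (m - k) * coeff p (m - k)"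
    using less.prems by (simp add: coeff_pderiv Suc_diff_Suc)
  ultimately have "of_nat (m - k) * coeff p (m - k) = (\<Sum>x\<in>R. coeff (s x) (m - Suc k))"
    by (simp add: coeff_sum)
  also have "\<dots> = (\<Sum>x\<in>R. \<Sum>r\<le>k. coeff p (m - k + r) * x ^ r)"
    using coeff_linear_quotient[OF s less.prems] by (intro sum.cong) auto
  also have "\<dots> = (\<Sum>r\<le>k. coeff p (m - k + r) * (\<Sum>x\<in>R. x ^ r))"
    by (subst sum.swap) (simp add: sum_distrib_left)
  also have "\<dots> = (\<Sum>r<k. coeff p (m - k + r) * (\<Sum>x\<in>R. x ^ r)) + (\<Sum>x\<in>R. x ^ k)"
    using less.prems lead by (simp add: lessThan_Suc_atMost[symmetric])
  also have "(\<Sum>r<k. coeff p (m - k + r) * (\<Sum>x\<in>R. x ^ r)) = (\<Sum>r<k. coeff p (m - k + r) * newton (coeff p) m r)"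
    using less.IH less.prems by (intro sum.cong) auto
  finally show ?case by (simp add: newton.simps[of _ m k])
qed

text \<open>The laws are required on \<open>F\<close> only, since an embedding in the sense of the
  definitions may take arbitrary values outside its carrier.\<close>

locale field_embedding = real_subfield F for F +
  fixes \<sigma> :: "real \<Rightarrow> complex"
  assumes one [simp]: "\<sigma> 1 = 1"
    and add: "x \<in> F \<Longrightarrow> y \<in> F \<Longrightarrow> \<sigma> (x + y) = \<sigma> x + \<sigma> y"
    and mult: "x \<in> F \<Longrightarrow> y \<in> F \<Longrightarrow> \<sigma> (x * y) = \<sigma> x * \<sigma> y"
begin

lemma zero [simp]: "\<sigma> 0 = 0"
  using add[of 0 0] by simp

lemma uminus: "x \<in> F \<Longrightarrow> \<sigma> (- x) = - \<sigma> x"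
  using add[of x "- x"] by (simp add: uminus_mem add_eq_0_iff)

lemma diff: "x \<in> F \<Longrightarrow> y \<in> F \<Longrightarrow> \<sigma> (x - y) = \<sigma> x - \<sigma> y"
  using add[of x "- y"] by (simp add: uminus_mem uminus)

lemma sum: "(\<And>a. a \<in> A \<Longrightarrow> f a \<in> F) \<Longrightarrow> \<sigma> (sum f A) = (\<Sum>a\<in>A. \<sigma> (f a))"
proof (induction A rule: infinite_finite_induct)
  case (insert a A)
  have "sum f A \<in> F" using insert.prems by blast
  thus ?case using insert by (simp add: add)
qed simp_all

lemma of_nat [simp]: "\<sigma> (of_nat n) = of_nat n"
proof (induction n)
  case (Suc n)
  have "\<sigma> (of_nat (Suc n)) = \<sigma> (1 + of_nat n)" by simp
  also have "\<dots> = 1 + of_nat n" by (subst add) (simp_all add: Suc)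
  finally show ?case by simp
qed simp

lemma of_int [simp]: "\<sigma> (of_int n) = of_int n"
  by (cases n rule: int_cases2) (simp_all add: uminus)

lemma of_rat [simp]: "\<sigma> (of_rat q) = of_rat q"
proof (cases q)
  case (Fract a b)
  have "\<sigma> (of_rat q) * \<sigma> (of_int b) = \<sigma> (of_rat q * of_int b)" by (rule mult[symmetric]) auto
  also have "of_rat q * of_int b = (of_int a :: real)" using Fract by (simp add: of_rat_rat)
  finally show ?thesis using Fract by (simp add: of_rat_rat field_simps)
qed

lemma map_poly_mult: "coeffs_in F p \<Longrightarrow> coeffs_in F q \<Longrightarrow>
    map_poly \<sigma> (p * q) = map_poly \<sigma> p * map_poly \<sigma> q"
proof (rule poly_eqI)
  fix n assume pq: "coeffs_in F p" "coeffs_in F q"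
  have "\<sigma> (\<Sum>i\<le>n. coeff p i * coeff q (n - i)) = (\<Sum>i\<le>n. \<sigma> (coeff p i * coeff q (n - i)))"
    using pq by (intro sum) (auto simp: coeffs_in_def)
  also have "\<dots> = (\<Sum>i\<le>n. \<sigma> (coeff p i) * \<sigma> (coeff q (n - i)))"
    using pq by (simp add: coeffs_in_def mult)
  finally show "coeff (map_poly \<sigma> (p * q)) n = coeff (map_poly \<sigma> p * map_poly \<sigma> q) n"
    by (simp add: coeff_map_poly coeff_mult)
qed

lemma map_poly_of_rat_comp: "map_poly \<sigma> (map_poly of_rat q) = map_poly of_rat q"
  by (rule poly_eqI) (simp add: coeff_map_poly)

lemma newton_hom:
  assumes "\<And>i. c i \<in> F"
  shows "newton c m k \<in> F \<and> \<sigma> (newton c m k) = newton (\<lambda>i. \<sigma> (c i)) m k"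
proof (induction k rule: less_induct)
  case (less k)
  have 1: "of_nat (m - k) * c (m - k) \<in> F" using assms by auto
  have 2: "c (m - k + r) * newton c m r \<in> F" if "r \<in> {..<k}" for r using assms less that by auto
  have 3: "(\<Sum>r<k. c (m - k + r) * newton c m r) \<in> F" using 2 by (rule sum_mem)
  have "\<sigma> (newton c m k) = \<sigma> (of_nat (m - k) * c (m - k)) - \<sigma> (\<Sum>r<k. c (m - k + r) * newton c m r)"
    by (subst newton.simps) (rule diff[OF 1 3])
  also have "\<sigma> (\<Sum>r<k. c (m - k + r) * newton c m r) = (\<Sum>r<k. \<sigma> (c (m - k + r) * newton c m r))"
    by (rule sum[OF 2])
  also have "\<sigma> (of_nat (m - k) * c (m - k)) = of_nat (m - k) * \<sigma> (c (m - k))"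
    using assms by (subst mult) auto
  also have "(\<Sum>r<k. \<sigma> (c (m - k + r) * newton c m r)) =
      (\<Sum>r<k. \<sigma> (c (m - k + r)) * newton (\<lambda>i. \<sigma> (c i)) m r)"
    using assms less by (intro sum.cong) (auto simp: mult)
  finally have "\<sigma> (newton c m k) = newton (\<lambda>i. \<sigma> (c i)) m k" by (subst newton.simps)
  moreover have "newton c m k \<in> F" using diff_mem[OF 1 3] by (subst newton.simps)
  ultimately show ?case by blast
qed

end

locale salem_polynomial = real_subfield F for F +
  fixes l :: real and p :: "real poly"
  assumes salem: "Salem_number l" and F_sub: "F \<subseteq> rat_adjoin (l + inverse l)"
    and over: "coeffs_in F p" and monic: "lead_coeff p = 1" and root: "poly p l = 0"
    and minimal: "\<And>g. coeffs_in F g \<Longrightarrow> poly g l = 0 \<Longrightarrow> \<exists>q. coeffs_in F q \<and> g = q * p"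
begin

lemma l_gt_1: "l > 1" and algebraic_int_l: "algebraic_int l"
  using salem by (auto simp: Salem_number_def)

lemma rational_polynomial:
  obtains q where "rat_irreducible q" "qeval q l = 0" "qeval q (inverse l) = 0"
    "\<And>z :: complex. qeval q z = 0 \<Longrightarrow> z = of_real l \<or> z = of_real (inverse l) \<or> cmod z = 1"
proof -
  obtain q where q: "rat_irreducible q" "qeval q (of_real l :: complex) = 0"
    "qeval q (of_real (inverse l) :: complex) = 0"
    using salem unfolding Salem_number_def conjugate_over_rat_def qeval_def by blast
  have c: "z = of_real l \<or> z = of_real (inverse l) \<or> cmod z = 1" if "qeval q z = 0" for z :: complex
    using salem q that unfolding Salem_number_def conjugate_over_rat_def qeval_def by blast
  show ?thesis
    by (rule that[OF q(1) _ _ c]) (use q(2,3) in \<open>simp_all only: qeval_of_real of_real_eq_0_iff\<close>)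
qed

lemma qeval_transfer: "qeval g l = 0 \<Longrightarrow> qeval g (inverse l) = 0"
proof -
  assume g: "qeval g l = 0"
  obtain q where q: "rat_irreducible q" "qeval q l = 0" "qeval q (inverse l) = 0"
    by (rule rational_polynomial)
  have "q dvd g" by (rule irreducible_rat_poly_dvd[OF q(1,2) g])
  thus ?thesis using q(3) by (auto elim!: dvdE)
qed

text \<open>Write l + 1/l as a polynomial w in l. The rational relation x w(x) = x^2 + 1 at x = l
  passes to every conjugate z, so w computes the trace z + 1/z there.\<close>

lemma trace_polynomial:
  obtains w where "qeval w l = l + inverse l" "qeval w (inverse l) = l + inverse l"
    "\<And>z :: complex. z \<noteq> 0 \<Longrightarrow> (\<And>g. qeval g l = 0 \<Longrightarrow> qeval g z = 0) \<Longrightarrow> qeval w z = z + inverse z"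
proof -
  have alg: "Polynomial.algebraic l" using algebraic_int_l by blast
  interpret L: real_subfield "rat_adjoin l" by (intro real_subfield.intro subfield_rat_adjoin)
  have "l + inverse l \<in> rat_adjoin l" using rat_adjoin_self by blast
  then obtain w where w: "qeval w l = l + inverse l" unfolding rat_adjoin_eq[OF alg] by auto
  define g where "g = [:0, 1:] * w - [:1, 0, 1:]"
  have g: "qeval g z = z * qeval w z - (z * z + 1)" for z :: "'a::field_char_0"
    by (simp add: g_def right_diff_distrib)
  have "qeval g l = 0" unfolding g w using l_gt_1 by (simp add: distrib_left)
  have gz: "qeval w z = z + inverse z" if "z \<noteq> 0" "qeval g z = 0" for z :: "'a::field_char_0"
    proof -
    have "z * (z + inverse z) = z * z + 1" using that(1) by (simp add: distrib_left)
    hence "z * qeval w z = z * (z + inverse z)" using that(2) by (simp add: g)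
    thus ?thesis using that(1) by (simp only: mult_cancel_left) simp
  qed
  show ?thesis
  proof (rule that[OF w])
    show "qeval w (inverse l) = l + inverse l"
      using gz[OF _ qeval_transfer[OF \<open>qeval g l = 0\<close>]] l_gt_1 by simp
    show "qeval w z = z + inverse z" if "z \<noteq> 0" "\<And>g. qeval g l = 0 \<Longrightarrow> qeval g z = 0" for z :: complex
      using gz[OF that(1) that(2)[OF \<open>qeval g l = 0\<close>]] .
  qed
qed

lemma algebraic_trace: "Polynomial.algebraic (l + inverse l)"
proof -
  obtain g where g: "lead_coeff g = 1" "ieval g l = 0"
    using algebraic_int_l unfolding algebraic_int_iff_ieval by blast
  hence "ieval g (inverse l) = 0" using qeval_transfer by (simp add: ieval_qeval)
  with g(1) have "algebraic_int (inverse l)" unfolding algebraic_int_iff_ieval by blast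
  with algebraic_int_l have "algebraic_int (l + inverse l)" by (rule algebraic_int_add)
  thus ?thesis by blast
qed

lemma F_trace: "x \<in> F \<Longrightarrow> \<exists>g. x = qeval g (l + inverse l)"
proof -
  assume "x \<in> F"
  interpret L: real_subfield "rat_adjoin l" by (intro real_subfield.intro subfield_rat_adjoin)
  show ?thesis using F_sub \<open>x \<in> F\<close> algebraic_trace rat_adjoin_eq by blast
qed

text \<open>The coefficients of \<open>p\<close> are polynomials in l + 1/l, which the conjugation
  of l to 1/l leaves fixed.\<close>

lemma root_inverse: "poly p (inverse l) = 0"
proof -
  obtain w where w: "qeval w l = l + inverse l" "qeval w (inverse l) = l + inverse l"
    by (rule trace_polynomial) blast
  have "\<forall>i. \<exists>g. coeff p i = qeval g (l + inverse l)" using F_trace over by (auto simp: coeffs_in_def)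
  then obtain g where g: "\<And>i. coeff p i = qeval (g i) (l + inverse l)" by metis
  define R where "R = (\<Sum>i\<le>degree p. [:0, 1:] ^ i * pcompose (g i) w)"
  have R: "qeval R x = poly p x" if "qeval w x = l + inverse l" for x :: real
    unfolding R_def poly_altdef by (simp add: that g mult.commute)
  have "qeval R l = 0" using R[OF w(1)] root by simp
  hence "qeval R (inverse l) = 0" by (rule qeval_transfer)
  thus ?thesis using R[OF w(2)] by simp
qed

end

locale salem_embedding = salem_polynomial F l p + field_embedding F \<sigma> for F l p \<sigma>
begin

definition roots :: "complex set" where "roots = {z. poly (map_poly \<sigma> p) z = 0}"

lemma transfer: "coeffs_in F g \<Longrightarrow> poly g l = 0 \<Longrightarrow> z \<in> roots \<Longrightarrow> poly (map_poly \<sigma> g) z = 0"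
  using minimal[of g] over by (auto simp: map_poly_mult roots_def)

lemma qeval_roots: "qeval g l = 0 \<Longrightarrow> z \<in> roots \<Longrightarrow> qeval g z = 0"
  using transfer[of "map_poly of_rat g"] by (simp add: qeval_def map_poly_of_rat_comp)

lemma roots_cases: "z \<in> roots \<Longrightarrow> z = of_real l \<or> z = of_real (inverse l) \<or> cmod z = 1"
  using rational_polynomial qeval_roots by metis

lemma roots_nonzero: "z \<in> roots \<Longrightarrow> z \<noteq> 0"
  using roots_cases[of z] l_gt_1 by auto

text \<open>With \<open>w\<close> from \<open>trace_polynomial\<close>, the polynomial x - g(w(X))
  over F vanishes at l, so it is a multiple of \<open>p\<close> and its image under \<sigma>
  vanishes at z. Thus \<sigma> can be read off from any single root z of the image of
  \<open>p\<close>.\<close>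

lemma embedding_trace:
  assumes "z \<in> roots" and mem: "qeval g (l + inverse l) \<in> F"
  shows "\<sigma> (qeval g (l + inverse l)) = qeval g (z + inverse z)"
proof -
  obtain w where w: "qeval w l = l + inverse l"
    "\<And>z :: complex. z \<noteq> 0 \<Longrightarrow> (\<And>g. qeval g l = 0 \<Longrightarrow> qeval g z = 0) \<Longrightarrow> qeval w z = z + inverse z"
    by (rule trace_polynomial) blast
  define x where "x = qeval g (l + inverse l)"
  define f where "f = [:x:] - map_poly of_rat (pcompose g w)"
  have wz: "qeval w z = z + inverse z" using w(2) roots_nonzero qeval_roots assms by blast
  have x: "x \<in> F" using mem by (simp add: x_def)
  have "poly f l = 0" unfolding f_def x_def using w(1) by (simp add: qeval_def[symmetric])
  moreover have "coeffs_in F f" unfolding f_def using x by (intro coeffs_in_diff) auto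
  ultimately have "poly (map_poly \<sigma> f) z = 0" using transfer assms by blast
  moreover have "map_poly \<sigma> f = [:\<sigma> x:] - map_poly of_rat (pcompose g w)"
    by (rule poly_eqI) (auto simp: f_def coeff_map_poly coeff_pCons diff x split: nat.splits)
  ultimately have "\<sigma> x = qeval (pcompose g w) z" by (simp add: qeval_def[symmetric])
  thus ?thesis using wz by (simp add: x_def)
qed

lemma lead_map: "coeff (map_poly \<sigma> p) (degree p) = 1"
  using monic by (simp add: coeff_map_poly)

lemma degree_map [simp]: "degree (map_poly \<sigma> p) = degree p"
  by (intro antisym map_poly_degree_leq le_degree) (simp_all add: lead_map)

lemma degree_pos: "degree p > 0"
proof (rule ccontr)
  assume "\<not> degree p > 0"
  hence "p = [:1:]" using monic by (metis degree_0_id gr0I)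
  thus False using root by simp
qed

lemma roots_nonempty: "roots \<noteq> {}"
proof -
  have "\<not> constant (poly (map_poly \<sigma> p))" using degree_pos by (simp add: constant_degree)
  thus ?thesis using fundamental_theorem_of_algebra by (auto simp: roots_def)
qed

lemma real_trace: "z \<in> roots \<Longrightarrow> z + inverse z \<in> \<real>"
proof -
  assume "z \<in> roots"
  hence "z = of_real l \<or> z = of_real (inverse l) \<or> cmod z = 1" by (rule roots_cases)
  moreover have "inverse z = cnj z" if "cmod z = 1"
    using that complex_norm_square[of z] by (intro inverse_unique) simp
  ultimately have "z = of_real l \<or> z = of_real (inverse l) \<or> inverse z = cnj z" by blast
  thus ?thesis
  proof (elim disjE)
    assume "inverse z = cnj z"
    thus ?thesis by (simp add: complex_add_cnj)
  qed (simp_all add: Reals_add Reals_inverse)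
qed

text \<open>By \<open>embedding_trace\<close> the image of x is a rational polynomial in z + 1/z,
  which is real for every root z. This yields total reality of the field.\<close>

lemma real: "x \<in> F \<Longrightarrow> \<sigma> x \<in> \<real>"
proof -
  assume x: "x \<in> F"
  obtain z where z: "z \<in> roots" using roots_nonempty by blast
  obtain g where g: "x = qeval g (l + inverse l)" using F_trace[OF x] by blast
  obtain y where y: "z + inverse z = of_real y" using real_trace[OF z] by (auto elim: Reals_cases)
  have "\<sigma> x = qeval g (of_real y)" using embedding_trace[OF z, of g] x by (simp only: g y)
  thus ?thesis by (simp add: qeval_of_real)
qed

text \<open>A root off the unit circle is l or 1/l and so has the trace l + 1/l, from which \<sigma>
  is determined.\<close>

lemma trivial_embedding: "z \<in> roots \<Longrightarrow> cmod z \<noteq> 1 \<Longrightarrow> x \<in> F \<Longrightarrow> \<sigma> x = of_real x"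
proof -
  assume z: "z \<in> roots" "cmod z \<noteq> 1" and x: "x \<in> F"
  have "z + inverse z = of_real (l + inverse l)" using roots_cases[OF z(1)] z(2) by auto
  moreover obtain g where g: "x = qeval g (l + inverse l)" using F_trace[OF x] by blast
  ultimately have "\<sigma> x = qeval g (of_real (l + inverse l))"
    using embedding_trace[OF z(1), of g] x by (simp only: g)
  thus ?thesis by (simp only: qeval_of_real g)
qed

lemma map_trivial: "(\<And>x. x \<in> F \<Longrightarrow> \<sigma> x = of_real x) \<Longrightarrow> map_poly \<sigma> p = map_poly of_real p"
  using over by (intro poly_eqI) (simp add: coeff_map_poly coeffs_in_def)

lemma roots_l: "(\<And>x. x \<in> F \<Longrightarrow> \<sigma> x = of_real x) \<Longrightarrow> of_real l \<in> roots \<and> of_real (inverse l) \<in> roots"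
  using root root_inverse map_trivial by (simp only: roots_def mem_Collect_eq cpoly_of_real of_real_0)

text \<open>On the unit circle the inverse is the complex conjugate, and the image of
  \<open>p\<close> has real coefficients. Off the circle the embedding is trivial and the roots l
  and 1/l are exchanged.\<close>

lemma roots_inverse: "z \<in> roots \<Longrightarrow> inverse z \<in> roots"
proof -
  assume z: "z \<in> roots"
  show ?thesis
  proof (cases "cmod z = 1")
    case True
    hence "inverse z = cnj z" using complex_norm_square[of z] by (intro inverse_unique) simp
    moreover have "poly (map_poly \<sigma> p) (cnj z) = cnj (poly (map_poly \<sigma> p) z)"
    proof -
      have "cnj (\<sigma> (coeff p i)) = \<sigma> (coeff p i)" for i
        using real[of "coeff p i"] over by (simp add: coeffs_in_def Reals_cnj_iff)
      thus ?thesis by (simp add: poly_altdef coeff_map_poly)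
    qed
    ultimately show ?thesis using z by (simp add: roots_def)
  next
    case False
    have "of_real l \<in> roots \<and> of_real (inverse l) \<in> roots"
      by (rule roots_l) (rule trivial_embedding[OF z False])
    thus ?thesis using roots_cases[OF z] False by auto
  qed
qed

text \<open>The image of \<open>p\<close> divides an irreducible rational polynomial, so its roots
  are simple.\<close>

lemma decomposition: "map_poly \<sigma> p = (\<Prod>z\<in>roots. [:- z, 1:])"
  and finite_roots: "finite roots" and card_roots: "card roots = degree p"
proof -
  have nz: "map_poly \<sigma> p \<noteq> 0" using lead_map by auto
  show "finite roots" unfolding roots_def using nz by (rule poly_roots_finite)
  obtain q where q: "rat_irreducible q" "qeval q l = 0" using rational_polynomial by metis
  then obtain r where r: "coeffs_in F r" "map_poly of_rat q = r * p"
    using minimal[of "map_poly of_rat q"] by (auto simp: qeval_def)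
  have qr: "map_poly of_rat q = map_poly \<sigma> r * map_poly \<sigma> p"
    using map_poly_mult[OF r(1) over] r(2) map_poly_of_rat_comp by metis
  have "rsquarefree (map_poly \<sigma> p)"
    unfolding rsquarefree_roots
  proof (intro allI notI)
    fix z assume z: "poly (map_poly \<sigma> p) z = 0 \<and> poly (pderiv (map_poly \<sigma> p)) z = 0"
    have "qeval (pderiv q) z = 0" "qeval q z = 0"
      unfolding qeval_pderiv qr using z by (simp_all add: pderiv_mult qeval_def qr)
    thus False using irreducible_rat_poly_separable[OF q(1), of z] by blast
  qed
  from complex_poly_decompose_rsquarefree[OF this]
  show *: "map_poly \<sigma> p = (\<Prod>z\<in>roots. [:- z, 1:])" by (simp add: roots_def lead_map)
  have "degree p = degree (\<Prod>z\<in>roots. [:- z, 1:])" using degree_map by (simp only: *)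
  also have "\<dots> = card roots" by (subst degree_prod_eq_sum_degree) auto
  finally show "card roots = degree p" by simp
qed

lemma newton_mem: "newton (coeff p) m k \<in> F"
  using newton_hom[of "coeff p"] over by (simp add: coeffs_in_def)

lemma embedding_newton:
  assumes "k < degree p"
  shows "\<sigma> (newton (coeff p) (degree p) k) = (\<Sum>z\<in>roots. z ^ k)"
proof -
  have "\<sigma> (newton (coeff p) (degree p) k) = newton (\<lambda>i. \<sigma> (coeff p i)) (degree p) k"
    using newton_hom[of "coeff p"] over by (simp add: coeffs_in_def)
  also have "(\<lambda>i. \<sigma> (coeff p i)) = coeff (map_poly \<sigma> p)" by (simp add: fun_eq_iff coeff_map_poly)
  also have "newton \<dots> (degree p) k = (\<Sum>z\<in>roots. z ^ k)"
    by (rule newton_power_sum[OF finite_roots card_roots decomposition assms])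
  finally show ?thesis .
qed

lemma algebraic_int_root: "z \<in> roots \<Longrightarrow> algebraic_int z"
proof -
  assume z: "z \<in> roots"
  obtain g where g: "lead_coeff g = 1" "ieval g l = 0"
    using algebraic_int_l unfolding algebraic_int_iff_ieval by blast
  hence "ieval g z = 0" using qeval_roots[OF _ z] by (simp add: ieval_qeval)
  thus ?thesis using g(1) unfolding algebraic_int_iff_ieval by blast
qed

text \<open>Coefficients are ring expressions in the roots. The inverse of the constant term is, up
  to sign, the product of the inverse roots, which are roots again; being a unit, it makes
  \<open>unshift\<close> integral.\<close>

lemma algebraic_int_coeff: "algebraic_int (\<sigma> (coeff p i))" "algebraic_int (inverse (\<sigma> (coeff p 0)))"
proof -
  have "algebraic_int (coeff (\<Prod>z\<in>roots. [:- z, 1:]) i)"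
    by (rule algebraic_int_prod_poly)
       (auto simp: coeff_pCons algebraic_int_root split: nat.splits)
  thus "algebraic_int (\<sigma> (coeff p i))" by (simp add: coeff_map_poly flip: decomposition)
  have "\<sigma> (coeff p 0) = poly (map_poly \<sigma> p) 0" by (simp add: poly_0_coeff_0 coeff_map_poly)
  also have "\<dots> = (\<Prod>z\<in>roots. - z)" by (simp only: decomposition poly_prod) simp
  finally have "inverse (\<sigma> (coeff p 0)) = (\<Prod>z\<in>roots. - inverse z)"
    by (simp add: prod_inversef[symmetric] comp_def)
  thus "algebraic_int (inverse (\<sigma> (coeff p 0)))"
    by (simp only:) (intro algebraic_int_prod algebraic_int_minus algebraic_int_root roots_inverse)
qed

end

subsection \<open>Trace forms\<close>

text \<open>\<open>f\<close> numbers the coordinates: those with number below \<open>m\<close> are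
  the coefficients of a polynomial of degree less than \<open>m\<close>, the others carry the
  additional squares. In truncated subtraction \<open>f i - f j + (f j - f i)\<close> is the
  absolute difference.\<close>

locale trace_form =
  fixes f :: "'i::finite \<Rightarrow> nat" and m :: nat and R :: "complex set" and B :: "real ^ 'i ^ 'i"
  assumes inj_f: "inj f" and finite_R: "finite R" and card_R: "card R = m"
    and R_inverse: "z \<in> R \<Longrightarrow> inverse z \<in> R" and R_nonzero: "0 \<notin> R"
    and B: "of_real (B $ i $ j) = (if f i < m \<and> f j < m
      then \<Sum>z\<in>R. z ^ (f i - f j + (f j - f i)) else if i = j then 1 else 0)"
begin

text \<open>The value at \<open>z\<close> of the polynomial whose coefficients are the coordinates
  numbered below \<open>m\<close>.\<close>

definition ev :: "complex \<Rightarrow> real ^ 'i \<Rightarrow> complex"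
  where "ev z x = (\<Sum>i\<in>UNIV. of_real (x $ i) * (if f i < m then z ^ f i else 0))"

definition rest :: "real ^ 'i \<Rightarrow> real ^ 'i \<Rightarrow> real"
  where "rest x y = (\<Sum>i\<in>UNIV. if f i < m then 0 else x $ i * y $ i)"

lemma ev_linear: "ev z (x + y) = ev z x + ev z y" "ev z (x - y) = ev z x - ev z y"
    "ev z (c *\<^sub>R x) = of_real c * ev z x"
  by (simp_all add: ev_def sum.distrib sum_subtractf distrib_right left_diff_distrib sum_distrib_left mult_ac)

lemma ev_cnj: "ev (cnj z) x = cnj (ev z x)"
  unfolding ev_def cnj_sum by (intro sum.cong refl) simp

lemma sum_R_inverse: "(\<Sum>z\<in>R. g (inverse z)) = (\<Sum>z\<in>R. g z)" for g :: "complex \<Rightarrow> complex"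
  by (rule sum.reindex_bij_witness[of _ inverse inverse]) (auto simp: R_inverse)

text \<open>For i < j the exponent j - i is turned into i - j by exchanging z and 1/z in the
  sum.\<close>

lemma power_sum_difference: "(\<Sum>z\<in>R. z ^ (i - j + (j - i))) = (\<Sum>z\<in>R. z ^ i * inverse z ^ j)"
proof (cases "j \<le> i")
  case True
  have "z ^ (i - j + (j - i)) = z ^ i * inverse z ^ j" if "z \<in> R" for z
  proof -
    have "z \<noteq> 0" using that R_nonzero by auto
    thus ?thesis using True by (simp add: power_diff divide_inverse power_inverse)
  qed
  thus ?thesis by (rule sum.cong[OF refl])
next
  case False
  have "(\<Sum>z\<in>R. z ^ (i - j + (j - i))) = (\<Sum>z\<in>R. inverse z ^ (i - j + (j - i)))"
    by (rule sum_R_inverse[symmetric])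
  also have "\<dots> = (\<Sum>z\<in>R. z ^ i * inverse z ^ j)"
  proof (rule sum.cong[OF refl])
    fix z assume "z \<in> R"
    hence "z \<noteq> 0" using R_nonzero by auto
    thus "inverse z ^ (i - j + (j - i)) = z ^ i * inverse z ^ j"
      using False by (simp add: power_diff field_simps)
  qed
  finally show ?thesis .
qed

lemma bform_ev: "of_real (bform B x y) = (\<Sum>z\<in>R. ev z x * ev (inverse z) y) + of_real (rest x y)"
proof -
  define c where "c z i = (if f i < m then z ^ f i else 0)" for z :: complex and i
  have Bc: "of_real (B $ i $ j) = (\<Sum>z\<in>R. c z i * c (inverse z) j) + (if i = j \<and> \<not> f i < m then 1 else 0)" for i j
    by (auto simp: B c_def power_sum_difference)
  have "of_real (bform B x y) = (\<Sum>i\<in>UNIV. \<Sum>j\<in>UNIV. of_real (x $ i * y $ j) * of_real (B $ i $ j) :: complex)"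
    by (simp add: bform_altdef mult_ac)
  also have "\<dots> = (\<Sum>i\<in>UNIV. \<Sum>j\<in>UNIV. \<Sum>z\<in>R. (of_real (x $ i) * c z i) * (of_real (y $ j) * c (inverse z) j))
      + (\<Sum>i\<in>UNIV. \<Sum>j\<in>UNIV. if i = j then (if f i < m then 0 else of_real (x $ i * y $ j)) else 0)"
    unfolding Bc distrib_left sum.distrib sum_distrib_left
    by (intro arg_cong2[of _ _ _ _ "(+)"] sum.cong refl) (auto simp: mult_ac)
  also have "(\<Sum>i\<in>UNIV. \<Sum>j\<in>UNIV. if i = j then (if f i < m then 0 else of_real (x $ i * y $ j)) else (0::complex))
      = of_real (rest x y)"
    unfolding rest_def of_real_sum by (intro sum.cong refl) (subst sum.delta'; simp)
  also have "(\<Sum>i\<in>UNIV. \<Sum>j\<in>UNIV. \<Sum>z\<in>R. (of_real (x $ i) * c z i) * (of_real (y $ j) * c (inverse z) j))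
      = (\<Sum>z\<in>R. ev z x * ev (inverse z) y)"
  proof -
    have "(\<Sum>i\<in>UNIV. \<Sum>j\<in>UNIV. \<Sum>z\<in>R. (of_real (x $ i) * c z i) * (of_real (y $ j) * c (inverse z) j))
        = (\<Sum>i\<in>UNIV. \<Sum>z\<in>R. \<Sum>j\<in>UNIV. (of_real (x $ i) * c z i) * (of_real (y $ j) * c (inverse z) j))"
      by (intro sum.cong refl sum.swap)
    also have "\<dots> = (\<Sum>z\<in>R. \<Sum>i\<in>UNIV. \<Sum>j\<in>UNIV. (of_real (x $ i) * c z i) * (of_real (y $ j) * c (inverse z) j))"
      by (rule sum.swap)
    also have "\<dots> = (\<Sum>z\<in>R. ev z x * ev (inverse z) y)"
      by (simp only: ev_def sum_product c_def)
    finally show ?thesis .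
  qed
  finally show ?thesis .
qed

text \<open>A polynomial of degree less than \<open>m\<close> that vanishes on the \<open>m\<close>
  elements of \<open>R\<close> is 0.\<close>

lemma ev_eq_0:
  assumes ev: "\<And>z. z \<in> R \<Longrightarrow> ev z x = 0" and i: "f i < m"
  shows "x $ i = 0"
proof -
  define g :: "complex poly" where "g = (\<Sum>i\<in>UNIV. if f i < m then monom (of_real (x $ i)) (f i) else 0)"
  have "poly g z = ev z x" for z
    unfolding g_def ev_def poly_sum by (intro sum.cong refl) (simp add: poly_monom)
  hence sub: "R \<subseteq> {z. poly g z = 0}" using ev by auto
  have "g = 0"
  proof (rule ccontr)
    assume g: "g \<noteq> 0"
    have "m \<le> card {z. poly g z = 0}" using card_mono[OF poly_roots_finite[OF g] sub] card_R by simp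
    also have "\<dots> \<le> degree g" using g by (rule card_poly_roots_bound)
    finally have "coeff g (degree g) = 0" unfolding g_def coeff_sum
      by (intro sum.neutral) (auto simp: coeff_monom)
    thus False using g by simp
  qed
  hence "coeff g (f i) = 0" by simp
  moreover have "coeff g (f i) = (\<Sum>k\<in>UNIV. if k = i then of_real (x $ i) else 0)"
    unfolding g_def coeff_sum using i inj_f by (intro sum.cong) (auto simp: inj_eq)
  ultimately show ?thesis by simp
qed

lemma ev_eqI:
  assumes "\<And>z. z \<in> R \<Longrightarrow> ev z x = ev z y" "\<And>i. \<not> f i < m \<Longrightarrow> x $ i = y $ i"
  shows "x = y"
proof -
  have "(x - y) $ i = 0" if "f i < m" for i
    by (rule ev_eq_0[OF _ that]) (simp add: ev_linear assms(1))
  thus ?thesis using assms(2) by (auto simp: vec_eq_iff)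
qed

lemma rest_nonneg: "rest x x \<ge> 0"
  unfolding rest_def by (intro sum_nonneg) auto

lemma rest_eq_0: "rest x x = 0 \<Longrightarrow> \<not> f i < m \<Longrightarrow> x $ i = 0"
proof -
  assume 0: "rest x x = 0" and i: "\<not> f i < m"
  have "\<forall>i\<in>UNIV. (if f i < m then 0 else x $ i * x $ i) = 0"
    using 0 unfolding rest_def by (subst (asm) sum_nonneg_eq_0_iff) auto
  thus ?thesis using i by (auto split: if_splits)
qed

lemma unit_circle_ev: "cmod z = 1 \<Longrightarrow> ev (inverse z) x = cnj (ev z x)"
proof -
  assume "cmod z = 1"
  hence "inverse z = cnj z" using complex_norm_square[of z] by (intro inverse_unique) simp
  thus ?thesis by (simp add: ev_cnj)
qed

lemma positive_definite_unit_circle: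
  assumes unit: "\<And>z. z \<in> R \<Longrightarrow> cmod z = 1"
  shows "positive_definite B"
  unfolding positive_definite_def
proof (intro allI impI)
  fix x :: "real ^ 'i" assume x: "x \<noteq> 0"
  define N where "N = (\<Sum>z\<in>R. (cmod (ev z x))\<^sup>2)"
  have "of_real (qform B x) = (\<Sum>z\<in>R. ev z x * cnj (ev z x)) + of_real (rest x x)"
    by (simp add: qform_bform bform_ev unit_circle_ev unit)
  also have "\<dots> = of_real (N + rest x x)"
    unfolding N_def of_real_add of_real_sum complex_norm_square ..
  finally have q: "qform B x = N + rest x x" by (simp only: of_real_eq_iff)
  have N: "N \<ge> 0" unfolding N_def by (intro sum_nonneg) auto
  have "N + rest x x \<noteq> 0"
  proof
    assume "N + rest x x = 0"
    hence N0: "N = 0" and r0: "rest x x = 0" using N rest_nonneg[of x] by linarith+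
    have "\<forall>z\<in>R. (cmod (ev z x))\<^sup>2 = 0"
      using N0 finite_R unfolding N_def by (subst (asm) sum_nonneg_eq_0_iff) auto
    hence "x = 0" by (intro ev_eqI) (use rest_eq_0[OF r0] in \<open>auto simp: ev_def\<close>)
    with x show False by blast
  qed
  thus "qform B x > 0" using q N rest_nonneg[of x] by linarith
qed

end

text \<open>Meant for the identity embedding, the only one whose root set leaves the unit
  circle.\<close>

locale salem_trace_form = trace_form f m R B
  for f :: "'i::finite \<Rightarrow> nat" and m R B +
  fixes l :: real and p :: "real poly"
  assumes l: "l > 1" and l_R: "of_real l \<in> R"
    and R_cases: "z \<in> R \<Longrightarrow> z = of_real l \<or> z = of_real (inverse l) \<or> cmod z = 1"
    and R_roots: "z \<in> R \<Longrightarrow> cpoly p z = 0"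
    and p_monic: "lead_coeff p = 1" and p_degree: "degree p = m"
    and f_range: "{..<m} \<subseteq> range f"
begin

definition er :: "real \<Rightarrow> real ^ 'i \<Rightarrow> real"
  where "er y x = (\<Sum>i\<in>UNIV. x $ i * (if f i < m then y ^ f i else 0))"

lemma ev_of_real: "ev (of_real y) x = of_real (er y x)"
  unfolding ev_def er_def of_real_sum by (intro sum.cong refl) simp

definition circle :: "complex set" where "circle = R - {of_real l, of_real (inverse l)}"

lemma circle: "z \<in> circle \<Longrightarrow> cmod z = 1" "circle \<subseteq> R" "finite circle"
  using R_cases finite_R by (auto simp: circle_def)

lemma inverse_l_R: "of_real (inverse l) \<in> R"
  using R_inverse[OF l_R] by simp

lemma l_ne: "l \<noteq> inverse l"
proof -
  have "inverse l < 1" using l by (simp add: inverse_less_1_iff)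
  thus ?thesis using l by linarith
qed

lemma index: assumes "k < m" obtains i where "f i = k"
proof -
  have "k \<in> range f" using f_range assms by auto
  then obtain i where "k = f i" by (rule rangeE)
  thus ?thesis by (intro that[of i]) simp
qed

lemma m_pos: "m > 0"
proof -
  have "R \<noteq> {}" using l_R by auto
  hence "card R > 0" unfolding card_gt_0_iff using finite_R by simp
  thus ?thesis by (simp add: card_R)
qed

lemma bform_er: "bform B x y = er l x * er (inverse l) y + er (inverse l) x * er l y
    + (\<Sum>z\<in>circle. Re (ev z x * cnj (ev z y))) + rest x y"
proof -
  have ne: "(of_real l :: complex) \<noteq> of_real (inverse l)"
    using l_ne unfolding of_real_eq_iff .
  have "(\<Sum>z\<in>R. ev z x * ev (inverse z) y) = (\<Sum>z\<in>circle. ev z x * ev (inverse z) y)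
      + (\<Sum>z\<in>{of_real l, of_real (inverse l)}. ev z x * ev (inverse z) y)"
    unfolding circle_def by (rule sum.subset_diff) (use l_R inverse_l_R finite_R in auto)
  also have "(\<Sum>z\<in>{of_real l, of_real (inverse l)}. ev z x * ev (inverse z) y)
      = ev (of_real l) x * ev (of_real (inverse l)) y + ev (of_real (inverse l)) x * ev (of_real l) y"
    using ne by simp
  also have "(\<Sum>z\<in>circle. ev z x * ev (inverse z) y) = (\<Sum>z\<in>circle. ev z x * cnj (ev z y))"
    using circle(1) by (simp add: unit_circle_ev)
  finally have "Re (of_real (bform B x y)) = Re ((\<Sum>z\<in>circle. ev z x * cnj (ev z y)) +
      of_real (er l x * er (inverse l) y + er (inverse l) x * er l y) + of_real (rest x y))"
    unfolding bform_ev ev_of_real by (simp only: of_real_mult of_real_add)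
  thus ?thesis by (simp only: Re_complex_of_real plus_complex.sel Re_sum)
qed

definition pos :: "real ^ 'i \<Rightarrow> real"
  where "pos x = (\<Sum>z\<in>circle. (cmod (ev z x))\<^sup>2) + rest x x"

lemma qform_er: "qform B x = 2 * (er l x * er (inverse l) x) + pos x"
proof -
  have "Re (w * cnj w) = (cmod w)\<^sup>2" for w
    by (simp only: complex_norm_square[symmetric] Re_complex_of_real)
  thus ?thesis by (simp only: qform_bform bform_er pos_def) simp
qed

lemma pos_nonneg: "pos x \<ge> 0"
  unfolding pos_def by (intro add_nonneg_nonneg sum_nonneg rest_nonneg) auto

lemma pos_eq_0:
  assumes "pos x = 0" "er l x = 0" "er (inverse l) x = 0"
  shows "x = 0"
proof -
  have N: "(\<Sum>z\<in>circle. (cmod (ev z x))\<^sup>2) \<ge> 0" by (intro sum_nonneg) auto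
  hence N0: "(\<Sum>z\<in>circle. (cmod (ev z x))\<^sup>2) = 0" and r0: "rest x x = 0"
    using assms(1) rest_nonneg[of x] unfolding pos_def by linarith+
  have c: "\<forall>z\<in>circle. (cmod (ev z x))\<^sup>2 = 0"
    using N0 circle(3) by (subst (asm) sum_nonneg_eq_0_iff) auto
  show ?thesis
  proof (rule ev_eqI)
    fix z assume "z \<in> R"
    hence "z \<in> circle \<or> z = of_real l \<or> z = of_real (inverse l)" by (auto simp: circle_def)
    hence "ev z x = 0"
    proof (elim disjE)
      assume "z \<in> circle" with c show ?thesis by simp
    qed (simp_all only: ev_of_real assms of_real_0)
    thus "ev z x = ev z 0" by (simp add: ev_def)
  qed (use rest_eq_0[OF r0] in auto)
qed

definition vec_of :: "real poly \<Rightarrow> real ^ 'i"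
  where "vec_of g = (\<chi> i. if f i < m then coeff g (f i) else 0)"

lemma sum_reindex: "(\<Sum>i\<in>UNIV. if f i < m then F (f i) else 0) = (\<Sum>k<m. F k)"
proof -
  have "f ` {i. f i < m} = {..<m}" using f_range by blast
  moreover have "inj_on f {i. f i < m}" using inj_f by (rule inj_on_subset) simp
  ultimately have "(\<Sum>k<m. F k) = (\<Sum>i | f i < m. F (f i))"
    using sum.reindex[of f "{i. f i < m}" F] by (simp add: comp_def)
  thus ?thesis by (simp add: sum.If_cases)
qed

lemma ev_vec_of:
  assumes "degree g < m"
  shows "ev z (vec_of g) = cpoly g z"
proof -
  have "ev z (vec_of g) = (\<Sum>i\<in>UNIV. if f i < m then of_real (coeff g (f i)) * z ^ f i else 0)"
    unfolding ev_def vec_of_def by (intro sum.cong) auto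
  also have "\<dots> = (\<Sum>k<m. of_real (coeff g k) * z ^ k)" by (rule sum_reindex)
  also have "\<dots> = (\<Sum>k\<le>degree g. of_real (coeff g k) * z ^ k)"
    using assms by (intro sum.mono_neutral_right) (auto simp: coeff_eq_0)
  also have "\<dots> = cpoly g z" by (simp add: poly_altdef coeff_map_poly degree_map_poly)
  finally show ?thesis .
qed

text \<open>The coefficient vector of p / (x - y) vanishes at all other roots. It cannot vanish at y
  as well, having degree less than \<open>m\<close>. These vectors become the eigenvectors of
  \<open>shift\<close>.\<close>

lemma dual_vector:
  assumes y: "of_real y \<in> R"
  shows "\<exists>a. er y a \<noteq> 0 \<and> (\<forall>z\<in>R. z \<noteq> of_real y \<longrightarrow> ev z a = 0) \<and> (\<forall>i. \<not> f i < m \<longrightarrow> a $ i = 0)"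
proof -
  have "poly p y = 0" using R_roots[OF y] by (simp add: cpoly_of_real)
  then obtain g where g: "p = [:- y, 1:] * g" unfolding poly_eq_0_iff_dvd by blast
  have "p \<noteq> 0" using p_monic by auto
  hence g0: "g \<noteq> 0" using g by auto
  have "degree p = Suc (degree g)" unfolding g using g0 by (subst degree_mult_eq) auto
  hence deg: "degree g < m" by (simp add: p_degree)
  define a where "a = vec_of g"
  have ev0: "ev z a = 0" if "z \<in> R" "z \<noteq> of_real y" for z
  proof -
    have "cpoly [:- y, 1:] z * cpoly g z = 0" using R_roots[OF that(1)] unfolding g cpoly_mult .
    moreover have "cpoly [:- y, 1:] z \<noteq> 0" using that(2) by (simp add: map_poly_pCons)
    ultimately show ?thesis by (simp add: a_def ev_vec_of[OF deg])
  qed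
  have "er y a \<noteq> 0"
  proof
    assume "er y a = 0"
    hence "ev z a = 0" if "z \<in> R" for z using ev0[OF that] by (cases "z = of_real y") (simp_all add: ev_of_real)
    hence ai: "a $ i = 0" if "f i < m" for i by (rule ev_eq_0[OF _ that])
    obtain i where "f i = degree g" using deg by (rule index)
    hence "lead_coeff g = 0" using ai[of i] deg by (simp add: a_def vec_of_def)
    thus False using g0 by simp
  qed
  moreover have "a $ i = 0" if "\<not> f i < m" for i using that by (simp add: a_def vec_of_def)
  ultimately show ?thesis using ev0 by blast
qed

text \<open>Multiplication by the variable, and its inverse, modulo \<open>p\<close>.\<close>

definition shift :: "real ^ 'i ^ 'i"
  where "shift = (\<chi> i j. if f i < m \<and> f j < m
     then (if f i = Suc (f j) then 1 else 0) - (if Suc (f j) = m then coeff p (f i) else 0)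
     else if i = j then 1 else 0)"

definition unshift :: "real ^ 'i ^ 'i"
  where "unshift = (\<chi> i j. if f i < m \<and> f j < m
     then (if f j = Suc (f i) then 1 else 0) - (if f j = 0 then coeff p (Suc (f i)) / coeff p 0 else 0)
     else if i = j then 1 else 0)"

lemma ev_matrix:
  assumes 0: "\<And>i j. f i < m \<Longrightarrow> \<not> f j < m \<Longrightarrow> T $ i $ j = 0"
    and col: "\<And>j. f j < m \<Longrightarrow> (\<Sum>i\<in>UNIV. if f i < m then of_real (T $ i $ j) * z ^ f i else 0) = w * z ^ f j"
  shows "ev z (T *v x) = w * ev z x"
proof -
  have "ev z (T *v x) = (\<Sum>i\<in>UNIV. \<Sum>j\<in>UNIV. of_real (x $ j) * (if f i < m then of_real (T $ i $ j) * z ^ f i else 0))"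
    unfolding ev_def matrix_vector_mult_def by (intro sum.cong) (auto simp: sum_distrib_right sum_distrib_left mult_ac)
  also have "\<dots> = (\<Sum>j\<in>UNIV. of_real (x $ j) * (\<Sum>i\<in>UNIV. if f i < m then of_real (T $ i $ j) * z ^ f i else 0))"
    by (subst sum.swap) (simp add: sum_distrib_left)
  also have "\<dots> = (\<Sum>j\<in>UNIV. of_real (x $ j) * (w * (if f j < m then z ^ f j else 0)))"
  proof (rule sum.cong[OF refl])
    fix j
    have "(\<Sum>i\<in>UNIV. if f i < m then of_real (T $ i $ j) * z ^ f i else 0) = w * (if f j < m then z ^ f j else 0)"
    proof (cases "f j < m")
      case False
      hence "(\<Sum>i\<in>UNIV. if f i < m then of_real (T $ i $ j) * z ^ f i else 0) = 0"
        by (intro sum.neutral) (auto simp: 0)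
      thus ?thesis using False by simp
    qed (simp add: col)
    thus "of_real (x $ j) * (\<Sum>i\<in>UNIV. if f i < m then of_real (T $ i $ j) * z ^ f i else 0)
        = of_real (x $ j) * (w * (if f j < m then z ^ f j else 0))" by (rule arg_cong)
  qed
  also have "\<dots> = w * ev z x" by (simp add: ev_def sum_distrib_left mult_ac)
  finally show ?thesis .
qed

lemma root_sum:
  assumes "z \<in> R"
  shows "(\<Sum>k<m. of_real (coeff p k) * z ^ k) = - (z ^ m)"
    "z * (\<Sum>k<m. of_real (coeff p (Suc k)) * z ^ k) = - of_real (coeff p 0)"
proof -
  have 0: "(\<Sum>k\<le>m. of_real (coeff p k) * z ^ k) = 0"
    using R_roots[OF assms] by (simp add: poly_altdef coeff_map_poly degree_map_poly p_degree)
  have cm: "coeff p m = 1" using p_monic by (simp add: p_degree)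
  have "(\<Sum>k<m. of_real (coeff p k) * z ^ k) + z ^ m = 0" using 0 cm by (simp add: lessThan_Suc_atMost[symmetric])
  thus "(\<Sum>k<m. of_real (coeff p k) * z ^ k) = - (z ^ m)" by (simp add: add_eq_0_iff2)
  have "of_real (coeff p 0) + z * (\<Sum>k<m. of_real (coeff p (Suc k)) * z ^ k) = 0"
  proof -
    have "(\<Sum>k\<le>m. of_real (coeff p k) * z ^ k) =
        of_real (coeff p 0) * z ^ 0 + (\<Sum>k<m. of_real (coeff p (Suc k)) * z ^ Suc k)"
      by (simp only: lessThan_Suc_atMost[symmetric] sum.lessThan_Suc_shift)
    moreover have "(\<Sum>k<m. of_real (coeff p (Suc k)) * z ^ Suc k) = z * (\<Sum>k<m. of_real (coeff p (Suc k)) * z ^ k)"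
      unfolding sum_distrib_left by (intro sum.cong refl) simp
    ultimately show ?thesis using 0 by simp
  qed
  thus "z * (\<Sum>k<m. of_real (coeff p (Suc k)) * z ^ k) = - of_real (coeff p 0)" by (simp add: add_eq_0_iff)
qed

text \<open>Otherwise p / x, which has degree m - 1, would vanish at all \<open>m\<close> elements
  of \<open>R\<close>, as none of them is 0.\<close>

lemma coeff_0: "coeff p 0 \<noteq> 0"
proof
  assume "coeff p 0 = 0"
  hence "(\<Sum>k<m. of_real (coeff p (Suc k)) * z ^ k) = 0" if "z \<in> R" for z
  proof -
    have "z \<noteq> 0" using that R_nonzero by auto
    moreover have "z * (\<Sum>k<m. of_real (coeff p (Suc k)) * z ^ k) = 0"
      unfolding root_sum(2)[OF that] using \<open>coeff p 0 = 0\<close> by simp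
    ultimately show ?thesis by (simp only: mult_eq_0_iff) simp
  qed
  moreover have "ev z (\<chi> i. coeff p (Suc (f i))) = (\<Sum>k<m. of_real (coeff p (Suc k)) * z ^ k)" for z
  proof -
    have "ev z (\<chi> i. coeff p (Suc (f i))) = (\<Sum>i\<in>UNIV. if f i < m then of_real (coeff p (Suc (f i))) * z ^ f i else 0)"
      unfolding ev_def by (intro sum.cong refl) simp
    also have "\<dots> = (\<Sum>k<m. of_real (coeff p (Suc k)) * z ^ k)" by (rule sum_reindex)
    finally show ?thesis .
  qed
  ultimately have ev: "ev z (\<chi> i. coeff p (Suc (f i))) = 0" if "z \<in> R" for z using that by simp
  have "m - 1 < m" using m_pos by simp
  then obtain i where "f i = m - 1" by (rule index)
  hence i: "Suc (f i) = m" using m_pos by simp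
  hence "f i < m" by simp
  have "(\<chi> i. coeff p (Suc (f i))) $ i = 0" by (rule ev_eq_0[OF ev \<open>f i < m\<close>])
  hence "coeff p m = 0" by (simp add: i)
  thus False using p_monic by (simp add: p_degree)
qed

lemma ev_shift: "z \<in> R \<Longrightarrow> ev z (shift *v x) = z * ev z x"
proof (rule ev_matrix)
  fix j assume z: "z \<in> R" and j: "f j < m"
  have "(\<Sum>i\<in>UNIV. if f i < m then of_real (shift $ i $ j) * z ^ f i else 0)
      = (\<Sum>i\<in>UNIV. if f i < m then ((if f i = Suc (f j) then 1 else 0)
          - (if Suc (f j) = m then of_real (coeff p (f i)) else 0)) * z ^ f i else 0)"
    using j by (intro sum.cong) (auto simp: shift_def)
  also have "\<dots> = (\<Sum>k<m. ((if k = Suc (f j) then 1 else 0) - (if Suc (f j) = m then of_real (coeff p k) else 0)) * z ^ k)"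
    by (rule sum_reindex)
  also have "\<dots> = z * z ^ f j"
  proof (cases "Suc (f j) = m")
    case True
    have "(\<Sum>k<m. ((if k = Suc (f j) then 1 else 0) - (if Suc (f j) = m then of_real (coeff p k) else 0)) * z ^ k)
        = (\<Sum>k<m. - (of_real (coeff p k) * z ^ k))"
      using True by (intro sum.cong) auto
    also have "\<dots> = z ^ m" by (simp only: sum_negf root_sum(1)[OF z] minus_minus)
    finally show ?thesis by (simp flip: True)
  next
    case False
    have "(\<Sum>k<m. ((if k = Suc (f j) then 1 else 0) - (if Suc (f j) = m then of_real (coeff p k) else 0)) * z ^ k)
        = (\<Sum>k<m. if k = Suc (f j) then z ^ k else 0)"
      using False by (intro sum.cong) auto
    thus ?thesis using False j by simp
  qed
  finally show "(\<Sum>i\<in>UNIV. if f i < m then of_real (shift $ i $ j) * z ^ f i else 0) = z * z ^ f j" .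
qed (auto simp: shift_def)

lemma ev_unshift: "z \<in> R \<Longrightarrow> ev z (unshift *v x) = inverse z * ev z x"
proof (rule ev_matrix)
  fix j assume z: "z \<in> R" and j: "f j < m"
  have z0: "z \<noteq> 0" using z R_nonzero by auto
  have "(\<Sum>i\<in>UNIV. if f i < m then of_real (unshift $ i $ j) * z ^ f i else 0)
      = (\<Sum>i\<in>UNIV. if f i < m then ((if f j = Suc (f i) then 1 else 0)
          - (if f j = 0 then of_real (coeff p (Suc (f i))) / of_real (coeff p 0) else 0)) * z ^ f i else 0)"
    using j by (intro sum.cong) (auto simp: unshift_def)
  also have "\<dots> = (\<Sum>k<m. ((if f j = Suc k then 1 else 0)
      - (if f j = 0 then of_real (coeff p (Suc k)) / of_real (coeff p 0) else 0)) * z ^ k)"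
    by (rule sum_reindex)
  also have "\<dots> = inverse z * z ^ f j"
  proof (cases "f j")
    \<comment> \<open>This column represents 1/x: modulo \<open>p\<close> it equals minus the sum of
      coeff p (k + 1) x^k, divided by p(0).\<close>
    case 0
    have "(\<Sum>k<m. ((if f j = Suc k then 1 else 0)
      - (if f j = 0 then of_real (coeff p (Suc k)) / of_real (coeff p 0) else 0)) * z ^ k)
        = - ((\<Sum>k<m. of_real (coeff p (Suc k)) * z ^ k) / of_real (coeff p 0))"
      using 0 by (simp add: sum_divide_distrib sum_negf)
    also have "\<dots> = inverse z" using root_sum(2)[OF z] z0 coeff_0 by (simp add: field_simps)
    finally show ?thesis using 0 by simp
  next
    case (Suc k')
    have "(\<Sum>k<m. ((if f j = Suc k then 1 else 0)
      - (if f j = 0 then of_real (coeff p (Suc k)) / of_real (coeff p 0) else 0)) * z ^ k)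
        = (\<Sum>k<m. if k = k' then z ^ k else 0)"
      using Suc by (intro sum.cong) auto
    thus ?thesis using Suc j z0 by simp
  qed
  finally show "(\<Sum>i\<in>UNIV. if f i < m then of_real (unshift $ i $ j) * z ^ f i else 0) = inverse z * z ^ f j" .
qed (auto simp: unshift_def)

lemma shift_rest: "\<not> f i < m \<Longrightarrow> (shift *v x) $ i = x $ i" "\<not> f i < m \<Longrightarrow> (unshift *v x) $ i = x $ i"
proof -
  assume i: "\<not> f i < m"
  have "(shift *v x) $ i = (\<Sum>j\<in>UNIV. if i = j then x $ j else 0)"
    "(unshift *v x) $ i = (\<Sum>j\<in>UNIV. if i = j then x $ j else 0)"
    unfolding matrix_vector_mult_def shift_def unshift_def vec_lambda_beta
    by (rule sum.cong; use i in simp)+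
  thus "(shift *v x) $ i = x $ i" "(unshift *v x) $ i = x $ i" by simp_all
qed

lemma shift_unshift: "shift ** unshift = mat 1" "unshift ** shift = mat 1"
proof -
  have "unshift *v (shift *v x) = x" for x
  proof (rule ev_eqI)
    fix z assume z: "z \<in> R"
    hence "z \<noteq> 0" using R_nonzero by auto
    hence "inverse z * (z * w) = w" for w by simp
    thus "ev z (unshift *v (shift *v x)) = ev z x" by (simp only: ev_unshift[OF z] ev_shift[OF z])
  qed (simp add: shift_rest)
  hence "(unshift ** shift) *v x = mat 1 *v x" for x by (simp flip: matrix_vector_mul_assoc)
  hence *: "unshift ** shift = mat 1" unfolding matrix_eq by blast
  show "unshift ** shift = mat 1" by (rule *)
  show "shift ** unshift = mat 1" using * unfolding matrix_left_right_inverse[of unshift] .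
qed

lemma rest_shift: "rest x (shift *v y) = rest x y" "rest (shift *v x) (shift *v y) = rest x y"
proof -
  have 1: "(if f i < m then 0 else x $ i * (shift *v y) $ i) = (if f i < m then 0 else x $ i * y $ i)"
    "(if f i < m then 0 else (shift *v x) $ i * (shift *v y) $ i) = (if f i < m then 0 else x $ i * y $ i)" for i
    by (simp_all add: shift_rest(1) split: if_split)
  show "rest x (shift *v y) = rest x y" "rest (shift *v x) (shift *v y) = rest x y"
    unfolding rest_def 1 by (rule refl)+
qed

lemma shift_preserves: "bform B (shift *v x) (shift *v y) = bform B x y"
proof -
  have "ev z (shift *v x) * ev (inverse z) (shift *v y) = ev z x * ev (inverse z) y" if z: "z \<in> R" for z
  proof -
    have "z \<noteq> 0" using z R_nonzero by auto
    hence "z * a * (inverse z * b) = a * b" for a b by simp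
    thus ?thesis by (simp only: ev_shift[OF z] ev_shift[OF R_inverse[OF z]])
  qed
  hence "(\<Sum>z\<in>R. ev z (shift *v x) * ev (inverse z) (shift *v y)) = (\<Sum>z\<in>R. ev z x * ev (inverse z) y)"
    by (rule sum.cong[OF refl])
  hence "(of_real (bform B (shift *v x) (shift *v y)) :: complex) = of_real (bform B x y)"
    by (simp only: bform_ev rest_shift(2))
  thus ?thesis by (simp only: of_real_eq_iff)
qed

lemma er_shift: "of_real y \<in> R \<Longrightarrow> er y (shift *v x) = y * er y x"
proof -
  assume y: "of_real y \<in> R"
  have "(of_real (er y (shift *v x)) :: complex) = of_real (y * er y x)"
    using ev_shift[OF y, of x] unfolding ev_of_real of_real_mult .
  thus ?thesis unfolding of_real_eq_iff .
qed

text \<open>Provides the condition of \<open>O_primeI\<close>. At a negative vector the product e of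
  the values at l and 1/l is negative, and its coefficient rises from 2 to l + 1/l, whereas the
  contributions of the unit circle do not grow.\<close>

lemma shift_negative:
  assumes "qform B x < 0"
  shows "bform B x (shift *v x) < 0"
proof -
  define e where "e = er l x * er (inverse l) x"
  have e: "e < 0" using assms pos_nonneg[of x] unfolding qform_er e_def by linarith
  have c: "Re (ev z x * cnj (ev z (shift *v x))) \<le> (cmod (ev z x))\<^sup>2" if "z \<in> circle" for z
  proof -
    have "z \<in> R" using that circle(2) by blast
    have "Re (ev z x * cnj (ev z (shift *v x))) \<le> cmod (ev z x * cnj (ev z (shift *v x)))" by (rule complex_Re_le_cmod)
    also have "\<dots> = (cmod (ev z x))\<^sup>2"
      using circle(1)[OF that] by (simp add: ev_shift[OF \<open>z \<in> R\<close>] norm_mult power2_eq_square)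
    finally show ?thesis .
  qed
  have "bform B x (shift *v x) \<le> (l + inverse l) * e + pos x"
    unfolding bform_er er_shift[OF l_R] er_shift[OF inverse_l_R] rest_shift pos_def e_def using sum_mono[OF c] by (simp add: algebra_simps)
  also have "(l + inverse l) * e \<le> 2 * e"
  proof -
    have "0 < (l - 1) * (l - 1)" using l by simp
    also have "\<dots> = l * (l + inverse l - 2)"
      using l by (simp add: distrib_left distrib_right left_diff_distrib right_diff_distrib)
    finally have "2 \<le> l + inverse l" using l by (simp add: zero_less_mult_iff)
    thus ?thesis using e by (intro mult_right_mono_neg) auto
  qed
  finally show ?thesis using assms by (simp add: qform_er e_def)
qed

lemma null_eigenvectors:
  obtains a b u where "shift *v a = l *\<^sub>R a" "shift *v b = inverse l *\<^sub>R b"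
    "qform B a = 0" "qform B b = 0" "bform B a b \<noteq> 0" "qform B u < 0"
    "\<And>z. bform B z u = 0 \<Longrightarrow> z \<noteq> 0 \<Longrightarrow> qform B z > 0"
proof -
  note ne = l_ne
  obtain a where a: "er l a \<noteq> 0" "\<And>z. z \<in> R \<Longrightarrow> z \<noteq> of_real l \<Longrightarrow> ev z a = 0" "\<And>i. \<not> f i < m \<Longrightarrow> a $ i = 0"
    using dual_vector[OF l_R] by blast
  obtain b where b: "er (inverse l) b \<noteq> 0" "\<And>z. z \<in> R \<Longrightarrow> z \<noteq> of_real (inverse l) \<Longrightarrow> ev z b = 0"
    "\<And>i. \<not> f i < m \<Longrightarrow> b $ i = 0"
    using dual_vector[OF inverse_l_R] by blast
  have ab0: "er (inverse l) a = 0" "er l b = 0"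
  proof -
    have "(of_real (er (inverse l) a) :: complex) = 0"
      using a(2)[OF inverse_l_R] ne[symmetric] unfolding ev_of_real of_real_eq_iff by blast
    moreover have "(of_real (er l b) :: complex) = 0"
      using b(2)[OF l_R] ne unfolding ev_of_real of_real_eq_iff by blast
    ultimately show "er (inverse l) a = 0" "er l b = 0" by (simp_all only: of_real_eq_0_iff)
  qed
  have circ0: "ev z a = 0" "ev z b = 0" if "z \<in> circle" for z
  proof -
    have z: "z \<in> R" "z \<noteq> of_real l" "z \<noteq> of_real (inverse l)" using that by (simp_all add: circle_def)
    show "ev z a = 0" "ev z b = 0" by (rule a(2)[OF z(1,2)], rule b(2)[OF z(1,3)])
  qed
  have rest0: "rest x a = 0" "rest x b = 0" for x
    unfolding rest_def by (simp_all add: a(3) b(3) cong: if_cong)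
  have bfa: "bform B x a = er (inverse l) x * er l a" and bfb: "bform B x b = er l x * er (inverse l) b" for x
    unfolding bform_er using circ0 by (simp_all add: ab0 rest0)
  have sa: "shift *v a = l *\<^sub>R a"
  proof (rule ev_eqI)
    fix z assume z: "z \<in> R"
    show "ev z (shift *v a) = ev z (l *\<^sub>R a)"
    proof (cases "z = of_real l")
      case True
      thus ?thesis unfolding ev_shift[OF z] ev_linear by (rule arg_cong)
    next
      case False
      thus ?thesis unfolding ev_shift[OF z] ev_linear by (simp add: a(2)[OF z])
    qed
  qed (simp add: shift_rest a(3))
  have sb: "shift *v b = inverse l *\<^sub>R b"
  proof (rule ev_eqI)
    fix z assume z: "z \<in> R"
    show "ev z (shift *v b) = ev z (inverse l *\<^sub>R b)"
    proof (cases "z = of_real (inverse l)")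
      case True
      thus ?thesis unfolding ev_shift[OF z] ev_linear by (rule arg_cong)
    next
      case False
      thus ?thesis unfolding ev_shift[OF z] ev_linear by (simp add: b(2)[OF z])
    qed
  qed (simp add: shift_rest b(3))
  \<comment> \<open>The scaling of \<open>u\<close> makes its product with z equal to z(1/l) - z(l),
    where z(y) stands for \<open>er y z\<close>. For z orthogonal to \<open>u\<close> the hyperbolic
    part 2 z(l) z(1/l) is then 2 z(l)^2.\<close>
  define \<alpha> \<beta> where "\<alpha> = er l a" and "\<beta> = er (inverse l) b"
  define u where "u = inverse \<alpha> *\<^sub>R a - inverse \<beta> *\<^sub>R b"
  have \<alpha>\<beta>: "\<alpha> \<noteq> 0" "\<beta> \<noteq> 0" using a(1) b(1) by (simp_all add: \<alpha>_def \<beta>_def)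
  have bu: "bform B z u = er (inverse l) z - er l z" for z
  proof -
    have *: "inverse \<alpha> * (c * \<alpha>) = c" "inverse \<beta> * (c * \<beta>) = c" for c using \<alpha>\<beta> by simp_all
    show ?thesis unfolding u_def bform_linear bfa bfb \<alpha>_def[symmetric] \<beta>_def[symmetric] * ..
  qed
  have er_u: "er y u = inverse \<alpha> * er y a - inverse \<beta> * er y b" for y
    unfolding er_def u_def sum_distrib_left sum_subtractf[symmetric]
    by (intro sum.cong refl) (simp add: algebra_simps)
  have "qform B u = - 2"
    unfolding qform_bform bu er_u ab0 \<alpha>_def[symmetric] \<beta>_def[symmetric] using \<alpha>\<beta> by simp
  moreover have "qform B z > 0" if z: "bform B z u = 0" "z \<noteq> 0" for z
  proof -
    have e: "er (inverse l) z = er l z" using z(1) by (simp add: bu)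
    have "pos z \<noteq> 0 \<or> er l z \<noteq> 0" using pos_eq_0[of z] z(2) e by auto
    hence "0 < 2 * (er l z * er l z) + pos z"
      using pos_nonneg[of z] by (smt (verit) mult_nonneg_nonneg not_real_square_gt_zero)
    thus ?thesis by (simp add: qform_er e)
  qed
  moreover have "qform B a = 0" "qform B b = 0" "bform B a b \<noteq> 0"
    using a(1) b(1) by (simp_all add: qform_bform bfa bfb ab0)
  ultimately show ?thesis using sa sb by (intro that[of a b u]) simp_all
qed

end

section \<open>The arithmetic lattice of a Salem number\<close>

lemma commensurable_O_prime_self:
  assumes R: "real_subring R"
  shows "commensurable GL_group (O_prime A R) (O_prime A R)"
proof -
  have "rcosets\<^bsub>GL_group\<lparr>carrier := O_prime A R\<rparr>\<^esub> (O_prime A R) \<subseteq> {O_prime A R}"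
  proof
    fix C assume "C \<in> rcosets\<^bsub>GL_group\<lparr>carrier := O_prime A R\<rparr>\<^esub> (O_prime A R)"
    then obtain a where a: "a \<in> O_prime A R" and C: "C = (\<lambda>h. h ** a) ` O_prime A R"
      by (auto simp: RCOSETS_def r_coset_def GL_group_def)
    have inv: "invertible a" using a unfolding O_prime_def by (auto intro: GL_imp_invertible)
    have "C = O_prime A R"
    proof
      show "C \<subseteq> O_prime A R" unfolding C using O_prime_mult[OF R _ a] by blast
      show "O_prime A R \<subseteq> C"
      proof
        fix h assume h: "h \<in> O_prime A R"
        have "h ** matrix_inv a \<in> O_prime A R" by (rule O_prime_mult[OF R h O_prime_inv[OF a]])
        moreover have "h ** matrix_inv a ** a = h"
          using matrix_inv_props[OF inv] by (simp flip: matrix_mul_assoc)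
        ultimately show "h \<in> C" unfolding C by (metis imageI)
      qed
    qed
    thus "C \<in> {O_prime A R}" by simp
  qed
  hence "finite (rcosets\<^bsub>GL_group\<lparr>carrier := O_prime A R\<rparr>\<^esub> (O_prime A R))" by (rule finite_subset) simp
  thus ?thesis by (simp add: commensurable_def finite_index_def)
qed

lemma arithmetic_conj_O_prime:
  fixes A P :: "('n::finite) lmat"
  assumes K: "totally_real_number_field K" and A: "admissible K A"
    and P: "invertible P" "\<And>x. qform A (P *v x) = lorentz_form x"
  shows "arithmetic_simplest_type K ((\<lambda>S. matrix_inv P ** S ** P) ` O_prime A (ring_of_integers K))"
proof -
  define Ob where "Ob = O_prime A (ring_of_integers K)"
  define c where "c S = matrix_inv P ** S ** P" for S
  have "subfield K real_field" using K by (simp add: totally_real_number_field_def number_field_def)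
  note RI = real_subring_integers[OF this]
  note PP = matrix_inv_props[OF P(1)]
  have c_mult: "c (x ** y) = c x ** c y" for x y
  proof -
    have "c x ** c y = matrix_inv P ** x ** (P ** matrix_inv P) ** y ** P"
      by (simp only: c_def matrix_mul_assoc)
    also have "\<dots> = c (x ** y)" by (simp only: PP matrix_mul_rid c_def matrix_mul_assoc)
    finally show ?thesis by simp
  qed
  have c_one: "c (mat 1) = mat 1" by (simp add: c_def PP)
  have c_back: "P ** c x ** matrix_inv P = x" for x
  proof -
    have "P ** c x ** matrix_inv P = (P ** matrix_inv P) ** x ** (P ** matrix_inv P)"
      by (simp only: c_def matrix_mul_assoc)
    thus ?thesis by (simp only: PP matrix_mul_rid matrix_mul_lid)
  qed
  have inv: "invertible x" if "x \<in> Ob" for x using that unfolding Ob_def O_prime_def by (auto intro: GL_imp_invertible)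
  have c_inv: "invertible (c x)" "matrix_inv (c x) = c (matrix_inv x)" if "x \<in> Ob" for x
  proof -
    note xx = matrix_inv_props[OF inv[OF that]]
    have e: "c x ** c (matrix_inv x) = mat 1" "c (matrix_inv x) ** c x = mat 1"
      by (simp_all only: c_mult[symmetric] xx c_one)
    show "invertible (c x)" unfolding invertible_def using e by blast
    show "matrix_inv (c x) = c (matrix_inv x)" by (rule matrix_inv_unique) (use e in simp_all)
  qed
  interpret G: group "GL_group :: ('n lmat) monoid" by (rule GL_group_group)
  have sub: "subgroup (c ` Ob) GL_group"
  proof (rule G.subgroupI)
    show "c ` Ob \<subseteq> carrier GL_group" using c_inv(1) by (auto simp: GL_UNIV_iff)
    show "c ` Ob \<noteq> {}" using O_prime_one[OF RI, of A] by (auto simp: Ob_def)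
    fix a assume "a \<in> c ` Ob"
    then obtain x where x: "x \<in> Ob" "a = c x" by blast
    have "matrix_inv x \<in> Ob" using O_prime_inv x(1) unfolding Ob_def by blast
    thus "inv\<^bsub>GL_group\<^esub> a \<in> c ` Ob" using c_inv[OF x(1)] by (simp add: x(2) GL_group_inv)
    fix b assume "b \<in> c ` Ob"
    then obtain y where y: "y \<in> Ob" "b = c y" by blast
    have "x ** y \<in> Ob" using O_prime_mult[OF RI] x(1) y(1) unfolding Ob_def by blast
    hence "c (x ** y) \<in> c ` Ob" by (rule imageI)
    thus "a \<otimes>\<^bsub>GL_group\<^esub> b \<in> c ` Ob" by (simp add: x(2) y(2) c_mult)
  qed
  have pos: "c ` Ob \<subseteq> pos_lorentz"
    using conj_O_prime_pos_lorentz[OF P] by (auto simp: c_def Ob_def)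
  have conj_back: "(\<lambda>T. P ** T ** matrix_inv P) ` (c ` Ob) = Ob"
    by (simp add: image_image c_back)
  have "commensurable GL_group ((\<lambda>T. P ** T ** matrix_inv P) ` (c ` Ob)) Ob"
    unfolding conj_back unfolding Ob_def by (rule commensurable_O_prime_self[OF RI])
  moreover have "P \<in> GL UNIV" using P(1) by (simp add: GL_UNIV_iff)
  ultimately have "arithmetic_simplest_type K (c ` Ob)"
    unfolding arithmetic_simplest_type_def using K A P(2) sub pos
    by (intro conjI exI[of _ A] exI[of _ P]) (simp_all add: Ob_def)
  thus ?thesis by (simp only: c_def[abs_def] Ob_def)
qed

theorem Salem_arithmetic_hyperbolic:
  fixes l :: real
  assumes salem: "Salem_number l" and K: "subfield K real_field" and sub: "K \<subseteq> rat_adjoin (l + inverse l)"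
    and deg: "degree_over K l \<le> CARD('n::finite) + 1"
  shows "\<exists>(\<Gamma> :: 'n lmat set) \<gamma>. arithmetic_simplest_type K \<Gamma> \<and> \<gamma> \<in> \<Gamma> \<and> hyperbolic \<gamma> \<and>
    l = exp (translation_length \<gamma>)"
proof -
  interpret K: real_subfield K using K by (rule real_subfield.intro)
  have l1: "l > 1" and "algebraic_int l" using salem by (simp_all add: Salem_number_def)
  hence "Polynomial.algebraic l" by blast
  then obtain q where q: "q \<noteq> 0" "qeval q l = 0" unfolding algebraic_iff_qeval by blast
  obtain p0 where p0: "p0 \<noteq> 0" "coeffs_in K p0" "poly p0 l = 0" "degree p0 = degree_over K l"
    using degree_over_attained[OF K, of "map_poly of_rat q" l] q by (auto simp: qeval_def)
  obtain p where p: "coeffs_in K p" "lead_coeff p = 1" "poly p l = 0" "degree p \<le> degree p0"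
    "\<And>g. coeffs_in K g \<Longrightarrow> poly g l = 0 \<Longrightarrow> \<exists>q. coeffs_in K q \<and> g = q * p"
    using K.minimal_polynomial_over_exists[OF p0(2,1,3)] by metis
  interpret S: salem_polynomial K l p using salem sub p by unfold_locales
  define m where "m = degree p"
  have m_le: "m \<le> CARD('n option)" using p(4) p0(4) deg by (simp add: m_def)
  have emb: "salem_embedding K l p \<sigma>" if "\<sigma> \<in> ring_hom (real_field\<lparr>carrier := K\<rparr>) complex_field" for \<sigma>
  proof unfold_locales
    show "\<sigma> 1 = 1" using ring_hom_one[OF that] by simp
    show "\<sigma> (x + y) = \<sigma> x + \<sigma> y" if "x \<in> K" "y \<in> K" for x y
      using ring_hom_add[OF \<open>\<sigma> \<in> _\<close>, of x y] that by simp
    show "\<sigma> (x * y) = \<sigma> x * \<sigma> y" if "x \<in> K" "y \<in> K" for x y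
      using ring_hom_mult[OF \<open>\<sigma> \<in> _\<close>, of x y] that by simp
  qed
  interpret I: salem_embedding K l p of_real by unfold_locales simp_all
  \<comment> \<open>Total reality follows from the inclusion in \<rat>(\<lambda> + 1/\<lambda>):
    every embedding is given on traces by some root z of the image of \<open>p\<close>, and z + 1/z
    is real.\<close>
  have K_real: "totally_real_number_field K"
    unfolding totally_real_number_field_def
  proof (intro conjI ballI subsetI)
    show "number_field K" by (rule number_field_subset_adjoin[OF K S.algebraic_trace sub])
    fix \<sigma> y assume s: "\<sigma> \<in> ring_hom (real_field\<lparr>carrier := K\<rparr>) complex_field" and "y \<in> \<sigma> ` K"
    then obtain x where "x \<in> K" "y = \<sigma> x" by blast
    thus "y \<in> \<real>" using salem_embedding.real[OF emb[OF s]] by blast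
  qed
  \<comment> \<open>A numbering of the n + 1 coordinates; the first m = degree p of them serve as
    K[x]/p.\<close>
  obtain f :: "'n option \<Rightarrow> nat" where f: "bij_betw f UNIV {0..<CARD('n option)}"
    using ex_bij_betw_finite_nat[of "UNIV :: 'n option set"] by auto
  have inj: "inj f" and range: "{..<m} \<subseteq> range f" using f m_le by (auto simp: bij_betw_def)
  \<comment> \<open>The entry for x^i and x^j is the trace of x^(i - j). Differences of numbers
    below \<open>m\<close> stay below \<open>m\<close>, the range in which Newton's recursion yields
    power sums.\<close>
  define A :: "'n lmat" where "A = (\<chi> i j. if f i < m \<and> f j < m
    then newton (coeff p) m (f i - f j + (f j - f i)) else if i = j then 1 else 0)"
  have trace: "trace_form f m (salem_embedding.roots p \<sigma>) B"
    if \<sigma>: "salem_embedding K l p \<sigma>" and B: "\<And>i j. of_real (B $ i $ j) = \<sigma> (A $ i $ j)" for \<sigma> B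
  proof -
    interpret E: salem_embedding K l p \<sigma> by fact
    show ?thesis
    proof
      show "inj f" by fact
      show "finite E.roots" "card E.roots = m" using E.finite_roots E.card_roots by (simp_all add: m_def)
      show "inverse z \<in> E.roots" if "z \<in> E.roots" for z using that by (rule E.roots_inverse)
      show "0 \<notin> E.roots" using E.roots_nonzero by blast
      fix i j
      show "complex_of_real (B $ i $ j) = (if f i < m \<and> f j < m
        then \<Sum>z\<in>E.roots. z ^ (f i - f j + (f j - f i)) else if i = j then 1 else 0)"
      proof (cases "f i < m \<and> f j < m")
        case True
        hence "f i - f j + (f j - f i) < degree p" unfolding m_def by linarith
        from E.embedding_newton[OF this] show ?thesis using True unfolding B A_def by (simp add: m_def)
      qed (auto simp: B A_def)
    qed
  qed
  interpret T: salem_trace_form f m I.roots A l p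
  proof (intro salem_trace_form.intro salem_trace_form_axioms.intro)
    show "trace_form f m I.roots A" by (rule trace) (unfold_locales, simp)
    have "of_real l \<in> I.roots \<and> of_real (inverse l) \<in> I.roots" by (rule I.roots_l) simp
    thus "of_real l \<in> I.roots" by blast
    show "z = of_real l \<or> z = of_real (inverse l) \<or> cmod z = 1" if "z \<in> I.roots" for z
      using that by (rule I.roots_cases)
    show "cpoly p z = 0" if "z \<in> I.roots" for z using that by (simp add: I.roots_def)
    show "degree p = m" by (simp add: m_def)
  qed (fact l1 p(2) range)+
  obtain a b u where ab: "T.shift *v a = l *\<^sub>R a" "T.shift *v b = inverse l *\<^sub>R b"
    "qform A a = 0" "qform A b = 0" "bform A a b \<noteq> 0" and u: "qform A u < 0"
    "\<And>z. bform A z u = 0 \<Longrightarrow> z \<noteq> 0 \<Longrightarrow> qform A z > 0"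
    by (rule T.null_eigenvectors) blast
  have sym: "transpose A = A"
    by (simp add: A_def transpose_def vec_eq_iff add.commute conj_commute eq_commute)
  have "\<exists>P :: 'n lmat. invertible P \<and> (\<forall>x. qform A (P *v x) = lorentz_form x) \<and> has_signature A CARD('n) 1"
  proof (rule lorentz_diagonalization[OF sym u])
    fix P :: "'n lmat"
    assume "invertible P" "\<And>x. qform A (P *v x) = lorentz_form x" "has_signature A CARD('n) 1"
    thus ?thesis by (intro exI[of _ P] conjI allI)
  qed
  then obtain P :: "'n lmat" where P: "invertible P" "\<And>x. qform A (P *v x) = lorentz_form x"
    and sig: "has_signature A CARD('n) 1" by blast
  have A_over: "matrix_over K A" unfolding matrix_over_def A_def using I.newton_mem by auto
  have adm: "admissible K A"
    unfolding admissible_def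
  proof (intro conjI ballI impI A_over sym sig)
    fix \<sigma> assume s: "\<sigma> \<in> ring_hom (real_field\<lparr>carrier := K\<rparr>) real_field" and ne: "\<exists>x\<in>K. \<sigma> x \<noteq> x"
    define \<tau> where "\<tau> x = complex_of_real (\<sigma> x)" for x
    have t: "salem_embedding K l p \<tau>"
    proof unfold_locales
      show "\<tau> 1 = 1" using ring_hom_one[OF s] by (simp add: \<tau>_def)
      show "\<tau> (x + y) = \<tau> x + \<tau> y" if "x \<in> K" "y \<in> K" for x y
        using ring_hom_add[OF s, of x y] that by (simp add: \<tau>_def)
      show "\<tau> (x * y) = \<tau> x * \<tau> y" if "x \<in> K" "y \<in> K" for x y
        using ring_hom_mult[OF s, of x y] that by (simp add: \<tau>_def)
    qed
    interpret E: salem_embedding K l p \<tau> by (rule t)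
    interpret TE: trace_form f m E.roots "\<chi> i j. \<sigma> (A $ i $ j)"
      by (rule trace[OF t]) (simp add: \<tau>_def)
    show "positive_definite (\<chi> i j. \<sigma> (A $ i $ j))"
    proof (rule TE.positive_definite_unit_circle)
      fix z assume z: "z \<in> E.roots"
      show "cmod z = 1"
      proof (rule ccontr)
        assume "cmod z \<noteq> 1"
        hence "\<tau> x = of_real x" if "x \<in> K" for x using E.trivial_embedding[OF z _ that] by blast
        with ne show False by (auto simp: \<tau>_def)
      qed
    qed
  qed
  have ints: "0 \<in> ring_of_integers K" "1 \<in> ring_of_integers K"
    using K.zero_mem K.one_mem by (auto simp: ring_of_integers_def)
  have pK: "coeff p i \<in> K" for i using p(1) by (simp add: coeffs_in_def)
  have p_int: "algebraic_int (coeff p i)" for i using I.algebraic_int_coeff(1)[of i] by simp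
  have "algebraic_int (complex_of_real (inverse (coeff p 0)))" using I.algebraic_int_coeff(2) by simp
  hence p0_int: "algebraic_int (inverse (coeff p 0))" by (simp only: algebraic_int_of_real_iff)
  note RI = real_subring_integers[OF K]
  have c1: "coeff p i \<in> ring_of_integers K" for i using pK p_int by (simp add: ring_of_integers_def)
  have c2: "coeff p i / coeff p 0 \<in> ring_of_integers K" for i
    using pK p_int p0_int by (auto simp: ring_of_integers_def divide_inverse)
  have diffs: "x - y \<in> ring_of_integers K" if "x \<in> ring_of_integers K" "y \<in> ring_of_integers K" for x y
    using that RI by (auto simp: real_subring_def)
  have negs: "- x \<in> ring_of_integers K" if "x \<in> ring_of_integers K" for x
    using diffs[OF ints(1) that] by simp
  have s1: "matrix_over (ring_of_integers K) T.shift"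
    unfolding matrix_over_def T.shift_def using c1 ints by (auto intro!: diffs negs)
  have s2: "matrix_over (ring_of_integers K) T.unshift"
    unfolding matrix_over_def T.unshift_def using c2 ints by (auto intro!: diffs negs)
  have "T.shift \<in> GL (ring_of_integers K)"
    unfolding GL_def using s1 s2 T.shift_unshift by blast
  moreover have "transpose T.shift ** A ** T.shift = A"
    unfolding bform_preserved_iff using T.shift_preserves by blast
  ultimately have shift: "T.shift \<in> O_prime A (ring_of_integers K)"
    by (rule O_primeI[OF sym]) (rule T.shift_negative)
  define \<gamma> where "\<gamma> = matrix_inv P ** T.shift ** P"
  note PP = matrix_inv_props[OF P(1)]
  have conj_back: "P *v (matrix_inv P *v x) = x" for x
    by (simp only: matrix_vector_mul_assoc PP matrix_vector_mul_lid)
  have bl: "lorentz_inner (matrix_inv P *v x) (matrix_inv P *v y) = bform A x y" for x y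
    unfolding bform_eq_lorentz[OF sym P(2), symmetric] by (simp only: conj_back)
  have ql: "lorentz_form (matrix_inv P *v x) = qform A x" for x
    unfolding P(2)[symmetric] by (simp only: conj_back)
  have \<gamma>_vec: "\<gamma> *v (matrix_inv P *v x) = matrix_inv P *v (T.shift *v x)" for x
    unfolding \<gamma>_def by (simp only: matrix_vector_mul_assoc[symmetric] conj_back)
  have "\<gamma> \<in> pos_lorentz" unfolding \<gamma>_def by (rule conj_O_prime_pos_lorentz[OF P shift])
  hence hyp: "hyperbolic \<gamma>" "exp (translation_length \<gamma>) = l"
    using hyperbolic_if_null_eigenvectors[of \<gamma> "matrix_inv P *v a" "matrix_inv P *v b" l]
    by (simp_all only: bl ql \<gamma>_vec ab l1 matrix_vector_mult_scaleR simp_thms True_implies_equals)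
  show ?thesis
    by (intro exI[of _ "(\<lambda>S. matrix_inv P ** S ** P) ` O_prime A (ring_of_integers K)"] exI[of _ \<gamma>] conjI
        arithmetic_conj_O_prime[OF K_real adm P])
       (use hyp shift in \<open>simp_all add: \<gamma>_def\<close>)
qed

theorem theorem1p1:
  assumes n_ge_2: "CARD('n::finite) \<ge> 2"
  shows
    "(\<forall>(K :: real set) (\<Gamma> :: 'n lmat set) \<gamma> l.
        arithmetic_simplest_type K \<Gamma> \<longrightarrow> \<gamma> \<in> \<Gamma> \<longrightarrow> hyperbolic \<gamma> \<longrightarrow>
        l = exp (translation_length \<gamma>) \<longrightarrow>
        even CARD('n) \<or> \<gamma> \<in> squares_subgroup \<Gamma> \<longrightarrow>
        Salem_number l \<and> K \<subseteq> rat_adjoin (l + inverse l) \<and> degree_over K l \<le> CARD('n) + 1)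
     \<and>
     (\<forall>(l :: real) (K :: real set).
        Salem_number l \<longrightarrow> subfield K real_field \<longrightarrow> K \<subseteq> rat_adjoin (l + inverse l) \<longrightarrow>
        degree_over K l \<le> CARD('n) + 1 \<longrightarrow>
        (\<exists>(\<Gamma> :: 'n lmat set) \<gamma>.
           arithmetic_simplest_type K \<Gamma> \<and> \<gamma> \<in> \<Gamma> \<and> hyperbolic \<gamma> \<and>
           l = exp (translation_length \<gamma>)))"
proof (intro conjI[of "\<forall>K. _ K"] allI impI)
  fix K \<gamma> and l :: real and \<Gamma> :: "'n lmat set"
  assume "arithmetic_simplest_type K \<Gamma>" "\<gamma> \<in> \<Gamma>" "hyperbolic \<gamma>" "l = exp (translation_length \<gamma>)"
    "even CARD('n) \<or> \<gamma> \<in> squares_subgroup \<Gamma>"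
  thus "Salem_number l \<and> K \<subseteq> rat_adjoin (l + inverse l) \<and> degree_over K l \<le> CARD('n) + 1"
    by (rule arithmetic_hyperbolic_Salem[OF n_ge_2])
qed (rule Salem_arithmetic_hyperbolic)

end
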